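(* Let $\Omega\subset\mathbb{R}^3$ be a convex polyhedral domain and let $\{\mathcal{T}_h\}$ be a shape regular, quasi-uniform family of tetrahedral meshes of $\Omega$. There exists $\kappa_0\ge 1$, independent of $h$, such that for every fixed $\kappa\ge\kappa_0$ the following holds. Let $\tilde\rho(x)=\sqrt{\rho(x)^2+\kappa^2h^2}$. There is a constant $c>0$ independent of $h$ and $q$ such that for every $q\in L^2(\partial\Omega)$ the discrete solution $u_h=u_h(q)\in\widehat V_h$ of $$u_h\in E_hP_h^\partial q+V_h,\qquad (\nabla u_h,\nabla\varphi_h)=0\quad\text{for all }\varphi_h\in V_h$$ satisfies $$\|\tilde\rho^{\frac12}\nabla u_h\|_{L^2(\Omega)}\le c\,\|P_h^\partial q\|_{L^2(\partial\Omega)}.$$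
   Context: Polyhedral domains are bounded. $(\cdot,\cdot)$ is the $L^2(\Omega)$ inner product. $h$ is the mesh size of $\mathcal{T}_h$, whose cells $K$ are open tetrahedra. $\widehat V_h\subset H^1(\Omega)$ is the space of continuous functions that are affine linear on every cell of $\mathcal{T}_h$ (linear finite elements), $V_h=\widehat V_h\cap H^1_0(\Omega)$, and $V_h^\partial$ is the space of traces on $\partial\Omega$ of functions in $\widehat V_h$. $P_h^\partial\colon L^2(\partial\Omega)\to V_h^\partial$ is the $L^2(\partial\Omega)$-orthogonal projection, and $E_h\colon V_h^\partial\to\widehat V_h$ is the extension-by-zero operator (the extension whose nodal values at interior nodes are zero). $\rho\colon\overline\Omega\to[0,\infty)$ is a fixed regularized distance to the boundary: $\rho\in C^\infty(\Omega)$, there are constants $c_1,c_2>0$ with $c_1\rho(x)\le\operatorname{dist}(x,\partial\Omega)\le c_2\rho(x)$ for all $x\in\overline\Omega$, and for every multi-index $\beta\in\mathbb{N}_0^3$ there is a constant $c$ with $|D^\beta\rho(x)|\le c\,\rho(x)^{1-|\beta|}$ for all $x\in\Omega$. *)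

theory Defs
  imports "HOL-Analysis.Analysis"
begin

subsection \<open>Partial derivatives and smooth functions\<close>

definition pd :: "3 \<Rightarrow> (real^3 \<Rightarrow> real) \<Rightarrow> real^3 \<Rightarrow> real"
  where "pd i f x = frechet_derivative f (at x) (axis i 1)"

definition multi_pd :: "nat^3 \<Rightarrow> (real^3 \<Rightarrow> real) \<Rightarrow> real^3 \<Rightarrow> real"
  where "multi_pd \<beta> f = (pd 1 ^^ (\<beta> $ 1)) ((pd 2 ^^ (\<beta> $ 2)) ((pd 3 ^^ (\<beta> $ 3)) f))"

definition multi_order :: "nat^3 \<Rightarrow> nat"
  where "multi_order \<beta> = (\<Sum>i\<in>UNIV. \<beta> $ i)"

text \<open>The following is meant for open sets. Total differentiability is required at every order, so
  mixed partial derivatives commute and it suffices to consider a fixed order of differentiation.\<close>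

definition smooth_on :: "(real^3) set \<Rightarrow> (real^3 \<Rightarrow> real) \<Rightarrow> bool"
  where "smooth_on S f \<longleftrightarrow> (\<forall>\<beta>. multi_pd \<beta> f differentiable_on S)"

definition test_functions :: "(real^3) set \<Rightarrow> (real^3 \<Rightarrow> real) set"
  where "test_functions \<Omega> =
    {\<phi>. smooth_on UNIV \<phi> \<and> compact (closure {x. \<phi> x \<noteq> 0}) \<and> closure {x. \<phi> x \<noteq> 0} \<subseteq> \<Omega>}"


subsection \<open>Square-integrable functions and Sobolev spaces\<close>

definition L2 :: "'a measure \<Rightarrow> ('a \<Rightarrow> 'b::real_normed_vector) set"
  where "L2 M = {f \<in> borel_measurable M. integrable M (\<lambda>x. (norm (f x))\<^sup>2)}"

definition L2_norm :: "'a measure \<Rightarrow> ('a \<Rightarrow> 'b::real_normed_vector) \<Rightarrow> real"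
  where "L2_norm M f = sqrt (LINT x|M. (norm (f x))\<^sup>2)"

definition has_weak_gradient :: "(real^3) set \<Rightarrow> (real^3 \<Rightarrow> real) \<Rightarrow> (real^3 \<Rightarrow> real^3) \<Rightarrow> bool"
  where "has_weak_gradient \<Omega> u g \<longleftrightarrow>
    u \<in> L2 (lebesgue_on \<Omega>) \<and> g \<in> L2 (lebesgue_on \<Omega>) \<and>
    (\<forall>\<phi>\<in>test_functions \<Omega>. \<forall>i.
      (LINT x|lebesgue_on \<Omega>. u x * pd i \<phi> x) = - (LINT x|lebesgue_on \<Omega>. g x $ i * \<phi> x))"

definition H1 :: "(real^3) set \<Rightarrow> (real^3 \<Rightarrow> real) set"
  where "H1 \<Omega> = {u. \<exists>g. has_weak_gradient \<Omega> u g}"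

text \<open>A representative of the weak gradient, which is unique only up to null sets and off \<open>\<Omega>\<close>.\<close>

definition weak_grad :: "(real^3) set \<Rightarrow> (real^3 \<Rightarrow> real) \<Rightarrow> real^3 \<Rightarrow> real^3"
  where "weak_grad \<Omega> u = (SOME g. has_weak_gradient \<Omega> u g)"

definition H1_norm :: "(real^3) set \<Rightarrow> (real^3 \<Rightarrow> real) \<Rightarrow> real"
  where "H1_norm \<Omega> u =
    sqrt ((L2_norm (lebesgue_on \<Omega>) u)\<^sup>2 + (L2_norm (lebesgue_on \<Omega>) (weak_grad \<Omega> u))\<^sup>2)"

definition H10 :: "(real^3) set \<Rightarrow> (real^3 \<Rightarrow> real) set"
  where "H10 \<Omega> = {u \<in> H1 \<Omega>. \<exists>\<phi>. (\<forall>n. \<phi> n \<in> test_functions \<Omega>) \<and>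
    (\<lambda>n::nat. H1_norm \<Omega> (\<lambda>x. u x - \<phi> n x)) \<longlonglongrightarrow> 0}"


subsection \<open>Domain, surface measure, regularized distance\<close>

definition convex_polyhedral_domain :: "(real^3) set \<Rightarrow> bool"
  where "convex_polyhedral_domain \<Omega> \<longleftrightarrow>
    open \<Omega> \<and> \<Omega> \<noteq> {} \<and> bounded \<Omega> \<and> convex \<Omega> \<and> polyhedron (closure \<Omega>)"

text \<open>On every facet, the surface measure of a polyhedral boundary is the planar Lebesgue measure in
  Cartesian coordinates of the plane spanned by the facet; the choice of these is immaterial.\<close>

definition plane_chart :: "(real^3) set \<Rightarrow> real^2 \<Rightarrow> real^3"
  where "plane_chart F =
    (SOME \<phi>. (\<forall>s t. dist (\<phi> s) (\<phi> t) = dist s t) \<and> range \<phi> = affine hull F)"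

definition surface_measure :: "(real^3) set \<Rightarrow> (real^3) measure"
  where "surface_measure \<Omega> =
    measure_of (frontier \<Omega>) (sets (restrict_space borel (frontier \<Omega>)))
      (\<lambda>A. \<Sum>F\<in>{F. F facet_of closure \<Omega>}. emeasure lborel (plane_chart F -` (A \<inter> F)))"

definition regularized_distance :: "(real^3) set \<Rightarrow> (real^3 \<Rightarrow> real) \<Rightarrow> bool"
  where "regularized_distance \<Omega> \<rho> \<longleftrightarrow>
    (\<forall>x\<in>closure \<Omega>. 0 \<le> \<rho> x) \<and>
    smooth_on \<Omega> \<rho> \<and>
    (\<exists>c1>0. \<exists>c2>0. \<forall>x\<in>closure \<Omega>.
      c1 * \<rho> x \<le> infdist x (frontier \<Omega>) \<and> infdist x (frontier \<Omega>) \<le> c2 * \<rho> x) \<and>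
    (\<forall>\<beta>. \<exists>c. \<forall>x\<in>\<Omega>. \<bar>multi_pd \<beta> \<rho> x\<bar> \<le> c * \<rho> x powi (1 - int (multi_order \<beta>)))"

definition rho_tilde :: "(real^3 \<Rightarrow> real) \<Rightarrow> real \<Rightarrow> real \<Rightarrow> real^3 \<Rightarrow> real"
  where "rho_tilde \<rho> \<kappa> h x = sqrt ((\<rho> x)\<^sup>2 + \<kappa>\<^sup>2 * h\<^sup>2)"


subsection \<open>Meshes\<close>

definition open_tetrahedron :: "(real^3) set \<Rightarrow> bool"
  where "open_tetrahedron K \<longleftrightarrow> (\<exists>S. 3 simplex S \<and> K = interior S)"

text \<open>Conformity of the mesh is part of \<^const>\<open>triangulation\<close>: any two closed cells meet in a common face.\<close>

definition tetrahedral_mesh :: "(real^3) set \<Rightarrow> (real^3) set set \<Rightarrow> bool"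
  where "tetrahedral_mesh \<Omega> \<T> \<longleftrightarrow>
    (\<forall>K\<in>\<T>. open_tetrahedron K) \<and> triangulation (closure ` \<T>) \<and>
    (\<Union>K\<in>\<T>. closure K) = closure \<Omega>"

definition mesh_size :: "(real^3) set set \<Rightarrow> real"
  where "mesh_size \<T> = Max (diameter ` \<T>)"

definition inradius :: "(real^3) set \<Rightarrow> real"
  where "inradius K = Sup {r. \<exists>x. ball x r \<subseteq> K}"

definition mesh_family :: "(real^3) set \<Rightarrow> real set \<Rightarrow> (real \<Rightarrow> (real^3) set set) \<Rightarrow> bool"
  where "mesh_family \<Omega> H \<T> \<longleftrightarrow>
    (\<forall>h\<in>H. tetrahedral_mesh \<Omega> (\<T> h) \<and> mesh_size (\<T> h) = h)"

definition shape_regular :: "real set \<Rightarrow> (real \<Rightarrow> (real^3) set set) \<Rightarrow> bool"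
  where "shape_regular H \<T> \<longleftrightarrow>
    (\<exists>\<sigma>>0. \<forall>h\<in>H. \<forall>K\<in>\<T> h. diameter K \<le> \<sigma> * inradius K)"

definition quasi_uniform :: "real set \<Rightarrow> (real \<Rightarrow> (real^3) set set) \<Rightarrow> bool"
  where "quasi_uniform H \<T> \<longleftrightarrow>
    (\<exists>\<tau>>0. \<forall>h\<in>H. \<forall>K\<in>\<T> h. h \<le> \<tau> * diameter K)"

definition mesh_nodes :: "(real^3) set set \<Rightarrow> (real^3) set"
  where "mesh_nodes \<T> = {z. \<exists>K\<in>\<T>. z extreme_point_of closure K}"


subsection \<open>Linear finite elements\<close>

text \<open>Functions on \<open>closure \<Omega>\<close> and on \<open>frontier \<Omega>\<close> are represented by functions on the whole space
  that vanish off the respective set; this makes projection and extension below unique.\<close>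

definition FE_space :: "(real^3) set \<Rightarrow> (real^3) set set \<Rightarrow> (real^3 \<Rightarrow> real) set"
  where "FE_space \<Omega> \<T> = {u \<in> H1 \<Omega>.
    continuous_on (closure \<Omega>) u \<and>
    (\<forall>K\<in>\<T>. \<exists>a b. \<forall>x\<in>K. u x = a \<bullet> x + b) \<and>
    (\<forall>x. x \<notin> closure \<Omega> \<longrightarrow> u x = 0)}"

definition FE_space0 :: "(real^3) set \<Rightarrow> (real^3) set set \<Rightarrow> (real^3 \<Rightarrow> real) set"
  where "FE_space0 \<Omega> \<T> = FE_space \<Omega> \<T> \<inter> H10 \<Omega>"

text \<open>Only used for functions that are continuous on \<open>closure \<Omega>\<close>.\<close>

definition bdry_trace :: "(real^3) set \<Rightarrow> (real^3 \<Rightarrow> real) \<Rightarrow> real^3 \<Rightarrow> real"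
  where "bdry_trace \<Omega> u x = (if x \<in> frontier \<Omega> then u x else 0)"

definition FE_trace_space :: "(real^3) set \<Rightarrow> (real^3) set set \<Rightarrow> (real^3 \<Rightarrow> real) set"
  where "FE_trace_space \<Omega> \<T> = bdry_trace \<Omega> ` FE_space \<Omega> \<T>"

definition boundary_projection ::
    "(real^3) set \<Rightarrow> (real^3) set set \<Rightarrow> (real^3 \<Rightarrow> real) \<Rightarrow> real^3 \<Rightarrow> real"
  where "boundary_projection \<Omega> \<T> q =
    (THE p. p \<in> FE_trace_space \<Omega> \<T> \<and>
      (\<forall>v\<in>FE_trace_space \<Omega> \<T>. (LINT x|surface_measure \<Omega>. (q x - p x) * v x) = 0))"

definition zero_extension ::
    "(real^3) set \<Rightarrow> (real^3) set set \<Rightarrow> (real^3 \<Rightarrow> real) \<Rightarrow> real^3 \<Rightarrow> real"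
  where "zero_extension \<Omega> \<T> p =
    (THE u. u \<in> FE_space \<Omega> \<T> \<and> bdry_trace \<Omega> u = p \<and> (\<forall>z\<in>mesh_nodes \<T> \<inter> \<Omega>. u z = 0))"

definition discrete_solution ::
    "(real^3) set \<Rightarrow> (real^3) set set \<Rightarrow> (real^3 \<Rightarrow> real) \<Rightarrow> (real^3 \<Rightarrow> real) \<Rightarrow> bool"
  where "discrete_solution \<Omega> \<T> q u \<longleftrightarrow>
    u \<in> FE_space \<Omega> \<T> \<and>
    (\<exists>v\<in>FE_space0 \<Omega> \<T>. u = (\<lambda>x. zero_extension \<Omega> \<T> (boundary_projection \<Omega> \<T> q) x + v x)) \<and>
    (\<forall>\<phi>\<in>FE_space0 \<Omega> \<T>. (LINT x|lebesgue_on \<Omega>. weak_grad \<Omega> u x \<bullet> weak_grad \<Omega> \<phi> x) = 0)"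

end

theory Submission
  imports Defs
begin

text \<open>
  The weight \<open>\<rho>_tilde\<close> is dominated by a concave one. For every facet of the domain let
  \<open>y i x = k h + dist(x, H i)\<close>, where \<open>H i\<close> is the plane of the facet, and let \<open>1 / \<omega> = (\<Sum>i. 1 / y i)\<close>.
  As a harmonic mean of affine functions, \<open>\<omega>\<close> is concave; its gradient has norm at most 1, and
  \<open>\<rho>_tilde \<le> M N \<omega>\<close>, where \<open>N\<close> is the number of facets. The parameter \<open>k\<close> is chosen independently of \<open>\<kappa>\<close>,
  which only affects \<open>M\<close>; hence \<open>\<kappa>0 = 1\<close> will do.

  Write \<open>u = w + v\<close>, where \<open>w\<close> is the extension by zero of the boundary data and \<open>v\<close> vanishes on the
  boundary, and test the equation with the interpolant of \<open>\<omega> v\<close>. The term \<open>\<integral> v \<nabla>v \<bullet> \<nabla>\<omega>\<close> equals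
  \<open>- 1/2 \<integral> v\<^sup>2 \<Delta>\<omega> \<ge> 0\<close>; the interpolation error is controlled through the Hardy inequality
  \<open>\<integral> v\<^sup>2 / \<omega>\<^sup>2 \<le> 4 N\<^sup>2 \<integral> |\<nabla>v|\<^sup>2\<close>; and the terms with \<open>\<nabla>w\<close> live on cells touching the boundary, where
  \<open>\<omega> \<le> (k + 1) h\<close> and \<open>|v| \<le> h |\<nabla>v|\<close>. This bounds \<open>\<integral> \<omega> |\<nabla>u|\<^sup>2\<close> by
  \<open>h (C \<integral> |\<nabla>u|\<^sup>2 + C' \<integral> |\<nabla>w|\<^sup>2)\<close> with \<open>C\<close> independent of \<open>k\<close>. Since \<open>\<omega> \<ge> k h / N\<close>, the first term
  is absorbed for large \<open>k\<close>, and \<open>h \<integral> |\<nabla>w|\<^sup>2\<close> is bounded by the squared norm of the boundary data because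
  the nodal values of a finite element function are controlled by its trace.
\<close>

subsection \<open>Smooth bump functions\<close>

text \<open>The term \<open>v x * (grad v x \<bullet> grad \<omega> x)\<close> from the product rule
  carries no factor \<open>h\<close>, so no choice of \<open>k\<close> absorbs it; it is disposed of
  by its sign, and this is why the weight has to be concave. The minimum of the distances to the
  facet planes would be concave as well, but it has kinks, whereas the interpolation error needs a
  weight with second derivatives of order \<open>1 / \<omega>\<close>. The harmonic mean has both
  properties.

  The absorption is not circular: the factor \<open>k + 1\<close> from the boundary layer multiplies
  \<open>|grad u| |grad w|\<close>, and Young's inequality moves all of it to \<open>grad w\<close>.
  The coefficient of the unweighted energy of \<open>u\<close> thus depends only on \<open>N\<close>
  and on \<open>h / r\<close>, where balls of radius \<open>r\<close> fit into all cells.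

  Much of the work makes the definitions usable. \<open>H10\<close> is a closure of test functions,
  but the argument needs pointwise boundary values; projection and extension are definite
  descriptions, so existence and uniqueness have to be proved; and each integration by parts rests
  on the fact that difference quotients of compactly supported Lipschitz functions integrate to
  zero.\<close>

definition flat :: "nat \<Rightarrow> real \<Rightarrow> real"
  where "flat k t = (if 0 < t then (1 / t) ^ k * exp (- (1 / t)) else 0)"

lemma flat_nonneg: "0 \<le> flat k t"
  by (simp add: flat_def)

lemma flat_0_le_1: "flat 0 t \<le> 1"
  by (simp add: flat_def)

lemma flat_0_pos_iff: "0 < flat 0 t \<longleftrightarrow> 0 < t"
  by (simp add: flat_def)

lemma flat_tendsto_0: "(flat k \<longlongrightarrow> 0) (at 0)"
proof -
  have "((\<lambda>t. (inverse t) ^ k / exp (inverse t)) \<longlongrightarrow> (0::real)) (at_right 0)"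
    using filterlim_compose[OF tendsto_power_div_exp_0 filterlim_inverse_at_top_right] .
  moreover have "\<forall>\<^sub>F t in at_right (0::real). (inverse t) ^ k / exp (inverse t) = flat k t"
    unfolding eventually_at_right_field
    by (intro exI[of _ 1]) (auto simp: flat_def exp_minus field_simps)
  ultimately have "(flat k \<longlongrightarrow> 0) (at_right 0)"
    by (rule Lim_transform_eventually)
  moreover have "(flat k \<longlongrightarrow> 0) (at_left 0)"
    by (rule tendsto_eventually, unfold eventually_at_left_field, intro exI[of _ "-1"])
      (auto simp: flat_def)
  ultimately show ?thesis
    by (simp add: filterlim_split_at)
qed

text \<open>The powers of \<open>1 / t\<close> in \<open>flat\<close> are there for this formula:
  the family is closed under differentiation up to linear combinations, which settles all orders at
  once. At \<open>t = 0\<close> the difference quotient of \<open>flat k\<close> is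
  \<open>flat (k + 1)\<close>, and its limit is 0 because the exponential beats every power.\<close>

lemma flat_deriv:
  "(flat k has_real_derivative (flat (k + 2) t - real k * flat (k + 1) t)) (at t)"
proof -
  consider "t < 0" | "t = 0" | "t > 0" by linarith
  then show ?thesis
  proof cases
    case 1
    have "((\<lambda>_. 0) has_real_derivative 0) (at t)" by simp
    then have "(flat k has_real_derivative 0) (at t)"
      by (rule has_field_derivative_transform_within_open[of _ _ _ "{..<0}"])
        (use 1 in \<open>auto simp: flat_def\<close>)
    then show ?thesis using 1 by (simp add: flat_def)
  next
    case 2
    have "((\<lambda>h. (flat k (0 + h) - flat k 0) / h) \<longlongrightarrow> 0) (at 0)"
    proof (rule Lim_transform_eventually[OF flat_tendsto_0[of "k + 1"]])
      show "\<forall>\<^sub>F h in at 0. flat (k + 1) h = (flat k (0 + h) - flat k 0) / h"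
        by (rule always_eventually) (auto simp: flat_def)
    qed
    then show ?thesis using 2 by (simp add: DERIV_def flat_def)
  next
    case 3
    have d: "((\<lambda>t. 1 / t) has_real_derivative - ((1 / t)\<^sup>2)) (at t)"
      using 3 by (auto intro!: derivative_eq_intros simp: power2_eq_square)
    have "((\<lambda>t. (1 / t) ^ k * exp (- (1 / t))) has_real_derivative
        (flat (k + 2) t - real k * flat (k + 1) t)) (at t)"
      by (rule DERIV_cong[OF DERIV_mult[OF DERIV_power[OF d] DERIV_fun_exp[OF DERIV_minus[OF d]]]])
        (use 3 in \<open>cases k; simp add: flat_def field_simps power2_eq_square\<close>)
    then show ?thesis
      by (rule has_field_derivative_transform_within_open[of _ _ _ "{0<..}"])
        (use 3 in \<open>auto simp: flat_def\<close>)
  qed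
qed

text \<open>This set is closed under partial differentiation, so all of its members are smooth.\<close>

inductive_set flat_alg :: "(real^3 \<Rightarrow> real) set" where
  const: "(\<lambda>x. c) \<in> flat_alg"
| flat: "(\<lambda>x. flat k (\<alpha> * x $ i + \<beta>)) \<in> flat_alg"
| add: "f \<in> flat_alg \<Longrightarrow> g \<in> flat_alg \<Longrightarrow> (\<lambda>x. f x + g x) \<in> flat_alg"
| mult: "f \<in> flat_alg \<Longrightarrow> g \<in> flat_alg \<Longrightarrow> (\<lambda>x. f x * g x) \<in> flat_alg"

lemma flat_alg_derivative:
  assumes "f \<in> flat_alg"
  obtains g where "\<And>i. g i \<in> flat_alg"
    "\<And>x. (f has_derivative (\<lambda>d. \<Sum>i\<in>UNIV. d $ i * g i x)) (at x)"
proof -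
  have "\<exists>g. (\<forall>i. g i \<in> flat_alg) \<and>
      (\<forall>x. (f has_derivative (\<lambda>d. \<Sum>i\<in>UNIV. d $ i * g i x)) (at x))"
    using assms
  proof (induction rule: flat_alg.induct)
    case (const c)
    have "(\<lambda>x. 0) \<in> flat_alg" by (rule flat_alg.const)
    then show ?case by (intro exI[of _ "\<lambda>i x. 0"]) auto
  next
    case (flat k \<alpha> j \<beta>)
    define g where "g = (\<lambda>i x. (if i = j then \<alpha> else 0) *
      (flat (k + 2) (\<alpha> * x $ j + \<beta>) + (- real k) * flat (k + 1) (\<alpha> * x $ j + \<beta>)))"
    have "g i \<in> flat_alg" for i
      unfolding g_def by (intro flat_alg.intros)
    moreover have "((\<lambda>x. flat k (\<alpha> * x $ j + \<beta>)) has_derivative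
        (\<lambda>d. \<Sum>i\<in>UNIV. d $ i * g i x)) (at x)" for x :: "real^3"
    proof -
      have l: "((\<lambda>x::real^3. \<alpha> * x $ j + \<beta>) has_derivative (\<lambda>d. \<alpha> * d $ j)) (at x)"
        by (auto intro!: derivative_eq_intros bounded_linear_imp_has_derivative bounded_linear_vec_nth)
      have "((\<lambda>x. flat k (\<alpha> * x $ j + \<beta>)) has_derivative
        (\<lambda>d. (flat (k + 2) (\<alpha> * x $ j + \<beta>) - real k * flat (k + 1) (\<alpha> * x $ j + \<beta>)) * (\<alpha> * d $ j))) (at x)"
        using has_derivative_compose[OF l, of "flat k"] flat_deriv[of k "\<alpha> * x $ j + \<beta>"]
        by (simp add: has_field_derivative_def)
      moreover have "(\<Sum>i\<in>UNIV. d $ i * g i x) =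
        (flat (k + 2) (\<alpha> * x $ j + \<beta>) - real k * flat (k + 1) (\<alpha> * x $ j + \<beta>)) * (\<alpha> * d $ j)" for d
        by (simp add: g_def if_distrib[of "\<lambda>z. _ * z"] if_distrib[of "\<lambda>z. z * _"] sum.delta cong: if_cong)
      ultimately show ?thesis by simp
    qed
    ultimately show ?case by blast
  next
    case (add f1 f2)
    then obtain g1 g2 where g: "\<And>i. g1 i \<in> flat_alg" "\<And>i. g2 i \<in> flat_alg"
      "\<And>x. (f1 has_derivative (\<lambda>d. \<Sum>i\<in>UNIV. d $ i * g1 i x)) (at x)"
      "\<And>x. (f2 has_derivative (\<lambda>d. \<Sum>i\<in>UNIV. d $ i * g2 i x)) (at x)"
      by blast
    have "((\<lambda>x. f1 x + f2 x) has_derivative (\<lambda>d. \<Sum>i\<in>UNIV. d $ i * (g1 i x + g2 i x))) (at x)" for x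
      using has_derivative_add[OF g(3,4)] by (simp add: sum.distrib algebra_simps)
    then show ?case using g(1,2) flat_alg.add by (intro exI[of _ "\<lambda>i x. g1 i x + g2 i x"]) auto
  next
    case (mult f1 f2)
    then obtain g1 g2 where g: "\<And>i. g1 i \<in> flat_alg" "\<And>i. g2 i \<in> flat_alg"
      "\<And>x. (f1 has_derivative (\<lambda>d. \<Sum>i\<in>UNIV. d $ i * g1 i x)) (at x)"
      "\<And>x. (f2 has_derivative (\<lambda>d. \<Sum>i\<in>UNIV. d $ i * g2 i x)) (at x)"
      by blast
    have "((\<lambda>x. f1 x * f2 x) has_derivative
        (\<lambda>d. \<Sum>i\<in>UNIV. d $ i * (f1 x * g2 i x + g1 i x * f2 x))) (at x)" for x
      using has_derivative_mult[OF g(3)[of x] g(4)[of x]]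
      by (simp add: sum.distrib algebra_simps sum_distrib_left)
    moreover have "(\<lambda>x. f1 x * g2 i x + g1 i x * f2 x) \<in> flat_alg" for i
      using g mult.hyps by (intro flat_alg.intros)
    ultimately show ?case by (intro exI[of _ "\<lambda>i x. f1 x * g2 i x + g1 i x * f2 x"]) auto
  qed
  then show ?thesis using that by blast
qed

lemma pd_eq:
  assumes "(f has_derivative (\<lambda>d. \<Sum>i\<in>UNIV. d $ i * g i)) (at x)"
  shows "pd i f x = g i"
proof -
  have "frechet_derivative f (at x) = (\<lambda>d. \<Sum>i\<in>UNIV. d $ i * g i)"
    using frechet_derivative_at[OF assms] by simp
  then show ?thesis
    by (simp add: pd_def axis_def if_distrib[of "\<lambda>z. z * _"] cong: if_cong)
qed

lemma flat_alg_pd: "f \<in> flat_alg \<Longrightarrow> pd i f \<in> flat_alg"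
proof (erule flat_alg_derivative)
  fix g assume g: "\<And>i. g i \<in> flat_alg"
    "\<And>x. (f has_derivative (\<lambda>d. \<Sum>i\<in>UNIV. d $ i * g i x)) (at x)"
  have "pd i f = g i" using pd_eq[OF g(2)] by auto
  then show ?thesis using g(1) by simp
qed

lemma flat_alg_differentiable: "f \<in> flat_alg \<Longrightarrow> f differentiable at x"
  by (erule flat_alg_derivative) (auto simp: differentiable_def)

lemma has_derivative_pd:
  fixes f :: "real^3 \<Rightarrow> real"
  assumes "f differentiable at x"
  shows "(f has_derivative (\<lambda>d. \<Sum>i\<in>UNIV. d $ i * pd i f x)) (at x)"
proof -
  have f: "(f has_derivative frechet_derivative f (at x)) (at x)"
    using assms frechet_derivative_works by blast
  have lin: "linear (frechet_derivative f (at x))"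
    using f has_derivative_linear by blast
  have "frechet_derivative f (at x) d = (\<Sum>i\<in>UNIV. d $ i * pd i f x)" for d
  proof -
    have "d = (\<Sum>i\<in>UNIV. d $ i *\<^sub>R axis i 1)"
      using basis_expansion[of d] by (simp add: scalar_mult_eq_scaleR)
    then have "frechet_derivative f (at x) d = frechet_derivative f (at x) (\<Sum>i\<in>UNIV. d $ i *\<^sub>R axis i 1)"
      by simp
    also have "\<dots> = (\<Sum>i\<in>UNIV. d $ i * pd i f x)"
      using lin by (simp add: linear_sum linear_cmul pd_def)
    finally show ?thesis .
  qed
  then have "frechet_derivative f (at x) = (\<lambda>d. \<Sum>i\<in>UNIV. d $ i * pd i f x)" by auto
  then show ?thesis using f by simp
qed

text \<open>Iterated partial derivatives never leave a class that is closed under \<open>pd\<close>,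
  so smoothness reduces to one derivative of a general member. It serves for \<open>flat_alg\<close>
  and for the convolutions of a fixed integrable function.\<close>

lemma smooth_onI_closed:
  assumes "f \<in> X" "\<And>g i. g \<in> X \<Longrightarrow> pd i g \<in> X" "\<And>g x. g \<in> X \<Longrightarrow> g differentiable at x"
  shows "smooth_on UNIV f"
proof -
  have *: "(pd i ^^ n) g \<in> X" if "g \<in> X" for i n g
    using that by (induction n) (auto intro: assms(2))
  have "multi_pd \<beta> f \<in> X" for \<beta>
    unfolding multi_pd_def by (intro * assms(1))
  then show ?thesis
    unfolding smooth_on_def differentiable_on_def using assms(3) by blast
qed

lemma flat_alg_smooth: "f \<in> flat_alg \<Longrightarrow> smooth_on UNIV f"
  by (rule smooth_onI_closed[where X = flat_alg]) (auto intro: flat_alg_pd flat_alg_differentiable)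

lemma flat_alg_continuous: "f \<in> flat_alg \<Longrightarrow> continuous_on S f"
  using flat_alg_differentiable by (metis continuous_at_imp_continuous_on differentiable_imp_continuous_within)

lemma smooth_on_UNIV_differentiable: "smooth_on UNIV f \<Longrightarrow> f differentiable at x"
  by (drule smooth_on_def[THEN iffD1, THEN spec[of _ "0"]])
    (auto simp: multi_pd_def differentiable_on_def)

lemma smooth_on_UNIV_pd_differentiable:
  assumes "smooth_on UNIV f" shows "pd i f differentiable at x"
proof -
  have "multi_pd (axis i 1) f = pd i f"
    using exhaust_3[of i] by (auto simp: multi_pd_def axis_def)
  then show ?thesis using assms unfolding smooth_on_def differentiable_on_def by (metis UNIV_I)
qed

lemma flat_alg_prod: "finite S \<Longrightarrow> (\<And>j. j \<in> S \<Longrightarrow> f j \<in> flat_alg) \<Longrightarrow> (\<lambda>x. \<Prod>j\<in>S. f j x) \<in> flat_alg"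
  by (induction S rule: finite_induct) (auto intro: flat_alg.intros)

text \<open>The factor \<open>n\<close> only steepens the flanks: the function is positive exactly
  on the open box for every \<open>n > 0\<close>, and for growing \<open>n\<close> it tends to the
  indicator of the box. The arguments are spelled out in the shape of the generators of
  \<open>flat_alg\<close>.\<close>

definition box_bump :: "real \<Rightarrow> real^3 \<Rightarrow> real^3 \<Rightarrow> real^3 \<Rightarrow> real"
  where "box_bump n a b x = (\<Prod>i\<in>UNIV. flat 0 (n * x $ i + - n * a $ i) * flat 0 (- n * x $ i + n * b $ i))"

lemma box_bump_flat_alg: "box_bump n a b \<in> flat_alg"
  unfolding box_bump_def[abs_def] by (intro flat_alg_prod flat_alg.mult flat_alg.flat finite)

lemma box_bump_nonneg: "0 \<le> box_bump n a b x"
  unfolding box_bump_def by (intro prod_nonneg ballI mult_nonneg_nonneg flat_nonneg)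

lemma box_bump_le_1: "box_bump n a b x \<le> 1"
  unfolding box_bump_def
  by (intro prod_le_1 conjI mult_nonneg_nonneg flat_nonneg mult_le_one flat_0_le_1)

lemma box_bump_pos_iff:
  assumes "n > 0" shows "0 < box_bump n a b x \<longleftrightarrow> x \<in> box a b"
proof -
  define f where "f i = flat 0 (n * x $ i + - n * a $ i) * flat 0 (- n * x $ i + n * b $ i)" for i
  have f0: "0 \<le> f i" for i
    by (simp add: f_def flat_nonneg)
  have *: "0 < f i \<longleftrightarrow> a $ i < x $ i \<and> x $ i < b $ i" for i
  proof -
    have "0 < f i \<longleftrightarrow> 0 < flat 0 (n * x $ i + - n * a $ i) \<and> 0 < flat 0 (- n * x $ i + n * b $ i)"
      unfolding f_def using flat_nonneg[of 0 "n * x $ i + - n * a $ i"]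
      by (auto simp: zero_less_mult_iff not_less simp del: mult_minus_left)
    then show ?thesis using assms by (simp add: flat_0_pos_iff)
  qed
  have "0 < prod f UNIV \<longleftrightarrow> (\<forall>i. 0 < f i)"
    using f0 by (metis UNIV_I finite order_less_le prod_pos prod_zero_iff)
  moreover have "box_bump n a b x = prod f UNIV"
    unfolding box_bump_def by (rule prod.cong) (simp_all add: f_def)
  ultimately show ?thesis by (simp add: * mem_box_cart)
qed

lemma box_bump_eq_0: "n > 0 \<Longrightarrow> x \<notin> box a b \<Longrightarrow> box_bump n a b x = 0"
  using box_bump_pos_iff box_bump_nonneg by (metis order_less_le)

lemma box_bump_support:
  assumes "n > 0" shows "{x. box_bump n a b x \<noteq> 0} = box a b"
proof -
  have "box_bump n a b x \<noteq> 0 \<longleftrightarrow> x \<in> box a b" for x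
    using box_bump_pos_iff[OF assms, of a b x] box_bump_nonneg[of n a b x] by linarith
  then show ?thesis by blast
qed

lemma box_bump_test:
  assumes "n > 0" "cbox a b \<subseteq> \<Omega>" shows "box_bump n a b \<in> test_functions \<Omega>"
proof -
  have "closure (box a b) \<subseteq> cbox a b"
    by (intro closure_minimal box_subset_cbox closed_cbox)
  moreover have "compact (closure (box a b))"
    using bounded_box compact_closure by blast
  ultimately show ?thesis
    using assms flat_alg_smooth[OF box_bump_flat_alg] by (auto simp: test_functions_def box_bump_support)
qed

lemma flat_at_top: "((\<lambda>n. flat 0 (real n * t)) \<longlongrightarrow> (if t > 0 then 1 else 0)) sequentially"
proof (cases "t > 0")
  case True
  have "(\<lambda>n. (1 / t) * (1 / real n)) \<longlonglongrightarrow> (1 / t) * 0"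
    by (intro tendsto_mult tendsto_const lim_1_over_n)
  then have "(\<lambda>n. exp (- ((1 / t) * (1 / real n)))) \<longlonglongrightarrow> exp (- ((1 / t) * 0))"
    by (intro tendsto_intros)
  then have "(\<lambda>n. exp (- (1 / (real n * t)))) \<longlonglongrightarrow> exp (- 0)"
    by (simp add: mult.commute)
  moreover have "\<forall>\<^sub>F n in sequentially. exp (- (1 / (real n * t))) = flat 0 (real n * t)"
    using eventually_gt_at_top[of 0] by eventually_elim (use True in \<open>simp add: flat_def\<close>)
  ultimately show ?thesis using True by (simp add: filterlim_cong)
next
  case False
  then have "flat 0 (real n * t) = 0" for n
    by (auto simp: flat_def zero_less_mult_iff)
  then show ?thesis using False by simp
qed

lemma box_bump_tendsto: "(\<lambda>n. box_bump (real n) a b x) \<longlonglongrightarrow> indicator (box a b) x"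
proof -
  have eq: "box_bump (real n) a b x =
      (\<Prod>i\<in>UNIV. flat 0 (real n * (x $ i - a $ i)) * flat 0 (real n * (b $ i - x $ i)))" for n
    unfolding box_bump_def by (simp add: right_diff_distrib)
  have lim: "(\<lambda>n. box_bump (real n) a b x) \<longlonglongrightarrow>
    (\<Prod>i\<in>UNIV. (if x $ i - a $ i > 0 then 1 else 0) * (if b $ i - x $ i > 0 then 1 else 0))"
    unfolding eq by (intro tendsto_prod tendsto_mult flat_at_top)
  have val: "(\<Prod>i\<in>UNIV. (if x $ i - a $ i > 0 then 1 else 0) * (if b $ i - x $ i > 0 then 1 else 0)) =
      (indicator (box a b) x :: real)"
  proof (cases "x \<in> box a b")
    case True
    then show ?thesis by (simp add: mem_box_cart)
  next
    case False
    then obtain i where i: "\<not> (a $ i < x $ i \<and> x $ i < b $ i)" by (auto simp: mem_box_cart)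
    have "(\<Prod>i\<in>UNIV. (if x $ i - a $ i > 0 then 1 else 0) * (if b $ i - x $ i > 0 then 1 else 0)) = (0::real)"
      by (rule prod_zero) (use i in auto)
    then show ?thesis using False by simp
  qed
  show ?thesis using lim unfolding val .
qed

subsection \<open>Integration and gradients\<close>

lemma integrable_bounded_support:
  fixes f :: "'a::euclidean_space \<Rightarrow> real"
  assumes "f \<in> borel_measurable lebesgue" "\<And>x. \<bar>f x\<bar> \<le> B" "\<And>x. x \<notin> S \<Longrightarrow> f x = 0" "bounded S"
  shows "integrable lebesgue f"
proof -
  obtain R where R: "S \<subseteq> cball 0 R"
    using bounded_subset_ballD[OF assms(4), of 0] ball_subset_cball by blast
  have "integrable lebesgue (\<lambda>x. B * indicator (cball 0 R :: 'a set) x)"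
    by (intro integrable_mult_right integrable_real_indicator)
      (use emeasure_bounded_finite[OF bounded_cball, of 0 R] in \<open>auto simp: less_top\<close>)
  then show ?thesis
  proof (rule Bochner_Integration.integrable_bound[OF _ assms(1)])
    show "AE x in lebesgue. norm (f x) \<le> norm (B * indicator (cball 0 R) x)"
    proof (rule AE_I2)
      fix x
      show "norm (f x) \<le> norm (B * indicator (cball 0 R) x)"
        using assms(2)[of x] assms(3)[of x] R by (cases "x \<in> cball 0 R") (auto simp: subset_eq)
    qed
  qed
qed

lemma integral_lebesgue_translation:
  fixes f :: "'a::euclidean_space \<Rightarrow> real"
  assumes "f \<in> borel_measurable borel"
  shows "(LINT x|lebesgue. f (x + w)) = (LINT x|lebesgue. f x)"
proof -
  have m: "(\<lambda>x. f (x + w)) \<in> borel_measurable borel"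
    using assms by measurable
  have "(LINT x|lebesgue. f (x + w)) = (LINT x|lborel. f (x + w))"
    by (rule integral_completion) (use m in simp)
  also have "\<dots> = (LINT x|lborel. f (w + x))"
    by (simp add: add.commute)
  also have "\<dots> = (LINT x|distr lborel borel ((+) w). f x)"
    by (rule integral_distr[symmetric]) (use assms in auto)
  also have "\<dots> = (LINT x|lborel. f x)"
    by (simp add: lborel_distr_plus)
  also have "\<dots> = (LINT x|lebesgue. f x)"
    by (rule integral_completion[symmetric]) (use assms in simp)
  finally show ?thesis .
qed

lemma lipschitz_imp_continuous_on_UNIV:
  fixes F :: "'a::real_normed_vector \<Rightarrow> real"
  assumes "\<And>x y. \<bar>F x - F y\<bar> \<le> L * norm (x - y)"
  shows "continuous_on UNIV F"
proof -
  have "(\<bar>L\<bar>)-lipschitz_on UNIV F"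
  proof (rule lipschitz_onI)
    fix x y show "dist (F x) (F y) \<le> \<bar>L\<bar> * dist x y"
      using order_trans[OF assms[of x y] mult_right_mono[of L "\<bar>L\<bar>" "norm (x - y)"]]
      by (simp add: dist_norm)
  qed simp
  then show ?thesis by (rule lipschitz_on_continuous_on)
qed

text \<open>By translation invariance each difference quotient in direction \<open>v\<close> has
  integral zero. The quotients are bounded by \<open>L * norm v\<close> and vanish off a fixed ball,
  so dominated convergence passes this on to the derivative. Every integration by parts below goes
  back to this lemma.\<close>

lemma lipschitz_directional_derivative_integral_0:
  fixes F G :: "'a::euclidean_space \<Rightarrow> real"
  assumes lip: "\<And>x y. \<bar>F x - F y\<bar> \<le> L * norm (x - y)"
    and supp: "\<And>x. x \<notin> S \<Longrightarrow> F x = 0" "bounded S"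
    and deriv: "AE x in lebesgue. ((\<lambda>t. F (x + t *\<^sub>R v)) has_real_derivative G x) (at 0)"
    and G: "G \<in> borel_measurable lebesgue"
  shows "(LINT x|lebesgue. G x) = 0"
proof -
  have cont: "continuous_on UNIV F"
    by (rule lipschitz_imp_continuous_on_UNIV[OF lip])
  then have Fb: "F \<in> borel_measurable borel"
    by (rule borel_measurable_continuous_onI)
  obtain R where R: "S \<subseteq> cball 0 R" "R > 0"
    using bounded_subset_ballD[OF supp(2), of 0] ball_subset_cball by blast
  obtain x0 where x0: "x0 \<notin> cball (0::'a) R"
    using bounded_cball[of 0 R] not_bounded_UNIV by (metis UNIV_eq_I)
  define h where "h n = 1 / (real n + 1)" for n
  have h: "0 < h n" "h n \<le> 1" for n by (auto simp: h_def)
  define D where "D n x = (F (x + h n *\<^sub>R v) - F x) / h n" for n x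
  \<comment> \<open>As \<open>h n \<le> 1\<close>, neither \<open>x\<close> nor its translate lies
    in the support once \<open>x\<close> is outside this ball; one dominating function thus serves
    all \<open>n\<close>.\<close>
  define B where "B = cball (0::'a) (R + norm v)"
  have Fshift: "(\<lambda>x. F (x + w)) \<in> borel_measurable borel" for w
    using Fb by measurable
  have intF: "integrable lebesgue (\<lambda>x. F (x + w))" for w
  proof -
    have bnd: "\<bar>F x\<bar> \<le> \<bar>L\<bar> * (norm x0 + R)" for x
    proof (cases "x \<in> cball 0 R")
      case True
      have "\<bar>F x - F x0\<bar> \<le> L * norm (x - x0)" by (rule lip)
      also have "\<dots> \<le> \<bar>L\<bar> * (norm x0 + R)"
        using True norm_triangle_ineq4[of x x0] by (intro mult_mono) auto
      finally have "\<bar>F x - F x0\<bar> \<le> \<bar>L\<bar> * (norm x0 + R)" .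
      moreover have "F x0 = 0" using supp(1) x0 R by blast
      ultimately show ?thesis by simp
    next
      case False
      then have "F x = 0" using supp(1) R by blast
      then show ?thesis using R by simp
    qed
    show ?thesis
    proof (rule integrable_bounded_support[where S = "cball (- w) R"])
      show "(\<lambda>x. F (x + w)) \<in> borel_measurable lebesgue"
        by (rule measurable_completion) (use Fshift in simp)
      show "F (x + w) = 0" if "x \<notin> cball (- w) R" for x
        using that supp(1)[of "x + w"] R by (auto simp: dist_norm subset_eq norm_minus_commute algebra_simps)
    qed (use bnd in auto)
  qed
  have int0: "(LINT x|lebesgue. D n x) = 0" for n
  proof -
    have "(LINT x|lebesgue. D n x) = ((LINT x|lebesgue. F (x + h n *\<^sub>R v)) - (LINT x|lebesgue. F x)) / h n"
      unfolding D_def using intF[of "h n *\<^sub>R v"] intF[of 0] by simp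
    then show ?thesis by (simp add: integral_lebesgue_translation[OF Fb])
  qed
  have "(\<lambda>n. LINT x|lebesgue. D n x) \<longlonglongrightarrow> (LINT x|lebesgue. G x)"
  proof (rule integral_dominated_convergence[where w = "\<lambda>x. (L * norm v) * indicator B x"])
    show "D n \<in> borel_measurable lebesgue" for n
      unfolding D_def[abs_def] using intF[of "h n *\<^sub>R v"] intF[of 0] by simp
    show "integrable lebesgue (\<lambda>x. (L * norm v) * indicator B x)"
      by (intro integrable_mult_right integrable_real_indicator)
        (use emeasure_bounded_finite[OF bounded_cball, of 0 "R + norm v"] in \<open>auto simp: less_top B_def\<close>)
    show "AE x in lebesgue. (\<lambda>n. D n x) \<longlonglongrightarrow> G x"
      using deriv
    proof eventually_elim
      fix x assume "((\<lambda>t. F (x + t *\<^sub>R v)) has_real_derivative G x) (at 0)"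
      then have "((\<lambda>t. (F (x + t *\<^sub>R v) - F x) / t) \<longlongrightarrow> G x) (at 0)"
        by (simp add: DERIV_def)
      moreover have "filterlim h (at 0) sequentially"
        unfolding filterlim_at
        using h(1) LIMSEQ_inverse_real_of_nat by (auto simp: h_def[abs_def] inverse_eq_divide add.commute less_imp_neq)
      ultimately have "((\<lambda>n. (F (x + h n *\<^sub>R v) - F x) / h n) \<longlongrightarrow> G x) sequentially"
        by (rule filterlim_compose)
      then show "(\<lambda>n. D n x) \<longlonglongrightarrow> G x" by (simp add: D_def)
    qed
    show "AE x in lebesgue. norm (D n x) \<le> (L * norm v) * indicator B x" for n
    proof (rule AE_I2)
      fix x
      show "norm (D n x) \<le> (L * norm v) * indicator B x"
      proof (cases "x \<in> B")
        case True
        have "\<bar>F (x + h n *\<^sub>R v) - F x\<bar> \<le> L * norm (h n *\<^sub>R v)"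
          using lip[of "x + h n *\<^sub>R v" x] by simp
        then have "\<bar>D n x\<bar> \<le> L * norm v"
          using h(1)[of n] by (simp add: D_def abs_divide divide_le_eq mult_ac)
        then show ?thesis using True by simp
      next
        case False
        have "norm (h n *\<^sub>R v) \<le> norm v"
          using h[of n] mult_right_mono[of "h n" 1 "norm v"] by simp
        then have "norm (x + h n *\<^sub>R v) > R"
          using False norm_triangle_ineq4[of "x + h n *\<^sub>R v" "h n *\<^sub>R v"] by (auto simp: B_def)
        moreover have "norm x > R"
          using False norm_ge_zero[of v] unfolding B_def mem_cball_0 by linarith
        ultimately have "x + h n *\<^sub>R v \<notin> S" "x \<notin> S"
          using R(1) by (auto dest!: subsetD)
        then have "F (x + h n *\<^sub>R v) = 0" "F x = 0"
          using supp(1) by blast+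
        then show ?thesis using False by (simp add: D_def)
      qed
    qed
  qed (rule G)
  then show ?thesis unfolding int0 using LIMSEQ_unique tendsto_const by blast
qed

text \<open>Boxes are an intersection-stable generator of the Borel sets, so Dynkin's argument
  spreads the vanishing integrals to all Borel sets; the total integral serves the complements.
  Lebesgue sets differ from Borel sets by null sets, and densities with equal integrals agree almost
  everywhere.\<close>

lemma AE_0_if_box_integrals_0:
  fixes g :: "'a::euclidean_space \<Rightarrow> real"
  assumes g: "integrable lebesgue g"
    and total: "(LINT x|lebesgue. g x) = 0"
    and box: "\<And>c d. (LINT x:box c d|lebesgue. g x) = 0"
  shows "AE x in lebesgue. g x = 0"
proof -
  have si: "set_integrable lebesgue A g" if "A \<in> sets lebesgue" for A
    unfolding set_integrable_def using that g by (rule integrable_mult_indicator)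
  have borel: "(LINT x:A|lebesgue. g x) = 0" if "A \<in> sets borel" for A :: "'a set"
  proof -
    have "Int_stable (range (\<lambda>(a, b). box a b :: 'a set))"
      by (auto simp: Int_stable_def box_Int_box)
    moreover have "range (\<lambda>(a, b). box a b :: 'a set) \<subseteq> Pow UNIV" by simp
    moreover have "A \<in> sigma_sets UNIV (range (\<lambda>(a, b). box a b :: 'a set))"
      using that by (simp add: borel_eq_box)
    ultimately have "A \<in> sets borel \<and> (LINT x:A|lebesgue. g x) = 0"
    proof (induction rule: sigma_sets_induct_disjoint)
      case (basic A)
      then show ?case using box by auto
    next
      case empty
      then show ?case by (simp add: set_lebesgue_integral_def)
    next
      case (compl A)
      then have A: "A \<in> sets lebesgue" by auto
      have "(LINT x:(UNIV - A)|lebesgue. g x) = (LINT x|lebesgue. g x - indicator A x *\<^sub>R g x)"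
        unfolding set_lebesgue_integral_def
        by (rule Bochner_Integration.integral_cong) (auto simp: indicator_def)
      also have "\<dots> = (LINT x|lebesgue. g x) - (LINT x:A|lebesgue. g x)"
        unfolding set_lebesgue_integral_def
        using g si[OF A] by (intro Bochner_Integration.integral_diff) (auto simp: set_integrable_def)
      finally show ?case using compl total by (auto simp: Compl_eq_Diff_UNIV[symmetric])
    next
      case (union A)
      then have A: "\<And>i. A i \<in> sets lebesgue" by auto
      have "(LINT x:(\<Union>i. A i)|lebesgue. g x) = (\<Sum>i. LINT x:A i|lebesgue. g x)"
      proof (rule lebesgue_integral_countable_add)
        show "\<And>i j. i \<noteq> j \<Longrightarrow> A i \<inter> A j = {}"
          using union(1) by (auto simp: disjoint_family_on_def)
        show "set_integrable lebesgue (\<Union>i. A i) g"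
          by (rule si) (use A in auto)
      qed (use A in auto)
      then show ?case using union by auto
    qed
    then show ?thesis by simp
  qed
  have "(LINT x:A|lebesgue. g x) = 0" if A: "A \<in> sets lebesgue" for A
  proof -
    obtain S N N' where SN: "A = S \<union> N" "S \<in> sets borel" "N \<subseteq> N'" "N' \<in> null_sets lborel"
      using A by (elim sets_completionE) (auto simp: sets_lborel)
    have "AE x in lebesgue. x \<notin> N'"
      using SN(4) by (intro AE_completion AE_not_in)
    then have "AE x in lebesgue. indicator A x *\<^sub>R g x = indicator S x *\<^sub>R g x"
      by eventually_elim (use SN in \<open>auto simp: indicator_def\<close>)
    then have "(LINT x:A|lebesgue. g x) = (LINT x:S|lebesgue. g x)"
      unfolding set_lebesgue_integral_def
      using si[of A] si[of S] A SN(2) by (intro integral_cong_AE) (auto simp: set_integrable_def)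
    then show ?thesis using borel[OF SN(2)] by simp
  qed
  then show ?thesis
    using density_unique_real[OF g, of "\<lambda>_. 0"] by (simp add: set_lebesgue_integral_def)
qed

text \<open>Steepening \<open>box_bump\<close> turns the test condition into vanishing integrals
  over boxes whose closure lies in \<Omega>. Such boxes are stable under intersection, so
  \<open>AE_0_if_box_integrals_0\<close> applies to \<open>f\<close> cut off to any of them, and
  countably many closed boxes exhaust the open set.\<close>

lemma fundamental_lemma:
  fixes f :: "real^3 \<Rightarrow> real"
  assumes "open \<Omega>" and f: "integrable (lebesgue_on \<Omega>) f"
    and test: "\<And>\<phi>. \<phi> \<in> test_functions \<Omega> \<Longrightarrow> (LINT x|lebesgue_on \<Omega>. f x * \<phi> x) = 0"
  shows "AE x in lebesgue_on \<Omega>. f x = 0"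
proof -
  have \<Omega>: "\<Omega> \<in> sets lebesgue" using assms(1) by auto
  have fi: "integrable lebesgue (\<lambda>x. indicator \<Omega> x *\<^sub>R f x)"
    using f \<Omega> by (subst integrable_restrict_space[symmetric]) auto
  have box0: "(LINT x|lebesgue. indicator (box a b) x * f x) = 0" if ab: "cbox a b \<subseteq> \<Omega>" for a b
  proof -
    have sub: "box a b \<subseteq> \<Omega>" using ab box_subset_cbox by blast
    have "(\<lambda>n. LINT x|lebesgue_on \<Omega>. f x * box_bump (real n) a b x) \<longlonglongrightarrow>
        (LINT x|lebesgue_on \<Omega>. f x * indicator (box a b) x)"
    proof (rule integral_dominated_convergence[where w = "\<lambda>x. norm (f x)"])
      have "(indicator (box a b) :: _ \<Rightarrow> real) \<in> borel_measurable (lebesgue_on \<Omega>)"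
        by (intro measurable_restrict_space1 borel_measurable_indicator) auto
      then show "(\<lambda>x. f x * indicator (box a b) x) \<in> borel_measurable (lebesgue_on \<Omega>)"
        using f by (intro borel_measurable_times) auto
      have "box_bump (real n) a b \<in> borel_measurable (lebesgue_on \<Omega>)" for n
        using flat_alg_continuous[OF box_bump_flat_alg] \<Omega>
        by (intro continuous_imp_measurable_on_sets_lebesgue) auto
      then show "(\<lambda>x. f x * box_bump (real n) a b x) \<in> borel_measurable (lebesgue_on \<Omega>)" for n
        using f by (intro borel_measurable_times) auto
      show "AE x in lebesgue_on \<Omega>. (\<lambda>n. f x * box_bump (real n) a b x) \<longlonglongrightarrow> f x * indicator (box a b) x"
        by (intro AE_I2 tendsto_mult tendsto_const box_bump_tendsto)
      show "AE x in lebesgue_on \<Omega>. norm (f x * box_bump (real n) a b x) \<le> norm (f x)" for n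
        using box_bump_nonneg box_bump_le_1 by (intro AE_I2) (auto simp: abs_mult mult_left_le)
    qed (use f in auto)
    moreover have "(\<lambda>n. LINT x|lebesgue_on \<Omega>. f x * box_bump (real n) a b x) \<longlonglongrightarrow> 0"
    proof (rule tendsto_eventually)
      show "\<forall>\<^sub>F n in sequentially. (LINT x|lebesgue_on \<Omega>. f x * box_bump (real n) a b x) = 0"
        using eventually_gt_at_top[of 0]
        by eventually_elim (use test box_bump_test ab in auto)
    qed
    ultimately have "(LINT x|lebesgue_on \<Omega>. f x * indicator (box a b) x) = 0"
      using LIMSEQ_unique by blast
    also have "(LINT x|lebesgue_on \<Omega>. f x * indicator (box a b) x) =
        (LINT x|lebesgue. indicator \<Omega> x *\<^sub>R (f x * indicator (box a b) x))"
      using \<Omega> by (intro integral_restrict_space) auto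
    also have "\<dots> = (LINT x|lebesgue. indicator (box a b) x * f x)"
      by (rule Bochner_Integration.integral_cong) (use sub in \<open>auto simp: indicator_def\<close>)
    finally show ?thesis .
  qed
  have boxAE: "AE x in lebesgue. x \<in> cbox a b \<longrightarrow> f x = 0" if ab: "cbox a b \<subseteq> \<Omega>" for a b
  proof -
    define g where "g x = indicator (box a b) x * f x" for x
    have sub: "box a b \<subseteq> \<Omega>" using ab box_subset_cbox by blast
    have "integrable lebesgue (\<lambda>x. indicator (box a b) x *\<^sub>R (indicator \<Omega> x *\<^sub>R f x))"
      by (rule integrable_mult_indicator[OF _ fi]) auto
    moreover have "(\<lambda>x. indicator (box a b) x *\<^sub>R (indicator \<Omega> x *\<^sub>R f x)) = g"
      using sub by (intro ext) (auto simp: g_def indicator_def)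
    ultimately have gi: "integrable lebesgue g" by simp
    have "AE x in lebesgue. g x = 0"
    proof (rule AE_0_if_box_integrals_0[OF gi])
      show "(LINT x|lebesgue. g x) = 0"
        unfolding g_def by (rule box0[OF ab])
      fix c d :: "real^3"
      obtain a' b' where "box a b \<inter> box c d = box a' b'" "cbox a b \<inter> cbox c d = cbox a' b'"
        by (simp add: box_Int_box Int_interval)
      then have "(LINT x|lebesgue. indicator (box a' b') x * f x) = 0" "box a b \<inter> box c d = box a' b'"
        using box0[of a' b'] ab by auto
      moreover have "(LINT x:box c d|lebesgue. g x) = (LINT x|lebesgue. indicator (box a b \<inter> box c d) x * f x)"
        unfolding set_lebesgue_integral_def g_def
        by (rule Bochner_Integration.integral_cong) (auto simp: indicator_def)
      ultimately show "(LINT x:box c d|lebesgue. g x) = 0" by simp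
    qed
    moreover have "AE x in lebesgue. x \<notin> cbox a b - box a b"
    proof -
      have "negligible (cbox a b - box a b)"
        using negligible_frontier_interval[of a b] by simp
      then have "cbox a b - box a b \<in> null_sets lebesgue"
        by (simp add: negligible_iff_null_sets)
      then show ?thesis by (rule AE_not_in)
    qed
    ultimately show ?thesis
      by eventually_elim (auto simp: g_def indicator_def split: if_splits)
  qed
  obtain \<D> where \<D>: "countable \<D>" "\<D> \<subseteq> Pow \<Omega>" "\<And>X. X \<in> \<D> \<Longrightarrow> \<exists>a b. X = cbox a b" "\<Union>\<D> = \<Omega>"
    using open_countable_Union_open_cbox[OF \<open>open \<Omega>\<close>] by blast
  have "AE x in lebesgue. \<forall>X\<in>\<D>. x \<in> X \<longrightarrow> f x = 0"
    unfolding AE_ball_countable[OF \<D>(1)]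
  proof
    fix X assume X: "X \<in> \<D>"
    then obtain a b where "X = cbox a b" using \<D>(3) by blast
    then show "AE x in lebesgue. x \<in> X \<longrightarrow> f x = 0"
      using boxAE[of a b] X \<D>(2) by blast
  qed
  then have "AE x in lebesgue. x \<in> \<Omega> \<longrightarrow> f x = 0"
    by eventually_elim (use \<D>(4) in blast)
  then show ?thesis
    using \<Omega> by (subst AE_restrict_space_iff) auto
qed

lemma compact_support_bounded:
  fixes f :: "'a::metric_space \<Rightarrow> real"
  assumes "continuous_on UNIV f" "compact S" "\<And>x. x \<notin> S \<Longrightarrow> f x = 0"
  obtains B where "B \<ge> 0" "\<And>x. \<bar>f x\<bar> \<le> B"
proof -
  have "bounded (f ` S)"
    using assms continuous_on_subset compact_continuous_image compact_imp_bounded by blast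
  then obtain B where B: "\<And>x. x \<in> S \<Longrightarrow> \<bar>f x\<bar> \<le> B" "B > 0"
    by (auto simp: bounded_pos)
  have "\<bar>f x\<bar> \<le> B" for x
    using B(1)[of x] B(2) assms(3)[of x] by (cases "x \<in> S") auto
  then show ?thesis using that[of B] B(2) by auto
qed

text \<open>\<open>pd\<close> is defined through a choice of a derivative. Locality is therefore
  shown for the whole predicate \<open>has_derivative\<close>: equal predicates lead to equal
  choices, also where no derivative exists.\<close>

lemma pd_cong_open:
  assumes "open U" "x \<in> U" "\<And>y. y \<in> U \<Longrightarrow> f y = g y"
  shows "pd i f x = pd i g x"
proof -
  have "(f has_derivative f') (at x) \<longleftrightarrow> (g has_derivative f') (at x)" for f'
    using assms has_derivative_transform_within_open[of f f' x UNIV U g]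
      has_derivative_transform_within_open[of g f' x UNIV U f] by auto
  then show ?thesis by (simp add: pd_def frechet_derivative_def)
qed

section \<open>Calculus of classical gradients\<close>

definition grad :: "(real^3 \<Rightarrow> real) \<Rightarrow> real^3 \<Rightarrow> real^3"
  where "grad f x = (\<chi> i. pd i f x)"

lemma grad_nth [simp]: "grad f x $ i = pd i f x"
  by (simp add: grad_def)

lemma has_derivative_grad:
  assumes "f differentiable at x"
  shows "(f has_derivative (\<lambda>d. grad f x \<bullet> d)) (at x)"
  using has_derivative_pd[OF assms] by (simp add: inner_vec_def mult.commute)

lemma grad_eq:
  assumes "(f has_derivative (\<lambda>d. g \<bullet> d)) (at x)"
  shows "grad f x = g"
proof -
  have "(f has_derivative (\<lambda>d. \<Sum>i\<in>UNIV. d $ i * g $ i)) (at x)"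
    using assms by (simp add: inner_vec_def mult.commute)
  then show ?thesis using pd_eq[of f "\<lambda>i. g $ i" x] by (simp add: vec_eq_iff)
qed

lemma grad_add:
  assumes "f differentiable at x" "g differentiable at x"
  shows "grad (\<lambda>x. f x + g x) x = grad f x + grad g x"
  by (rule grad_eq)
    (use has_derivative_add[OF assms[THEN has_derivative_grad]] in \<open>simp add: inner_add_left\<close>)

lemma grad_diff:
  assumes "f differentiable at x" "g differentiable at x"
  shows "grad (\<lambda>x. f x - g x) x = grad f x - grad g x"
  by (rule grad_eq)
    (use has_derivative_diff[OF assms[THEN has_derivative_grad]] in \<open>simp add: inner_diff_left\<close>)

lemma grad_mult:
  assumes "f differentiable at x" "g differentiable at x"
  shows "grad (\<lambda>x. f x * g x) x = f x *\<^sub>R grad g x + g x *\<^sub>R grad f x"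
proof (rule grad_eq)
  show "((\<lambda>x. f x * g x) has_derivative (\<lambda>d. (f x *\<^sub>R grad g x + g x *\<^sub>R grad f x) \<bullet> d)) (at x)"
    using has_derivative_mult[OF assms[THEN has_derivative_grad]]
    by (simp add: inner_add_left mult.commute)
qed

lemma affine_has_derivative: "((\<lambda>y::real^3. a \<bullet> y + b) has_derivative (\<lambda>d. a \<bullet> d)) (at x)"
  by (auto intro!: derivative_eq_intros)

lemma locally_affine_has_derivative:
  fixes f :: "real^3 \<Rightarrow> real"
  assumes "open U" "x \<in> U" "\<And>y. y \<in> U \<Longrightarrow> f y = a \<bullet> y + b"
  shows "(f has_derivative (\<lambda>d. a \<bullet> d)) (at x)"
  by (rule has_derivative_transform_within_open[OF affine_has_derivative assms(1,2)])
    (use assms(3) in simp)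

lemma directional_derivative_grad:
  assumes "f differentiable at x"
  shows "((\<lambda>t. f (x + t *\<^sub>R v)) has_real_derivative grad f x \<bullet> v) (at 0)"
proof -
  have l: "((\<lambda>t. x + t *\<^sub>R v) has_derivative (\<lambda>t. t *\<^sub>R v)) (at (0::real))"
    by (auto intro!: derivative_eq_intros)
  have "(f has_derivative (\<lambda>d. grad f x \<bullet> d)) (at (x + 0 *\<^sub>R v))"
    using has_derivative_grad[OF assms] by simp
  from has_derivative_compose[OF l this]
  show ?thesis by (simp add: has_field_derivative_def mult_commute_abs)
qed

text \<open>In the direction of the gradient itself the difference quotient tends to the squared
  norm of the gradient, while the Lipschitz bound allows at most \<open>L\<close> times its
  norm.\<close>

lemma norm_grad_le_lipschitz:
  assumes "f differentiable at x" "open U" "x \<in> U" "\<And>y. y \<in> U \<Longrightarrow> \<bar>f y - f x\<bar> \<le> L * norm (y - x)"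
  shows "norm (grad f x) \<le> L"
proof (cases "grad f x = 0")
  \<comment> \<open>Only \<open>0 \<le> L\<close> is left; it is read off from the Lipschitz bound
    at a second point of \<open>U\<close>.\<close>
  case True
  obtain e where e: "e > 0" "cball x e \<subseteq> U" using assms(2,3) open_contains_cball by blast
  have "x + e *\<^sub>R axis 1 1 \<in> U" using e by (auto simp: subset_eq dist_norm)
  from assms(4)[OF this] have "0 \<le> L * e" using e by simp
  then show ?thesis using e True by (simp add: zero_le_mult_iff)
next
  case False
  define v where "v = grad f x"
  obtain e where e: "e > 0" "cball x e \<subseteq> U" using assms(2,3) open_contains_cball by blast
  have "((\<lambda>t. (f (x + t *\<^sub>R v) - f x) / t) \<longlongrightarrow> v \<bullet> v) (at 0)"
    using directional_derivative_grad[OF assms(1), of v] by (simp add: DERIV_def v_def)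
  then have "((\<lambda>t. (f (x + t *\<^sub>R v) - f x) / t) \<longlongrightarrow> v \<bullet> v) (at_right 0)"
    by (rule filterlim_mono) (auto intro: at_le)
  then have "v \<bullet> v \<le> L * norm v"
  proof (rule tendsto_upperbound)
    show "\<forall>\<^sub>F t in at_right 0. (f (x + t *\<^sub>R v) - f x) / t \<le> L * norm v"
      unfolding eventually_at_right_field
    proof (intro exI conjI allI impI)
      show "e / norm v > 0" using e False v_def by simp
      fix t assume t: "0 < t" "t < e / norm v"
      have "x + t *\<^sub>R v \<in> U"
        using e t False by (auto simp: subset_eq dist_norm v_def field_simps)
      from assms(4)[OF this] have "f (x + t *\<^sub>R v) - f x \<le> L * (t * norm v)" using t by simp
      then show "(f (x + t *\<^sub>R v) - f x) / t \<le> L * norm v" using t by (simp add: field_simps)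
    qed
  qed simp
  then have "norm v * norm v \<le> L * norm v" by (simp add: power2_norm_eq_inner[symmetric] power2_eq_square)
  then show ?thesis using False by (simp add: v_def)
qed

lemma C1_compact_support_lipschitz:
  fixes f :: "real^3 \<Rightarrow> real"
  assumes "\<And>x. f differentiable at x" "\<And>i. continuous_on UNIV (pd i f)"
    "compact S" "\<And>x. x \<notin> S \<Longrightarrow> f x = 0"
  obtains L where "L \<ge> 0" "\<And>x y. \<bar>f x - f y\<bar> \<le> L * norm (x - y)"
proof -
  have "\<exists>B\<ge>0. \<forall>x. \<bar>pd i f x\<bar> \<le> B" for i
  proof -
    have "pd i f x = 0" if "x \<notin> S" for x
    proof -
      have "pd i f x = pd i (\<lambda>x. 0) x"
        by (rule pd_cong_open[of "- S"]) (use that assms(3,4) compact_imp_closed in auto)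
      also have "\<dots> = 0" using pd_eq[of "\<lambda>x. 0" "\<lambda>i. 0" x i] by simp
      finally show ?thesis .
    qed
    then show ?thesis using compact_support_bounded[OF assms(2) assms(3)] by metis
  qed
  then obtain B where B: "\<And>i. B i \<ge> 0" "\<And>i x. \<bar>pd i f x\<bar> \<le> B i" by metis
  define L where "L = (\<Sum>i\<in>UNIV. B i)"
  have "norm (f x - f y) \<le> L * norm (x - y)" for x y
  proof (rule differentiable_bound[OF convex_UNIV])
    fix z :: "real^3"
    show "(f has_derivative (\<lambda>d. \<Sum>i\<in>UNIV. d $ i * pd i f z)) (at z within UNIV)"
      using has_derivative_pd[OF assms(1)] by simp
    show "onorm (\<lambda>d. \<Sum>i\<in>UNIV. d $ i * pd i f z) \<le> L"
    proof (rule onorm_le)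
      fix d :: "real^3"
      have "norm (d $ i * pd i f z) \<le> norm d * B i" for i
        using mult_mono[OF component_le_norm_cart B(2)] by (simp add: abs_mult)
      then have "norm (\<Sum>i\<in>UNIV. d $ i * pd i f z) \<le> (\<Sum>i\<in>UNIV. norm d * B i)"
        by (intro order_trans[OF norm_sum sum_mono])
      then show "norm (\<Sum>i\<in>UNIV. d $ i * pd i f z) \<le> L * norm d"
        unfolding sum_distrib_left[symmetric] L_def by (simp only: mult.commute)
    qed
  qed auto
  moreover have "L \<ge> 0" using B by (simp add: L_def sum_nonneg)
  ultimately show ?thesis using that[of L] by simp
qed

lemma test_function_facts:
  assumes "\<phi> \<in> test_functions \<Omega>"
  shows "\<And>x. \<phi> differentiable at x"
    and "continuous_on UNIV \<phi>"
    and "\<And>i. continuous_on UNIV (pd i \<phi>)"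
    and "\<exists>S. compact S \<and> S \<subseteq> \<Omega> \<and> (\<forall>x. x \<notin> S \<longrightarrow> \<phi> x = 0 \<and> (\<forall>i. pd i \<phi> x = 0))"
    and "\<exists>B\<ge>0. \<forall>x. \<bar>\<phi> x\<bar> \<le> B \<and> (\<forall>i. \<bar>pd i \<phi> x\<bar> \<le> B)"
    and "\<exists>L\<ge>0. \<forall>x y. \<bar>\<phi> x - \<phi> y\<bar> \<le> L * norm (x - y)"
proof -
  have s: "smooth_on UNIV \<phi>" using assms by (simp add: test_functions_def)
  show d: "\<phi> differentiable at x" for x
    by (rule smooth_on_UNIV_differentiable[OF s])
  show c: "continuous_on UNIV \<phi>"
    using d by (meson continuous_at_imp_continuous_on differentiable_imp_continuous_within)
  show cd: "continuous_on UNIV (pd i \<phi>)" for i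
    using smooth_on_UNIV_pd_differentiable[OF s]
    by (meson continuous_at_imp_continuous_on differentiable_imp_continuous_within)
  define S where "S = closure {x. \<phi> x \<noteq> 0}"
  have S: "compact S" "S \<subseteq> \<Omega>" using assms by (auto simp: S_def test_functions_def)
  have S0: "\<phi> x = 0" if "x \<notin> S" for x
    using that closure_subset[of "{x. \<phi> x \<noteq> 0}"] by (auto simp: S_def)
  have S1: "pd i \<phi> x = 0" if "x \<notin> S" for x i
  proof -
    have "pd i \<phi> x = pd i (\<lambda>x. 0) x"
      by (rule pd_cong_open[of "- S"]) (use that S S0 compact_imp_closed in auto)
    also have "\<dots> = 0" using pd_eq[of "\<lambda>x. 0" "\<lambda>i. 0" x i] by simp
    finally show ?thesis .
  qed
  show "\<exists>S. compact S \<and> S \<subseteq> \<Omega> \<and> (\<forall>x. x \<notin> S \<longrightarrow> \<phi> x = 0 \<and> (\<forall>i. pd i \<phi> x = 0))"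
    using S S0 S1 by blast
  obtain B0 where B0: "B0 \<ge> 0" "\<And>x. \<bar>\<phi> x\<bar> \<le> B0"
    using compact_support_bounded[OF c S(1) S0] by blast
  have "\<exists>B. B \<ge> 0 \<and> (\<forall>x. \<bar>pd i \<phi> x\<bar> \<le> B)" for i
    using compact_support_bounded[OF cd S(1) S1] by metis
  then obtain B where B: "\<And>i. B i \<ge> 0" "\<And>i x. \<bar>pd i \<phi> x\<bar> \<le> B i" by metis
  have "B i \<le> B0 + sum B UNIV" for i
    using member_le_sum[of i UNIV B] B(1) B0(1) by simp
  then have "\<bar>\<phi> x\<bar> \<le> B0 + sum B UNIV \<and> (\<forall>i. \<bar>pd i \<phi> x\<bar> \<le> B0 + sum B UNIV)" for x
    using B B0 sum_nonneg[of UNIV B] by (meson add_increasing2 order_trans)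
  moreover have "B0 + sum B UNIV \<ge> 0" using B B0 by (simp add: sum_nonneg)
  ultimately show "\<exists>B\<ge>0. \<forall>x. \<bar>\<phi> x\<bar> \<le> B \<and> (\<forall>i. \<bar>pd i \<phi> x\<bar> \<le> B)" by blast
  show "\<exists>L\<ge>0. \<forall>x y. \<bar>\<phi> x - \<phi> y\<bar> \<le> L * norm (x - y)"
    using C1_compact_support_lipschitz[OF d cd S(1) S0] by metis
qed

lemma integrable_bounded_on:
  fixes f :: "real^3 \<Rightarrow> real"
  assumes "\<Omega> \<in> lmeasurable" "f \<in> borel_measurable (lebesgue_on \<Omega>)" "AE x in lebesgue_on \<Omega>. \<bar>f x\<bar> \<le> B"
  shows "integrable (lebesgue_on \<Omega>) f"
proof -
  interpret finite_measure "lebesgue_on \<Omega>"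
    using assms(1) by (rule finite_measure_lebesgue_on)
  show ?thesis
    by (rule integrable_const_bound[of _ B]) (use assms in auto)
qed

lemma continuous_measurable_on_open:
  fixes f :: "real^3 \<Rightarrow> real"
  assumes "continuous_on \<Omega> f" "open \<Omega>"
  shows "f \<in> borel_measurable (lebesgue_on \<Omega>)"
  using assms by (intro continuous_imp_measurable_on_sets_lebesgue) auto

subsection \<open>Weak gradients\<close>

text \<open>Finite element functions have this property on the union of the open cells, which fills
  the domain up to a negligible set. The affine piece may vary from point to point.\<close>

definition locally_affine_on :: "(real^3) set \<Rightarrow> (real^3 \<Rightarrow> real) \<Rightarrow> bool"
  where "locally_affine_on U u \<longleftrightarrow>
    (\<forall>x\<in>U. \<exists>V a b. open V \<and> x \<in> V \<and> V \<subseteq> U \<and> (\<forall>y\<in>V. u y = a \<bullet> y + b))"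

lemma locally_affine_on_open: "locally_affine_on U u \<Longrightarrow> open U"
  unfolding locally_affine_on_def by (meson openI open_contains_ball subset_trans)

lemma locally_affine_on_differentiable:
  "locally_affine_on U u \<Longrightarrow> x \<in> U \<Longrightarrow> u differentiable at x"
  unfolding locally_affine_on_def differentiable_def
  using locally_affine_has_derivative by metis

lemma grad_locally_affine:
  assumes "open V" "x \<in> V" "\<And>y. y \<in> V \<Longrightarrow> u y = a \<bullet> y + b"
  shows "grad u x = a"
  using grad_eq[OF locally_affine_has_derivative[OF assms]] .

lemma locally_affine_on_grad_continuous:
  assumes "locally_affine_on U u"
  shows "continuous_on U (grad u)"
proof (rule continuous_at_imp_continuous_on, rule ballI)
  fix x assume "x \<in> U"
  then obtain V a b where V: "open V" "x \<in> V" "\<And>y. y \<in> V \<Longrightarrow> u y = a \<bullet> y + b"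
    using assms unfolding locally_affine_on_def by metis
  have "\<forall>\<^sub>F y in nhds x. grad u y = a"
    unfolding eventually_nhds using V grad_locally_affine[OF V(1) _ V(3)] by blast
  then show "isCont (grad u) x" by (subst isCont_cong) auto
qed

text \<open>\<open>F\<close> may fail to be differentiable on the negligible set between
  \<open>U\<close> and \<Omega>, for instance on the faces of a mesh. Lipschitz continuity across
  that set is what rules out jump contributions.\<close>

lemma integral_grad_0:
  fixes F :: "real^3 \<Rightarrow> real"
  assumes \<Omega>: "open \<Omega>" "bounded \<Omega>" "negligible (frontier \<Omega>)"
    and U: "open U" "U \<subseteq> \<Omega>" "negligible (\<Omega> - U)"
    and lip: "\<And>x y. \<bar>F x - F y\<bar> \<le> L * norm (x - y)"
    and zero: "\<And>x. x \<notin> \<Omega> \<Longrightarrow> F x = 0"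
    and diff: "\<And>x. x \<in> U \<Longrightarrow> F differentiable at x"
    and g: "\<And>x. x \<in> U \<Longrightarrow> grad F x \<bullet> v = g x" "g \<in> borel_measurable (lebesgue_on \<Omega>)"
  shows "(LINT x|lebesgue_on \<Omega>. g x) = 0"
proof -
  define G where "G x = (if x \<in> U then g x else 0)" for x
  have G: "G \<in> borel_measurable lebesgue"
    unfolding G_def[abs_def]
    by (rule borel_measurable_if_I[OF measurable_restrict_mono[OF g(2) U(2)]]) (use U in auto)
  have AE1: "AE x in lebesgue. x \<notin> frontier \<Omega> \<and> x \<notin> \<Omega> - U"
    using \<Omega>(3) U(3) by (intro AE_conjI AE_not_in) (auto simp: negligible_iff_null_sets)
  have "(LINT x|lebesgue. G x) = 0"
  proof (rule lipschitz_directional_derivative_integral_0[OF lip zero \<Omega>(2) _ G])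
    show "AE x in lebesgue. ((\<lambda>t. F (x + t *\<^sub>R v)) has_real_derivative G x) (at 0)"
      using AE1
    proof eventually_elim
      fix x assume x: "x \<notin> frontier \<Omega> \<and> x \<notin> \<Omega> - U"
      show "((\<lambda>t. F (x + t *\<^sub>R v)) has_real_derivative G x) (at 0)"
      proof (cases "x \<in> U")
        case True
        then show ?thesis using directional_derivative_grad[OF diff, of x v] g(1) by (simp add: G_def)
      next
        case False
        \<comment> \<open>With the frontier and the exceptional set removed, the remaining points
          lie in the exterior, an open set on which \<open>F\<close> is identically zero.\<close>
        then have xc: "x \<in> - closure \<Omega>"
          using x \<Omega>(1) U(2) by (auto simp: frontier_def interior_open)
        have F0: "F y = 0 \<bullet> y + 0" if "y \<in> - closure \<Omega>" for y
          using zero that closure_subset[of \<Omega>] by auto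
        have op: "open (- closure \<Omega>)" by (intro open_Compl closed_closure)
        have "F differentiable at x" "grad F x = 0"
          using locally_affine_has_derivative[OF op xc F0] grad_locally_affine[OF op xc F0]
          by (auto simp: differentiable_def)
        then show ?thesis using directional_derivative_grad[of F x v] False by (simp add: G_def)
      qed
    qed
  qed
  moreover have "(LINT x|lebesgue_on \<Omega>. g x) = (LINT x|lebesgue_on \<Omega>. G x)"
  proof (rule integral_cong_AE)
    show "G \<in> borel_measurable (lebesgue_on \<Omega>)"
      using G by (rule measurable_restrict_space1)
    show "AE x in lebesgue_on \<Omega>. g x = G x"
      using AE1 \<Omega>(1) by (subst AE_restrict_space_iff) (auto simp: G_def)
  qed (rule g)
  moreover have "(LINT x|lebesgue_on \<Omega>. G x) = (LINT x|lebesgue. G x)"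
  proof -
    have "(LINT x|lebesgue_on \<Omega>. G x) = (LINT x|lebesgue. indicator \<Omega> x *\<^sub>R G x)"
      using \<Omega>(1) by (intro integral_restrict_space) auto
    also have "\<dots> = (LINT x|lebesgue. G x)"
      by (rule Bochner_Integration.integral_cong) (use U(2) in \<open>auto simp: G_def indicator_def\<close>)
    finally show ?thesis .
  qed
  ultimately show ?thesis by simp
qed

lemma locally_affine_grad_measurable:
  assumes "locally_affine_on U u" "U \<subseteq> \<Omega>" "negligible (\<Omega> - U)" "open \<Omega>"
  shows "grad u \<in> borel_measurable (lebesgue_on \<Omega>)"
    and "pd i u \<in> borel_measurable (lebesgue_on \<Omega>)"
proof -
  have U: "open U" using assms(1) by (rule locally_affine_on_open)
  have "grad u \<in> borel_measurable (lebesgue_on U)"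
    using locally_affine_on_grad_continuous[OF assms(1)] U
    by (intro continuous_imp_measurable_on_sets_lebesgue) auto
  then have "(\<lambda>x. if x \<in> U then grad u x else 0) \<in> borel_measurable lebesgue"
    using U by (intro borel_measurable_if_I) auto
  then have "(\<lambda>x. if x \<in> \<Omega> then grad u x else 0) \<in> borel_measurable lebesgue"
  proof (rule borel_measurable_AE)
    have "AE x in lebesgue. x \<notin> \<Omega> - U"
      using assms(3) by (intro AE_not_in) (simp add: negligible_iff_null_sets)
    then show "AE x in lebesgue. (if x \<in> U then grad u x else 0) = (if x \<in> \<Omega> then grad u x else 0)"
      by eventually_elim (use assms(2) in auto)
  qed
  then show m: "grad u \<in> borel_measurable (lebesgue_on \<Omega>)"
    using assms(4) by (subst borel_measurable_if[symmetric]) auto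
  have "(\<lambda>x. grad u x $ i) \<in> borel_measurable (lebesgue_on \<Omega>)"
    using borel_measurable_inner[OF m measurable_const, of "axis i 1"] by (simp add: inner_axis)
  then show "pd i u \<in> borel_measurable (lebesgue_on \<Omega>)" by simp
qed

text \<open>Nothing is known of \<open>u\<close> off \<open>S\<close>, but \<phi> is zero there: for
  \<open>x\<close> in \<open>S\<close> and \<open>y\<close> outside, the difference of the products
  is \<open>u x * (\<phi> x - \<phi> y)\<close>, so only the bound on \<open>u\<close> inside
  \<open>S\<close> enters.\<close>

lemma lipschitz_times_zero_extension:
  fixes u \<phi> :: "'a::real_normed_vector \<Rightarrow> real"
  assumes u: "\<And>x y. x \<in> S \<Longrightarrow> y \<in> S \<Longrightarrow> \<bar>u x - u y\<bar> \<le> A1 * norm (x - y)" "\<And>x. x \<in> S \<Longrightarrow> \<bar>u x\<bar> \<le> B1"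
    and \<phi>: "\<And>x y. \<bar>\<phi> x - \<phi> y\<bar> \<le> A2 * norm (x - y)" "\<And>x. \<bar>\<phi> x\<bar> \<le> B2" "\<And>x. x \<notin> S \<Longrightarrow> \<phi> x = 0"
    and nn: "A1 \<ge> 0" "B2 \<ge> 0" "A2 \<ge> 0" "B1 \<ge> 0"
  shows "\<bar>u x * \<phi> x - u y * \<phi> y\<bar> \<le> (B1 * A2 + B2 * A1) * norm (x - y)"
proof -
  have one: "\<bar>u x * \<phi> x - u y * \<phi> y\<bar> \<le> (B1 * A2 + B2 * A1) * norm (x - y)" if "x \<in> S" for x y
  proof (cases "y \<in> S")
    case True
    have "\<bar>u x * \<phi> x - u y * \<phi> y\<bar> = \<bar>u x * (\<phi> x - \<phi> y) + (u x - u y) * \<phi> y\<bar>"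
      by (simp add: algebra_simps)
    also have "\<dots> \<le> \<bar>u x\<bar> * \<bar>\<phi> x - \<phi> y\<bar> + \<bar>u x - u y\<bar> * \<bar>\<phi> y\<bar>"
      by (metis abs_mult abs_triangle_ineq)
    also have "\<dots> \<le> B1 * (A2 * norm (x - y)) + (A1 * norm (x - y)) * B2"
      using u[OF \<open>x \<in> S\<close>] u(1)[OF that True] \<phi>(1)[of x y] \<phi>(2)[of y] nn
      by (intro add_mono mult_mono) auto
    finally show ?thesis by (simp add: algebra_simps)
  next
    case False
    then have "\<bar>u x * \<phi> x - u y * \<phi> y\<bar> = \<bar>u x\<bar> * \<bar>\<phi> x - \<phi> y\<bar>"
      using \<phi>(3)[of y] by (simp add: abs_mult)
    also have "\<dots> \<le> B1 * (A2 * norm (x - y))"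
      using u(2)[OF that] \<phi>(1)[of x y] nn by (intro mult_mono) auto
    also have "\<dots> \<le> (B1 * A2 + B2 * A1) * norm (x - y)"
      using nn by (simp add: algebra_simps)
    finally show ?thesis .
  qed
  show ?thesis
  proof (cases "x \<in> S")
    case True then show ?thesis by (rule one)
  next
    case xS: False
    show ?thesis
    proof (cases "y \<in> S")
      case True then show ?thesis using one[OF True, of x] by (simp add: abs_minus_commute norm_minus_commute)
    next
      case False then show ?thesis using xS \<phi>(3) nn by simp
    qed
  qed
qed

lemma L2_boundedI:
  fixes f :: "real^3 \<Rightarrow> 'b::{real_normed_vector,second_countable_topology}"
  assumes "\<Omega> \<in> lmeasurable" "f \<in> borel_measurable (lebesgue_on \<Omega>)" "AE x in lebesgue_on \<Omega>. norm (f x) \<le> B"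
  shows "f \<in> L2 (lebesgue_on \<Omega>)"
proof -
  have "(\<lambda>x. (norm (f x))\<^sup>2) \<in> borel_measurable (lebesgue_on \<Omega>)"
    using assms(2) by measurable
  moreover have "AE x in lebesgue_on \<Omega>. \<bar>(norm (f x))\<^sup>2\<bar> \<le> B\<^sup>2"
    using assms(3) by eventually_elim (auto intro: power_mono)
  ultimately have "integrable (lebesgue_on \<Omega>) (\<lambda>x. (norm (f x))\<^sup>2)"
    by (rule integrable_bounded_on[OF assms(1)])
  then show ?thesis using assms(2) by (simp add: L2_def)
qed

lemma L2_integrable_times_bounded:
  fixes f \<phi> :: "real^3 \<Rightarrow> real"
  assumes "\<Omega> \<in> lmeasurable" "f \<in> borel_measurable (lebesgue_on \<Omega>)"
    "integrable (lebesgue_on \<Omega>) (\<lambda>x. (f x)\<^sup>2)"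
    "\<phi> \<in> borel_measurable (lebesgue_on \<Omega>)" "\<And>x. \<bar>\<phi> x\<bar> \<le> B"
  shows "integrable (lebesgue_on \<Omega>) (\<lambda>x. f x * \<phi> x)"
proof -
  interpret finite_measure "lebesgue_on \<Omega>"
    using assms(1) by (rule finite_measure_lebesgue_on)
  have i: "integrable (lebesgue_on \<Omega>) (\<lambda>x. (1 + (f x)\<^sup>2) * B)"
    using assms(3) by (intro integrable_mult_left Bochner_Integration.integrable_add) auto
  have b: "\<bar>t\<bar> \<le> 1 + t\<^sup>2" for t :: real
  proof -
    have "0 \<le> (\<bar>t\<bar> - 1)\<^sup>2" by simp
    then have "2 * \<bar>t\<bar> \<le> 1 + t\<^sup>2" by (simp add: power2_diff)
    then show ?thesis by linarith
  qed
  show ?thesis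
  proof (rule Bochner_Integration.integrable_bound[OF i])
    show "(\<lambda>x. f x * \<phi> x) \<in> borel_measurable (lebesgue_on \<Omega>)"
      using assms(2,4) by (rule borel_measurable_times)
    show "AE x in lebesgue_on \<Omega>. norm (f x * \<phi> x) \<le> norm ((1 + (f x)\<^sup>2) * B)"
    proof (rule AE_I2)
      fix x
      have "0 \<le> B" using assms(5)[of x] by linarith
      have "\<bar>f x\<bar> * \<bar>\<phi> x\<bar> \<le> (1 + (f x)\<^sup>2) * B"
        using b[of "f x"] assms(5)[of x] by (intro mult_mono) auto
      then show "norm (f x * \<phi> x) \<le> norm ((1 + (f x)\<^sup>2) * B)"
        using \<open>0 \<le> B\<close> by (simp add: abs_mult)
    qed
  qed
qed

lemma L2_nth:
  fixes g :: "real^3 \<Rightarrow> real^3"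
  assumes "g \<in> L2 M"
  shows "(\<lambda>x. g x $ i) \<in> borel_measurable M" "integrable M (\<lambda>x. (g x $ i)\<^sup>2)"
proof -
  have g: "g \<in> borel_measurable M" "integrable M (\<lambda>x. (norm (g x))\<^sup>2)"
    using assms by (auto simp: L2_def)
  show m: "(\<lambda>x. g x $ i) \<in> borel_measurable M"
    using borel_measurable_inner[OF g(1) measurable_const, of "axis i 1"] by (simp add: inner_axis)
  show "integrable M (\<lambda>x. (g x $ i)\<^sup>2)"
  proof (rule Bochner_Integration.integrable_bound[OF g(2)])
    show "(\<lambda>x. (g x $ i)\<^sup>2) \<in> borel_measurable M" using m by measurable
    have "(g x $ i)\<^sup>2 \<le> (norm (g x))\<^sup>2" for x
      using component_le_norm_cart[of "g x" i] by (metis abs_ge_zero power2_abs power_mono)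
    then show "AE x in M. norm ((g x $ i)\<^sup>2) \<le> norm ((norm (g x))\<^sup>2)" by simp
  qed
qed

lemma test_function_measurable:
  assumes "\<phi> \<in> test_functions \<Omega>" "open \<Omega>"
  shows "\<phi> \<in> borel_measurable (lebesgue_on \<Omega>)" "pd i \<phi> \<in> borel_measurable (lebesgue_on \<Omega>)"
  using test_function_facts(2,3)[OF assms(1)] assms(2) continuous_on_subset
  by (blast intro: continuous_measurable_on_open)+

lemma weak_gradient_unique:
  assumes "open \<Omega>" "bounded \<Omega>" "has_weak_gradient \<Omega> u g1" "has_weak_gradient \<Omega> u g2"
  shows "AE x in lebesgue_on \<Omega>. g1 x = g2 x"
proof -
  have \<Omega>: "\<Omega> \<in> lmeasurable" using assms(1,2) by (simp add: lmeasurable_open)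
  have L2: "g1 \<in> L2 (lebesgue_on \<Omega>)" "g2 \<in> L2 (lebesgue_on \<Omega>)"
    using assms(3,4) by (auto simp: has_weak_gradient_def)
  have "AE x in lebesgue_on \<Omega>. g1 x $ i - g2 x $ i = 0" for i
  proof (rule fundamental_lemma[OF assms(1)])
    have one: "integrable (lebesgue_on \<Omega>) (\<lambda>x. g x $ i * 1)" if "g \<in> L2 (lebesgue_on \<Omega>)" for g :: "real^3 \<Rightarrow> real^3"
      using L2_nth[OF that, of i] by (intro L2_integrable_times_bounded[OF \<Omega>, of _ _ 1]) auto
    show "integrable (lebesgue_on \<Omega>) (\<lambda>x. g1 x $ i - g2 x $ i)"
      using one[OF L2(1)] one[OF L2(2)] by simp
    fix \<phi> assume \<phi>: "\<phi> \<in> test_functions \<Omega>"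
    obtain B where B: "\<And>x. \<bar>\<phi> x\<bar> \<le> B" using test_function_facts(5)[OF \<phi>] by blast
    have int: "integrable (lebesgue_on \<Omega>) (\<lambda>x. g x $ i * \<phi> x)" if "g \<in> L2 (lebesgue_on \<Omega>)" for g :: "real^3 \<Rightarrow> real^3"
      using L2_nth[OF that, of i] test_function_measurable[OF \<phi> assms(1)] B
      by (intro L2_integrable_times_bounded[OF \<Omega>, of _ _ B]) auto
    have minus_eq: "(LINT x|lebesgue_on \<Omega>. g x $ i * \<phi> x) = - (LINT x|lebesgue_on \<Omega>. u x * pd i \<phi> x)"
      if "has_weak_gradient \<Omega> u g" for g
      using that \<phi> unfolding has_weak_gradient_def by fastforce
    have "(LINT x|lebesgue_on \<Omega>. (g1 x $ i - g2 x $ i) * \<phi> x) =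
        (LINT x|lebesgue_on \<Omega>. g1 x $ i * \<phi> x) - (LINT x|lebesgue_on \<Omega>. g2 x $ i * \<phi> x)"
      using int[OF L2(1)] int[OF L2(2)] by (simp add: left_diff_distrib)
    also have "\<dots> = 0"
      unfolding minus_eq[OF assms(3)] minus_eq[OF assms(4)] by simp
    finally show "(LINT x|lebesgue_on \<Omega>. (g1 x $ i - g2 x $ i) * \<phi> x) = 0" .
  qed
  then have "AE x in lebesgue_on \<Omega>. \<forall>i. g1 x $ i - g2 x $ i = 0"
    by (subst AE_all_countable) auto
  then show ?thesis by eventually_elim (simp add: vec_eq_iff)
qed

lemma weak_grad_AE:
  assumes "open \<Omega>" "bounded \<Omega>" "has_weak_gradient \<Omega> u g"
  shows "AE x in lebesgue_on \<Omega>. weak_grad \<Omega> u x = g x"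
    and "has_weak_gradient \<Omega> u (weak_grad \<Omega> u)"
proof -
  show "has_weak_gradient \<Omega> u (weak_grad \<Omega> u)"
    unfolding weak_grad_def by (rule someI[where P = "has_weak_gradient \<Omega> u", OF assms(3)])
  then show "AE x in lebesgue_on \<Omega>. weak_grad \<Omega> u x = g x"
    using weak_gradient_unique[OF assms(1,2) _ assms(3)] by blast
qed

text \<open>The product of \<open>u\<close> with a test function is Lipschitz on the whole space and
  vanishes off \<Omega>, so the integral of its partial derivatives is zero by
  \<open>integral_grad_0\<close>; the product rule on \<open>U\<close> splits that integral into the
  two sides of the definition.\<close>

lemma lipschitz_weak_gradient:
  fixes u :: "real^3 \<Rightarrow> real"
  assumes \<Omega>: "open \<Omega>" "bounded \<Omega>" "negligible (frontier \<Omega>)"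
    and U: "open U" "U \<subseteq> \<Omega>" "negligible (\<Omega> - U)"
    and lip: "\<And>x y. x \<in> \<Omega> \<Longrightarrow> y \<in> \<Omega> \<Longrightarrow> \<bar>u x - u y\<bar> \<le> L * norm (x - y)"
    and diff: "\<And>x. x \<in> U \<Longrightarrow> u differentiable at x"
    and gu: "\<And>x. x \<in> U \<Longrightarrow> grad u x = g x"
    and gm: "g \<in> borel_measurable (lebesgue_on \<Omega>)"
  shows "has_weak_gradient \<Omega> u g"
proof -
  have \<Omega>m: "\<Omega> \<in> lmeasurable" using \<Omega>(1,2) by (simp add: lmeasurable_open)
  obtain R where R: "\<Omega> \<subseteq> ball 0 R" "R > 0" using bounded_subset_ballD[OF \<Omega>(2), of 0] by blast
  define L' where "L' = max L 0"
  have L': "L' \<ge> 0" by (simp add: L'_def)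
  have lip': "\<bar>u x - u y\<bar> \<le> L' * norm (x - y)" if "x \<in> \<Omega>" "y \<in> \<Omega>" for x y
    using lip[OF that] mult_right_mono[of L L' "norm (x - y)"] by (simp add: L'_def)
  have "\<exists>B\<ge>0. \<forall>x\<in>\<Omega>. \<bar>u x\<bar> \<le> B"
  proof (cases "\<Omega> = {}")
    case True then show ?thesis by (intro exI[of _ 0]) auto
  next
    case False
    then obtain x0 where x0: "x0 \<in> \<Omega>" by blast
    have "\<bar>u x\<bar> \<le> \<bar>u x0\<bar> + L' * (R + norm x0)" if x: "x \<in> \<Omega>" for x
    proof -
      have "\<bar>u x - u x0\<bar> \<le> L' * norm (x - x0)" using lip' x x0 by blast
      also have "\<dots> \<le> L' * (R + norm x0)"
        using R x norm_triangle_ineq4[of x x0] L' by (intro mult_left_mono) auto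
      finally show ?thesis by linarith
    qed
    then show ?thesis using L' R by (intro exI[of _ "\<bar>u x0\<bar> + L' * (R + norm x0)"]) auto
  qed
  then obtain B where B: "B \<ge> 0" "\<And>x. x \<in> \<Omega> \<Longrightarrow> \<bar>u x\<bar> \<le> B" by blast
  have uc: "continuous_on \<Omega> u"
  proof (rule lipschitz_on_continuous_on[of L'])
    show "L'-lipschitz_on \<Omega> u"
      using lip' L' by (intro lipschitz_onI) (auto simp: dist_norm)
  qed
  have um: "u \<in> borel_measurable (lebesgue_on \<Omega>)"
    using uc \<Omega>(1) by (rule continuous_measurable_on_open)
  have AEU: "AE x in lebesgue_on \<Omega>. x \<in> U"
  proof -
    have "AE x in lebesgue. x \<notin> \<Omega> - U"
      using U(3) by (intro AE_not_in) (simp add: negligible_iff_null_sets)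
    then show ?thesis using \<Omega>(1) by (subst AE_restrict_space_iff) auto
  qed
  have gb: "norm (grad u x) \<le> L'" if "x \<in> U" for x
    by (rule norm_grad_le_lipschitz[OF diff[OF that] U(1) that]) (use lip' U(2) that in auto)
  have gbAE: "AE x in lebesgue_on \<Omega>. norm (g x) \<le> L'"
    using AEU by eventually_elim (use gb gu in auto)
  have u2: "u \<in> L2 (lebesgue_on \<Omega>)"
    by (rule L2_boundedI[OF \<Omega>m um, of B]) (use B in \<open>auto intro!: AE_I2\<close>)
  have g2: "g \<in> L2 (lebesgue_on \<Omega>)"
    by (rule L2_boundedI[OF \<Omega>m gm gbAE])
  show ?thesis
    unfolding has_weak_gradient_def
  proof (intro conjI u2 g2 ballI allI)
    fix \<phi> i assume \<phi>: "\<phi> \<in> test_functions \<Omega>"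
    note \<phi>f = test_function_facts[OF \<phi>]
    obtain S where S: "S \<subseteq> \<Omega>" "\<And>x. x \<notin> S \<Longrightarrow> \<phi> x = 0" using \<phi>f(4) by blast
    have S0: "\<phi> x = 0" if "x \<notin> \<Omega>" for x using S that by blast
    obtain B2 where B2: "B2 \<ge> 0" "\<And>x. \<bar>\<phi> x\<bar> \<le> B2" "\<And>x. \<bar>pd i \<phi> x\<bar> \<le> B2" using \<phi>f(5) by blast
    obtain A2 where A2: "A2 \<ge> 0" "\<And>x y. \<bar>\<phi> x - \<phi> y\<bar> \<le> A2 * norm (x - y)" using \<phi>f(6) by blast
    have i1: "integrable (lebesgue_on \<Omega>) (\<lambda>x. u x * pd i \<phi> x)"
      using u2 test_function_measurable[OF \<phi> \<Omega>(1)] B2 um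
      by (intro L2_integrable_times_bounded[OF \<Omega>m, of _ _ B2]) (auto simp: L2_def)
    have i2: "integrable (lebesgue_on \<Omega>) (\<lambda>x. g x $ i * \<phi> x)"
      using L2_nth[OF g2, of i] test_function_measurable[OF \<phi> \<Omega>(1)] B2
      by (intro L2_integrable_times_bounded[OF \<Omega>m, of _ _ B2]) auto
    have "(LINT x|lebesgue_on \<Omega>. u x * pd i \<phi> x + g x $ i * \<phi> x) = 0"
    proof (rule integral_grad_0[OF \<Omega> U])
      show "\<bar>u x * \<phi> x - u y * \<phi> y\<bar> \<le> (B * A2 + B2 * L') * norm (x - y)" for x y
        by (rule lipschitz_times_zero_extension[of \<Omega>])
          (use lip' B A2 B2 S0 L' in auto)
      show "u x * \<phi> x = 0" if "x \<notin> \<Omega>" for x using S0[OF that] by simp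
      show "(\<lambda>x. u x * \<phi> x) differentiable at x" if "x \<in> U" for x
        using diff[OF that] \<phi>f(1) by (rule differentiable_mult)
      show "(\<lambda>x. u x * pd i \<phi> x + g x $ i * \<phi> x) \<in> borel_measurable (lebesgue_on \<Omega>)"
        using i1 i2 by (intro borel_measurable_add borel_measurable_integrable)
      show "grad (\<lambda>x. u x * \<phi> x) x \<bullet> axis i 1 = u x * pd i \<phi> x + g x $ i * \<phi> x" if "x \<in> U" for x
        using grad_mult[OF diff[OF that] \<phi>f(1)] gu[OF that]
        by (simp add: inner_axis vec_eq_iff)
    qed
    then show "(LINT x|lebesgue_on \<Omega>. u x * pd i \<phi> x) = - (LINT x|lebesgue_on \<Omega>. g x $ i * \<phi> x)"
      using i1 i2 by simp
  qed
qed

subsection \<open>Mollification and zero boundary values\<close>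

lemma pd_zero_off:
  assumes "closed S" "\<And>x. x \<notin> S \<Longrightarrow> f x = 0" "x \<notin> S"
  shows "pd i f x = 0"
proof -
  have "pd i f x = pd i (\<lambda>x. 0) x"
    by (rule pd_cong_open[of "- S"]) (use assms in auto)
  also have "\<dots> = 0" using pd_eq[of "\<lambda>x. 0" "\<lambda>i. 0" x i] by simp
  finally show ?thesis .
qed

lemma integrable_times_bounded:
  fixes f g :: "'a \<Rightarrow> real"
  assumes "integrable M f" "g \<in> borel_measurable M" "\<And>x. \<bar>g x\<bar> \<le> B"
  shows "integrable M (\<lambda>x. f x * g x)"
proof (rule Bochner_Integration.integrable_bound[of M "\<lambda>x. B * f x"])
  show "integrable M (\<lambda>x. B * f x)" using assms(1) by simp
  show "(\<lambda>x. f x * g x) \<in> borel_measurable M"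
    using borel_measurable_integrable[OF assms(1)] assms(2) by (rule borel_measurable_times)
  have "0 \<le> B" using assms(3)[of undefined] by linarith
  then show "AE x in M. norm (f x * g x) \<le> norm (B * f x)"
    using assms(3) by (intro AE_I2) (auto simp: abs_mult mult.commute[of B] intro: mult_left_mono)
qed

lemma flat_alg_reflect: "k \<in> flat_alg \<Longrightarrow> (\<lambda>y. k (x - y)) \<in> flat_alg"
proof (induction rule: flat_alg.induct)
  case (flat n \<alpha> i \<beta>)
  have "(\<lambda>y. flat n (\<alpha> * (x - y) $ i + \<beta>)) = (\<lambda>y. flat n ((- \<alpha>) * y $ i + (\<alpha> * x $ i + \<beta>)))"
    by (simp add: algebra_simps)
  then show ?case using flat_alg.flat by metis
qed (auto intro: flat_alg.intros)

lemma pd_reflect: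
  assumes "\<And>x. k differentiable at x"
  shows "pd i (\<lambda>y. k (x - y)) y = - pd i k (x - y)"
proof -
  have l: "((\<lambda>y. x - y) has_derivative (\<lambda>d. - d)) (at y)"
    by (auto intro!: derivative_eq_intros)
  have "((\<lambda>y. k (x - y)) has_derivative (\<lambda>d. grad k (x - y) \<bullet> (- d))) (at y)"
    by (rule has_derivative_compose[OF l has_derivative_grad[OF assms]])
  then have "((\<lambda>y. k (x - y)) has_derivative (\<lambda>d. (- grad k (x - y)) \<bullet> d)) (at y)"
    by simp
  then have "grad (\<lambda>y. k (x - y)) y = - grad k (x - y)" by (rule grad_eq)
  then show ?thesis by (metis grad_nth vector_uminus_component)
qed

lemma flat_alg_measurable:
  assumes "k \<in> flat_alg"
  shows "k \<in> borel_measurable borel" "k \<in> borel_measurable lebesgue"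
    "(\<lambda>y. k (x - y)) \<in> borel_measurable lebesgue"
proof -
  have b: "k \<in> borel_measurable borel" if "k \<in> flat_alg" for k
    using flat_alg_continuous[OF that] by (rule borel_measurable_continuous_onI)
  show "k \<in> borel_measurable borel" by (rule b[OF assms])
  show "k \<in> borel_measurable lebesgue" "(\<lambda>y. k (x - y)) \<in> borel_measurable lebesgue"
    using b[OF assms] b[OF flat_alg_reflect[OF assms]] by (auto intro: measurable_completion)
qed

text \<open>The partial derivatives of the kernel are Lipschitz because they are smooth with compact
  support. Hence the first-order Taylor remainder of the kernel is at most \<open>M\<close> times
  the squared increment, uniformly in the base point, and it stays so after integration against
  \<open>f\<close>.\<close>

lemma convolution_has_derivative:
  assumes f: "integrable lebesgue f" and k: "k \<in> flat_alg" and S: "compact S" "\<And>x. x \<notin> S \<Longrightarrow> k x = 0"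
  shows "((\<lambda>x. LINT y|lebesgue. f y * k (x - y)) has_derivative
    (\<lambda>d. \<Sum>i\<in>UNIV. d $ i * (LINT y|lebesgue. f y * pd i k (x - y)))) (at x)"
proof -
  have dk: "\<And>x. k differentiable at x" using flat_alg_differentiable[OF k] .
  have pk: "pd i k \<in> flat_alg" for i using flat_alg_pd[OF k] .
  have cl: "closed S" using S(1) compact_imp_closed by blast
  have pS: "pd i k x = 0" if "x \<notin> S" for i x
    using pd_zero_off[of S k x i] cl S(2) that by blast
  have "\<exists>L\<ge>0. \<forall>x y. \<bar>pd i k x - pd i k y\<bar> \<le> L * norm (x - y)" for i
    using C1_compact_support_lipschitz[OF flat_alg_differentiable[OF pk] flat_alg_continuous[OF flat_alg_pd[OF pk]] S(1) pS]
    by metis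
  then obtain L where L: "\<And>i. L i \<ge> 0" "\<And>i x y. \<bar>pd i k x - pd i k y\<bar> \<le> L i * norm (x - y)"
    by metis
  define M where "M = (\<Sum>i\<in>UNIV. L i)"
  have lin: "\<bar>k b - k a - (\<Sum>i\<in>UNIV. (b - a) $ i * pd i k a)\<bar> \<le> norm (b - a) * (M * norm (b - a))" for a b
  proof -
    have "norm (k b - k a - (\<Sum>i\<in>UNIV. (b - a) $ i * pd i k a)) \<le> norm (b - a) * (M * norm (b - a))"
    proof (rule differentiable_bound_linearization[where S = "closed_segment a b" and ?x0.0 = a and f = k
          and f' = "\<lambda>z d. \<Sum>i\<in>UNIV. d $ i * pd i k z"])
      show "a + t *\<^sub>R (b - a) \<in> closed_segment a b" if "t \<in> {0..1}" for t
        using that by (auto simp: in_segment algebra_simps intro!: exI[of _ t])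
      show "(k has_derivative (\<lambda>d. \<Sum>i\<in>UNIV. d $ i * pd i k z)) (at z within closed_segment a b)" for z
        using has_derivative_pd[OF dk] by (rule has_derivative_at_withinI)
      fix z assume z: "z \<in> closed_segment a b"
      have za: "norm (z - a) \<le> norm (b - a)"
        using segment_bound1[OF z] by (simp add: norm_minus_commute)
      show "onorm ((\<lambda>d. \<Sum>i\<in>UNIV. d $ i * pd i k z) - (\<lambda>d. \<Sum>i\<in>UNIV. d $ i * pd i k a)) \<le> M * norm (b - a)"
      proof (rule onorm_le)
        fix d :: "real^3"
        have c: "norm (d $ i * (pd i k z - pd i k a)) \<le> norm d * (L i * norm (b - a))" for i
        proof -
          have "L i * norm (z - a) \<le> L i * norm (b - a)" using za L(1) by (rule mult_left_mono)
          then have "\<bar>pd i k z - pd i k a\<bar> \<le> L i * norm (b - a)" using L(2)[of i z a] by linarith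
          then show ?thesis using component_le_norm_cart[of d i]
            unfolding real_norm_def abs_mult by (intro mult_mono) auto
        qed
        have "((\<lambda>d. \<Sum>i\<in>UNIV. d $ i * pd i k z) - (\<lambda>d. \<Sum>i\<in>UNIV. d $ i * pd i k a)) d =
            (\<Sum>i\<in>UNIV. d $ i * (pd i k z - pd i k a))"
          by (simp add: sum_subtractf right_diff_distrib)
        also have "norm \<dots> \<le> (\<Sum>i\<in>UNIV. norm d * (L i * norm (b - a)))"
          using c by (intro order_trans[OF norm_sum sum_mono])
        also have "\<dots> = M * norm (b - a) * norm d"
          unfolding M_def sum_distrib_right by (simp add: mult_ac)
        finally show "norm (((\<lambda>d. \<Sum>i\<in>UNIV. d $ i * pd i k z) - (\<lambda>d. \<Sum>i\<in>UNIV. d $ i * pd i k a)) d)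
            \<le> M * norm (b - a) * norm d" .
      qed
    qed simp
    then show ?thesis by simp
  qed
  have bnd: "\<exists>B. \<forall>x. \<bar>g x\<bar> \<le> B" if "g \<in> flat_alg" "\<And>x. x \<notin> S \<Longrightarrow> g x = 0" for g
    using compact_support_bounded[OF flat_alg_continuous[OF that(1)] S(1) that(2)] by metis
  have int: "integrable lebesgue (\<lambda>y. f y * g (x - y))" if g: "g \<in> flat_alg" "\<And>x. x \<notin> S \<Longrightarrow> g x = 0" for g x
    using bnd[OF g] integrable_times_bounded[OF f flat_alg_measurable(3)[OF g(1)]] by metis
  have intk: "\<And>x. integrable lebesgue (\<lambda>y. f y * k (x - y))" using int[OF k S(2)] .
  have intp: "\<And>i x. integrable lebesgue (\<lambda>y. f y * pd i k (x - y))" using int[OF pk pS] .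
  define I where "I = (LINT y|lebesgue. \<bar>f y\<bar>)"
  show ?thesis
  proof (rule has_derivativeI_sandwich[of 1 _ _ _ _ "\<lambda>z. M * norm (z - x) * I"])
    show "bounded_linear (\<lambda>d. \<Sum>i\<in>UNIV. d $ i * (LINT y|lebesgue. f y * pd i k (x - y)))"
      by (intro bounded_linear_sum bounded_linear_mult_left[THEN bounded_linear_compose] bounded_linear_vec_nth)
    show "((\<lambda>z. M * norm (z - x) * I) \<longlongrightarrow> 0) (at x)"
      by (auto intro!: tendsto_eq_intros)
    fix z assume "z \<noteq> x"
    have "(LINT y|lebesgue. f y * k (z - y)) - (LINT y|lebesgue. f y * k (x - y)) -
        (\<Sum>i\<in>UNIV. (z - x) $ i * (LINT y|lebesgue. f y * pd i k (x - y)))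
      = (LINT y|lebesgue. f y * k (z - y) - f y * k (x - y) - (\<Sum>i\<in>UNIV. (z - x) $ i * (f y * pd i k (x - y))))"
      using intk intp by simp
    also have "\<bar>\<dots>\<bar> \<le> (LINT y|lebesgue. \<bar>f y\<bar> * (norm (z - x) * (M * norm (z - x))))"
    proof (rule integral_abs_bound_integral)
      show "integrable lebesgue (\<lambda>y. f y * k (z - y) - f y * k (x - y) - (\<Sum>i\<in>UNIV. (z - x) $ i * (f y * pd i k (x - y))))"
        using intk intp by simp
      show "integrable lebesgue (\<lambda>y. \<bar>f y\<bar> * (norm (z - x) * (M * norm (z - x))))"
        using f by simp
      fix y
      have "f y * k (z - y) - f y * k (x - y) - (\<Sum>i\<in>UNIV. (z - x) $ i * (f y * pd i k (x - y)))
        = f y * (k (z - y) - k (x - y) - (\<Sum>i\<in>UNIV. ((z - y) - (x - y)) $ i * pd i k (x - y)))"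
        by (simp add: right_diff_distrib sum_distrib_left mult_ac)
      also have "\<bar>\<dots>\<bar> \<le> \<bar>f y\<bar> * (norm (z - x) * (M * norm (z - x)))"
        unfolding abs_mult using lin[of "z - y" "x - y"] by (intro mult_left_mono) auto
      finally show "\<bar>f y * k (z - y) - f y * k (x - y) - (\<Sum>i\<in>UNIV. (z - x) $ i * (f y * pd i k (x - y)))\<bar>
          \<le> \<bar>f y\<bar> * (norm (z - x) * (M * norm (z - x)))" .
    qed
    also have "\<dots> = I * (norm (z - x) * (M * norm (z - x)))"
      unfolding I_def by simp
    finally show "norm ((LINT y|lebesgue. f y * k (z - y)) - (LINT y|lebesgue. f y * k (x - y)) -
        (\<Sum>i\<in>UNIV. (z - x) $ i * (LINT y|lebesgue. f y * pd i k (x - y)))) / norm (z - x) \<le> M * norm (z - x) * I"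
      using \<open>z \<noteq> x\<close> by (simp add: divide_le_eq mult_ac)
  qed simp
qed

text \<open>Differentiating a convolution only replaces its kernel by a partial derivative, which is
  again in \<open>flat_alg\<close> and supported in \<open>S\<close>; the convolutions with all such
  kernels form a class as required by \<open>smooth_onI_closed\<close>.\<close>

lemma convolution_smooth:
  assumes f: "integrable lebesgue f" and k: "k \<in> flat_alg" and S: "compact S" "\<And>x. x \<notin> S \<Longrightarrow> k x = 0"
  shows "smooth_on UNIV (\<lambda>x. LINT y|lebesgue. f y * k (x - y))"
proof (rule smooth_onI_closed)
  let ?X = "{\<lambda>x. LINT y|lebesgue. f y * g (x - y) | g. g \<in> flat_alg \<and> (\<forall>x. x \<notin> S \<longrightarrow> g x = 0)}"
  have cl: "closed S" using S(1) compact_imp_closed by blast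
  show "(\<lambda>x. LINT y|lebesgue. f y * k (x - y)) \<in> ?X" using k S by blast
  fix F i assume "F \<in> ?X"
  then obtain g where g: "F = (\<lambda>x. LINT y|lebesgue. f y * g (x - y))" "g \<in> flat_alg" "\<And>x. x \<notin> S \<Longrightarrow> g x = 0"
    by blast
  note d = convolution_has_derivative[OF f g(2) S(1) g(3)]
  have "pd i F = (\<lambda>x. LINT y|lebesgue. f y * pd i g (x - y))"
    unfolding g(1) using pd_eq[OF d] by auto
  moreover have "pd i g \<in> flat_alg \<and> (\<forall>x. x \<notin> S \<longrightarrow> pd i g x = 0)"
    using flat_alg_pd[OF g(2)] pd_zero_off[of S g _ i] cl g(3) by blast
  ultimately show "pd i F \<in> ?X" by blast
next
  fix F x assume "F \<in> {\<lambda>x. LINT y|lebesgue. f y * g (x - y) | g. g \<in> flat_alg \<and> (\<forall>x. x \<notin> S \<longrightarrow> g x = 0)}"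
  then obtain g where g: "F = (\<lambda>x. LINT y|lebesgue. f y * g (x - y))" "g \<in> flat_alg" "\<And>x. x \<notin> S \<Longrightarrow> g x = 0"
    by blast
  show "F differentiable at x"
    unfolding g(1) differentiable_def using convolution_has_derivative[OF f g(2) S(1) g(3)] by blast
qed

text \<open>The kernel is taken to be even so that a convolution can be rewritten as an average over
  translates of the function, see \<open>mollifier_shift\<close>.\<close>

definition mollifier :: "real \<Rightarrow> (real^3 \<Rightarrow> real) \<Rightarrow> bool"
  where "mollifier \<epsilon> k \<longleftrightarrow> k \<in> flat_alg \<and> (\<forall>x. 0 \<le> k x) \<and> (\<forall>x. k x \<noteq> 0 \<longrightarrow> norm x < \<epsilon>) \<and>
    (\<forall>x. k (- x) = k x) \<and> integrable lebesgue k \<and> (LINT x|lebesgue. k x) = 1"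

lemma mollifier_exists:
  assumes "\<epsilon> > 0" obtains k where "mollifier \<epsilon> k"
proof -
  \<comment> \<open>With half-width \<open>\<epsilon> / 3\<close> the sum of the three coordinates
    in absolute value, and with it the Euclidean norm, stays below \<epsilon>.\<close>
  define c :: "real^3" where "c = (\<chi> i. \<epsilon> / 3)"
  define b where "b = box_bump 1 (- c) c"
  define I where "I = (LINT x|lebesgue. b x)"
  have ba: "b \<in> flat_alg" unfolding b_def by (rule box_bump_flat_alg)
  have b0: "b x \<ge> 0" for x unfolding b_def by (rule box_bump_nonneg)
  have bs: "b x = 0" if "x \<notin> box (- c) c" for x
    unfolding b_def using that by (intro box_bump_eq_0) auto
  have bp: "b x > 0" if "x \<in> box (- c) c" for x
    unfolding b_def using that by (subst box_bump_pos_iff) auto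
  have bi: "integrable lebesgue b"
    by (rule integrable_bounded_support[where S = "box (- c) c" and B = 1])
      (use flat_alg_measurable(2)[OF ba] bs b0 box_bump_le_1 bounded_box in \<open>auto simp: b_def box_bump_nonneg\<close>)
  have bsym: "b (- x) = b x" for x
    unfolding b_def box_bump_def by (rule prod.cong) (auto simp: mult.commute)
  have small: "norm x < \<epsilon>" if "x \<in> box (- c) c" for x
  proof -
    have "\<bar>x $ i\<bar> < \<epsilon> / 3" for i
    proof -
      have "- (\<epsilon> / 3) < x $ i \<and> x $ i < \<epsilon> / 3" using that by (auto simp: mem_box_cart c_def)
      then show ?thesis by linarith
    qed
    then have "(\<Sum>i\<in>UNIV. \<bar>x $ i\<bar>) < (\<Sum>i\<in>(UNIV::3 set). \<epsilon> / 3)"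
      by (intro sum_strict_mono) auto
    then show ?thesis using norm_le_l1_cart[of x] by simp
  qed
  have "I \<noteq> 0"
  proof
    assume "I = 0"
    then have "AE x in lebesgue. b x = 0"
      using integral_nonneg_eq_0_iff_AE[OF bi] b0 by (auto simp: I_def)
    then have "AE x in lebesgue. x \<notin> box (- c) c"
      by eventually_elim (use bp in force)
    then have "box (- c) c \<in> null_sets lebesgue"
      by (subst (asm) AE_iff_null_sets[symmetric]) auto
    then have "negligible (box (- c) c)" by (simp add: negligible_iff_null_sets)
    moreover have "box (- c) c \<noteq> {}"
    proof -
      have "0 \<in> box (- c) c" using assms by (simp add: mem_box_cart c_def)
      then show ?thesis by blast
    qed
    ultimately show False using open_not_negligible[OF open_box] by blast
  qed
  moreover have "I \<ge> 0" unfolding I_def using b0 by simp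
  ultimately have I: "I > 0" by simp
  have "mollifier \<epsilon> (\<lambda>x. (1 / I) * b x)"
    unfolding mollifier_def
  proof (intro conjI allI impI)
    show "(\<lambda>x. (1 / I) * b x) \<in> flat_alg" using ba by (intro flat_alg.mult flat_alg.const)
    show "(LINT x|lebesgue. (1 / I) * b x) = 1" using I I_def by simp
    show "norm x < \<epsilon>" if "(1 / I) * b x \<noteq> 0" for x using that bs small by force
  qed (use I b0 bsym bi in auto)
  then show ?thesis by (rule that)
qed

lemma mollifier_shift:
  assumes "mollifier \<epsilon> k" "V \<in> borel_measurable borel"
  shows "(LINT y|lebesgue. V y * k (x - y)) = (LINT y|lebesgue. V (x + y) * k y)"
proof -
  have k: "k \<in> flat_alg" "\<And>x. k (- x) = k x" using assms(1) by (auto simp: mollifier_def)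
  have "(\<lambda>y. V y * k (x - y)) \<in> borel_measurable borel"
    using assms(2) flat_alg_measurable(1)[OF flat_alg_reflect[OF k(1)]] by (rule borel_measurable_times)
  from integral_lebesgue_translation[OF this, of x]
  have "(LINT y|lebesgue. V y * k (x - y)) = (LINT y|lebesgue. V (y + x) * k (x - (y + x)))" by simp
  also have "\<dots> = (LINT y|lebesgue. V (x + y) * k y)"
    by (simp add: add.commute k(2))
  finally show ?thesis .
qed

text \<open>A weighted average deviates from \<open>c\<close> by no more than the values do on the
  support of the weight. Choices of \<open>F\<close>, \<open>c\<close> and \<open>B\<close> yield
  closeness to the original function, Lipschitz bounds and, with \<open>B = 0\<close>, exact
  reproduction of affine increments.\<close>

lemma mollifier_average_bound:
  fixes c B :: real
  assumes "mollifier \<epsilon> k" "(\<lambda>y. F y * k y) \<in> borel_measurable lebesgue" "\<And>y. norm y < \<epsilon> \<Longrightarrow> \<bar>F y - c\<bar> \<le> B"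
  shows "integrable lebesgue (\<lambda>y. F y * k y)" "\<bar>(LINT y|lebesgue. F y * k y) - c\<bar> \<le> B"
proof -
  have k: "\<And>x. 0 \<le> k x" "\<And>x. k x \<noteq> 0 \<Longrightarrow> norm x < \<epsilon>" "integrable lebesgue k" "(LINT x|lebesgue. k x) = 1"
    using assms(1) by (auto simp: mollifier_def)
  have b: "\<bar>F y * k y - c * k y\<bar> \<le> B * k y" for y
  proof (cases "k y = 0")
    case False
    have "\<bar>F y * k y - c * k y\<bar> = \<bar>F y - c\<bar> * k y"
      using k(1)[of y] by (metis abs_mult abs_of_nonneg left_diff_distrib)
    also have "\<dots> \<le> B * k y" using assms(3)[OF k(2)[OF False]] k(1) by (rule mult_right_mono)
    finally show ?thesis .
  qed simp
  show i: "integrable lebesgue (\<lambda>y. F y * k y)"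
  proof (rule Bochner_Integration.integrable_bound[OF _ assms(2)])
    show "integrable lebesgue (\<lambda>y. (\<bar>c\<bar> + B) * k y)" using k(3) by simp
    have "\<bar>F y * k y\<bar> \<le> \<bar>c * k y\<bar> + B * k y" for y using b[of y] by linarith
    then have "\<bar>F y * k y\<bar> \<le> (\<bar>c\<bar> + B) * k y" for y
      using k(1)[of y] unfolding abs_mult distrib_right by (metis abs_of_nonneg add.commute)
    then have "\<bar>F y * k y\<bar> \<le> \<bar>(\<bar>c\<bar> + B) * k y\<bar>" for y by (meson abs_ge_self order_trans)
    then show "AE y in lebesgue. norm (F y * k y) \<le> norm ((\<bar>c\<bar> + B) * k y)" by simp
  qed
  have "(LINT y|lebesgue. F y * k y) - c = (LINT y|lebesgue. F y * k y - c * k y)"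
    using i k(3,4) by simp
  also have "\<bar>\<dots>\<bar> \<le> (LINT y|lebesgue. B * k y)"
    by (rule integral_abs_bound_integral) (use i k(3) b in auto)
  also have "\<dots> = B" using k(4) by simp
  finally show "\<bar>(LINT y|lebesgue. F y * k y) - c\<bar> \<le> B" .
qed

text \<open>Young's inequality in place of Cauchy-Schwarz: for a sequence tending to 0 in
  \<open>L2\<close> the last term disappears for fixed \<delta>, after which \<delta> can be made
  small.\<close>

lemma abs_integral_le_L2:
  fixes f :: "real^3 \<Rightarrow> real"
  assumes "\<Omega> \<in> lmeasurable" "f \<in> borel_measurable (lebesgue_on \<Omega>)"
    "integrable (lebesgue_on \<Omega>) (\<lambda>x. (f x)\<^sup>2)" "\<delta> > 0"
  shows "integrable (lebesgue_on \<Omega>) (\<lambda>x. \<bar>f x\<bar>)"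
    "(LINT x|lebesgue_on \<Omega>. \<bar>f x\<bar>) \<le> \<delta> * measure lebesgue \<Omega> + (1 / \<delta>) * (LINT x|lebesgue_on \<Omega>. (f x)\<^sup>2)"
proof -
  interpret finite_measure "lebesgue_on \<Omega>"
    using assms(1) by (rule finite_measure_lebesgue_on)
  have b: "\<bar>t\<bar> \<le> \<delta> + (1 / \<delta>) * t\<^sup>2" for t :: real
  proof -
    have "0 \<le> (\<bar>t\<bar> - \<delta>)\<^sup>2" by simp
    then have "2 * \<bar>t\<bar> * \<delta> \<le> \<delta>\<^sup>2 + t\<^sup>2" by (simp add: power2_diff)
    moreover have "0 \<le> \<bar>t\<bar> * \<delta>" using assms(4) by simp
    ultimately have "\<bar>t\<bar> * \<delta> \<le> \<delta>\<^sup>2 + t\<^sup>2" by linarith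
    then show ?thesis using assms(4) by (simp add: field_simps power2_eq_square)
  qed
  have i: "integrable (lebesgue_on \<Omega>) (\<lambda>x. \<delta> + (1 / \<delta>) * (f x)\<^sup>2)"
    using assms(3) by simp
  show a: "integrable (lebesgue_on \<Omega>) (\<lambda>x. \<bar>f x\<bar>)"
    by (rule Bochner_Integration.integrable_bound[OF i])
      (use assms(2) order_trans[OF b abs_ge_self] in \<open>auto intro!: AE_I2\<close>)
  have "(LINT x|lebesgue_on \<Omega>. \<bar>f x\<bar>) \<le> (LINT x|lebesgue_on \<Omega>. \<delta> + (1 / \<delta>) * (f x)\<^sup>2)"
    by (rule integral_mono[OF a i b])
  also have "\<dots> = \<delta> * measure lebesgue \<Omega> + (1 / \<delta>) * (LINT x|lebesgue_on \<Omega>. (f x)\<^sup>2)"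
    using assms(1,3) by (simp add: measure_restrict_space space_restrict_space fmeasurableD mult.commute)
  finally show "(LINT x|lebesgue_on \<Omega>. \<bar>f x\<bar>) \<le> \<delta> * measure lebesgue \<Omega> + (1 / \<delta>) * (LINT x|lebesgue_on \<Omega>. (f x)\<^sup>2)" .
qed

section \<open>Integration by parts without boundary terms\<close>

lemma test_function_weak_gradient:
  assumes "open \<Omega>" "bounded \<Omega>" "negligible (frontier \<Omega>)" "\<phi> \<in> test_functions \<Omega>"
  shows "has_weak_gradient \<Omega> \<phi> (grad \<phi>)"
proof -
  note f = test_function_facts[OF assms(4)]
  obtain L where L: "\<And>x y. \<bar>\<phi> x - \<phi> y\<bar> \<le> L * norm (x - y)" using f(6) by blast
  have "continuous_on \<Omega> (grad \<phi>)"
    unfolding grad_def[abs_def] using continuous_on_subset[OF f(3)] by (intro continuous_on_vec_lambda) auto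
  then have "grad \<phi> \<in> borel_measurable (lebesgue_on \<Omega>)"
    using assms(1) by (intro continuous_imp_measurable_on_sets_lebesgue) auto
  then show ?thesis
    by (intro lipschitz_weak_gradient[OF assms(1-3) assms(1) subset_refl, of _ L]) (use L f(1) in auto)
qed

text \<open>The roles are exchanged: \<psi>, whose support may reach beyond \<Omega>, is the
  function with a weak gradient, and \<phi> is the test function.\<close>

lemma integral_by_parts_test_function:
  assumes \<Omega>: "open \<Omega>" "bounded \<Omega>" "negligible (frontier \<Omega>)"
    and \<psi>: "\<psi> \<in> flat_alg" "compact S" "\<And>x. x \<notin> S \<Longrightarrow> \<psi> x = 0"
    and \<phi>: "\<phi> \<in> test_functions \<Omega>"
  shows "(LINT x|lebesgue_on \<Omega>. \<psi> x * pd i \<phi> x) = - (LINT x|lebesgue_on \<Omega>. pd i \<psi> x * \<phi> x)"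
proof -
  have d: "\<psi> differentiable at x" for x by (rule flat_alg_differentiable[OF \<psi>(1)])
  have c: "continuous_on A (pd i \<psi>)" for i A by (rule flat_alg_continuous[OF flat_alg_pd[OF \<psi>(1)]])
  obtain L where "0 \<le> L" and L: "\<And>x y. \<bar>\<psi> x - \<psi> y\<bar> \<le> L * norm (x - y)"
    by (rule C1_compact_support_lipschitz[of \<psi> S]) (use d c \<psi> that in blast)+
  have "continuous_on \<Omega> (grad \<psi>)"
    unfolding grad_def[abs_def] using c by (intro continuous_on_vec_lambda) auto
  then have "grad \<psi> \<in> borel_measurable (lebesgue_on \<Omega>)"
    using \<Omega>(1) by (intro continuous_imp_measurable_on_sets_lebesgue) auto
  then have "has_weak_gradient \<Omega> \<psi> (grad \<psi>)"
    by (intro lipschitz_weak_gradient[OF \<Omega> \<Omega>(1) subset_refl, of _ L]) (use L d in auto)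
  then show ?thesis using \<phi> by (simp add: has_weak_gradient_def)
qed

text \<open>Unlike in the definition of a weak gradient, \<open>\<psi>\<close> need not vanish on the boundary here.\<close>

lemma H10_integral_by_parts:
  assumes \<Omega>: "open \<Omega>" "bounded \<Omega>" "negligible (frontier \<Omega>)"
    and v: "v \<in> H10 \<Omega>" "has_weak_gradient \<Omega> v g"
    and \<psi>: "\<psi> \<in> flat_alg" "compact S" "\<And>x. x \<notin> S \<Longrightarrow> \<psi> x = 0"
  shows "(LINT x|lebesgue_on \<Omega>. v x * pd i \<psi> x) = - (LINT x|lebesgue_on \<Omega>. g x $ i * \<psi> x)"
proof -
  have \<Omega>m: "\<Omega> \<in> lmeasurable" using \<Omega>(1,2) by (simp add: lmeasurable_open)
  obtain \<phi> where \<phi>: "\<And>n::nat. \<phi> n \<in> test_functions \<Omega>"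
    "(\<lambda>n. H1_norm \<Omega> (\<lambda>x. v x - \<phi> n x)) \<longlonglongrightarrow> 0"
    using v(1) unfolding H10_def by blast
  have clS: "closed S" using \<psi>(2) compact_imp_closed by blast
  obtain B1 where "0 \<le> B1" and B1: "\<And>x. \<bar>\<psi> x\<bar> \<le> B1"
    by (rule compact_support_bounded[of \<psi> S]) (use flat_alg_continuous[OF \<psi>(1)] \<psi> that in blast)+
  have p0: "pd i \<psi> x = 0" if "x \<notin> S" for x
    using pd_zero_off[of S \<psi> x i] clS \<psi>(3) that by blast
  obtain B2 where "0 \<le> B2" and B2: "\<And>x. \<bar>pd i \<psi> x\<bar> \<le> B2"
    by (rule compact_support_bounded[of "pd i \<psi>" S])
      (use flat_alg_continuous[OF flat_alg_pd[OF \<psi>(1)]] \<psi>(2) p0 that in blast)+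
  define B where "B = max B1 B2"
  have B: "\<bar>\<psi> x\<bar> \<le> B" "\<bar>pd i \<psi> x\<bar> \<le> B" for x using B1[of x] B2[of x] by (auto simp: B_def)
  have B0: "B \<ge> 0" using B(1)[of undefined] by linarith
  have \<psi>m: "\<psi> \<in> borel_measurable (lebesgue_on \<Omega>)" "pd i \<psi> \<in> borel_measurable (lebesgue_on \<Omega>)"
    using flat_alg_measurable(2)[OF \<psi>(1)] flat_alg_measurable(2)[OF flat_alg_pd[OF \<psi>(1)]]
    by (auto intro: measurable_restrict_space1)
  \<comment> \<open>The defect of the claimed identity. It is zero for each \<phi> n in place of
    \<open>v\<close>, so only the difference \<open>v - \<phi> n\<close> contributes, and that is
    small in \<open>H1_norm\<close>.\<close>
  define J where "J = (LINT x|lebesgue_on \<Omega>. v x * pd i \<psi> x) + (LINT x|lebesgue_on \<Omega>. g x $ i * \<psi> x)"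
  have J: "\<bar>J\<bar> \<le> B * (2 * (\<delta> * measure lebesgue \<Omega>) + (1 / \<delta>) * (H1_norm \<Omega> (\<lambda>x. v x - \<phi> n x))\<^sup>2)"
    if \<delta>: "\<delta> > 0" for n \<delta>
  proof -
    define d where "d x = v x - \<phi> n x" for x
    define G where "G x = g x - grad (\<phi> n) x" for x
    have wv: "v \<in> L2 (lebesgue_on \<Omega>)" "g \<in> L2 (lebesgue_on \<Omega>)"
      using v(2) by (auto simp: has_weak_gradient_def)
    have wp: "has_weak_gradient \<Omega> (\<phi> n) (grad (\<phi> n))"
      by (rule test_function_weak_gradient[OF \<Omega> \<phi>(1)])
    then have wp2: "\<phi> n \<in> L2 (lebesgue_on \<Omega>)" "grad (\<phi> n) \<in> L2 (lebesgue_on \<Omega>)"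
      by (auto simp: has_weak_gradient_def)
    have L2d: "(\<lambda>x. f1 x - f2 x) \<in> L2 (lebesgue_on \<Omega>)"
      if f: "f1 \<in> L2 (lebesgue_on \<Omega>)" "f2 \<in> L2 (lebesgue_on \<Omega>)"
      for f1 f2 :: "real^3 \<Rightarrow> 'b::euclidean_space"
    proof -
      have m: "(\<lambda>x. f1 x - f2 x) \<in> borel_measurable (lebesgue_on \<Omega>)"
        using f by (auto simp: L2_def intro: borel_measurable_diff)
      have i: "integrable (lebesgue_on \<Omega>) (\<lambda>x. 2 * (norm (f1 x))\<^sup>2 + 2 * (norm (f2 x))\<^sup>2)"
        using f by (auto simp: L2_def)
      have b: "(norm (a - b))\<^sup>2 \<le> 2 * (norm a)\<^sup>2 + 2 * (norm b)\<^sup>2" for a b :: 'b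
      proof -
        have "(norm (a - b))\<^sup>2 \<le> (norm a + norm b)\<^sup>2"
          by (intro power_mono norm_triangle_ineq4) auto
        also have "\<dots> \<le> 2 * (norm a)\<^sup>2 + 2 * (norm b)\<^sup>2"
          using sum_squares_ge_zero[of "norm a - norm b" 0] by (simp add: power2_eq_square algebra_simps)
        finally show ?thesis .
      qed
      have "integrable (lebesgue_on \<Omega>) (\<lambda>x. (norm (f1 x - f2 x))\<^sup>2)"
        by (rule Bochner_Integration.integrable_bound[OF i])
          (use m b in \<open>auto intro!: AE_I2 borel_measurable_power borel_measurable_norm\<close>)
      then show ?thesis using m by (simp add: L2_def)
    qed
    have d2: "d \<in> L2 (lebesgue_on \<Omega>)" and G2: "G \<in> L2 (lebesgue_on \<Omega>)"
      unfolding d_def[abs_def] G_def[abs_def] by (rule L2d wv wp2)+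
    \<comment> \<open>\<open>H1_norm\<close> is defined with a chosen weak gradient of the
      difference. Uniqueness up to null sets identifies it with \<open>G\<close>, provided that
      \<open>G\<close> is shown to be a weak gradient.\<close>
    have wd: "has_weak_gradient \<Omega> d G"
      unfolding has_weak_gradient_def
    proof (intro conjI d2 G2 ballI allI)
      fix \<eta> j assume \<eta>: "\<eta> \<in> test_functions \<Omega>"
      obtain C where C: "\<And>x. \<bar>\<eta> x\<bar> \<le> C" "\<And>x. \<bar>pd j \<eta> x\<bar> \<le> C"
        using test_function_facts(5)[OF \<eta>] by blast
      have a: "integrable (lebesgue_on \<Omega>) (\<lambda>x. f x * pd j \<eta> x)" if "f \<in> L2 (lebesgue_on \<Omega>)" for f :: "real^3 \<Rightarrow> real"
        using that test_function_measurable[OF \<eta> \<Omega>(1)] C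
        by (intro L2_integrable_times_bounded[OF \<Omega>m, of _ _ C]) (auto simp: L2_def)
      have b: "integrable (lebesgue_on \<Omega>) (\<lambda>x. f x $ j * \<eta> x)" if "f \<in> L2 (lebesgue_on \<Omega>)" for f :: "real^3 \<Rightarrow> real^3"
        using L2_nth[OF that, of j] test_function_measurable[OF \<eta> \<Omega>(1)] C
        by (intro L2_integrable_times_bounded[OF \<Omega>m, of _ _ C]) auto
      have "(LINT x|lebesgue_on \<Omega>. d x * pd j \<eta> x) =
          (LINT x|lebesgue_on \<Omega>. v x * pd j \<eta> x) - (LINT x|lebesgue_on \<Omega>. \<phi> n x * pd j \<eta> x)"
        using a[OF wv(1)] a[OF wp2(1)] by (simp add: d_def left_diff_distrib)
      also have "\<dots> = - (LINT x|lebesgue_on \<Omega>. g x $ j * \<eta> x) + (LINT x|lebesgue_on \<Omega>. grad (\<phi> n) x $ j * \<eta> x)"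
        using v(2) wp \<eta> unfolding has_weak_gradient_def by simp
      also have "\<dots> = - (LINT x|lebesgue_on \<Omega>. G x $ j * \<eta> x)"
        using b[OF wv(2)] b[OF wp2(2)] by (simp add: G_def left_diff_distrib)
      finally show "(LINT x|lebesgue_on \<Omega>. d x * pd j \<eta> x) = - (LINT x|lebesgue_on \<Omega>. G x $ j * \<eta> x)" .
    qed
    note wG = weak_grad_AE[OF \<Omega>(1,2) wd]
    have "(H1_norm \<Omega> d)\<^sup>2 = (LINT x|lebesgue_on \<Omega>. (norm (d x))\<^sup>2) + (LINT x|lebesgue_on \<Omega>. (norm (weak_grad \<Omega> d x))\<^sup>2)"
      unfolding H1_norm_def L2_norm_def by (simp add: add_nonneg_nonneg)
    also have "(LINT x|lebesgue_on \<Omega>. (norm (weak_grad \<Omega> d x))\<^sup>2) = (LINT x|lebesgue_on \<Omega>. (norm (G x))\<^sup>2)"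
    proof (rule integral_cong_AE)
      show "(\<lambda>x. (norm (weak_grad \<Omega> d x))\<^sup>2) \<in> borel_measurable (lebesgue_on \<Omega>)"
        using wG(2) by (auto simp: has_weak_gradient_def L2_def)
      show "(\<lambda>x. (norm (G x))\<^sup>2) \<in> borel_measurable (lebesgue_on \<Omega>)"
        using G2 by (auto simp: L2_def)
      show "AE x in lebesgue_on \<Omega>. (norm (weak_grad \<Omega> d x))\<^sup>2 = (norm (G x))\<^sup>2"
        using wG(1) by eventually_elim simp
    qed
    finally have H1: "(H1_norm \<Omega> d)\<^sup>2 = (LINT x|lebesgue_on \<Omega>. (norm (d x))\<^sup>2) + (LINT x|lebesgue_on \<Omega>. (norm (G x))\<^sup>2)" .
    have dm: "d \<in> borel_measurable (lebesgue_on \<Omega>)" "integrable (lebesgue_on \<Omega>) (\<lambda>x. (d x)\<^sup>2)"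
      using d2 by (auto simp: L2_def)
    note Gm = L2_nth[OF G2, of i]
    have Gle: "(LINT x|lebesgue_on \<Omega>. (G x $ i)\<^sup>2) \<le> (LINT x|lebesgue_on \<Omega>. (norm (G x))\<^sup>2)"
    proof (rule integral_mono[OF Gm(2)])
      show "integrable (lebesgue_on \<Omega>) (\<lambda>x. (norm (G x))\<^sup>2)" using G2 by (simp add: L2_def)
      show "(G x $ i)\<^sup>2 \<le> (norm (G x))\<^sup>2" for x
        using component_le_norm_cart[of "G x" i] by (metis abs_ge_zero power2_abs power_mono)
    qed
    note ad = abs_integral_le_L2[OF \<Omega>m dm \<delta>]
    note aG = abs_integral_le_L2[OF \<Omega>m Gm \<delta>]
    have i1: "integrable (lebesgue_on \<Omega>) (\<lambda>x. d x * pd i \<psi> x)"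
      by (rule L2_integrable_times_bounded[OF \<Omega>m dm \<psi>m(2) B(2)])
    have i2: "integrable (lebesgue_on \<Omega>) (\<lambda>x. G x $ i * \<psi> x)"
      by (rule L2_integrable_times_bounded[OF \<Omega>m Gm \<psi>m(1) B(1)])
    have i3: "integrable (lebesgue_on \<Omega>) (\<lambda>x. \<phi> n x * pd i \<psi> x)"
      using wp2(1) by (intro L2_integrable_times_bounded[OF \<Omega>m _ _ \<psi>m(2) B(2)]) (auto simp: L2_def)
    have i4: "integrable (lebesgue_on \<Omega>) (\<lambda>x. grad (\<phi> n) x $ i * \<psi> x)"
      using L2_nth[OF wp2(2), of i] by (rule L2_integrable_times_bounded[OF \<Omega>m _ _ \<psi>m(1) B(1)])
    have "(LINT x|lebesgue_on \<Omega>. \<phi> n x * pd i \<psi> x) + (LINT x|lebesgue_on \<Omega>. grad (\<phi> n) x $ i * \<psi> x) = 0"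
      using integral_by_parts_test_function[OF \<Omega> \<psi> \<phi>(1), of i n] by (simp add: mult.commute)
    moreover have "(LINT x|lebesgue_on \<Omega>. v x * pd i \<psi> x) = (LINT x|lebesgue_on \<Omega>. d x * pd i \<psi> x + \<phi> n x * pd i \<psi> x)"
      by (rule Bochner_Integration.integral_cong) (auto simp: d_def algebra_simps)
    moreover have "(LINT x|lebesgue_on \<Omega>. g x $ i * \<psi> x) = (LINT x|lebesgue_on \<Omega>. G x $ i * \<psi> x + grad (\<phi> n) x $ i * \<psi> x)"
      by (rule Bochner_Integration.integral_cong) (auto simp: G_def algebra_simps)
    ultimately have J': "J = (LINT x|lebesgue_on \<Omega>. d x * pd i \<psi> x) + (LINT x|lebesgue_on \<Omega>. G x $ i * \<psi> x)"
      using i1 i2 i3 i4 by (simp add: J_def)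
    have "\<bar>LINT x|lebesgue_on \<Omega>. d x * pd i \<psi> x\<bar> \<le> (LINT x|lebesgue_on \<Omega>. \<bar>d x\<bar> * B)"
      by (rule integral_abs_bound_integral)
        (use i1 ad(1) B(2) in \<open>auto simp: abs_mult intro: mult_left_mono\<close>)
    moreover have "\<bar>LINT x|lebesgue_on \<Omega>. G x $ i * \<psi> x\<bar> \<le> (LINT x|lebesgue_on \<Omega>. \<bar>G x $ i\<bar> * B)"
      by (rule integral_abs_bound_integral)
        (use i2 aG(1) B(1) in \<open>auto simp: abs_mult intro: mult_left_mono\<close>)
    ultimately have "\<bar>J\<bar> \<le> B * ((LINT x|lebesgue_on \<Omega>. \<bar>d x\<bar>) + (LINT x|lebesgue_on \<Omega>. \<bar>G x $ i\<bar>))"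
      unfolding J' by (simp add: algebra_simps)
    also have "\<dots> \<le> B * (2 * (\<delta> * measure lebesgue \<Omega>) + (1 / \<delta>) * (H1_norm \<Omega> d)\<^sup>2)"
    proof (rule mult_left_mono[OF _ B0])
      have "(1 / \<delta>) * (LINT x|lebesgue_on \<Omega>. (G x $ i)\<^sup>2) \<le> (1 / \<delta>) * (LINT x|lebesgue_on \<Omega>. (norm (G x))\<^sup>2)"
        using Gle \<delta> by (intro mult_left_mono) auto
      then show "(LINT x|lebesgue_on \<Omega>. \<bar>d x\<bar>) + (LINT x|lebesgue_on \<Omega>. \<bar>G x $ i\<bar>)
          \<le> 2 * (\<delta> * measure lebesgue \<Omega>) + (1 / \<delta>) * (H1_norm \<Omega> d)\<^sup>2"
        using ad(2) aG(2) unfolding H1 distrib_left by simp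
    qed
    finally show ?thesis unfolding d_def .
  qed
  \<comment> \<open>First \<open>n\<close> tends to infinity for fixed \<delta>. The bound that
    remains is proportional to \<delta>, which forces \<open>J = 0\<close>.\<close>
  have J2: "\<bar>J\<bar> \<le> B * (2 * (\<delta> * measure lebesgue \<Omega>))" if "\<delta> > 0" for \<delta>
  proof (rule tendsto_lowerbound)
    show "(\<lambda>n. B * (2 * (\<delta> * measure lebesgue \<Omega>) + (1 / \<delta>) * (H1_norm \<Omega> (\<lambda>x. v x - \<phi> n x))\<^sup>2))
        \<longlonglongrightarrow> B * (2 * (\<delta> * measure lebesgue \<Omega>))"
      using \<phi>(2) that by (auto intro!: tendsto_eq_intros)
  qed (use J[OF that] in auto)
  have "J = 0"
  proof (rule ccontr)
    assume "J \<noteq> 0"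
    define M where "M = B * 2 * measure lebesgue \<Omega> + 1"
    have M: "M > 0" using B0 by (simp add: M_def add_nonneg_pos)
    have "\<bar>J\<bar> \<le> B * (2 * (\<bar>J\<bar> / (2 * M) * measure lebesgue \<Omega>))"
      using J2[of "\<bar>J\<bar> / (2 * M)"] M \<open>J \<noteq> 0\<close> by simp
    also have "\<dots> = (\<bar>J\<bar> / (2 * M)) * (M - 1)" by (simp add: M_def)
    also have "\<dots> < \<bar>J\<bar>" using M \<open>J \<noteq> 0\<close> by (simp add: field_simps add_pos_pos)
    finally show False by simp
  qed
  then show ?thesis by (simp add: J_def)
qed

text \<open>Extended by zero, \<open>v\<close> must not jump across the frontier. Integration by
  parts in \<open>H10\<close> has no boundary term, so the partial derivatives of the mollified
  extension are averages of \<open>g\<close> and hence bounded by \<open>L\<close>, even near the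
  frontier. Letting the radius tend to 0 gives \<open>|v x| \<le> 3 * L * norm (x - y)\<close> for
  \<open>x\<close> inside and \<open>y\<close> outside the closure. By convexity \<Omega> is the
  interior of its closure, so points of both kinds come arbitrarily close to each frontier
  point.\<close>

lemma H10_lipschitz_zero_on_frontier:
  assumes \<Omega>: "open \<Omega>" "bounded \<Omega>" "convex \<Omega>"
    and v: "v \<in> H10 \<Omega>" "has_weak_gradient \<Omega> v g"
    and lip: "\<And>x y. x \<in> closure \<Omega> \<Longrightarrow> y \<in> closure \<Omega> \<Longrightarrow> \<bar>v x - v y\<bar> \<le> L * norm (x - y)"
    and g: "AE x in lebesgue_on \<Omega>. norm (g x) \<le> L"
    and z: "z \<in> frontier \<Omega>"
  shows "v z = 0"
proof -
  have nf: "negligible (frontier \<Omega>)" using \<Omega>(3) by (rule negligible_convex_frontier)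
  have \<Omega>m: "\<Omega> \<in> lmeasurable" using \<Omega>(1,2) by (simp add: lmeasurable_open)
  have zc: "z \<in> closure \<Omega>" using z by (simp add: frontier_def)
  have intc: "interior (closure \<Omega>) = \<Omega>"
    using \<Omega>(1,3) by (simp add: convex_interior_closure interior_open)
  have L0: "L \<ge> 0"
  proof -
    have "\<Omega> \<noteq> {}" using zc by auto
    then obtain x where "x \<in> \<Omega>" by blast
    moreover have "z \<notin> \<Omega>" using z \<Omega>(1) by (simp add: frontier_def interior_open)
    ultimately have "x \<noteq> z" "x \<in> closure \<Omega>" using closure_subset by auto
    then have "0 \<le> L * norm (x - z)" "norm (x - z) > 0" using lip[of x z] zc by auto
    then show ?thesis by (simp add: zero_le_mult_iff)
  qed
  define V where "V x = indicator \<Omega> x *\<^sub>R v x" for x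
  have vc: "continuous_on \<Omega> v"
  proof (rule lipschitz_on_continuous_on[of L])
    show "L-lipschitz_on \<Omega> v"
      using lip L0 closure_subset[of \<Omega>] by (intro lipschitz_onI) (auto simp: dist_norm)
  qed
  have Vb: "V \<in> borel_measurable borel"
    unfolding V_def[abs_def] using \<Omega>(1) vc by (intro borel_measurable_continuous_on_indicator) auto
  have v2: "v \<in> L2 (lebesgue_on \<Omega>)"
    using v(2) by (auto simp: has_weak_gradient_def)
  have vi: "integrable (lebesgue_on \<Omega>) v"
  proof -
    have "integrable (lebesgue_on \<Omega>) (\<lambda>x. v x * 1)"
      by (rule L2_integrable_times_bounded[OF \<Omega>m, where B = 1]) (use v2 in \<open>auto simp: L2_def\<close>)
    then show ?thesis by simp
  qed
  have Vi: "integrable lebesgue V"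
    unfolding V_def[abs_def] using vi \<Omega>(1) by (subst integrable_restrict_space[symmetric]) auto
  have V_int: "(LINT y|lebesgue. V y * f y) = (LINT y|lebesgue_on \<Omega>. v y * f y)" for f
    unfolding V_def using \<Omega>(1) by (subst integral_restrict_space) (auto simp: mult.assoc)
  have main: "\<bar>v x\<bar> \<le> 3 * L * norm (x - y)" if x: "x \<in> \<Omega>" and y: "y \<notin> closure \<Omega>" for x y
  proof -
    obtain e1 where e1: "e1 > 0" "ball x e1 \<subseteq> \<Omega>" using x \<Omega>(1) open_contains_ball by blast
    have "open (- closure \<Omega>)" by (intro open_Compl closed_closure)
    then obtain e2 where e2: "e2 > 0" "ball y e2 \<subseteq> - closure \<Omega>" using y open_contains_ball by blast
    have est: "\<bar>v x\<bar> \<le> L * \<epsilon> + 3 * L * norm (x - y)" if \<epsilon>: "\<epsilon> > 0" "\<epsilon> \<le> e1" "\<epsilon> \<le> e2" for \<epsilon>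
    proof -
      obtain k where k: "mollifier \<epsilon> k" using mollifier_exists[OF \<epsilon>(1)] by blast
      have kS: "\<And>x. x \<notin> cball 0 \<epsilon> \<Longrightarrow> k x = 0" using k by (auto simp: mollifier_def)
      have ka: "k \<in> flat_alg" "\<And>x. k x \<ge> 0" "integrable lebesgue k" "(LINT x|lebesgue. k x) = 1"
        "\<And>x. k (- x) = k x"
        using k by (auto simp: mollifier_def)
      define T where "T x = (LINT y|lebesgue. V y * k (x - y))" for x
      have Tshift: "T x = (LINT y|lebesgue. V (x + y) * k y)" for x
        unfolding T_def by (rule mollifier_shift[OF k Vb])
      have m: "(\<lambda>y. V (x + y) * k y) \<in> borel_measurable lebesgue" for x
      proof -
        have "(\<lambda>y. V (x + y)) \<in> borel_measurable borel" using Vb by measurable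
        then have "(\<lambda>y. V (x + y)) \<in> borel_measurable lebesgue" by (auto intro: measurable_completion)
        then show ?thesis using flat_alg_measurable(2)[OF ka(1)] by (rule borel_measurable_times)
      qed
      have "\<bar>T x - v x\<bar> \<le> L * \<epsilon>"
        unfolding Tshift
      proof (rule mollifier_average_bound(2)[OF k m])
        fix w :: "real^3" assume w: "norm w < \<epsilon>"
        then have xw: "x + w \<in> \<Omega>" using e1 \<epsilon> by (auto simp: subset_eq dist_norm)
        then have "\<bar>v (x + w) - v x\<bar> \<le> L * norm w"
          using lip[of "x + w" x] x closure_subset by fastforce
        also have "\<dots> \<le> L * \<epsilon>" using w L0 by (intro mult_left_mono) auto
        finally show "\<bar>V (x + w) - v x\<bar> \<le> L * \<epsilon>" using xw by (simp add: V_def)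
      qed
      moreover have "\<bar>T y - 0\<bar> \<le> 0"
        unfolding Tshift
      proof (rule mollifier_average_bound(2)[OF k m])
        fix w :: "real^3" assume w: "norm w < \<epsilon>"
        then have "y + w \<in> - closure \<Omega>" using e2 \<epsilon> by (auto simp: subset_eq dist_norm)
        then have "y + w \<notin> \<Omega>" using closure_subset by auto
        then show "\<bar>V (y + w) - 0\<bar> \<le> 0" by (simp add: V_def)
      qed
      moreover have "\<bar>T x - T y\<bar> \<le> 3 * L * norm (x - y)"
      proof -
        \<comment> \<open>The derivative is moved from the kernel to \<open>v\<close>. This is where
          \<open>v \<in> H10 \<Omega>\<close> enters, since the kernel need not vanish near the
          frontier.\<close>
        have pb: "\<bar>LINT y|lebesgue. V y * pd i k (x - y)\<bar> \<le> L" for i x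
        proof -
          define \<psi> where "\<psi> = (\<lambda>y. k (x - y))"
          have \<psi>a: "\<psi> \<in> flat_alg" unfolding \<psi>_def by (rule flat_alg_reflect[OF ka(1)])
          have \<psi>0: "\<psi> y = 0" if "y \<notin> cball x \<epsilon>" for y
            unfolding \<psi>_def using that by (intro kS) (auto simp: dist_norm norm_minus_commute)
          have \<psi>pd: "pd i \<psi> y = - pd i k (x - y)" for y
            unfolding \<psi>_def by (rule pd_reflect[OF flat_alg_differentiable[OF ka(1)]])
          have \<psi>p: "\<psi> y \<ge> 0" for y unfolding \<psi>_def by (rule ka(2))
          have \<psi>i: "integrable lebesgue \<psi>" "(LINT y|lebesgue. \<psi> y) = 1"
          proof -
            have "k (x - y) = k (y + (- x))" for y using ka(5)[of "x - y"] by simp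
            then have "\<psi> = (\<lambda>y. k (y + (- x)))" unfolding \<psi>_def by simp
            then show "(LINT y|lebesgue. \<psi> y) = 1"
              using integral_lebesgue_translation[OF flat_alg_measurable(1)[OF ka(1)], of "- x"] ka(4) by simp
            then show "integrable lebesgue \<psi>" using not_integrable_integral_eq by force
          qed
          have \<psi>io: "integrable (lebesgue_on \<Omega>) \<psi>"
          proof -
            have "integrable lebesgue (\<lambda>y. indicator \<Omega> y *\<^sub>R \<psi> y)"
              using \<Omega>(1) \<psi>i(1) by (intro integrable_mult_indicator) auto
            then show ?thesis using \<Omega>(1) by (subst integrable_restrict_space) auto
          qed
          have "(LINT y|lebesgue. V y * pd i k (x - y)) = - (LINT y|lebesgue_on \<Omega>. v y * pd i \<psi> y)"
            unfolding V_int \<psi>pd by simp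
          also have "\<dots> = (LINT y|lebesgue_on \<Omega>. g y $ i * \<psi> y)"
            using H10_integral_by_parts[where S = "cball x \<epsilon>" and i = i, OF \<Omega>(1,2) nf v \<psi>a compact_cball] \<psi>0 by auto
          also have "\<bar>\<dots>\<bar> \<le> (LINT y|lebesgue_on \<Omega>. \<bar>g y $ i * \<psi> y\<bar>)"
            by (rule integral_abs_bound)
          also have "\<dots> \<le> (LINT y|lebesgue_on \<Omega>. L * \<psi> y)"
          proof (rule integral_mono_AE')
            show "integrable (lebesgue_on \<Omega>) (\<lambda>y. L * \<psi> y)" using \<psi>io by simp
            show "AE y in lebesgue_on \<Omega>. \<bar>g y $ i * \<psi> y\<bar> \<le> L * \<psi> y"
              using g
            proof eventually_elim
              fix y assume "norm (g y) \<le> L"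
              then have "\<bar>g y $ i\<bar> \<le> L" using component_le_norm_cart[of "g y" i] by linarith
              then show "\<bar>g y $ i * \<psi> y\<bar> \<le> L * \<psi> y"
                using \<psi>p[of y] by (simp add: abs_mult mult_right_mono)
            qed
          qed (use L0 \<psi>p in auto)
          also have "\<dots> \<le> L * (LINT y|lebesgue. \<psi> y)"
          proof -
            have "(LINT y|lebesgue_on \<Omega>. \<psi> y) = (LINT y|lebesgue. indicator \<Omega> y *\<^sub>R \<psi> y)"
              using \<Omega>(1) by (intro integral_restrict_space) auto
            also have "\<dots> \<le> (LINT y|lebesgue. \<psi> y)"
              by (rule integral_mono_AE') (use \<psi>i \<psi>p in \<open>auto simp: indicator_def\<close>)
            finally show ?thesis using L0 by (simp add: mult_left_mono)
          qed
          finally show ?thesis using \<psi>i(2) by simp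
        qed
        \<comment> \<open>The factor 3 is the number of coordinates, each with a partial derivative
          bounded by \<open>L\<close>.\<close>
        have "norm (T x - T y) \<le> 3 * L * norm (x - y)"
        proof (rule differentiable_bound[OF convex_UNIV])
          fix x
          show "(T has_derivative (\<lambda>d. \<Sum>i\<in>UNIV. d $ i * (LINT y|lebesgue. V y * pd i k (x - y)))) (at x within UNIV)"
            unfolding T_def[abs_def]
            by (rule convolution_has_derivative[where S = "cball 0 \<epsilon>", OF Vi ka(1) compact_cball]) (use kS in auto)
          show "onorm (\<lambda>d. \<Sum>i\<in>UNIV. d $ i * (LINT y|lebesgue. V y * pd i k (x - y))) \<le> 3 * L"
          proof (rule onorm_le)
            fix d :: "real^3"
            have "norm (d $ i * (LINT y|lebesgue. V y * pd i k (x - y))) \<le> norm d * L" for i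
              unfolding real_norm_def abs_mult using pb L0 component_le_norm_cart by (intro mult_mono) auto
            then have "norm (\<Sum>i\<in>UNIV. d $ i * (LINT y|lebesgue. V y * pd i k (x - y))) \<le> (\<Sum>i\<in>(UNIV::3 set). norm d * L)"
              by (intro order_trans[OF norm_sum sum_mono])
            then show "norm (\<Sum>i\<in>UNIV. d $ i * (LINT y|lebesgue. V y * pd i k (x - y))) \<le> 3 * L * norm d"
              by (simp add: mult_ac)
          qed
        qed auto
        then show ?thesis by simp
      qed
      ultimately show ?thesis by linarith
    qed
    show ?thesis
    proof (rule field_le_epsilon)
      fix e :: real assume e: "e > 0"
      define \<epsilon> where "\<epsilon> = min (min e1 e2) (e / (L + 1))"
      have "\<epsilon> > 0" "\<epsilon> \<le> e1" "\<epsilon> \<le> e2" using e e1 e2 L0 by (auto simp: \<epsilon>_def)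
      note est[OF this]
      moreover have "L * \<epsilon> \<le> e"
      proof -
        have "L * \<epsilon> \<le> L * (e / (L + 1))" using L0 by (intro mult_left_mono) (auto simp: \<epsilon>_def)
        also have "\<dots> \<le> e" using L0 e by (simp add: field_simps)
        finally show ?thesis .
      qed
      ultimately show "\<bar>v x\<bar> \<le> 3 * L * norm (x - y) + e" by linarith
    qed
  qed
  have "\<bar>v z\<bar> \<le> 0 + e" if e: "e > 0" for e
  proof -
    \<comment> \<open>The path from \<open>z\<close> to \<open>x\<close> and the jump from
      \<open>x\<close> to \<open>y\<close> cost \<open>L * d + 3 * L * (2 * d)\<close>, together
      \<open>7 * L * d\<close>; adding 1 to \<open>L\<close> avoids a division by zero.\<close>
    define d where "d = e / (7 * (L + 1))"
    have d: "d > 0" using e L0 by (simp add: d_def)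
    obtain x where x: "x \<in> \<Omega>" "dist x z < d" using zc d closure_approachable by metis
    have "z \<notin> interior (closure \<Omega>)" using z \<Omega>(1) unfolding intc by (simp add: frontier_def interior_open)
    then have "\<not> ball z d \<subseteq> closure \<Omega>" using d by (meson centre_in_ball interior_maximal open_ball subsetD)
    then obtain y where "y \<in> ball z d" and y1: "y \<notin> closure \<Omega>" by blast
    then have y: "y \<notin> closure \<Omega>" "dist z y < d" by (auto simp del: closure_closed)
    have xy: "norm (x - y) \<le> 2 * d"
      using x(2) y(2) dist_triangle[of x y z] by (simp add: dist_norm)
    have "\<bar>v z\<bar> \<le> \<bar>v x\<bar> + \<bar>v x - v z\<bar>" by linarith
    also have "\<dots> \<le> 3 * L * norm (x - y) + L * norm (x - z)"
      using main[OF x(1) y(1)] lip[of x z] zc x(1) closure_subset by (intro add_mono) auto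
    also have "\<dots> \<le> 3 * L * (2 * d) + L * d"
      using xy x(2) L0 by (intro add_mono mult_left_mono) (auto simp: dist_norm)
    also have "\<dots> \<le> 7 * (L + 1) * d" using d L0 by (simp add: algebra_simps)
    also have "\<dots> = e" using L0 by (simp add: d_def)
    finally show ?thesis by simp
  qed
  then have "\<bar>v z\<bar> \<le> 0" by (rule field_le_epsilon)
  then show ?thesis by simp
qed


text \<open>To obtain test functions, \<open>W\<close> is compressed towards an interior point,
  which by convexity moves its support to a compact subset of \<Omega>, and then mollified with a
  radius below the distance of that subset to the frontier. The gradients converge because
  mollification preserves affine increments: near a point of \<open>U\<close> they are eventually
  \<open>1 + s n\<close> times the gradient of \<open>W\<close>. Dominated convergence then gives
  convergence in \<open>H1_norm\<close>.\<close>

lemma H10I_lipschitz_locally_affine: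
  assumes \<Omega>: "open \<Omega>" "bounded \<Omega>" "convex \<Omega>" "\<Omega> \<noteq> {}"
    and U: "locally_affine_on U W" "U \<subseteq> \<Omega>" "negligible (\<Omega> - U)"
    and lip: "\<And>x y. \<bar>W x - W y\<bar> \<le> L * norm (x - y)"
    and zero: "\<And>x. x \<notin> \<Omega> \<Longrightarrow> W x = 0"
  shows "W \<in> H10 \<Omega>"
proof -
  have nf: "negligible (frontier \<Omega>)" using \<Omega>(3) by (rule negligible_convex_frontier)
  have \<Omega>m: "\<Omega> \<in> lmeasurable" using \<Omega>(1,2) by (simp add: lmeasurable_open)
  have oU: "open U" using U(1) by (rule locally_affine_on_open)
  have dW: "\<And>x. x \<in> U \<Longrightarrow> W differentiable at x"
    by (rule locally_affine_on_differentiable[OF U(1)])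
  obtain x0 where x0: "x0 \<in> \<Omega>" using \<Omega>(4) by blast
  have L0: "L \<ge> 0"
    using lip[of "axis 1 1" 0] abs_ge_zero[of "W (axis 1 1) - W 0"] by (simp add: norm_axis_1)
  define D where "D = diameter \<Omega>"
  have D: "norm (x - x0) \<le> D" if "x \<in> \<Omega>" for x
    unfolding D_def using diameter_bounded_bound[OF \<Omega>(2) that x0] by (simp add: dist_norm)
  have D0: "D \<ge> 0" using D[OF x0] by simp
  define s where "s n = 1 / (real n + 1)" for n
  have s: "0 < s n" "s n \<le> 1" for n by (auto simp: s_def)
  have s_lim: "s \<longlonglongrightarrow> 0"
    using LIMSEQ_inverse_real_of_nat by (simp add: s_def[abs_def] inverse_eq_divide add.commute)
  define Y where "Y n x = x0 + (1 + s n) *\<^sub>R (x - x0)" for n x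
  \<comment> \<open>The image of the closed domain under the inverse of \<open>Y n\<close>; it
    contains the points where the compressed function \<open>V n\<close> is nonzero.\<close>
  define C where "C n = (\<lambda>y. x0 + (1 / (1 + s n)) *\<^sub>R (y - x0)) ` closure \<Omega>" for n
  have Cc: "compact (C n)" for n
    unfolding C_def using \<Omega>(2)
    by (intro compact_continuous_image continuous_intros) (simp add: compact_closure)
  have CO: "C n \<subseteq> \<Omega>" for n
  proof
    fix x assume "x \<in> C n"
    then obtain y where y: "y \<in> closure \<Omega>" "x = x0 + (1 / (1 + s n)) *\<^sub>R (y - x0)" by (auto simp: C_def)
    have e: "1 - 1 / (1 + s n) > 0" "1 - 1 / (1 + s n) \<le> 1" using s[of n] by (auto simp: field_simps)
    have "y - (1 - 1 / (1 + s n)) *\<^sub>R (y - x0) \<in> interior \<Omega>"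
      by (rule mem_interior_closure_convex_shrink[OF \<Omega>(3) _ y(1) e]) (use x0 \<Omega>(1) in \<open>simp add: interior_open\<close>)
    moreover have "y - (1 - 1 / (1 + s n)) *\<^sub>R (y - x0) = x" unfolding y(2) by (simp add: algebra_simps)
    ultimately show "x \<in> \<Omega>" using interior_subset by auto
  qed
  have YC: "x \<in> C n" if "W (Y n x) \<noteq> 0" for n x
  proof -
    have "Y n x \<in> closure \<Omega>" using zero that closure_subset by blast
    moreover have "x = x0 + (1 / (1 + s n)) *\<^sub>R (Y n x - x0)" using s(1)[of n] by (simp add: Y_def)
    ultimately show ?thesis unfolding C_def by blast
  qed
  have "\<exists>e>0. (\<Union>x\<in>C n. ball x e) \<subseteq> \<Omega>" for n
    using compact_subset_open_imp_ball_epsilon_subset[OF Cc \<Omega>(1) CO] by metis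
  then obtain e where e: "\<And>n. e n > 0" "\<And>n. (\<Union>x\<in>C n. ball x (e n)) \<subseteq> \<Omega>" by metis
  \<comment> \<open>The bound by \<open>e n / 2\<close> keeps the enlarged support inside \<Omega>,
    and the bound by \<open>s n\<close> makes the mollification error tend to zero.\<close>
  define \<epsilon> where "\<epsilon> n = min (e n / 2) (s n)" for n
  have \<epsilon>: "\<epsilon> n > 0" "\<epsilon> n \<le> s n" "\<epsilon> n < e n" for n
    using e(1)[of n] s(1)[of n] by (auto simp: \<epsilon>_def)
  have "\<exists>k. mollifier (\<epsilon> n) k" for n using mollifier_exists[OF \<epsilon>(1)] by metis
  then obtain k where k: "\<And>n. mollifier (\<epsilon> n) (k n)" by metis
  have ka: "k n \<in> flat_alg" "k n x \<ge> 0" "k n x \<noteq> 0 \<Longrightarrow> norm x < \<epsilon> n" for n x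
    using k[of n] by (auto simp: mollifier_def)
  have k0: "k n x = 0" if "x \<notin> cball 0 (\<epsilon> n)" for n x
    using ka(3)[of n x] that by force
  define V where "V n x = W (Y n x)" for n x
  have Wc: "continuous_on A W" for A
    using lipschitz_imp_continuous_on_UNIV[OF lip] continuous_on_subset by blast
  have Vc: "continuous_on A (V n)" for n A
    unfolding V_def[abs_def] Y_def[abs_def]
    by (rule continuous_on_compose2[OF Wc[of UNIV]]) (auto intro!: continuous_intros)
  have Vb: "V n \<in> borel_measurable borel" for n by (rule borel_measurable_continuous_onI[OF Vc])
  have Vlip: "\<bar>V n x - V n y\<bar> \<le> 2 * L * norm (x - y)" for n x y
  proof -
    have "\<bar>V n x - V n y\<bar> \<le> L * norm (Y n x - Y n y)" unfolding V_def by (rule lip)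
    also have "Y n x - Y n y = (1 + s n) *\<^sub>R (x - y)" by (simp add: Y_def algebra_simps)
    also have "L * norm ((1 + s n) *\<^sub>R (x - y)) \<le> L * (2 * norm (x - y))"
      using s[of n] L0 by (intro mult_left_mono) (auto intro: mult_right_mono)
    finally show ?thesis by simp
  qed
  have Vi: "integrable lebesgue (V n)" for n
  proof -
    obtain B where B: "\<And>x. \<bar>V n x\<bar> \<le> B"
    proof (rule compact_support_bounded[OF Vc Cc, of n n])
      show "V n x = 0" if "x \<notin> C n" for x using YC that by (auto simp: V_def)
    qed blast
    show ?thesis
      by (rule integrable_bounded_support[where S = "C n" and B = B])
        (use B YC Vb compact_imp_bounded[OF Cc] in \<open>auto simp: V_def intro: measurable_completion\<close>)
  qed
  define \<phi> where "\<phi> n x = (LINT y|lebesgue. V n y * k n (x - y))" for n x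
  have \<phi>s: "\<phi> n x = (LINT y|lebesgue. V n (x + y) * k n y)" for n x
    unfolding \<phi>_def by (rule mollifier_shift[OF k Vb])
  have m: "(\<lambda>y. V n (x + y) * k n y) \<in> borel_measurable lebesgue" for n x
  proof -
    have "(\<lambda>y. V n (x + y)) \<in> borel_measurable borel" using Vb[of n] by measurable
    then have "(\<lambda>y. V n (x + y)) \<in> borel_measurable lebesgue" by (auto intro: measurable_completion)
    then show ?thesis using flat_alg_measurable(2)[OF ka(1)] by (rule borel_measurable_times)
  qed
  have \<phi>smooth: "smooth_on UNIV (\<phi> n)" for n
    unfolding \<phi>_def[abs_def] 
    by (rule convolution_smooth[where S = "cball 0 (\<epsilon> n)", OF Vi ka(1) compact_cball]) (use k0 in auto)
  have \<phi>test: "\<phi> n \<in> test_functions \<Omega>" for n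
  proof -
    define Z where "Z = {x. infdist x (C n) \<le> \<epsilon> n}"
    have Cne: "C n \<noteq> {}" using \<Omega>(4) by (auto simp: C_def)
    have supp: "{x. \<phi> n x \<noteq> 0} \<subseteq> Z"
    proof
      fix x assume "x \<in> {x. \<phi> n x \<noteq> 0}"
      then have "\<exists>y. V n (x + y) * k n y \<noteq> 0"
        unfolding \<phi>s by (metis (mono_tags, lifting) Bochner_Integration.integral_cong integral_zero mem_Collect_eq)
      then obtain y where y: "V n (x + y) \<noteq> 0" "k n y \<noteq> 0" by auto
      then have "x + y \<in> C n" "norm y < \<epsilon> n" using YC ka(3) by (auto simp: V_def)
      then have "infdist x (C n) \<le> dist x (x + y)" by (intro infdist_le)
      then show "x \<in> Z" using \<open>norm y < \<epsilon> n\<close> by (simp add: Z_def dist_norm)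
    qed
    have Zc: "closed Z" unfolding Z_def by (intro closed_Collect_le continuous_intros)
    have ZO: "Z \<subseteq> \<Omega>"
    proof
      fix x assume "x \<in> Z"
      then obtain c where "c \<in> C n" "dist x c \<le> \<epsilon> n"
        using infdist_attains_inf[OF compact_imp_closed[OF Cc] Cne, of x] by (metis Z_def mem_Collect_eq)
      then have "x \<in> ball c (e n)" using \<epsilon>(3)[of n] by (simp add: dist_commute)
      then show "x \<in> \<Omega>" using e(2)[of n] \<open>c \<in> C n\<close> by blast
    qed
    have cl: "closure {x. \<phi> n x \<noteq> 0} \<subseteq> Z" using supp Zc by (rule closure_minimal)
    have "compact (closure {x. \<phi> n x \<noteq> 0})"
      using bounded_subset[OF \<Omega>(2), of "{x. \<phi> n x \<noteq> 0}"] supp ZO by (auto simp: compact_closure)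
    then show ?thesis using \<phi>smooth cl ZO by (auto simp: test_functions_def)
  qed
  have \<phi>lip: "\<bar>\<phi> n x - \<phi> n z\<bar> \<le> 2 * L * norm (x - z)" for n x z
  proof -
    have iz: "integrable lebesgue (\<lambda>y. V n (z + y) * k n y)" for z
    proof (rule mollifier_average_bound(1)[OF k m])
      fix y :: "real^3" assume "norm y < \<epsilon> n"
      then have "2 * L * norm y \<le> 2 * L * \<epsilon> n" using L0 by (intro mult_left_mono) auto
      then show "\<bar>V n (z + y) - V n z\<bar> \<le> 2 * L * \<epsilon> n" using Vlip[of n "z + y" z] by simp
    qed
    have "\<phi> n x - \<phi> n z = (LINT y|lebesgue. (V n (x + y) - V n (z + y)) * k n y)"
      unfolding \<phi>s using iz by (simp add: left_diff_distrib)
    moreover have "\<bar>(LINT y|lebesgue. (V n (x + y) - V n (z + y)) * k n y) - 0\<bar> \<le> 2 * L * norm (x - z)"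
    proof (rule mollifier_average_bound(2)[OF k])
      show "(\<lambda>y. (V n (x + y) - V n (z + y)) * k n y) \<in> borel_measurable lebesgue"
        using m[of n x] m[of n z] by (simp add: left_diff_distrib)
      show "\<bar>V n (x + y) - V n (z + y) - 0\<bar> \<le> 2 * L * norm (x - z)" for y
        using Vlip[of n "x + y" "z + y"] by simp
    qed
    ultimately show ?thesis by simp
  qed
  have Yd: "norm (Y n (x' + y) - x) \<le> s n * D + 2 * norm (x' - x) + 2 * norm y" if "x \<in> \<Omega>" for n x x' y
  proof -
    have "Y n (x' + y) - x = s n *\<^sub>R (x - x0) + (1 + s n) *\<^sub>R ((x' - x) + y)"
      by (simp add: Y_def algebra_simps)
    also have "norm \<dots> \<le> s n * norm (x - x0) + (1 + s n) * (norm (x' - x) + norm y)"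
      using s[of n] norm_triangle_ineq[of "x' - x" y]
      by (intro norm_triangle_le add_mono) (auto intro!: mult_left_mono)
    also have "\<dots> \<le> s n * D + 2 * (norm (x' - x) + norm y)"
      using s[of n] D[OF that] by (intro add_mono mult_left_mono mult_right_mono) auto
    finally show ?thesis by simp
  qed
  have \<phi>close: "\<bar>\<phi> n x - W x\<bar> \<le> s n * (L * (D + 2))" if x: "x \<in> \<Omega>" for n x
    unfolding \<phi>s
  proof (rule mollifier_average_bound(2)[OF k m])
    fix y :: "real^3" assume y: "norm y < \<epsilon> n"
    have "\<bar>V n (x + y) - W x\<bar> \<le> L * norm (Y n (x + y) - x)" unfolding V_def by (rule lip)
    also have "\<dots> \<le> L * (s n * D + 2 * s n)"
      using Yd[OF x, of n x y] y \<epsilon>(2)[of n] L0 by (intro mult_left_mono) auto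
    finally show "\<bar>V n (x + y) - W x\<bar> \<le> s n * (L * (D + 2))" by (simp add: algebra_simps)
  qed
  have grad_lim: "(\<lambda>n. grad (\<phi> n) x) \<longlonglongrightarrow> grad W x" if xU: "x \<in> U" for x
  proof -
    obtain V' a b where V': "open V'" "x \<in> V'" "\<And>y. y \<in> V' \<Longrightarrow> W y = a \<bullet> y + b"
      using U(1) xU unfolding locally_affine_on_def by metis
    obtain \<eta> where \<eta>: "\<eta> > 0" "ball x \<eta> \<subseteq> V'" using V' open_contains_ball by blast
    have xO: "x \<in> \<Omega>" using xU U(2) by blast
    have gW: "grad W x = a" by (rule grad_locally_affine[OF V'])
    have "(\<lambda>n. s n * (D + 2)) \<longlonglongrightarrow> 0" using s_lim by (auto intro!: tendsto_eq_intros)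
    then have "\<forall>\<^sub>F n in sequentially. s n * (D + 2) < \<eta> / 2"
      using \<eta>(1) by (intro order_tendstoD(2)) auto
    then have ev: "\<forall>\<^sub>F n in sequentially. (1 + s n) *\<^sub>R a = grad (\<phi> n) x"
    proof eventually_elim
      fix n assume n: "s n * (D + 2) < \<eta> / 2"
      define c where "c = a \<bullet> (x0 - (1 + s n) *\<^sub>R x0) + b"
      \<comment> \<open>By \<open>Yd\<close> the point \<open>Y n (z + y)\<close> stays in
        \<open>ball x \<eta>\<close>: the distance of \<open>z\<close> to \<open>x\<close>
        contributes less than \<open>2 * (\<eta> / 4)\<close>, and dilation and mollification
        together less than \<open>s n * (D + 2)\<close>, which is below
        \<open>\<eta> / 2\<close>.\<close>
      have aff: "\<phi> n x' = ((1 + s n) *\<^sub>R a) \<bullet> x' + (\<phi> n x - ((1 + s n) *\<^sub>R a) \<bullet> x)"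
        if x': "x' \<in> ball x (\<eta> / 4)" for x'
      proof -
        have Vaff: "V n (z + y) = a \<bullet> Y n (z + y) + b" if z: "z \<in> ball x (\<eta> / 4)" and y: "norm y < \<epsilon> n" for y z
        proof -
          have "norm (Y n (z + y) - x) \<le> s n * D + 2 * norm (z - x) + 2 * norm y" by (rule Yd[OF xO])
          also have "\<dots> < \<eta>"
            using n z y \<epsilon>(2)[of n] by (simp add: dist_norm norm_minus_commute algebra_simps)
          finally have "Y n (z + y) \<in> V'" using \<eta>(2) by (auto simp: subset_eq dist_norm norm_minus_commute)
          then show ?thesis by (simp add: V_def V'(3))
        qed
        have xx: "x \<in> ball x (\<eta> / 4)" using \<eta> by simp
        have iz: "integrable lebesgue (\<lambda>y. V n (z + y) * k n y)" for z
        proof (rule mollifier_average_bound(1)[OF k m])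
          fix y :: "real^3" assume "norm y < \<epsilon> n"
          then have "2 * L * norm y \<le> 2 * L * \<epsilon> n" using L0 by (intro mult_left_mono) auto
          then show "\<bar>V n (z + y) - V n z\<bar> \<le> 2 * L * \<epsilon> n" using Vlip[of n "z + y" z] by simp
        qed
        have "\<phi> n x' - \<phi> n x = (LINT y|lebesgue. (V n (x' + y) - V n (x + y)) * k n y)"
          unfolding \<phi>s using iz by (simp add: left_diff_distrib)
        moreover have "\<bar>(LINT y|lebesgue. (V n (x' + y) - V n (x + y)) * k n y) - (1 + s n) * (a \<bullet> (x' - x))\<bar> \<le> 0"
        proof (rule mollifier_average_bound(2)[OF k])
          show "(\<lambda>y. (V n (x' + y) - V n (x + y)) * k n y) \<in> borel_measurable lebesgue"
            using m[of n x'] m[of n x] by (simp add: left_diff_distrib)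
          fix y :: "real^3" assume y: "norm y < \<epsilon> n"
          show "\<bar>V n (x' + y) - V n (x + y) - (1 + s n) * (a \<bullet> (x' - x))\<bar> \<le> 0"
            unfolding Vaff[OF x' y] Vaff[OF xx y] by (simp add: Y_def algebra_simps inner_simps)
        qed
        ultimately have "\<phi> n x' - \<phi> n x = (1 + s n) * (a \<bullet> (x' - x))" by simp
        then show ?thesis by (simp add: algebra_simps inner_simps)
      qed
      have "grad (\<phi> n) x = (1 + s n) *\<^sub>R a"
        by (rule grad_locally_affine[where V = "ball x (\<eta> / 4)", OF open_ball _ aff]) (use \<eta> in auto)
      then show "(1 + s n) *\<^sub>R a = grad (\<phi> n) x" ..
    qed
    have "(\<lambda>n. (1 + s n) *\<^sub>R a) \<longlonglongrightarrow> (1 + 0) *\<^sub>R a" using s_lim by (intro tendsto_intros)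
    then show ?thesis unfolding gW using ev by (simp add: filterlim_cong)
  qed
  have d\<phi>: "\<phi> n differentiable at x" for n x by (rule smooth_on_UNIV_differentiable[OF \<phi>smooth])
  have g\<phi>m: "grad (\<phi> n) \<in> borel_measurable (lebesgue_on \<Omega>)" for n
    using test_function_weak_gradient[OF \<Omega>(1,2) nf \<phi>test] by (auto simp: has_weak_gradient_def L2_def)
  have gWm: "grad W \<in> borel_measurable (lebesgue_on \<Omega>)"
    by (rule locally_affine_grad_measurable(1)[OF U \<Omega>(1)])
  define G where "G n x = grad W x - grad (\<phi> n) x" for n x
  have Gm: "G n \<in> borel_measurable (lebesgue_on \<Omega>)" for n
    unfolding G_def[abs_def] using gWm g\<phi>m by (rule borel_measurable_diff)
  have wd: "has_weak_gradient \<Omega> (\<lambda>x. W x - \<phi> n x) (G n)" for n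
  proof (rule lipschitz_weak_gradient[OF \<Omega>(1,2) nf oU U(2,3)])
    show "\<bar>W x - \<phi> n x - (W y - \<phi> n y)\<bar> \<le> (3 * L) * norm (x - y)" for x y
      using lip[of x y] \<phi>lip[of n x y] by linarith
    show "(\<lambda>x. W x - \<phi> n x) differentiable at x" if "x \<in> U" for x
      using dW[OF that] d\<phi> by (rule differentiable_diff)
    show "grad (\<lambda>x. W x - \<phi> n x) x = G n x" if "x \<in> U" for x
      unfolding G_def using dW[OF that] d\<phi> by (rule grad_diff)
  qed (rule Gm)
  have wW: "has_weak_gradient \<Omega> W (grad W)"
    by (rule lipschitz_weak_gradient[OF \<Omega>(1,2) nf oU U(2,3)]) (use lip dW gWm in auto)
  have AEU: "AE x in lebesgue_on \<Omega>. x \<in> U"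
  proof -
    have "AE x in lebesgue. x \<notin> \<Omega> - U"
      using U(3) by (intro AE_not_in) (simp add: negligible_iff_null_sets)
    then show ?thesis using \<Omega>(1) by (subst AE_restrict_space_iff) auto
  qed
  interpret finite_measure "lebesgue_on \<Omega>"
    using \<Omega>m by (rule finite_measure_lebesgue_on)
  have l1: "(\<lambda>n. LINT x|lebesgue_on \<Omega>. (norm (W x - \<phi> n x))\<^sup>2) \<longlonglongrightarrow> (LINT x|lebesgue_on \<Omega>. (0::real))"
  proof (rule integral_dominated_convergence[where w = "\<lambda>x. (L * (D + 2))\<^sup>2"])
    show "(\<lambda>x. (norm (W x - \<phi> n x))\<^sup>2) \<in> borel_measurable (lebesgue_on \<Omega>)" for n
      using wd[of n] by (auto simp: has_weak_gradient_def L2_def)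
    show "AE x in lebesgue_on \<Omega>. norm ((norm (W x - \<phi> n x))\<^sup>2) \<le> (L * (D + 2))\<^sup>2" for n
    proof (rule AE_I2)
      fix x assume "x \<in> space (lebesgue_on \<Omega>)"
      then have "\<bar>\<phi> n x - W x\<bar> \<le> s n * (L * (D + 2))" using \<phi>close by simp
      also have "\<dots> \<le> 1 * (L * (D + 2))" using s[of n] L0 D0 by (intro mult_right_mono) auto
      finally show "norm ((norm (W x - \<phi> n x))\<^sup>2) \<le> (L * (D + 2))\<^sup>2"
        using power_mono[of "\<bar>W x - \<phi> n x\<bar>" "L * (D + 2)" 2] by (simp add: abs_minus_commute)
    qed
    show "AE x in lebesgue_on \<Omega>. (\<lambda>n. (norm (W x - \<phi> n x))\<^sup>2) \<longlonglongrightarrow> 0"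
    proof (rule AE_I2)
      fix x assume "x \<in> space (lebesgue_on \<Omega>)"
      then have "\<forall>n. norm (norm (W x - \<phi> n x)) \<le> s n * (L * (D + 2))"
        using \<phi>close by (simp add: abs_minus_commute)
      then have "\<forall>\<^sub>F n in sequentially. norm (norm (W x - \<phi> n x)) \<le> s n * (L * (D + 2))"
        by (rule always_eventually)
      moreover have "(\<lambda>n. s n * (L * (D + 2))) \<longlonglongrightarrow> 0" using s_lim by (auto intro!: tendsto_eq_intros)
      ultimately have "(\<lambda>n. norm (W x - \<phi> n x)) \<longlonglongrightarrow> 0"
        by (rule Lim_null_comparison)
      then have "(\<lambda>n. (norm (W x - \<phi> n x))\<^sup>2) \<longlonglongrightarrow> 0\<^sup>2" by (rule tendsto_power)
      then show "(\<lambda>n. (norm (W x - \<phi> n x))\<^sup>2) \<longlonglongrightarrow> 0" by simp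
    qed
  qed auto
  have l2: "(\<lambda>n. LINT x|lebesgue_on \<Omega>. (norm (G n x))\<^sup>2) \<longlonglongrightarrow> (LINT x|lebesgue_on \<Omega>. (0::real))"
  proof (rule integral_dominated_convergence[where w = "\<lambda>x. (3 * L)\<^sup>2"])
    show "(\<lambda>x. (norm (G n x))\<^sup>2) \<in> borel_measurable (lebesgue_on \<Omega>)" for n
      using wd[of n] by (auto simp: has_weak_gradient_def L2_def)
    show "AE x in lebesgue_on \<Omega>. norm ((norm (G n x))\<^sup>2) \<le> (3 * L)\<^sup>2" for n
      using AEU
    proof eventually_elim
      fix x assume xU: "x \<in> U"
      have "norm (grad W x) \<le> L"
        by (rule norm_grad_le_lipschitz[OF dW[OF xU] oU xU lip])
      moreover have "norm (grad (\<phi> n) x) \<le> 2 * L"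
        by (rule norm_grad_le_lipschitz[OF d\<phi> oU xU \<phi>lip])
      ultimately have "norm (G n x) \<le> 3 * L"
        using norm_triangle_ineq4[of "grad W x" "grad (\<phi> n) x"] by (simp add: G_def)
      then show "norm ((norm (G n x))\<^sup>2) \<le> (3 * L)\<^sup>2" using power_mono[of "norm (G n x)" "3 * L" 2] by simp
    qed
    show "AE x in lebesgue_on \<Omega>. (\<lambda>n. (norm (G n x))\<^sup>2) \<longlonglongrightarrow> 0"
      using AEU
    proof eventually_elim
      fix x assume "x \<in> U"
      then have "(\<lambda>n. grad (\<phi> n) x) \<longlonglongrightarrow> grad W x" by (rule grad_lim)
      then have "(\<lambda>n. (norm (grad W x - grad (\<phi> n) x))\<^sup>2) \<longlonglongrightarrow> (norm (grad W x - grad W x))\<^sup>2"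
        by (intro tendsto_intros)
      then show "(\<lambda>n. (norm (G n x))\<^sup>2) \<longlonglongrightarrow> 0" by (simp add: G_def)
    qed
  qed auto
  have H1: "H1_norm \<Omega> (\<lambda>x. W x - \<phi> n x) =
      sqrt ((LINT x|lebesgue_on \<Omega>. (norm (W x - \<phi> n x))\<^sup>2) + (LINT x|lebesgue_on \<Omega>. (norm (G n x))\<^sup>2))" for n
  proof -
    note w = weak_grad_AE[OF \<Omega>(1,2) wd[of n]]
    have "(LINT x|lebesgue_on \<Omega>. (norm (weak_grad \<Omega> (\<lambda>x. W x - \<phi> n x) x))\<^sup>2) = (LINT x|lebesgue_on \<Omega>. (norm (G n x))\<^sup>2)"
    proof (rule integral_cong_AE)
      show "(\<lambda>x. (norm (weak_grad \<Omega> (\<lambda>x. W x - \<phi> n x) x))\<^sup>2) \<in> borel_measurable (lebesgue_on \<Omega>)"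
        using w(2) by (auto simp: has_weak_gradient_def L2_def)
      show "(\<lambda>x. (norm (G n x))\<^sup>2) \<in> borel_measurable (lebesgue_on \<Omega>)"
        using wd[of n] by (auto simp: has_weak_gradient_def L2_def)
      show "AE x in lebesgue_on \<Omega>. (norm (weak_grad \<Omega> (\<lambda>x. W x - \<phi> n x) x))\<^sup>2 = (norm (G n x))\<^sup>2"
        using w(1) by eventually_elim simp
    qed
    then show ?thesis by (simp add: H1_norm_def L2_norm_def)
  qed
  have "(\<lambda>n. H1_norm \<Omega> (\<lambda>x. W x - \<phi> n x)) \<longlonglongrightarrow> 0"
    unfolding H1 using tendsto_real_sqrt[OF tendsto_add[OF l1 l2]] by simp
  then show ?thesis
    unfolding H10_def H1_def using wW \<phi>test by blast
qed

subsection \<open>Linear finite elements\<close>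

definition verts :: "(real^3) set \<Rightarrow> (real^3) set"
  where "verts K = {z. z extreme_point_of closure K}"

lemma open_tetrahedron_facts:
  assumes "open_tetrahedron K"
  shows "\<not> affine_dependent (verts K)" "card (verts K) = 4" "finite (verts K)"
    "closure K = convex hull (verts K)" "K = interior (closure K)"
    "open K" "convex K" "K \<noteq> {}" "compact (closure K)"
proof -
  obtain S where S: "3 simplex S" "K = interior S" using assms by (auto simp: open_tetrahedron_def)
  then obtain C where C: "\<not> affine_dependent C" "card C = 4" "S = convex hull C"
    by (auto simp: simplex_def)
  have fC: "finite C" using C(1) by (rule aff_independent_finite)
  have "aff_dim S = 3"
    using aff_dim_affine_independent[OF C(1)] C(2,3) by (simp add: aff_dim_convex_hull)
  then have "affine hull S = UNIV" using aff_dim_eq_full[of S] by simp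
  then have "rel_interior S = interior S" by (rule rel_interior_interior)
  moreover have "S \<noteq> {}" using C by auto
  ultimately have ne: "interior S \<noteq> {}" using C(3) rel_interior_eq_empty[of S] by auto
  have cS: "convex S" using C(3) by simp
  have clS: "closed S" using C(3) fC by (simp add: compact_imp_closed finite_imp_compact_convex_hull)
  have cK: "closure K = S"
    using convex_closure_interior[OF cS ne] clS S(2) by simp
  have vK: "verts K = C"
    unfolding verts_def cK C(3) using extreme_point_of_convex_hull_affine_independent[OF C(1)] by auto
  show "\<not> affine_dependent (verts K)" "card (verts K) = 4" "finite (verts K)"
    "closure K = convex hull (verts K)" "K = interior (closure K)"
    "open K" "convex K" "K \<noteq> {}" "compact (closure K)"
    using C fC cK vK S(2) ne cS by (auto simp: finite_imp_compact_convex_hull)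
qed

text \<open>Seen from one point of \<open>C\<close>, the others are linearly independent, so a
  linear functional with arbitrary values on them exists; \<open>adjoint g 1\<close> is the vector
  that represents it.\<close>

lemma affine_interpolation:
  fixes C :: "(real^3) set" and f :: "real^3 \<Rightarrow> real"
  assumes "\<not> affine_dependent C"
  obtains a b where "\<And>z. z \<in> C \<Longrightarrow> a \<bullet> z + b = f z"
proof (cases "C = {}")
  case True then show ?thesis using that by blast
next
  case False
  then obtain c where c: "c \<in> C" by blast
  define B where "B = (\<lambda>x. - c + x) ` (C - {c})"
  have "independent B"
    using affine_dependent_iff_dependent[of c "C - {c}"] assms c by (simp add: insert_absorb B_def)
  then obtain g where g: "linear g" "\<And>x. x \<in> B \<Longrightarrow> g x = f (c + x) - f c"
    using linear_independent_extend[of B "\<lambda>x. f (c + x) - f c"] by blast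
  have gi: "g x = adjoint g 1 \<bullet> x" for x
    using adjoint_works[OF g(1), of x 1] by (simp add: inner_commute)
  have "adjoint g 1 \<bullet> z + (f c - adjoint g 1 \<bullet> c) = f z" if "z \<in> C" for z
  proof (cases "z = c")
    case False
    then have "- c + z \<in> B" using that by (auto simp: B_def)
    from g(2)[OF this] have "adjoint g 1 \<bullet> (- c + z) = f z - f c" by (simp add: gi)
    then show ?thesis by (simp add: inner_diff_right)
  qed simp
  then show ?thesis by (rule that)
qed

lemma affine_on_convex_hull:
  fixes C :: "(real^3) set"
  assumes "finite C" "x \<in> convex hull C"
  shows "\<exists>w. (\<forall>z\<in>C. 0 \<le> w z) \<and> sum w C = 1 \<and> x = (\<Sum>z\<in>C. w z *\<^sub>R z) \<and>
    (\<forall>a b. a \<bullet> x + b = (\<Sum>z\<in>C. w z * (a \<bullet> z + b)))"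
proof -
  obtain w where w: "\<forall>z\<in>C. 0 \<le> w z" "sum w C = 1" "x = (\<Sum>z\<in>C. w z *\<^sub>R z)"
    using assms by (auto simp: convex_hull_finite)
  have "a \<bullet> x + b = (\<Sum>z\<in>C. w z * (a \<bullet> z + b))" for a b
    using w(2) unfolding w(3) by (simp add: inner_sum_right distrib_left sum.distrib sum_distrib_right[symmetric])
  then show ?thesis using w by blast
qed

lemma affine_bounded_on_convex_hull:
  fixes C :: "(real^3) set"
  assumes "finite C" "x \<in> convex hull C" "\<And>z. z \<in> C \<Longrightarrow> \<bar>a \<bullet> z + b\<bar> \<le> B"
  shows "\<bar>a \<bullet> x + b\<bar> \<le> B"
proof -
  obtain w where w: "\<forall>z\<in>C. 0 \<le> w z" "sum w C = 1"
    and wab: "\<forall>a b. a \<bullet> x + b = (\<Sum>z\<in>C. w z * (a \<bullet> z + b))"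
    using affine_on_convex_hull[OF assms(1,2)] by blast
  have "\<bar>a \<bullet> x + b\<bar> \<le> (\<Sum>z\<in>C. \<bar>w z * (a \<bullet> z + b)\<bar>)" unfolding wab[rule_format] by (rule sum_abs)
  also have "\<dots> \<le> (\<Sum>z\<in>C. w z * B)"
    by (rule sum_mono) (use w(1) assms(3) in \<open>auto simp: abs_mult intro: mult_left_mono\<close>)
  also have "\<dots> = B" using w(2) by (simp add: sum_distrib_right[symmetric])
  finally show ?thesis .
qed

text \<open>The inverse estimate, and the source of the powers of \<open>1 / r\<close> below: at two
  opposite points at distance \<open>s\<close> from the centre, in the directions of
  \<open>a\<close> and \<open>- a\<close>, the values differ by \<open>2 * s * norm a\<close>. The
  ball being open, \<open>s\<close> tends to \<open>r\<close> from below.\<close>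

lemma affine_gradient_bound:
  fixes a :: "real^3"
  assumes "\<And>x. x \<in> ball c r \<Longrightarrow> \<bar>a \<bullet> x + b\<bar> \<le> B" "r > 0"
  shows "norm a * r \<le> B"
proof (cases "a = 0")
  case True
  then show ?thesis using assms(1)[of c] assms(2) by simp
next
  case False
  have "norm a * s \<le> B" if s: "0 < s" "s < r" for s
  proof -
    define d where "d = (s / norm a) *\<^sub>R a"
    have "norm d = s" using False s by (simp add: d_def)
    then have "c + d \<in> ball c r" "c - d \<in> ball c r" using s by (auto simp: dist_norm)
    from assms(1)[OF this(1)] assms(1)[OF this(2)] have "2 * (a \<bullet> d) \<le> 2 * B"
      by (simp add: inner_add_right inner_diff_right)
    moreover have "a \<bullet> d = norm a * s"
      using False by (simp add: d_def power2_norm_eq_inner[symmetric] power2_eq_square)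
    ultimately show ?thesis by simp
  qed
  then have "\<forall>\<^sub>F s in at_left r. norm a * s \<le> B"
    unfolding eventually_at_left_field using assms(2) by (intro exI[of _ 0]) auto
  moreover have "((\<lambda>s. norm a * s) \<longlongrightarrow> norm a * r) (at_left r)" by (intro tendsto_intros)
  ultimately show ?thesis by (intro tendsto_upperbound[of _ _ "at_left r"]) auto
qed

text \<open>Convexity keeps the segment from \<open>x\<close> to \<open>y\<close> inside the cover.
  Along it the question is one about an interval covered by finitely many closed sets, where the
  constants of the pieces do not add up.\<close>

lemma lipschitz_convex_closed_cover:
  fixes u :: "real^3 \<Rightarrow> real"
  assumes "convex S" "finite I" "\<And>i. i \<in> I \<Longrightarrow> closed (C i)" "S \<subseteq> (\<Union>i\<in>I. C i)" "L \<ge> 0"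
    and lip: "\<And>i x y. i \<in> I \<Longrightarrow> x \<in> C i \<Longrightarrow> y \<in> C i \<Longrightarrow> \<bar>u x - u y\<bar> \<le> L * norm (x - y)"
    and xy: "x \<in> S" "y \<in> S"
  shows "\<bar>u x - u y\<bar> \<le> L * norm (x - y)"
proof -
  define p where "p t = x + t *\<^sub>R (y - x)" for t :: real
  have pc: "continuous_on A p" for A unfolding p_def[abs_def] by (intro continuous_intros)
  have pS: "p t \<in> S" if "t \<in> {0..1}" for t
  proof -
    have "p t = (1 - t) *\<^sub>R x + t *\<^sub>R y" by (simp add: p_def algebra_simps)
    then show ?thesis using convexD[OF assms(1) xy, of "1 - t" t] that by auto
  qed
  have "(L * norm (x - y))-lipschitz_on {0..1} (\<lambda>t. u (p t))"
  proof (rule lipschitz_on_closed_Union[OF _ _ assms(2)])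
    fix i assume i: "i \<in> I"
    show "closed (p -` C i)"
      using continuous_closed_vimage[OF assms(3)[OF i], of p] pc[of UNIV]
      by (simp add: continuous_on_eq_continuous_at)
    show "(L * norm (x - y))-lipschitz_on (p -` C i) (\<lambda>t. u (p t))"
    proof (rule lipschitz_onI)
      fix s t assume "s \<in> p -` C i" "t \<in> p -` C i"
      then have "\<bar>u (p s) - u (p t)\<bar> \<le> L * norm (p s - p t)" using lip[OF i] by simp
      also have "p s - p t = (s - t) *\<^sub>R (y - x)" by (simp add: p_def algebra_simps)
      finally show "dist (u (p s)) (u (p t)) \<le> L * norm (x - y) * dist s t"
        by (simp add: dist_norm norm_minus_commute mult_ac)
    qed (use assms(5) in simp)
  next
    show "{0..1} \<subseteq> (\<Union>i\<in>I. p -` C i)" using pS assms(4) by fastforce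
  qed (use assms(5) in simp)
  from lipschitz_onD[OF this, of 0 1] show ?thesis
    by (simp add: p_def dist_norm norm_minus_commute)
qed

section \<open>Geometry of a mesh and its finite element functions\<close>

locale fe_mesh =
  fixes \<Omega> :: "(real^3) set" and \<T> :: "(real^3) set set"
  assumes cpd: "convex_polyhedral_domain \<Omega>" and mesh: "tetrahedral_mesh \<Omega> \<T>"
begin

lemma \<Omega>: "open \<Omega>" "bounded \<Omega>" "convex \<Omega>" "\<Omega> \<noteq> {}" "polyhedron (closure \<Omega>)"
  using cpd by (auto simp: convex_polyhedral_domain_def)

lemma \<Omega>_lmeasurable: "\<Omega> \<in> lmeasurable"
  using \<Omega> by (simp add: lmeasurable_open)

lemma negligible_frontier: "negligible (frontier \<Omega>)"
  using \<Omega>(3) by (rule negligible_convex_frontier)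

lemma interior_closure: "interior (closure \<Omega>) = \<Omega>"
  using \<Omega> by (simp add: convex_interior_closure interior_open)

lemma closure_eq: "closure \<Omega> = \<Omega> \<union> frontier \<Omega>" "\<Omega> \<inter> frontier \<Omega> = {}"
  using \<Omega>(1) closure_subset[of \<Omega>] by (auto simp: frontier_def interior_open)

lemma cell: "K \<in> \<T> \<Longrightarrow> open_tetrahedron K"
  using mesh by (simp add: tetrahedral_mesh_def)

lemmas cell_facts = open_tetrahedron_facts[OF cell]

lemma cells_cover: "(\<Union>K\<in>\<T>. closure K) = closure \<Omega>"
  using mesh by (simp add: tetrahedral_mesh_def)

lemma cells_face: "K \<in> \<T> \<Longrightarrow> K' \<in> \<T> \<Longrightarrow> closure K \<inter> closure K' face_of closure K"
  using mesh by (simp add: tetrahedral_mesh_def triangulation_def)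

lemma finite_cells: "finite \<T>"
proof -
  have "finite (closure ` \<T>)" using mesh by (simp add: tetrahedral_mesh_def triangulation_def)
  moreover have "inj_on closure \<T>"
    using cell_facts(5) by (metis inj_onI)
  ultimately show ?thesis by (rule finite_imageD)
qed

lemma cells_nonempty: "\<T> \<noteq> {}"
  using cells_cover \<Omega>(4) closure_subset[of \<Omega>] by auto

lemma cell_closure_subset: "K \<in> \<T> \<Longrightarrow> closure K \<subseteq> closure \<Omega>"
  using cells_cover by blast

lemma cell_subset: "K \<in> \<T> \<Longrightarrow> K \<subseteq> \<Omega>"
  using cell_facts(5)[of K] interior_mono[OF cell_closure_subset] interior_closure by metis

lemma open_cells: "open (\<Union>\<T>)"
  using cell_facts(6) by blast

lemma cells_subset: "\<Union>\<T> \<subseteq> \<Omega>"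
  using cell_subset by blast

lemma negligible_off_cells: "negligible (\<Omega> - \<Union>\<T>)"
proof (rule negligible_subset)
  show "negligible (\<Union>K\<in>\<T>. frontier K)"
    using finite_cells negligible_convex_frontier[OF cell_facts(7)] by (intro negligible_Union) auto
  show "\<Omega> - \<Union>\<T> \<subseteq> (\<Union>K\<in>\<T>. frontier K)"
  proof
    fix x assume x: "x \<in> \<Omega> - \<Union>\<T>"
    then obtain K where K: "K \<in> \<T>" "x \<in> closure K" using cells_cover closure_subset[of \<Omega>] by blast
    then have "x \<in> frontier K" using x interior_subset by (fastforce simp: frontier_def)
    then show "x \<in> (\<Union>K\<in>\<T>. frontier K)" using K by blast
  qed
qed

lemma AE_cells: "AE x in lebesgue_on \<Omega>. x \<in> \<Union>\<T>"
proof -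
  have "AE x in lebesgue. x \<notin> \<Omega> - \<Union>\<T>"
    using negligible_off_cells by (intro AE_not_in) (simp add: negligible_iff_null_sets)
  then show ?thesis using \<Omega>(1) by (subst AE_restrict_space_iff) auto
qed

lemma mesh_nodes_eq: "mesh_nodes \<T> = (\<Union>K\<in>\<T>. verts K)"
  by (auto simp: mesh_nodes_def verts_def)

lemma finite_nodes: "finite (mesh_nodes \<T>)"
  unfolding mesh_nodes_eq using finite_cells cell_facts(3) by auto

lemma verts_subset: "K \<in> \<T> \<Longrightarrow> verts K \<subseteq> closure K"
  by (auto simp: verts_def extreme_point_of_def)

lemma nodes_subset: "mesh_nodes \<T> \<subseteq> closure \<Omega>"
  unfolding mesh_nodes_eq using verts_subset cell_closure_subset by blast

lemma FE_affine:
  assumes "u \<in> FE_space \<Omega> \<T>" "K \<in> \<T>"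
  obtains a b where "\<And>x. x \<in> closure K \<Longrightarrow> u x = a \<bullet> x + b"
proof -
  obtain a b where ab: "\<And>x. x \<in> K \<Longrightarrow> u x = a \<bullet> x + b"
    using assms by (auto simp: FE_space_def)
  have c: "continuous_on (closure K) (\<lambda>x. u x - (a \<bullet> x + b))"
    using assms cell_closure_subset by (intro continuous_intros) (auto simp: FE_space_def intro: continuous_on_subset)
  have "u x - (a \<bullet> x + b) = 0" if "x \<in> closure K" for x
    using continuous_constant_on_closure[OF c _ that] ab by simp
  then show ?thesis using that by force
qed

lemma FE_locally_affine:
  assumes "u \<in> FE_space \<Omega> \<T>"
  shows "locally_affine_on (\<Union>\<T>) u"
  unfolding locally_affine_on_def
proof
  fix x assume "x \<in> \<Union>\<T>"
  then obtain K where K: "K \<in> \<T>" "x \<in> K" by blast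
  obtain a b where "\<And>x. x \<in> closure K \<Longrightarrow> u x = a \<bullet> x + b" using FE_affine[OF assms K(1)] by blast
  then have "\<forall>y\<in>K. u y = a \<bullet> y + b" using closure_subset by blast
  then show "\<exists>V a b. open V \<and> x \<in> V \<and> V \<subseteq> \<Union>\<T> \<and> (\<forall>y\<in>V. u y = a \<bullet> y + b)"
    using K cell_facts(6)[OF K(1)] by blast
qed

lemma FE_grad:
  assumes "u \<in> FE_space \<Omega> \<T>" "K \<in> \<T>"
  obtains a b where "\<And>x. x \<in> closure K \<Longrightarrow> u x = a \<bullet> x + b" "\<And>x. x \<in> K \<Longrightarrow> grad u x = a"
proof -
  obtain a b where ab: "\<And>x. x \<in> closure K \<Longrightarrow> u x = a \<bullet> x + b" using FE_affine[OF assms] by blast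
  have "grad u x = a" if "x \<in> K" for x
    by (rule grad_locally_affine[OF cell_facts(6)[OF assms(2)] that, of u a b])
      (use ab closure_subset in blast)
  then show ?thesis using ab that by blast
qed

lemma piecewise_affine_lipschitz:
  assumes "\<And>K x. K \<in> \<T> \<Longrightarrow> x \<in> closure K \<Longrightarrow> u x = a K \<bullet> x + b K"
  obtains L where "L \<ge> 0" "\<And>x y. x \<in> closure \<Omega> \<Longrightarrow> y \<in> closure \<Omega> \<Longrightarrow> \<bar>u x - u y\<bar> \<le> L * norm (x - y)"
proof -
  \<comment> \<open>A crude constant that depends on the mesh. It is used only for measurability,
    boundedness and weak derivatives and does not enter the final estimate.\<close>
  define L where "L = (\<Sum>K\<in>\<T>. norm (a K))"
  have L0: "L \<ge> 0" by (simp add: L_def sum_nonneg)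
  have LK: "norm (a K) \<le> L" if "K \<in> \<T>" for K
    unfolding L_def using finite_cells that by (intro member_le_sum) auto
  have "\<bar>u x - u y\<bar> \<le> L * norm (x - y)" if "x \<in> closure \<Omega>" "y \<in> closure \<Omega>" for x y
  proof (rule lipschitz_convex_closed_cover[OF _ finite_cells, where C = closure])
    show "convex (closure \<Omega>)" using \<Omega>(3) by (rule convex_closure)
    show "closure \<Omega> \<subseteq> (\<Union>K\<in>\<T>. closure K)" using cells_cover by simp
    fix K x y assume K: "K \<in> \<T>" "x \<in> closure K" "y \<in> closure K"
    have "u x - u y = a K \<bullet> (x - y)" using assms[OF K(1,2)] assms[OF K(1,3)] by (simp add: inner_diff_right)
    then have "\<bar>u x - u y\<bar> \<le> norm (a K) * norm (x - y)" using Cauchy_Schwarz_ineq2 by metis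
    also have "\<dots> \<le> L * norm (x - y)" using LK[OF K(1)] by (rule mult_right_mono) simp
    finally show "\<bar>u x - u y\<bar> \<le> L * norm (x - y)" .
  qed (use that L0 in auto)
  then show ?thesis using L0 that by blast
qed

lemma FE_lipschitz:
  assumes "u \<in> FE_space \<Omega> \<T>"
  obtains L where "L \<ge> 0" "\<And>x y. x \<in> closure \<Omega> \<Longrightarrow> y \<in> closure \<Omega> \<Longrightarrow> \<bar>u x - u y\<bar> \<le> L * norm (x - y)"
proof -
  have "\<exists>a b. \<forall>x\<in>closure K. u x = a \<bullet> x + b" if "K \<in> \<T>" for K
    using FE_affine[OF assms that] by metis
  then obtain a b where ab: "\<And>K x. K \<in> \<T> \<Longrightarrow> x \<in> closure K \<Longrightarrow> u x = a K \<bullet> x + b K" by metis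
  show ?thesis by (rule piecewise_affine_lipschitz[where a = a and b = b]) (use ab that in auto)
qed

text \<open>As the affine formulas hold on closed cells, they agree where cells meet. This gives a
  Lipschitz function on the closed domain, and \<open>lipschitz_weak_gradient\<close> turns it into
  a member of \<open>H1\<close>.\<close>

lemma piecewise_affine_FE:
  assumes ab: "\<And>K x. K \<in> \<T> \<Longrightarrow> x \<in> closure K \<Longrightarrow> u x = a K \<bullet> x + b K"
    and off: "\<And>x. x \<notin> closure \<Omega> \<Longrightarrow> u x = 0"
  shows "u \<in> FE_space \<Omega> \<T>" "has_weak_gradient \<Omega> u (grad u)"
proof -
  obtain L where L: "L \<ge> 0" "\<And>x y. x \<in> closure \<Omega> \<Longrightarrow> y \<in> closure \<Omega> \<Longrightarrow> \<bar>u x - u y\<bar> \<le> L * norm (x - y)"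
    by (rule piecewise_affine_lipschitz[where a = a and b = b and u = u]) (use ab in auto)
  have cont: "continuous_on (closure \<Omega>) u"
  proof (rule lipschitz_on_continuous_on[of L])
    show "L-lipschitz_on (closure \<Omega>) u" using L by (intro lipschitz_onI) (auto simp: dist_norm)
  qed
  have la: "locally_affine_on (\<Union>\<T>) u"
    unfolding locally_affine_on_def
  proof
    fix x assume "x \<in> \<Union>\<T>"
    then obtain K where K: "K \<in> \<T>" "x \<in> K" by blast
    then have "\<forall>y\<in>K. u y = a K \<bullet> y + b K" using ab closure_subset by blast
    then show "\<exists>V a b. open V \<and> x \<in> V \<and> V \<subseteq> \<Union>\<T> \<and> (\<forall>y\<in>V. u y = a \<bullet> y + b)"
      using K cell_facts(6)[OF K(1)] by blast
  qed
  show wg: "has_weak_gradient \<Omega> u (grad u)"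
  proof (rule lipschitz_weak_gradient[OF \<Omega>(1,2) negligible_frontier open_cells cells_subset negligible_off_cells])
    show "\<bar>u x - u y\<bar> \<le> L * norm (x - y)" if "x \<in> \<Omega>" "y \<in> \<Omega>" for x y
      using L(2) that closure_subset by blast
    show "u differentiable at x" if "x \<in> \<Union>\<T>" for x
      using locally_affine_on_differentiable[OF la that] .
    show "grad u \<in> borel_measurable (lebesgue_on \<Omega>)"
      by (rule locally_affine_grad_measurable(1)[OF la cells_subset negligible_off_cells \<Omega>(1)])
  qed simp
  have "\<exists>a b. \<forall>x\<in>K. u x = a \<bullet> x + b" if "K \<in> \<T>" for K
    using ab[OF that] closure_subset by blast
  then show "u \<in> FE_space \<Omega> \<T>" using wg cont off by (auto simp: FE_space_def H1_def)
qed

lemma FE_weak_gradient: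
  assumes "u \<in> FE_space \<Omega> \<T>"
  shows "has_weak_gradient \<Omega> u (grad u)"
proof -
  have "\<exists>a b. \<forall>x\<in>closure K. u x = a \<bullet> x + b" if "K \<in> \<T>" for K
    using FE_affine[OF assms that] by metis
  then obtain a b where ab: "\<And>K x. K \<in> \<T> \<Longrightarrow> x \<in> closure K \<Longrightarrow> u x = a K \<bullet> x + b K" by metis
  show ?thesis
    by (rule piecewise_affine_FE(2)[where a = a and b = b]) (use ab assms in \<open>auto simp: FE_space_def\<close>)
qed

lemma FE_weak_grad_AE:
  assumes "u \<in> FE_space \<Omega> \<T>"
  shows "AE x in lebesgue_on \<Omega>. weak_grad \<Omega> u x = grad u x"
  by (rule weak_grad_AE(1)[OF \<Omega>(1,2) FE_weak_gradient[OF assms]])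

text \<open>Conformity makes the local interpolants fit together: two closed cells meet in a common
  face, the face is the hull of its extreme points, these are vertices of both cells, and two affine
  functions with equal values there agree on the face.\<close>

lemma FE_interpolant_exists:
  obtains u where "u \<in> FE_space \<Omega> \<T>" "\<And>z. z \<in> mesh_nodes \<T> \<Longrightarrow> u z = f z"
proof -
  have "\<exists>a b. \<forall>z\<in>verts K. a \<bullet> z + b = f z" if "K \<in> \<T>" for K
    using affine_interpolation[OF cell_facts(1)[OF that]] by metis
  then obtain a b where ab: "\<And>K z. K \<in> \<T> \<Longrightarrow> z \<in> verts K \<Longrightarrow> a K \<bullet> z + b K = f z" by metis
  \<comment> \<open>Some cell around \<open>x\<close>; by \<open>agree\<close> the choice does not
    influence the value of \<open>u\<close>.\<close>
  define c where "c x = (SOME K. K \<in> \<T> \<and> x \<in> closure K)" for x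
  define u where "u x = (if x \<in> closure \<Omega> then a (c x) \<bullet> x + b (c x) else 0)" for x
  have agree: "a K \<bullet> x + b K = a K' \<bullet> x + b K'"
    if K: "K \<in> \<T>" "K' \<in> \<T>" "x \<in> closure K" "x \<in> closure K'" for K K' x
  proof -
    let ?F = "closure K \<inter> closure K'"
    have F1: "?F face_of closure K" by (rule cells_face[OF K(1,2)])
    have F2: "?F face_of closure K'" using cells_face[OF K(2,1)] by (simp add: Int_commute)
    define E where "E = {z. z extreme_point_of ?F}"
    have E: "E \<subseteq> verts K" "E \<subseteq> verts K'"
      using extreme_point_of_face[OF F1] extreme_point_of_face[OF F2] by (auto simp: E_def verts_def)
    have fE: "finite E" using E(1) cell_facts(3)[OF K(1)] finite_subset by blast
    have "convex ?F" "compact ?F"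
      using face_of_imp_convex[OF F1] cell_facts(9)[OF K(1)] by (auto intro: compact_Int_closed)
    then have "?F = convex hull E" unfolding E_def using Krein_Milman_Minkowski by blast
    then have x: "x \<in> convex hull E" using K by blast
    have "\<bar>(a K - a K') \<bullet> x + (b K - b K')\<bar> \<le> 0"
    proof (rule affine_bounded_on_convex_hull[OF fE x])
      fix z assume "z \<in> E"
      then have "a K \<bullet> z + b K = f z" "a K' \<bullet> z + b K' = f z" using ab K E by blast+
      then show "\<bar>(a K - a K') \<bullet> z + (b K - b K')\<bar> \<le> 0" by (simp add: inner_diff_left)
    qed
    then show ?thesis by (simp add: inner_diff_left)
  qed
  have cK: "u x = a K \<bullet> x + b K" if "K \<in> \<T>" "x \<in> closure K" for K x
  proof -
    have "c x \<in> \<T> \<and> x \<in> closure (c x)" unfolding c_def using that by (rule_tac someI[of _ K]) simp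
    then show ?thesis using agree[of "c x" K x] that cell_closure_subset by (auto simp: u_def)
  qed
  have "u \<in> FE_space \<Omega> \<T>"
    by (rule piecewise_affine_FE(1)[where a = a and b = b]) (use cK in \<open>auto simp: u_def\<close>)
  moreover have "u z = f z" if z: "z \<in> mesh_nodes \<T>" for z
  proof -
    obtain K where K: "K \<in> \<T>" "z \<in> verts K" using z by (auto simp: mesh_nodes_eq)
    then have "z \<in> closure K" using verts_subset by blast
    then show ?thesis using cK[OF K(1)] ab[OF K] by simp
  qed
  ultimately show ?thesis by (rule that)
qed

lemma FE_lincomb:
  assumes "u \<in> FE_space \<Omega> \<T>" "v \<in> FE_space \<Omega> \<T>"
  shows "(\<lambda>x. s * u x + t * v x) \<in> FE_space \<Omega> \<T>"
proof -
  have "\<exists>a b. \<forall>x\<in>closure K. s * u x + t * v x = a \<bullet> x + b" if K: "K \<in> \<T>" for K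
  proof -
    obtain a b where ab: "\<And>x. x \<in> closure K \<Longrightarrow> u x = a \<bullet> x + b" using FE_affine[OF assms(1) K] by blast
    obtain a' b' where ab': "\<And>x. x \<in> closure K \<Longrightarrow> v x = a' \<bullet> x + b'" using FE_affine[OF assms(2) K] by blast
    show ?thesis
      by (intro exI[of _ "s *\<^sub>R a + t *\<^sub>R a'"] exI[of _ "s * b + t * b'"])
        (auto simp: ab ab' inner_add_left algebra_simps)
  qed
  then obtain a b where "\<And>K x. K \<in> \<T> \<Longrightarrow> x \<in> closure K \<Longrightarrow> s * u x + t * v x = a K \<bullet> x + b K" by metis
  then show ?thesis
    by (rule piecewise_affine_FE(1)) (use assms in \<open>auto simp: FE_space_def\<close>)
qed

lemma FE_eq_0_on_cell:
  assumes "u \<in> FE_space \<Omega> \<T>" "K \<in> \<T>" "\<And>z. z \<in> verts K \<Longrightarrow> u z = 0" "x \<in> closure K"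
  shows "u x = 0"
proof -
  obtain a b where ab: "\<And>x. x \<in> closure K \<Longrightarrow> u x = a \<bullet> x + b" using FE_affine[OF assms(1,2)] by blast
  have "\<bar>a \<bullet> x + b\<bar> \<le> 0"
  proof (rule affine_bounded_on_convex_hull[OF cell_facts(3)[OF assms(2)]])
    show "x \<in> convex hull verts K" using assms(4) cell_facts(4)[OF assms(2)] by simp
    show "\<bar>a \<bullet> z + b\<bar> \<le> 0" if "z \<in> verts K" for z
      using assms(3)[OF that] ab[of z] that verts_subset[OF assms(2)] by auto
  qed
  then show ?thesis using ab[OF assms(4)] by simp
qed

lemma FE_determined_by_nodes:
  assumes "u \<in> FE_space \<Omega> \<T>" "v \<in> FE_space \<Omega> \<T>" "\<And>z. z \<in> mesh_nodes \<T> \<Longrightarrow> u z = v z"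
  shows "u = v"
proof
  fix x
  have d: "(\<lambda>x. 1 * u x + (- 1) * v x) \<in> FE_space \<Omega> \<T>" by (rule FE_lincomb[OF assms(1,2)])
  show "u x = v x"
  proof (cases "x \<in> closure \<Omega>")
    case True
    then obtain K where K: "K \<in> \<T>" "x \<in> closure K" using cells_cover by blast
    show ?thesis using FE_eq_0_on_cell[OF d K(1) _ K(2)] assms(3) K(1) by (auto simp: mesh_nodes_eq)
  next
    case False
    then show ?thesis using assms(1,2) by (simp add: FE_space_def)
  qed
qed

text \<open>In a convex combination that lies on the boundary of a convex set with interior, no interior
  point has positive weight.\<close>

lemma FE_zero_on_frontier:
  assumes "u \<in> FE_space \<Omega> \<T>" "\<And>z. z \<in> mesh_nodes \<T> \<inter> frontier \<Omega> \<Longrightarrow> u z = 0" "x \<in> frontier \<Omega>"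
  shows "u x = 0"
proof -
  have "x \<in> closure \<Omega>" using assms(3) by (simp add: frontier_def)
  then obtain K where K: "K \<in> \<T>" "x \<in> closure K" using cells_cover by blast
  obtain a b where ab: "\<And>x. x \<in> closure K \<Longrightarrow> u x = a \<bullet> x + b" using FE_affine[OF assms(1) K(1)] by blast
  have "x \<in> convex hull verts K" using K cell_facts(4) by blast
  then obtain w where w0: "\<forall>z\<in>verts K. 0 \<le> w z" and w2: "sum w (verts K) = 1"
    and w3: "x = (\<Sum>z\<in>verts K. w z *\<^sub>R z)"
    and w4: "\<forall>a b. a \<bullet> x + b = (\<Sum>z\<in>verts K. w z * (a \<bullet> z + b))"
    using affine_on_convex_hull[OF cell_facts(3)[OF K(1)]] by blast
  note w = w0[rule_format] w2 w3 w4[rule_format]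
  have "w z * (a \<bullet> z + b) = 0" if z: "z \<in> verts K" for z
  proof (cases "z \<in> frontier \<Omega>")
    case True
    then have "u z = 0" using assms(2) z K(1) by (auto simp: mesh_nodes_eq)
    then show ?thesis using ab[of z] z verts_subset[OF K(1)] by auto
  next
    case False
    have vO: "verts K \<subseteq> closure \<Omega>" using verts_subset[OF K(1)] cell_closure_subset[OF K(1)] by blast
    then have zO: "z \<in> \<Omega>" using False z closure_eq(1) by blast
    have "w z = 0"
    proof (rule ccontr)
      assume "w z \<noteq> 0"
      then have wz: "w z > 0" using w(1)[OF z] by simp
      have "x \<in> \<Omega>"
      proof (cases "w z = 1")
        case True
        have "sum w (verts K - {z}) = 0"
          using w(2) True z cell_facts(3)[OF K(1)] by (simp add: sum_diff1)
        then have "\<forall>y\<in>verts K - {z}. w y = 0"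
          using w(1) cell_facts(3)[OF K(1)] by (subst (asm) sum_nonneg_eq_0_iff) auto
        then have "x = z"
          unfolding w(3) using z True cell_facts(3)[OF K(1)] by (simp add: sum.remove[of _ z])
        then show ?thesis using zO by simp
      next
        case False
        have s: "sum w (verts K - {z}) = 1 - w z"
          using w(2) z cell_facts(3)[OF K(1)] by (simp add: sum_diff1)
        moreover have "sum w (verts K - {z}) \<ge> 0" using w(1) by (intro sum_nonneg) auto
        ultimately have wl: "w z < 1" using False by simp
        \<comment> \<open>The convex combination without \<open>z\<close>, renormalised. Then
          \<open>x\<close> lies strictly between \<open>y\<close>, a point of the closure, and
          \<open>z\<close>, an interior point, and is therefore interior itself.\<close>
        define y where "y = (\<Sum>v\<in>verts K - {z}. (w v / (1 - w z)) *\<^sub>R v)"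
        have "y \<in> closure \<Omega>"
          unfolding y_def
        proof (rule convex_sum)
          show "convex (closure \<Omega>)" using \<Omega>(3) by (rule convex_closure)
          show "(\<Sum>v\<in>verts K - {z}. w v / (1 - w z)) = 1"
            using s wl by (simp add: sum_divide_distrib[symmetric])
        qed (use cell_facts(3)[OF K(1)] w(1) wl vO in auto)
        moreover have "x = y - w z *\<^sub>R (y - z)"
        proof -
          have "(1 - w z) *\<^sub>R y = (\<Sum>v\<in>verts K - {z}. w v *\<^sub>R v)"
            unfolding y_def scaleR_sum_right using wl by (intro sum.cong) auto
          moreover have "x = w z *\<^sub>R z + (\<Sum>v\<in>verts K - {z}. w v *\<^sub>R v)"
            unfolding w(3) using z cell_facts(3)[OF K(1)] by (simp add: sum.remove[of _ z])
          ultimately show ?thesis by (simp add: algebra_simps)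
        qed
        ultimately have "x \<in> interior \<Omega>"
          using mem_interior_closure_convex_shrink[OF \<Omega>(3), of z y "w z"] zO \<Omega>(1) wz wl
          by (simp add: interior_open)
        then show ?thesis using interior_subset by blast
      qed
      then show False using assms(3) closure_eq(2) by blast
    qed
    then show ?thesis by simp
  qed
  then have "a \<bullet> x + b = 0" unfolding w(4) by (intro sum.neutral ballI)
  then show ?thesis using ab[OF K(2)] by simp
qed

text \<open>A segment that leaves the domain meets the frontier, where \<open>u\<close> is zero, and
  the part up to that point is no longer than the whole.\<close>

lemma FE_zero_frontier_lipschitz:
  assumes "u \<in> FE_space \<Omega> \<T>" "\<And>x. x \<in> frontier \<Omega> \<Longrightarrow> u x = 0"
  obtains L where "L \<ge> 0" "\<And>x y. \<bar>u x - u y\<bar> \<le> L * norm (x - y)"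
proof -
  obtain L where L: "L \<ge> 0" "\<And>x y. x \<in> closure \<Omega> \<Longrightarrow> y \<in> closure \<Omega> \<Longrightarrow> \<bar>u x - u y\<bar> \<le> L * norm (x - y)"
    using FE_lipschitz[OF assms(1)] by blast
  have off: "u x = 0" if "x \<notin> \<Omega>" for x
    using assms that closure_eq(1) by (cases "x \<in> closure \<Omega>") (auto simp: FE_space_def)
  have one: "\<bar>u x - u y\<bar> \<le> L * norm (x - y)" if x: "x \<in> \<Omega>" and y: "y \<notin> \<Omega>" for x y
  proof -
    have "closed_segment x y \<inter> frontier \<Omega> \<noteq> {}"
      using connected_Int_frontier[of "closed_segment x y" \<Omega>] x y by auto
    then obtain f where f: "f \<in> closed_segment x y" "f \<in> frontier \<Omega>" by blast
    have "\<bar>u x - u f\<bar> \<le> L * norm (x - f)"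
      using L(2)[of x f] x f(2) closure_eq(1) by auto
    also have "\<dots> \<le> L * norm (x - y)"
      using segment_bound1[OF f(1)] L(1) by (intro mult_left_mono) (auto simp: norm_minus_commute)
    finally show ?thesis using off[OF y] assms(2)[OF f(2)] by simp
  qed
  have "\<bar>u x - u y\<bar> \<le> L * norm (x - y)" for x y
  proof (cases "x \<in> \<Omega>")
    case True
    then show ?thesis using one[OF True, of y] L(2)[of x y] closure_eq(1) by (cases "y \<in> \<Omega>") auto
  next
    case False
    show ?thesis
    proof (cases "y \<in> \<Omega>")
      case True
      then show ?thesis using one[OF True False] by (simp add: abs_minus_commute norm_minus_commute)
    next
      case yF: False
      then show ?thesis using off[OF False] off[OF yF] L(1) by simp
    qed
  qed
  then show ?thesis using L(1) that by blast
qed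

text \<open>The two directions are \<open>H10_lipschitz_zero_on_frontier\<close> and
  \<open>H10I_lipschitz_locally_affine\<close>. From here on test functions are constructed by
  prescribing nodal values, and the closure in the definition of \<open>H10\<close> does not appear
  again.\<close>

lemma FE_space0_iff: "u \<in> FE_space0 \<Omega> \<T> \<longleftrightarrow> u \<in> FE_space \<Omega> \<T> \<and> (\<forall>x\<in>frontier \<Omega>. u x = 0)"
proof (intro iffI conjI ballI)
  assume u: "u \<in> FE_space0 \<Omega> \<T>"
  then show uF: "u \<in> FE_space \<Omega> \<T>" by (simp add: FE_space0_def)
  fix x assume x: "x \<in> frontier \<Omega>"
  obtain L where L: "L \<ge> 0" "\<And>x y. x \<in> closure \<Omega> \<Longrightarrow> y \<in> closure \<Omega> \<Longrightarrow> \<bar>u x - u y\<bar> \<le> L * norm (x - y)"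
    using FE_lipschitz[OF uF] by blast
  show "u x = 0"
  proof (rule H10_lipschitz_zero_on_frontier[OF \<Omega>(1-3) _ FE_weak_gradient[OF uF] L(2) _ x])
    show "u \<in> H10 \<Omega>" using u by (simp add: FE_space0_def)
    show "AE x in lebesgue_on \<Omega>. norm (grad u x) \<le> L"
      using AE_cells
    proof eventually_elim
      fix y assume y: "y \<in> \<Union>\<T>"
      show "norm (grad u y) \<le> L"
      proof (rule norm_grad_le_lipschitz[OF _ open_cells y])
        show "u differentiable at y" by (rule locally_affine_on_differentiable[OF FE_locally_affine[OF uF] y])
        show "\<bar>u z - u y\<bar> \<le> L * norm (z - y)" if "z \<in> \<Union>\<T>" for z
          using L(2) that y cells_subset closure_eq(1) by blast
      qed
    qed
  qed
next
  assume "u \<in> FE_space \<Omega> \<T> \<and> (\<forall>x\<in>frontier \<Omega>. u x = 0)"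
  then have u: "u \<in> FE_space \<Omega> \<T>" "\<And>x. x \<in> frontier \<Omega> \<Longrightarrow> u x = 0" by auto
  obtain L where L: "L \<ge> 0" "\<And>x y. \<bar>u x - u y\<bar> \<le> L * norm (x - y)"
    using FE_zero_frontier_lipschitz[OF u] by blast
  have "u \<in> H10 \<Omega>"
  proof (rule H10I_lipschitz_locally_affine[OF \<Omega>(1-4) FE_locally_affine[OF u(1)] cells_subset negligible_off_cells L(2)])
    show "u x = 0" if "x \<notin> \<Omega>" for x
      using u that closure_eq(1) by (cases "x \<in> closure \<Omega>") (auto simp: FE_space_def)
  qed
  then show "u \<in> FE_space0 \<Omega> \<T>" using u(1) by (simp add: FE_space0_def)
qed

text \<open>The description is proper: interpolating the trace at frontier nodes and zero at the
  other nodes gives a candidate, whose trace is right on the whole frontier by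
  \<open>FE_zero_on_frontier\<close>; any two candidates agree at all nodes.\<close>

lemma zero_extension:
  assumes "p \<in> FE_trace_space \<Omega> \<T>"
  shows "zero_extension \<Omega> \<T> p \<in> FE_space \<Omega> \<T>" "bdry_trace \<Omega> (zero_extension \<Omega> \<T> p) = p"
    "\<And>z. z \<in> mesh_nodes \<T> \<inter> \<Omega> \<Longrightarrow> zero_extension \<Omega> \<T> p z = 0"
proof -
  let ?P = "\<lambda>u. u \<in> FE_space \<Omega> \<T> \<and> bdry_trace \<Omega> u = p \<and> (\<forall>z\<in>mesh_nodes \<T> \<inter> \<Omega>. u z = 0)"
  obtain q where q: "q \<in> FE_space \<Omega> \<T>" "p = bdry_trace \<Omega> q"
    using assms by (auto simp: FE_trace_space_def)
  have "\<exists>!u. ?P u"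
  proof (rule ex_ex1I)
    obtain u where u: "u \<in> FE_space \<Omega> \<T>" "\<And>z. z \<in> mesh_nodes \<T> \<Longrightarrow> u z = (if z \<in> frontier \<Omega> then q z else 0)"
      using FE_interpolant_exists[of "\<lambda>z. if z \<in> frontier \<Omega> then q z else 0"] by blast
    have d: "(\<lambda>x. 1 * u x + (- 1) * q x) \<in> FE_space \<Omega> \<T>" by (rule FE_lincomb[OF u(1) q(1)])
    have "u x = q x" if "x \<in> frontier \<Omega>" for x
      using FE_zero_on_frontier[OF d _ that] u(2) by simp
    then have "bdry_trace \<Omega> u = p" by (auto simp: q(2) bdry_trace_def)
    moreover have "u z = 0" if "z \<in> mesh_nodes \<T> \<inter> \<Omega>" for z
      using u(2) that closure_eq(2) by auto
    ultimately show "\<exists>u. ?P u" using u(1) by blast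
  next
    fix u v assume u: "?P u" and v: "?P v"
    show "u = v"
    proof (rule FE_determined_by_nodes)
      fix z assume z: "z \<in> mesh_nodes \<T>"
      show "u z = v z"
      proof (cases "z \<in> \<Omega>")
        case True
        then show ?thesis using u v z by simp
      next
        case False
        then have "z \<in> frontier \<Omega>" using z nodes_subset closure_eq(1) by blast
        moreover have "bdry_trace \<Omega> u z = bdry_trace \<Omega> v z" using u v by simp
        ultimately show ?thesis by (simp add: bdry_trace_def)
      qed
    qed (use u v in auto)
  qed
  then have "?P (zero_extension \<Omega> \<T> p)" unfolding zero_extension_def by (rule theI')
  then show "zero_extension \<Omega> \<T> p \<in> FE_space \<Omega> \<T>" "bdry_trace \<Omega> (zero_extension \<Omega> \<T> p) = p"
    "\<And>z. z \<in> mesh_nodes \<T> \<inter> \<Omega> \<Longrightarrow> zero_extension \<Omega> \<T> p z = 0" by auto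
qed

end

subsection \<open>Surface measure and boundary projection\<close>

text \<open>By polarisation an isometry that fixes the origin preserves inner products; expanding
  the squared norm of the defect of additivity or homogeneity then gives zero.\<close>

lemma isometry_imp_linear_translation:
  fixes \<phi> :: "'a::real_inner \<Rightarrow> 'b::real_inner"
  assumes "\<And>s t. dist (\<phi> s) (\<phi> t) = dist s t"
  shows "linear (\<lambda>x. \<phi> x - \<phi> 0)"
proof -
  define \<psi> where "\<psi> x = \<phi> x - \<phi> 0" for x
  have n: "norm (\<psi> x) = norm x" for x using assms[of x 0] by (simp add: \<psi>_def dist_norm)
  have d: "norm (\<psi> x - \<psi> y) = norm (x - y)" for x y using assms[of x y] by (simp add: \<psi>_def dist_norm)
  have sq: "\<psi> x \<bullet> \<psi> x = x \<bullet> x" for x using n[of x] by (simp add: norm_eq_sqrt_inner)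
  have sqd: "(\<psi> x - \<psi> y) \<bullet> (\<psi> x - \<psi> y) = (x - y) \<bullet> (x - y)" for x y
    using d[of x y] by (simp add: norm_eq_sqrt_inner)
  have ip: "\<psi> x \<bullet> \<psi> y = x \<bullet> y" for x y
    using sqd[of x y] sq[of x] sq[of y] by (simp add: inner_diff_left inner_diff_right inner_commute)
  have "\<psi> (x + y) - (\<psi> x + \<psi> y) = 0" for x y
  proof -
    have "(\<psi> (x + y) - (\<psi> x + \<psi> y)) \<bullet> (\<psi> (x + y) - (\<psi> x + \<psi> y)) = 0"
      by (simp add: inner_diff_left inner_diff_right inner_add_left inner_add_right ip)
    then show ?thesis by simp
  qed
  moreover have "\<psi> (c *\<^sub>R x) - c *\<^sub>R \<psi> x = 0" for c x
  proof -
    have "(\<psi> (c *\<^sub>R x) - c *\<^sub>R \<psi> x) \<bullet> (\<psi> (c *\<^sub>R x) - c *\<^sub>R \<psi> x) = 0"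
      by (simp add: inner_diff_left inner_diff_right ip)
    then show ?thesis by simp
  qed
  ultimately have "linear \<psi>" by (intro linearI) auto
  then show ?thesis by (simp add: \<psi>_def[abs_def])
qed

text \<open>Needed because \<open>plane_chart\<close> is a choice: the direction space of a
  two-dimensional affine hull is isometric to \<open>real^2\<close>, so a function with the required
  properties exists.\<close>

lemma plane_chart:
  assumes "aff_dim F = 2"
  shows "dist (plane_chart F s) (plane_chart F t) = dist s t" "range (plane_chart F) = affine hull F"
proof -
  have "F \<noteq> {}" using assms by auto
  then obtain a where a: "a \<in> affine hull F" by (metis affine_hull_eq_empty ex_in_conv)
  define V where "V = (\<lambda>x. - a + x) ` (affine hull F)"
  have V: "subspace V" unfolding V_def by (rule affine_diffs_subspace[OF affine_affine_hull a])
  have "affine_parallel (affine hull F) V" unfolding affine_parallel_def V_def by blast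
  then have "int (dim V) = 2"
    using aff_dim_affine[OF affine_affine_hull V, of F] a assms \<open>F \<noteq> {}\<close> by simp
  then have "dim (UNIV :: (real^2) set) = dim V" by simp
  then obtain f where f: "linear f" "f ` (UNIV :: (real^2) set) = V" "\<And>x. norm (f x) = norm x"
    using isometry_subspaces[OF subspace_UNIV V] by (metis UNIV_I)
  define \<phi> where "\<phi> s = a + f s" for s
  have "dist (\<phi> s) (\<phi> t) = dist s t" for s t
    using f(3)[of "s - t"] linear_diff[OF f(1)] by (simp add: \<phi>_def dist_norm)
  moreover have "range \<phi> = affine hull F"
  proof -
    have "range \<phi> = (+) a ` V" unfolding f(2)[symmetric] \<phi>_def by auto
    also have "\<dots> = affine hull F" unfolding V_def by (auto simp: image_image)
    finally show ?thesis .
  qed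
  ultimately have "\<exists>\<phi> :: real^2 \<Rightarrow> real^3. (\<forall>s t. dist (\<phi> s) (\<phi> t) = dist s t) \<and> range \<phi> = affine hull F"
    by (intro exI[of _ \<phi>]) auto
  then have "(\<forall>s t. dist (plane_chart F s) (plane_chart F t) = dist s t) \<and> range (plane_chart F) = affine hull F"
    unfolding plane_chart_def by (rule someI_ex)
  then show "dist (plane_chart F s) (plane_chart F t) = dist s t" "range (plane_chart F) = affine hull F" by auto
qed

text \<open>By a Schur complement, the solvability is passed on from \<open>S\<close> to \<open>insert w S\<close>.\<close>

lemma positive_definite_solvable:
  fixes G :: "'i \<Rightarrow> 'i \<Rightarrow> real"
  assumes "finite S"
    and "\<And>c. (\<exists>i\<in>S. c i \<noteq> 0) \<Longrightarrow> (\<Sum>i\<in>S. c i * (\<Sum>j\<in>S. G i j * c j)) > 0"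
  shows "\<exists>c. \<forall>i\<in>S. (\<Sum>j\<in>S. G i j * c j) = b i"
  using assms
proof (induction S arbitrary: b rule: finite_induct)
  case empty
  then show ?case by simp
next
  case (insert w S)
  have pd: "(\<Sum>i\<in>S. c i * (\<Sum>j\<in>S. G i j * c j)) > 0" if c: "\<exists>i\<in>S. c i \<noteq> 0" for c
  proof -
    define c' where "c' i = (if i = w then 0 else c i)" for i
    have e: "\<And>i. i \<in> S \<Longrightarrow> c' i = c i" using insert.hyps by (auto simp: c'_def)
    have "0 < (\<Sum>i\<in>insert w S. c' i * (\<Sum>j\<in>insert w S. G i j * c' j))"
      by (rule insert.prems) (use c e in auto)
    also have "\<dots> = (\<Sum>i\<in>S. c' i * (\<Sum>j\<in>S. G i j * c' j))"
      using insert.hyps by (simp add: c'_def[of w])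
    also have "\<dots> = (\<Sum>i\<in>S. c i * (\<Sum>j\<in>S. G i j * c j))" using e by (intro sum.cong arg_cong2[where f = "(*)"]) auto
    finally show ?thesis .
  qed
  obtain c0 where c0: "\<And>i. i \<in> S \<Longrightarrow> (\<Sum>j\<in>S. G i j * c0 j) = b i"
    using insert.IH[OF pd, of b] by blast
  obtain d where d: "\<And>i. i \<in> S \<Longrightarrow> (\<Sum>j\<in>S. G i j * d j) = - G i w"
    using insert.IH[OF pd, of "\<lambda>i. - G i w"] by blast
  \<comment> \<open>The Schur complement of the block \<open>S\<close>. It is positive since it is
    the value of the quadratic form at the vector that is 1 at \<open>w\<close> and \<open>d\<close>
    on \<open>S\<close>: by the choice of \<open>d\<close>, all rows other than \<open>w\<close>
    contribute nothing.\<close>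
  define s where "s = (\<Sum>j\<in>S. G w j * d j) + G w w"
  have "s > 0"
  proof -
    define e where "e i = (if i = w then 1 else d i)" for i
    have ei: "\<And>i. i \<in> S \<Longrightarrow> e i = d i" using insert.hyps by (auto simp: e_def)
    have eS: "(\<Sum>j\<in>S. G i j * e j) = (\<Sum>j\<in>S. G i j * d j)" for i using ei by (intro sum.cong) auto
    have "0 < (\<Sum>i\<in>insert w S. e i * (\<Sum>j\<in>insert w S. G i j * e j))"
      by (rule insert.prems) (auto simp: e_def)
    also have "\<dots> = (G w w + (\<Sum>j\<in>S. G w j * d j)) + (\<Sum>i\<in>S. e i * (G i w + (\<Sum>j\<in>S. G i j * d j)))"
      using insert.hyps by (simp add: eS e_def[of w])
    also have "(\<Sum>i\<in>S. e i * (G i w + (\<Sum>j\<in>S. G i j * d j))) = 0" using d by simp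
    finally show ?thesis by (simp add: s_def)
  qed
  define t where "t = (b w - (\<Sum>j\<in>S. G w j * c0 j)) / s"
  define c where "c i = (if i = w then t else c0 i + t * d i)" for i
  have ci: "\<And>i. i \<in> S \<Longrightarrow> c i = c0 i + t * d i" using insert.hyps by (auto simp: c_def)
  have row: "(\<Sum>j\<in>insert w S. G i j * c j) = (\<Sum>j\<in>S. G i j * c0 j) + t * ((\<Sum>j\<in>S. G i j * d j) + G i w)" for i
  proof -
    have "(\<Sum>j\<in>S. G i j * c j) = (\<Sum>j\<in>S. G i j * (c0 j + t * d j))" using ci by (intro sum.cong) auto
    also have "\<dots> = (\<Sum>j\<in>S. G i j * c0 j) + t * (\<Sum>j\<in>S. G i j * d j)"
      by (simp add: distrib_left sum.distrib sum_distrib_left mult_ac)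
    finally show ?thesis using insert.hyps by (simp add: c_def[of w] algebra_simps)
  qed
  have "(\<Sum>j\<in>insert w S. G i j * c j) = b i" if "i \<in> insert w S" for i
  proof (cases "i = w")
    case True
    have "t * s = b w - (\<Sum>j\<in>S. G w j * c0 j)" using \<open>s > 0\<close> by (simp add: t_def)
    then show ?thesis unfolding row True by (simp add: s_def)
  next
    case False
    then show ?thesis unfolding row using c0 d that by simp
  qed
  then show ?case by blast
qed

text \<open>There are no hanging nodes: a vertex of one cell is an extreme point of the common face
  with any cell that contains it, and extreme points of a face are extreme points of the
  cell.\<close>

lemma extreme_point_of_cell:
  assumes "\<And>K K'. K \<in> \<T> \<Longrightarrow> K' \<in> \<T> \<Longrightarrow> closure K \<inter> closure K' face_of closure K"
    and "K \<in> \<T>" "K' \<in> \<T>" "z \<in> verts K'" "z \<in> closure K"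
  shows "z \<in> verts K"
proof -
  let ?F = "closure K \<inter> closure K'"
  have F1: "?F face_of closure K" using assms(1)[OF assms(2,3)] .
  have F2: "?F face_of closure K'" using assms(1)[OF assms(3,2)] by (simp add: Int_commute)
  have "z \<in> ?F" using assms(4,5) by (auto simp: verts_def extreme_point_of_def)
  then have "z extreme_point_of ?F" using extreme_point_of_face[OF F2] assms(4) by (simp add: verts_def)
  then show ?thesis using extreme_point_of_face[OF F1] by (simp add: verts_def)
qed

section \<open>Surface measure on the facets\<close>

context fe_mesh
begin

lemma frontier_facets: "frontier \<Omega> = \<Union> {F. F facet_of closure \<Omega>}"
proof -
  have "rel_interior (closure \<Omega>) = interior (closure \<Omega>)"
    using \<Omega>(1,4) interior_closure by (intro rel_interior_interior affine_hull_nonempty_interior) auto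
  then show ?thesis
    using rel_boundary_of_polyhedron[OF \<Omega>(5)] interior_closure \<Omega>(1) by (simp add: frontier_def interior_open)
qed

lemma facet_aff_dim: "F facet_of closure \<Omega> \<Longrightarrow> aff_dim F = 2"
proof -
  have "interior (closure \<Omega>) \<noteq> {}" using interior_closure \<Omega>(4) by simp
  then have "aff_dim (closure \<Omega>) = 3" using aff_dim_nonempty_interior[of "closure \<Omega>"] by simp
  then show "F facet_of closure \<Omega> \<Longrightarrow> aff_dim F = 2" by (simp add: facet_of_def)
qed

lemma facet_closed: "F facet_of closure \<Omega> \<Longrightarrow> closed F"
  using \<Omega>(5) by (meson facet_of_imp_face_of face_of_imp_closed polyhedron_imp_convex closed_closure convex_closure \<Omega>(3))

lemma chart_continuous: "F facet_of closure \<Omega> \<Longrightarrow> continuous_on A (plane_chart F)"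
proof -
  assume F: "F facet_of closure \<Omega>"
  have "1-lipschitz_on A (plane_chart F)"
    by (intro lipschitz_onI) (simp_all add: plane_chart(1)[OF facet_aff_dim[OF F]])
  then show ?thesis by (rule lipschitz_on_continuous_on)
qed

lemma surface_sets: "sets (surface_measure \<Omega>) = sets (restrict_space borel (frontier \<Omega>))"
  and surface_space: "space (surface_measure \<Omega>) = frontier \<Omega>"
proof -
  have sub: "sets (restrict_space borel (frontier \<Omega>)) \<subseteq> Pow (frontier \<Omega>)"
    using sets.space_closed[of "restrict_space borel (frontier \<Omega>)"] by simp
  have "sigma_sets (frontier \<Omega>) (sets (restrict_space borel (frontier \<Omega>))) = sets (restrict_space borel (frontier \<Omega>))"
    using sets.sigma_sets_eq[of "restrict_space borel (frontier \<Omega>)"] by simp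
  then show "sets (surface_measure \<Omega>) = sets (restrict_space borel (frontier \<Omega>))"
    "space (surface_measure \<Omega>) = frontier \<Omega>"
    using sub by (simp_all add: surface_measure_def sets_measure_of_conv space_measure_of_conv)
qed

lemma chart_preimage_borel:
  assumes "F facet_of closure \<Omega>" "A \<in> sets borel"
  shows "plane_chart F -` (A \<inter> F) \<in> sets borel"
proof -
  have "plane_chart F \<in> borel_measurable borel"
    using chart_continuous[OF assms(1)] by (rule borel_measurable_continuous_onI)
  moreover have "A \<inter> F \<in> sets borel" using assms facet_closed by auto
  ultimately show ?thesis using measurable_sets[of "plane_chart F" borel borel "A \<inter> F"] by simp
qed

text \<open>\<open>measure_of\<close> returns the prescribed values only if they are countably
  additive. Each facet contributes the Lebesgue measure of disjoint preimages under its chart, and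
  the finite sum over the facets commutes with the series.\<close>

lemma surface_emeasure:
  assumes "A \<in> sets (surface_measure \<Omega>)"
  shows "emeasure (surface_measure \<Omega>) A = (\<Sum>F\<in>{F. F facet_of closure \<Omega>}. emeasure lborel (plane_chart F -` (A \<inter> F)))"
proof (rule emeasure_measure_of[OF surface_measure_def _ _ _ assms])
  show "sets (restrict_space borel (frontier \<Omega>)) \<subseteq> Pow (frontier \<Omega>)"
    using sets.space_closed[of "restrict_space borel (frontier \<Omega>)"] by simp
  show "positive (sets (surface_measure \<Omega>)) (\<lambda>A. \<Sum>F\<in>{F. F facet_of closure \<Omega>}. emeasure lborel (plane_chart F -` (A \<inter> F)))"
    by (simp add: positive_def)
  show "countably_additive (sets (surface_measure \<Omega>)) (\<lambda>A. \<Sum>F\<in>{F. F facet_of closure \<Omega>}. emeasure lborel (plane_chart F -` (A \<inter> F)))"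
  proof (rule countably_additiveI)
    fix A :: "nat \<Rightarrow> (real^3) set"
    assume A: "range A \<subseteq> sets (surface_measure \<Omega>)" "disjoint_family A"
    have Ab: "A i \<in> sets borel" for i
    proof -
      have "A i \<in> sets (restrict_space borel (frontier \<Omega>))" using A(1) surface_sets by auto
      then show ?thesis by (auto simp: sets_restrict_space)
    qed
    have "(\<Sum>i. \<Sum>F\<in>{F. F facet_of closure \<Omega>}. emeasure lborel (plane_chart F -` (A i \<inter> F))) =
        (\<Sum>F\<in>{F. F facet_of closure \<Omega>}. \<Sum>i. emeasure lborel (plane_chart F -` (A i \<inter> F)))"
      by (intro suminf_sum) auto
    also have "\<dots> = (\<Sum>F\<in>{F. F facet_of closure \<Omega>}. emeasure lborel (plane_chart F -` ((\<Union>i. A i) \<inter> F)))"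
    proof (rule sum.cong[OF refl])
      fix F assume "F \<in> {F. F facet_of closure \<Omega>}"
      then have F: "F facet_of closure \<Omega>" by simp
      have "(\<Sum>i. emeasure lborel (plane_chart F -` (A i \<inter> F))) = emeasure lborel (\<Union>i. plane_chart F -` (A i \<inter> F))"
        by (rule suminf_emeasure)
          (use chart_preimage_borel[OF F Ab] A(2) in \<open>auto simp: disjoint_family_on_def\<close>)
      also have "(\<Union>i. plane_chart F -` (A i \<inter> F)) = plane_chart F -` ((\<Union>i. A i) \<inter> F)" by auto
      finally show "(\<Sum>i. emeasure lborel (plane_chart F -` (A i \<inter> F))) =
          emeasure lborel (plane_chart F -` ((\<Union>i. A i) \<inter> F))" .
    qed
    finally show "(\<Sum>i. \<Sum>F\<in>{F. F facet_of closure \<Omega>}. emeasure lborel (plane_chart F -` (A i \<inter> F))) =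
        (\<Sum>F\<in>{F. F facet_of closure \<Omega>}. emeasure lborel (plane_chart F -` ((\<Union>i. A i) \<inter> F)))" .
  qed
qed

lemma finite_facets: "finite {F. F facet_of closure \<Omega>}"
  by (rule finite_polyhedron_facets[OF \<Omega>(5)])

lemma surface_finite: "finite_measure (surface_measure \<Omega>)"
proof (rule finite_measureI)
  have "emeasure lborel (plane_chart F -` (frontier \<Omega> \<inter> F)) < \<infinity>" if F: "F facet_of closure \<Omega>" for F
  proof -
    have "bounded (plane_chart F -` (frontier \<Omega> \<inter> F))"
    proof -
      have bf: "bounded (frontier \<Omega>)"
        using bounded_closure[OF \<Omega>(2)] by (rule bounded_subset) (simp add: frontier_def)
      obtain R where R: "frontier \<Omega> \<subseteq> cball (plane_chart F 0) R"
        using bounded_subset_ballD[OF bf, of "plane_chart F 0"] ball_subset_cball by blast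
      have "plane_chart F -` (frontier \<Omega> \<inter> F) \<subseteq> cball 0 R"
      proof
        fix x assume "x \<in> plane_chart F -` (frontier \<Omega> \<inter> F)"
        then have "dist (plane_chart F 0) (plane_chart F x) \<le> R" using R by auto
        then show "x \<in> cball 0 R" by (simp add: plane_chart(1)[OF facet_aff_dim[OF F]])
      qed
      then show ?thesis using bounded_cball bounded_subset by blast
    qed
    then show ?thesis by (rule emeasure_bounded_finite)
  qed
  then have "(\<Sum>F\<in>{F. F facet_of closure \<Omega>}. emeasure lborel (plane_chart F -` (frontier \<Omega> \<inter> F))) < \<infinity>"
    using finite_facets by (auto simp: less_top)
  then show "emeasure (surface_measure \<Omega>) (space (surface_measure \<Omega>)) \<noteq> \<infinity>"
    using surface_emeasure[OF sets.top] by (simp add: surface_space)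
qed

lemma surface_measurable:
  assumes "continuous_on (frontier \<Omega>) f"
  shows "f \<in> borel_measurable (surface_measure \<Omega>)"
proof -
  have "f \<in> borel_measurable (restrict_space borel (frontier \<Omega>))"
    using assms by (rule borel_measurable_continuous_on_restrict)
  then show ?thesis using surface_sets measurable_cong_sets by blast
qed

lemma bdry_trace_FE:
  assumes "u \<in> FE_space \<Omega> \<T>"
  shows "bdry_trace \<Omega> u \<in> borel_measurable (surface_measure \<Omega>)" "\<exists>B. \<forall>x. \<bar>bdry_trace \<Omega> u x\<bar> \<le> B"
proof -
  have c: "continuous_on (frontier \<Omega>) u"
    using assms closure_eq(1) by (auto simp: FE_space_def intro: continuous_on_subset)
  have "continuous_on (frontier \<Omega>) (bdry_trace \<Omega> u)"
    by (rule continuous_on_cong[THEN iffD1, OF refl _ c]) (simp add: bdry_trace_def)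
  then show "bdry_trace \<Omega> u \<in> borel_measurable (surface_measure \<Omega>)" by (rule surface_measurable)
  have "compact (frontier \<Omega>)" using \<Omega>(2) by (simp add: compact_frontier_bounded)
  then have "bounded (u ` frontier \<Omega>)" using c compact_continuous_image compact_imp_bounded by blast
  then obtain B where B: "\<And>x. x \<in> frontier \<Omega> \<Longrightarrow> \<bar>u x\<bar> \<le> B" "B > 0" by (auto simp: bounded_pos)
  then have "\<bar>bdry_trace \<Omega> u x\<bar> \<le> B" for x by (auto simp: bdry_trace_def)
  then show "\<exists>B. \<forall>x. \<bar>bdry_trace \<Omega> u x\<bar> \<le> B" by blast
qed

lemma surface_integrable_bounded:
  fixes f :: "real^3 \<Rightarrow> real"
  assumes "f \<in> borel_measurable (surface_measure \<Omega>)" "\<exists>B. \<forall>x. \<bar>f x\<bar> \<le> B"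
  shows "integrable (surface_measure \<Omega>) f"
proof -
  interpret finite_measure "surface_measure \<Omega>" by (rule surface_finite)
  obtain B where B: "\<And>x. \<bar>f x\<bar> \<le> B" using assms(2) by blast
  show ?thesis by (rule integrable_const_bound[of _ B]) (use assms(1) B in auto)
qed

lemma trace_times_integrable:
  assumes "u \<in> FE_space \<Omega> \<T>" "v \<in> FE_space \<Omega> \<T>"
  shows "integrable (surface_measure \<Omega>) (\<lambda>x. bdry_trace \<Omega> u x * bdry_trace \<Omega> v x)"
  using surface_integrable_bounded[OF bdry_trace_FE[OF assms(1)]] bdry_trace_FE[OF assms(2)]
    integrable_times_bounded by blast

section \<open>Nodal basis and lower bounds for traces\<close>

definition hat :: "real^3 \<Rightarrow> real^3 \<Rightarrow> real"
  where "hat z = (SOME u. u \<in> FE_space \<Omega> \<T> \<and> (\<forall>z'\<in>mesh_nodes \<T>. u z' = (if z' = z then 1 else 0)))"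

lemma hat: "hat z \<in> FE_space \<Omega> \<T>" "z' \<in> mesh_nodes \<T> \<Longrightarrow> hat z z' = (if z' = z then 1 else 0)"
proof -
  obtain u where "u \<in> FE_space \<Omega> \<T>" "\<And>z'. z' \<in> mesh_nodes \<T> \<Longrightarrow> u z' = (if z' = z then 1 else 0)"
    using FE_interpolant_exists[of "\<lambda>z'. if z' = z then 1 else 0"] by blast
  then have "\<exists>u. u \<in> FE_space \<Omega> \<T> \<and> (\<forall>z'\<in>mesh_nodes \<T>. u z' = (if z' = z then 1 else 0))" by blast
  then have "hat z \<in> FE_space \<Omega> \<T> \<and> (\<forall>z'\<in>mesh_nodes \<T>. hat z z' = (if z' = z then 1 else 0))"
    unfolding hat_def by (rule someI_ex)
  then show "hat z \<in> FE_space \<Omega> \<T>" "z' \<in> mesh_nodes \<T> \<Longrightarrow> hat z z' = (if z' = z then 1 else 0)" by auto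
qed

lemma FE_bounded_by_nodes:
  assumes "u \<in> FE_space \<Omega> \<T>" "K \<in> \<T>" "x \<in> closure K" "\<And>z. z \<in> verts K \<Longrightarrow> \<bar>u z - c\<bar> \<le> B"
  shows "\<bar>u x - c\<bar> \<le> B"
proof -
  obtain a b where ab: "\<And>x. x \<in> closure K \<Longrightarrow> u x = a \<bullet> x + b" using FE_affine[OF assms(1,2)] by blast
  have "\<bar>a \<bullet> x + (b - c)\<bar> \<le> B"
  proof (rule affine_bounded_on_convex_hull[OF cell_facts(3)[OF assms(2)]])
    show "x \<in> convex hull verts K" using assms(3) cell_facts(4)[OF assms(2)] by simp
    fix z assume z: "z \<in> verts K"
    then have "z \<in> closure K" using verts_subset[OF assms(2)] by blast
    then show "\<bar>a \<bullet> z + (b - c)\<bar> \<le> B" using assms(4)[OF z] ab[of z] by simp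
  qed
  then show ?thesis using ab[OF assms(3)] by simp
qed

text \<open>Two hat functions add up to at most 1 at every vertex, hence on every cell. The regions
  where they exceed 1/2 are thus disjoint, which allows local lower bounds for traces to be summed
  over the nodes.\<close>

lemma hat_disjoint:
  assumes "z \<noteq> z'" "x \<in> closure \<Omega>" "hat z x > 1/2" "hat z' x > 1/2"
  shows False
proof -
  obtain K where K: "K \<in> \<T>" "x \<in> closure K" using assms(2) cells_cover by blast
  have f: "(\<lambda>x. 1 * hat z x + 1 * hat z' x) \<in> FE_space \<Omega> \<T>" by (rule FE_lincomb[OF hat(1) hat(1)])
  have "\<bar>(1 * hat z x + 1 * hat z' x) - 0\<bar> \<le> 1"
  proof (rule FE_bounded_by_nodes[OF f K])
    fix y assume "y \<in> verts K"
    then have "y \<in> mesh_nodes \<T>" using K mesh_nodes_eq by auto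
    then show "\<bar>1 * hat z y + 1 * hat z' y - 0\<bar> \<le> 1" using assms(1) by (simp add: hat(2))
  qed
  then show False using assms(3,4) by simp
qed

lemma FE_sum:
  assumes "finite S"
  shows "(\<lambda>x. \<Sum>z\<in>S. c z * hat z x) \<in> FE_space \<Omega> \<T>"
  using assms
proof (induction S rule: finite_induct)
  case empty
  have "(\<lambda>x. 0 * hat 0 x + 0 * hat 0 x) \<in> FE_space \<Omega> \<T>" by (rule FE_lincomb[OF hat(1) hat(1)])
  then show ?case by simp
next
  case (insert w S)
  have "(\<lambda>x. c w * hat w x + 1 * (\<Sum>z\<in>S. c z * hat z x)) \<in> FE_space \<Omega> \<T>"
    by (rule FE_lincomb[OF hat(1) insert.IH])
  then show ?case using insert.hyps by simp
qed

end

lemma affine_hull_affine_image: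
  fixes \<phi> :: "'a::euclidean_space \<Rightarrow> 'b::euclidean_space"
  assumes "linear (\<lambda>x. \<phi> x - \<phi> 0)"
  shows "affine hull (\<phi> ` X) = \<phi> ` (affine hull X)"
proof -
  define \<psi> where "\<psi> x = \<phi> x - \<phi> 0" for x
  have l: "bounded_linear \<psi>" using assms by (simp add: \<psi>_def[abs_def] linear_conv_bounded_linear)
  have e: "\<phi> ` Y = (\<lambda>x. \<phi> 0 + x) ` (\<psi> ` Y)" for Y by (auto simp: \<psi>_def image_image)
  show ?thesis unfolding e affine_hull_translation affine_hull_linear_image[OF l] ..
qed

lemma emeasure_shrink_vimage:
  fixes B :: "(real^2) set"
  assumes "B \<in> sets borel" "0 < t"
  shows "emeasure lborel ((\<lambda>y. (1 - t) *\<^sub>R z + t *\<^sub>R y) -` B) = ennreal ((1 / t)\<^sup>2) * emeasure lborel B"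
proof -
  let ?f = "\<lambda>y. (1 - t) *\<^sub>R z + t *\<^sub>R y"
  have eq: "?f -` B = (\<lambda>x. (1 / t) *\<^sub>R x + (- ((1 - t) / t)) *\<^sub>R z) ` B"
  proof
    show "?f -` B \<subseteq> (\<lambda>x. (1 / t) *\<^sub>R x + (- ((1 - t) / t)) *\<^sub>R z) ` B"
    proof
      fix y assume "y \<in> ?f -` B"
      moreover have "y = (1 / t) *\<^sub>R ?f y + (- ((1 - t) / t)) *\<^sub>R z"
        using assms(2) by (simp add: scaleR_add_right scaleR_add_left[symmetric])
      ultimately show "y \<in> (\<lambda>x. (1 / t) *\<^sub>R x + (- ((1 - t) / t)) *\<^sub>R z) ` B" by blast
    qed
    show "(\<lambda>x. (1 / t) *\<^sub>R x + (- ((1 - t) / t)) *\<^sub>R z) ` B \<subseteq> ?f -` B"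
      using assms(2) by (auto simp: scaleR_diff_right)
  qed
  have m: "?f -` B \<in> sets borel"
  proof -
    have "?f \<in> borel_measurable borel" by (intro borel_measurable_continuous_onI continuous_intros)
    then show ?thesis using measurable_sets[of ?f borel borel B] assms(1) by simp
  qed
  have "emeasure lborel (?f -` B) = emeasure lebesgue (?f -` B)" using m by simp
  also have "\<dots> = ennreal (\<bar>1 / t\<bar> ^ 2) * emeasure lebesgue B"
    unfolding eq using emeasure_lebesgue_affine[of "1 / t" "(- ((1 - t) / t)) *\<^sub>R z" B] by (simp add: ennreal_power)
  finally show ?thesis using assms by simp
qed

context fe_mesh
begin

lemma chart_facts:
  assumes "G facet_of closure \<Omega>"
  shows "linear (\<lambda>x. plane_chart G x - plane_chart G 0)"
    "plane_chart G ((1 - t) *\<^sub>R x + t *\<^sub>R y) = (1 - t) *\<^sub>R plane_chart G x + t *\<^sub>R plane_chart G y"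
    "inj (plane_chart G)" "range (plane_chart G) = affine hull G"
proof -
  note d = plane_chart[OF facet_aff_dim[OF assms]]
  show l: "linear (\<lambda>x. plane_chart G x - plane_chart G 0)"
    using d(1) by (rule isometry_imp_linear_translation)
  define w where "w = (1 - t) *\<^sub>R x + t *\<^sub>R y"
  have "plane_chart G w - plane_chart G 0 =
      (1 - t) *\<^sub>R (plane_chart G x - plane_chart G 0) + t *\<^sub>R (plane_chart G y - plane_chart G 0)"
    using linear_add[OF l, of "(1 - t) *\<^sub>R x" "t *\<^sub>R y"] linear_cmul[OF l, of "1 - t" x] linear_cmul[OF l, of t y]
    by (simp add: w_def)
  then have "plane_chart G w = (1 - t) *\<^sub>R plane_chart G x + t *\<^sub>R plane_chart G y"
    by (simp add: algebra_simps)
  then show "plane_chart G ((1 - t) *\<^sub>R x + t *\<^sub>R y) = (1 - t) *\<^sub>R plane_chart G x + t *\<^sub>R plane_chart G y"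
    by (simp add: w_def)
  show "inj (plane_chart G)" using d(1) by (intro injI) (metis dist_eq_0_iff)
  show "range (plane_chart G) = affine hull G" by (rule d(2))
qed

text \<open>The cells whose intersection with the facet is lower dimensional are negligible in the plane of
  the facet and hence cannot cover a neighbourhood of a point of the facet.\<close>

lemma boundary_cell_exists:
  assumes G: "G facet_of closure \<Omega>" and z: "z \<in> G"
  obtains K where "K \<in> \<T>" "z \<in> closure K" "interior (plane_chart G -` (G \<inter> closure K)) \<noteq> {}"
proof -
  let ?\<phi> = "plane_chart G"
  note ch = chart_facts[OF G]
  define P where "P = ?\<phi> -` G"
  define Q where "Q K = ?\<phi> -` (G \<inter> closure K)" for K
  have Gr: "G \<subseteq> range ?\<phi>" unfolding ch(4) by (rule hull_subset)
  obtain z' where z': "z = ?\<phi> z'" using z Gr by blast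
  have cG: "convex G" using G facet_of_imp_face_of face_of_imp_convex by blast
  have cv: "convex (?\<phi> -` X)" if "convex X" for X
  proof (rule convexI)
    fix x y and u v :: real assume a: "x \<in> ?\<phi> -` X" "y \<in> ?\<phi> -` X" "0 \<le> u" "0 \<le> v" "u + v = 1"
    then have u: "u = 1 - v" by simp
    show "u *\<^sub>R x + v *\<^sub>R y \<in> ?\<phi> -` X"
      unfolding u using ch(2)[of v x y] convexD[OF that, of "?\<phi> x" "?\<phi> y" "1 - v" v] a by simp
  qed
  have cl: "closed (?\<phi> -` X)" if "closed X" for X
    using continuous_closed_vimage[OF that, of ?\<phi>] chart_continuous[OF G, of UNIV]
    by (simp add: continuous_on_eq_continuous_at)
  have cP: "convex P" unfolding P_def by (rule cv[OF cG])
  have cQ: "convex (Q K)" if "K \<in> \<T>" for K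
    unfolding Q_def using cG convex_closure[OF cell_facts(7)[OF that]] by (intro cv convex_Int)
  have clQ: "closed (Q K)" for K
    unfolding Q_def using facet_closed[OF G] by (intro cl closed_Int) auto
  have iP: "interior P \<noteq> {}"
  proof -
    have "?\<phi> ` P = G" unfolding P_def using Gr by auto
    then have "range ?\<phi> = ?\<phi> ` (affine hull P)" using ch(4) affine_hull_affine_image[OF ch(1), of P] by simp
    then have "affine hull P = UNIV" using ch(3) by (metis inj_image_eq_iff)
    then have "interior P = rel_interior P" by (rule rel_interior_interior[symmetric])
    moreover have "P \<noteq> {}" using z z' by (auto simp: P_def)
    ultimately show ?thesis using rel_interior_eq_empty[OF cP] by simp
  qed
  have "\<exists>K\<in>\<T>. z' \<in> Q K \<and> interior (Q K) \<noteq> {}"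
  proof (rule ccontr)
    assume no: "\<not> ?thesis"
    define C where "C = (\<Union>K\<in>{K\<in>\<T>. interior (Q K) \<noteq> {}}. Q K)"
    have "closed C" unfolding C_def using finite_cells clQ by (intro closed_UN) auto
    moreover have "z' \<notin> C" using no by (auto simp: C_def)
    moreover have "z' \<in> closure (interior P)"
    proof -
      have "z' \<in> P" using z z' by (simp add: P_def)
      then show ?thesis using convex_closure_interior[OF cP iP] closure_subset by blast
    qed
    ultimately have "interior P \<inter> - C \<noteq> {}"
      using open_Int_closure_eq_empty[of "- C" "interior P"] by auto
    moreover have "open (interior P \<inter> - C)" using \<open>closed C\<close> by auto
    moreover have "negligible (interior P \<inter> - C)"
    proof (rule negligible_subset)
      show "negligible (\<Union>K\<in>{K\<in>\<T>. interior (Q K) = {}}. Q K)"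
        using finite_cells cQ negligible_convex_interior by (intro negligible_Union) auto
      have "P \<subseteq> (\<Union>K\<in>\<T>. Q K)"
        using cells_cover facet_of_imp_subset[OF G] by (fastforce simp: P_def Q_def)
      then show "interior P \<inter> - C \<subseteq> (\<Union>K\<in>{K\<in>\<T>. interior (Q K) = {}}. Q K)"
        using interior_subset by (fastforce simp: C_def)
    qed
    ultimately show False using open_not_negligible by blast
  qed
  then show ?thesis using that z' unfolding Q_def by auto
qed

text \<open>Some cell at \<open>z\<close> has a face in a facet that contains a disc of radius
  \<open>r / 4\<close>. Contracting this disc towards \<open>z\<close> by 1/2 and by 1/4 gives two
  regions near \<open>z\<close>. As \<open>u\<close> is affine along rays from \<open>z\<close>, it
  cannot be small compared with \<open>u z\<close> on both, so the points where \<open>|u|\<close>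
  is at least a third of \<open>|u z|\<close> have an area comparable to that of the disc. Requiring
  \<open>hat z\<close> to exceed 1/2 ties the set to its node.\<close>

lemma trace_lower_bound_at_node:
  assumes r: "r > 0" "\<And>K. K \<in> \<T> \<Longrightarrow> \<exists>x. ball x r \<subseteq> K"
    and z: "z \<in> mesh_nodes \<T>" "z \<in> frontier \<Omega>" and u: "u \<in> FE_space \<Omega> \<T>"
  shows "\<exists>A\<in>sets (surface_measure \<Omega>). (\<forall>x\<in>A. x \<in> frontier \<Omega> \<and> \<bar>u z\<bar> / 3 \<le> \<bar>u x\<bar> \<and> hat z x > 1/2) \<and>
    unit_ball_vol 2 * (r / 4)\<^sup>2 / 20 \<le> measure (surface_measure \<Omega>) A"
proof -
  obtain G where G: "G facet_of closure \<Omega>" "z \<in> G" using z(2) frontier_facets by auto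
  let ?\<phi> = "plane_chart G"
  note ch = chart_facts[OF G(1)]
  note cd = plane_chart(1)[OF facet_aff_dim[OF G(1)]]
  obtain K where K: "K \<in> \<T>" "z \<in> closure K" "interior (?\<phi> -` (G \<inter> closure K)) \<noteq> {}"
    using boundary_cell_exists[OF G] by blast
  define F where "F = G \<inter> closure K"
  define E where "E = {e. e extreme_point_of F}"
  have Gfr: "G \<subseteq> frontier \<Omega>" using frontier_facets G(1) by auto
  have Ff: "F face_of closure K"
  proof -
    have "(G \<inter> closure K) face_of (closure \<Omega> \<inter> closure K)"
      by (rule face_of_slice) (use G(1) facet_of_imp_face_of convex_closure[OF cell_facts(7)[OF K(1)]] in auto)
    moreover have "closure \<Omega> \<inter> closure K = closure K" using cell_closure_subset[OF K(1)] by blast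
    ultimately show ?thesis by (simp add: F_def)
  qed
  have Fc: "convex F" "compact F"
    using face_of_imp_convex[OF Ff] facet_closed[OF G(1)] cell_facts(9)[OF K(1)]
    by (auto simp: F_def intro: closed_Int_compact)
  have FE: "F = convex hull E" unfolding E_def by (rule Krein_Milman_Minkowski[OF Fc(2,1)])
  have EK: "E \<subseteq> verts K" using extreme_point_of_face[OF Ff] by (auto simp: E_def verts_def)
  have fE: "finite E" using EK cell_facts(3)[OF K(1)] finite_subset by blast
  have zK: "z \<in> verts K"
  proof -
    obtain K' where "K' \<in> \<T>" "z \<in> verts K'" using z(1) mesh_nodes_eq by auto
    then show ?thesis using extreme_point_of_cell[OF cells_face K(1)] K(2) by blast
  qed
  have zE: "z \<in> E"
    using extreme_point_of_face[OF Ff, of z] zK G(2) K(2) by (auto simp: E_def verts_def F_def)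
  define N where "N = real (card E)"
  have N: "1 \<le> N" "N \<le> 4"
  proof -
    have "card E > 0" using zE fE by (auto simp: card_gt_0_iff)
    then show "1 \<le> N" by (simp add: N_def)
    have "card E \<le> 4" using card_mono[OF cell_facts(3)[OF K(1)] EK] cell_facts(2)[OF K(1)] by simp
    then show "N \<le> 4" by (simp add: N_def)
  qed
  have Fim: "?\<phi> ` (?\<phi> -` F) = F"
  proof -
    have "F \<subseteq> range ?\<phi>" using ch(4) hull_subset[of G affine] by (auto simp: F_def)
    then show ?thesis by (metis image_vimage_eq inf.absorb1)
  qed
  \<comment> \<open>The face spans the plane of the facet, so each point of the plane is an affine
    combination of the vertices in \<open>E\<close>. Membership in the face is then a matter of the
    signs of the coefficients.\<close>
  have hullE: "?\<phi> y \<in> affine hull E" for y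
  proof -
    have "affine hull F = ?\<phi> ` (affine hull (?\<phi> -` F))"
      using affine_hull_affine_image[OF ch(1), of "?\<phi> -` F"] Fim by simp
    moreover have "affine hull (?\<phi> -` F) = UNIV"
      using K(3) by (intro affine_hull_nonempty_interior) (simp add: F_def)
    ultimately have "?\<phi> y \<in> affine hull F" by simp
    then show ?thesis by (simp add: FE)
  qed
  obtain ch_a ch_b where hz: "\<And>x. x \<in> closure K \<Longrightarrow> hat z x = ch_a \<bullet> x + ch_b"
    using FE_affine[OF hat(1) K(1)] by blast
  obtain ua ub where uab: "\<And>x. x \<in> closure K \<Longrightarrow> u x = ua \<bullet> x + ub"
    using FE_affine[OF u K(1)] by blast
  have "\<exists>a b. \<forall>v\<in>verts K. a \<bullet> v + b = (if v = e then 1 else 0)" for e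
    using affine_interpolation[OF cell_facts(1)[OF K(1)], of "\<lambda>v. if v = e then 1 else 0"] by metis
  then obtain la lb where lam: "\<And>e v. v \<in> verts K \<Longrightarrow> la e \<bullet> v + lb e = (if v = e then 1 else 0)" by metis
  have lan: "norm (la e) * r \<le> 1" for e
  proof -
    obtain c where c: "ball c r \<subseteq> K" using r(2)[OF K(1)] by blast
    show ?thesis
    proof (rule affine_gradient_bound[OF _ r(1)])
      fix x assume "x \<in> ball c r"
      then have "x \<in> convex hull verts K" using c closure_subset cell_facts(4)[OF K(1)] by blast
      then show "\<bar>la e \<bullet> x + lb e\<bar> \<le> 1"
        by (rule affine_bounded_on_convex_hull[OF cell_facts(3)[OF K(1)]]) (use lam in auto)
    qed
  qed
  \<comment> \<open>The barycentre of the face. There each barycentric coordinate is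
    \<open>1 / N \<ge> 1 / 4\<close>, and its gradient has norm at most \<open>1 / r\<close> by
    \<open>lan\<close>; it is therefore positive at distances below \<open>r / 4\<close>.\<close>
  define m where "m = (\<Sum>e\<in>E. (1 / N) *\<^sub>R e)"
  have mF: "m \<in> F"
    unfolding m_def
  proof (rule convex_sum[OF fE Fc(1)])
    show "(\<Sum>e\<in>E. 1 / N) = 1" using N by (simp add: N_def)
    show "e \<in> F" if "e \<in> E" for e using that unfolding FE by (rule hull_inc)
  qed (use N in auto)
  obtain m' where m': "m = ?\<phi> m'" using mF Fim by auto
  obtain z' where z': "z = ?\<phi> z'" using G(2) ch(4) hull_subset[of G affine] by auto
  have lm: "la e \<bullet> m + lb e = 1 / N" if e: "e \<in> E" for e
  proof -
    have "(\<Sum>v\<in>E. 1 / N) = 1" using N by (simp add: N_def)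
    then have "la e \<bullet> m + lb e = (\<Sum>v\<in>E. (1 / N) * (la e \<bullet> v + lb e))"
      unfolding m_def by (simp add: inner_sum_right distrib_left sum.distrib sum_distrib_right[symmetric])
    also have "\<dots> = (\<Sum>v\<in>E. if v = e then 1 / N else 0)"
      using EK lam by (intro sum.cong) auto
    also have "\<dots> = 1 / N" using fE e by simp
    finally show ?thesis .
  qed
  define D where "D = ball m' (r / 4)"
  have disc: "?\<phi> y \<in> F \<and> hat z (?\<phi> y) > 0" if y: "y \<in> D" for y
  proof -
    obtain w where w: "sum w E = 1" "(\<Sum>v\<in>E. w v *\<^sub>R v) = ?\<phi> y"
      using hullE[of y] by (auto simp: affine_hull_finite[OF fE])
    have aff: "a \<bullet> ?\<phi> y + b = (\<Sum>v\<in>E. w v * (a \<bullet> v + b))" for a b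
      unfolding w(2)[symmetric] using w(1)
      by (simp add: inner_sum_right distrib_left sum.distrib sum_distrib_right[symmetric])
    have wpos: "w e > 0" if e: "e \<in> E" for e
    proof -
      have "la e \<bullet> ?\<phi> y + lb e = (\<Sum>v\<in>E. if v = e then w v else 0)"
        unfolding aff using EK lam by (intro sum.cong) auto
      then have we: "w e = la e \<bullet> ?\<phi> y + lb e" using fE e by simp
      have "norm (?\<phi> y - m) < r / 4"
        using y cd[of m' y] by (simp add: D_def m' dist_norm norm_minus_commute)
      then have "norm (la e) * norm (?\<phi> y - m) < 1 / 4"
      proof (cases "la e = 0")
        case False
        assume n: "norm (?\<phi> y - m) < r / 4"
        have "norm (la e) * norm (?\<phi> y - m) < norm (la e) * (r / 4)"
          using n False by (intro mult_strict_left_mono) auto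
        then show ?thesis using lan[of e] by simp
      qed simp
      then have "\<bar>la e \<bullet> (?\<phi> y - m)\<bar> < 1 / 4" using Cauchy_Schwarz_ineq2[of "la e" "?\<phi> y - m"] by linarith
      moreover have "1 / N \<ge> 1 / 4" using N by (simp add: field_simps)
      moreover have "w e = 1 / N + la e \<bullet> (?\<phi> y - m)" unfolding we using lm[OF e] by (simp add: inner_diff_right)
      ultimately show ?thesis by linarith
    qed
    have "?\<phi> y \<in> convex hull E"
      unfolding convex_hull_finite[OF fE] using w wpos less_imp_le by blast
    then have yF: "?\<phi> y \<in> F" using FE by simp
    have "hat z (?\<phi> y) = (\<Sum>v\<in>E. w v * (ch_a \<bullet> v + ch_b))"
      using hz[of "?\<phi> y"] yF aff by (simp add: F_def)
    also have "\<dots> = (\<Sum>v\<in>E. if v = z then w v else 0)"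
    proof (rule sum.cong[OF refl])
      fix v assume v: "v \<in> E"
      then have "v \<in> closure K" "v \<in> mesh_nodes \<T>" using EK verts_subset[OF K(1)] K(1) mesh_nodes_eq by auto
      then show "w v * (ch_a \<bullet> v + ch_b) = (if v = z then w v else 0)"
      proof -
        assume v: "v \<in> closure K" "v \<in> mesh_nodes \<T>"
        have "ch_a \<bullet> v + ch_b = (if v = z then 1 else 0)"
          unfolding hz[OF v(1), symmetric] by (rule hat(2)[OF v(2)])
        then show ?thesis by simp
      qed
    qed
    also have "\<dots> = w z" using fE zE by simp
    finally show ?thesis using wpos[OF zE] yF by simp
  qed
  define A where "A = {x \<in> space (surface_measure \<Omega>). \<bar>u z\<bar> / 3 \<le> \<bar>u x\<bar> \<and> hat z x > 1/2}"
  have cfr: "continuous_on (frontier \<Omega>) v" if "v \<in> FE_space \<Omega> \<T>" for v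
    using that closure_eq(1) by (auto simp: FE_space_def intro: continuous_on_subset)
  have As: "A \<in> sets (surface_measure \<Omega>)"
  proof -
    have [measurable]: "u \<in> borel_measurable (surface_measure \<Omega>)" "hat z \<in> borel_measurable (surface_measure \<Omega>)"
      using surface_measurable[OF cfr[OF u]] surface_measurable[OF cfr[OF hat(1)]] by auto
    show ?thesis unfolding A_def by measurable
  qed
  have Ab: "A \<in> sets borel"
    using As surface_sets by (auto simp: sets_restrict_space)
  define B where "B = ?\<phi> -` (A \<inter> G)"
  have Bb: "B \<in> sets borel" unfolding B_def by (rule chart_preimage_borel[OF G(1) Ab])
  define f where "f t y = (1 - t) *\<^sub>R z' + t *\<^sub>R y" for t y
  have \<phi>f: "?\<phi> (f t y) = (1 - t) *\<^sub>R z + t *\<^sub>R ?\<phi> y" for t y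
    unfolding f_def ch(2) z' ..
  have zF: "z \<in> F" using G(2) K(2) by (simp add: F_def)
  have fF: "?\<phi> (f t y) \<in> F" if "y \<in> D" "0 < t" "t < 1" for t y
    unfolding \<phi>f using convexD[OF Fc(1) zF, of "?\<phi> y" "1 - t" t] disc[OF that(1)] that by simp
  have hf: "hat z (?\<phi> (f t y)) > 1/2" if y: "y \<in> D" and t: "0 < t" "t \<le> 1/2" for t y
  proof -
    have "hat z (?\<phi> (f t y)) = ch_a \<bullet> ?\<phi> (f t y) + ch_b"
      using hz[of "?\<phi> (f t y)"] fF[OF y] t by (simp add: F_def)
    also have "\<dots> = (1 - t) * (ch_a \<bullet> z + ch_b) + t * (ch_a \<bullet> ?\<phi> y + ch_b)"
      unfolding \<phi>f by (simp add: inner_add_right algebra_simps)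
    also have "\<dots> = (1 - t) * hat z z + t * hat z (?\<phi> y)"
      using hz[of z] hz[of "?\<phi> y"] K(2) disc[OF y] by (simp add: F_def)
    also have "\<dots> = (1 - t) + t * hat z (?\<phi> y)" using hat(2)[OF z(1), of z] by simp
    also have "t * hat z (?\<phi> y) > 0" using disc[OF y] t by simp
    then have "(1 - t) + t * hat z (?\<phi> y) > 1/2" using t by linarith
    finally show ?thesis .
  qed
  have uf: "u (?\<phi> (f t y)) = (1 - t) * u z + t * u (?\<phi> y)" if y: "y \<in> D" and t: "0 < t" "t \<le> 1/2" for t y
  proof -
    have "u (?\<phi> (f t y)) = ua \<bullet> ?\<phi> (f t y) + ub"
      using uab[of "?\<phi> (f t y)"] fF[OF y] t by (simp add: F_def)
    also have "\<dots> = (1 - t) * (ua \<bullet> z + ub) + t * (ua \<bullet> ?\<phi> y + ub)"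
      unfolding \<phi>f by (simp add: inner_add_right algebra_simps)
    also have "\<dots> = (1 - t) * u z + t * u (?\<phi> y)"
      using uab[of z] uab[of "?\<phi> y"] K(2) disc[OF y] by (simp add: F_def)
    finally show ?thesis .
  qed
  \<comment> \<open>The values at parameters 1/4 and 1/2 on the segment from \<open>z\<close>
    extrapolate to \<open>u z\<close> with coefficients 2 and -1, so one of them is at least a third
    of \<open>u z\<close> in absolute value. Parameters up to 1/2 also keep \<open>hat z\<close>
    above 1/2.\<close>
  have Dsub: "D \<subseteq> f (1/2) -` B \<union> f (1/4) -` B"
  proof
    fix y assume y: "y \<in> D"
    have inB: "f t y \<in> B" if t: "0 < t" "t \<le> 1/2" and ge: "\<bar>u z\<bar> / 3 \<le> \<bar>u (?\<phi> (f t y))\<bar>" for t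
    proof -
      have "?\<phi> (f t y) \<in> G" using fF[OF y] t by (simp add: F_def)
      then show ?thesis using Gfr ge hf[OF y t] by (auto simp: B_def A_def surface_space)
    qed
    have "u z = 2 * u (?\<phi> (f (1/4) y)) - u (?\<phi> (f (1/2) y))"
      using uf[OF y, of "1/4"] uf[OF y, of "1/2"] by simp
    then have "\<bar>u z\<bar> / 3 \<le> \<bar>u (?\<phi> (f (1/4) y))\<bar> \<or> \<bar>u z\<bar> / 3 \<le> \<bar>u (?\<phi> (f (1/2) y))\<bar>" by linarith
    then show "y \<in> f (1/2) -` B \<union> f (1/4) -` B" using inB[of "1/4"] inB[of "1/2"] by auto
  qed
  have fb: "f t -` B \<in> sets borel" for t
  proof -
    have "f t \<in> borel_measurable borel" unfolding f_def by (intro borel_measurable_continuous_onI continuous_intros)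
    then show ?thesis using measurable_sets[of "f t" borel borel B] Bb by simp
  qed
  have "emeasure lborel D \<le> emeasure lborel (f (1/2) -` B \<union> f (1/4) -` B)"
    using fb Dsub by (intro emeasure_mono) auto
  also have "\<dots> \<le> emeasure lborel (f (1/2) -` B) + emeasure lborel (f (1/4) -` B)"
    using fb by (intro emeasure_subadditive) auto
  \<comment> \<open>Undoing planar contractions by 1/2 and 1/4 multiplies areas by 4 and 16; their
    sum is the 20 of the statement.\<close>
  also have "\<dots> = ennreal 4 * emeasure lborel B + ennreal 16 * emeasure lborel B"
  proof -
    have e: "emeasure lborel (f t -` B) = ennreal ((1 / t)\<^sup>2) * emeasure lborel B" if "0 < t" for t
      unfolding f_def[abs_def] by (rule emeasure_shrink_vimage[OF Bb that])
    show ?thesis using e[of "1/2"] e[of "1/4"] by (simp add: power2_eq_square)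
  qed
  also have "\<dots> = ennreal 20 * emeasure lborel B"
    by (simp add: distrib_right[symmetric] ennreal_plus[symmetric] del: ennreal_plus ennreal_numeral)
  also have "emeasure lborel B \<le> emeasure (surface_measure \<Omega>) A"
    unfolding surface_emeasure[OF As] B_def using finite_facets G(1) by (intro member_le_sum) auto
  finally have "emeasure lborel D \<le> ennreal 20 * emeasure (surface_measure \<Omega>) A"
    by (simp add: mult_left_mono)
  moreover interpret finite_measure "surface_measure \<Omega>" by (rule surface_finite)
  have "emeasure (surface_measure \<Omega>) A = ennreal (measure (surface_measure \<Omega>) A)" by (rule emeasure_eq_measure)
  moreover have "emeasure lborel D = ennreal (unit_ball_vol 2 * (r / 4)\<^sup>2)"
    unfolding D_def using r(1) by (simp add: emeasure_ball)
  ultimately have "ennreal (unit_ball_vol 2 * (r / 4)\<^sup>2) \<le> ennreal (20 * measure (surface_measure \<Omega>) A)"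
    by (simp add: ennreal_mult)
  then have "unit_ball_vol 2 * (r / 4)\<^sup>2 \<le> 20 * measure (surface_measure \<Omega>) A"
    by (subst (asm) ennreal_le_iff) auto
  then show ?thesis
    using As by (intro bexI[of _ A]) (auto simp: A_def surface_space)
qed

text \<open>The sets of \<open>trace_lower_bound_at_node\<close> for different nodes are disjoint by
  \<open>hat_disjoint\<close>, so their contributions add up. The constant 180 is 20 times 9, the
  square of the 3 in \<open>|u z| / 3\<close>.\<close>

lemma trace_lower_bound:
  assumes r: "r > 0" "\<And>K. K \<in> \<T> \<Longrightarrow> \<exists>x. ball x r \<subseteq> K" and u: "u \<in> FE_space \<Omega> \<T>"
  shows "(\<Sum>z\<in>mesh_nodes \<T> \<inter> frontier \<Omega>. (u z)\<^sup>2) * (unit_ball_vol 2 * (r / 4)\<^sup>2 / 180)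
    \<le> (LINT x|surface_measure \<Omega>. (bdry_trace \<Omega> u x)\<^sup>2)"
proof -
  interpret finite_measure "surface_measure \<Omega>" by (rule surface_finite)
  let ?N = "mesh_nodes \<T> \<inter> frontier \<Omega>"
  have fN: "finite ?N" using finite_nodes by simp
  have "\<forall>z\<in>?N. \<exists>A. A \<in> sets (surface_measure \<Omega>) \<and>
    (\<forall>x\<in>A. x \<in> frontier \<Omega> \<and> \<bar>u z\<bar> / 3 \<le> \<bar>u x\<bar> \<and> hat z x > 1/2) \<and>
    unit_ball_vol 2 * (r / 4)\<^sup>2 / 20 \<le> measure (surface_measure \<Omega>) A"
    using trace_lower_bound_at_node[OF r _ _ u] by blast
  then obtain A where A: "\<And>z. z \<in> ?N \<Longrightarrow> A z \<in> sets (surface_measure \<Omega>)"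
    "\<And>z x. z \<in> ?N \<Longrightarrow> x \<in> A z \<Longrightarrow> x \<in> frontier \<Omega> \<and> \<bar>u z\<bar> / 3 \<le> \<bar>u x\<bar> \<and> hat z x > 1/2"
    "\<And>z. z \<in> ?N \<Longrightarrow> unit_ball_vol 2 * (r / 4)\<^sup>2 / 20 \<le> measure (surface_measure \<Omega>) (A z)"
    by (metis (no_types, lifting))
  have i1: "integrable (surface_measure \<Omega>) (\<lambda>x. \<Sum>z\<in>?N. (u z)\<^sup>2 / 9 * indicator (A z) x)"
    using A(1) by (intro Bochner_Integration.integrable_sum integrable_mult_right integrable_real_indicator)
      (auto simp: emeasure_eq_measure)
  have i2: "integrable (surface_measure \<Omega>) (\<lambda>x. (bdry_trace \<Omega> u x)\<^sup>2)"
    using trace_times_integrable[OF u u] by (simp add: power2_eq_square)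
  have "(\<Sum>z\<in>?N. (u z)\<^sup>2) * (unit_ball_vol 2 * (r / 4)\<^sup>2 / 180) =
      (\<Sum>z\<in>?N. (u z)\<^sup>2 / 9 * (unit_ball_vol 2 * (r / 4)\<^sup>2 / 20))"
    by (simp add: sum_distrib_right)
  also have "\<dots> \<le> (\<Sum>z\<in>?N. (u z)\<^sup>2 / 9 * measure (surface_measure \<Omega>) (A z))"
    using A(3) by (intro sum_mono mult_left_mono) auto
  also have "\<dots> = (LINT x|surface_measure \<Omega>. (\<Sum>z\<in>?N. (u z)\<^sup>2 / 9 * indicator (A z) x))"
  proof -
    have "(LINT x|surface_measure \<Omega>. (\<Sum>z\<in>?N. (u z)\<^sup>2 / 9 * indicator (A z) x)) =
        (\<Sum>z\<in>?N. (LINT x|surface_measure \<Omega>. (u z)\<^sup>2 / 9 * indicator (A z) x))"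
      by (rule Bochner_Integration.integral_sum)
        (use A(1) in \<open>auto intro!: integrable_mult_right integrable_real_indicator simp: emeasure_eq_measure\<close>)
    also have "\<dots> = (\<Sum>z\<in>?N. (u z)\<^sup>2 / 9 * measure (surface_measure \<Omega>) (A z))"
      by (rule sum.cong[OF refl]) (use A(1) in \<open>simp add: sets.Int_space_eq2\<close>)
    finally show ?thesis ..
  qed
  also have "\<dots> \<le> (LINT x|surface_measure \<Omega>. (bdry_trace \<Omega> u x)\<^sup>2)"
  proof (rule integral_mono[OF i1 i2])
    fix x
    show "(\<Sum>z\<in>?N. (u z)\<^sup>2 / 9 * indicator (A z) x) \<le> (bdry_trace \<Omega> u x)\<^sup>2"
    proof (cases "\<exists>z\<in>?N. x \<in> A z")
      case True
      then obtain z where z: "z \<in> ?N" "x \<in> A z" by blast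
      have xf: "x \<in> frontier \<Omega>" using A(2)[OF z] by simp
      have "x \<notin> A z'" if z': "z' \<in> ?N" "z' \<noteq> z" for z'
        using hat_disjoint[of z' z x] A(2)[OF z] A(2)[OF z'(1)] z'(2) closure_eq(1) by blast
      then have "(\<Sum>z\<in>?N. (u z)\<^sup>2 / 9 * indicator (A z) x) = (\<Sum>z'\<in>{z}. (u z')\<^sup>2 / 9 * indicator (A z') x)"
        using fN z by (intro sum.mono_neutral_right) auto
      also have "\<dots> = (\<bar>u z\<bar> / 3)\<^sup>2" using z by (simp add: power2_eq_square)
      also have "\<dots> \<le> \<bar>u x\<bar>\<^sup>2" using A(2)[OF z] by (intro power_mono) auto
      finally show ?thesis using xf by (simp add: bdry_trace_def)
    next
      case False
      then have "(\<Sum>z\<in>?N. (u z)\<^sup>2 / 9 * indicator (A z) x) = 0" by (intro sum.neutral) auto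
      then show ?thesis by simp
    qed
  qed
  finally show ?thesis .
qed

text \<open>The description in \<open>boundary_projection\<close> is proper. The Gram matrix of the
  traces of the frontier hat functions is positive definite by \<open>trace_lower_bound\<close>, so
  the normal equations are solvable; the difference of two solutions is orthogonal to itself, and
  the same bound makes its nodal values vanish.\<close>

lemma boundary_projection_trace:
  assumes r: "r > 0" "\<And>K. K \<in> \<T> \<Longrightarrow> \<exists>x. ball x r \<subseteq> K" and q: "q \<in> L2 (surface_measure \<Omega>)"
  shows "boundary_projection \<Omega> \<T> q \<in> FE_trace_space \<Omega> \<T>"
proof -
  interpret finite_measure "surface_measure \<Omega>" by (rule surface_finite)
  let ?N = "mesh_nodes \<T> \<inter> frontier \<Omega>"
  have fN: "finite ?N" using finite_nodes by simp
  define c0 where "c0 = unit_ball_vol 2 * (r / 4)\<^sup>2 / 180"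
  have c0: "c0 > 0" using r(1) by (simp add: c0_def)
  define t where "t z = bdry_trace \<Omega> (hat z)" for z
  have ti: "integrable (surface_measure \<Omega>) (\<lambda>x. t z x * t z' x)" for z z'
    unfolding t_def by (rule trace_times_integrable[OF hat(1) hat(1)])
  have qi: "integrable (surface_measure \<Omega>) (\<lambda>x. q x * bdry_trace \<Omega> v x)" if v: "v \<in> FE_space \<Omega> \<T>" for v
  proof -
    have q1: "integrable (surface_measure \<Omega>) q"
    proof (rule Bochner_Integration.integrable_bound)
      show "integrable (surface_measure \<Omega>) (\<lambda>x. 1 + (norm (q x))\<^sup>2)" using q by (simp add: L2_def)
      show "q \<in> borel_measurable (surface_measure \<Omega>)" using q by (simp add: L2_def)
      have b: "\<bar>s\<bar> \<le> 1 + s\<^sup>2" for s :: real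
      proof -
        have "0 \<le> (\<bar>s\<bar> - 1)\<^sup>2" by simp
        then have "2 * \<bar>s\<bar> \<le> 1 + s\<^sup>2" by (simp add: power2_diff)
        then show ?thesis by linarith
      qed
      show "AE x in surface_measure \<Omega>. norm (q x) \<le> norm (1 + (norm (q x))\<^sup>2)"
        using b by (intro AE_I2) (simp add: abs_of_nonneg)
    qed
    show ?thesis using integrable_times_bounded[OF q1 bdry_trace_FE(1)[OF v]] bdry_trace_FE(2)[OF v] by blast
  qed
  define G where "G z z' = (LINT x|surface_measure \<Omega>. t z x * t z' x)" for z z'
  have tsum: "bdry_trace \<Omega> (\<lambda>x. \<Sum>z\<in>?N. c z * hat z x) = (\<lambda>x. \<Sum>z\<in>?N. c z * t z x)" for c
    by (auto simp: bdry_trace_def t_def)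
  have nodal: "(\<Sum>z\<in>?N. c z * hat z z') = c z'" if "z' \<in> ?N" for c z'
  proof -
    have "(\<Sum>z\<in>?N. c z * hat z z') = (\<Sum>z\<in>?N. if z = z' then c z else 0)"
      using that by (intro sum.cong) (auto simp: hat(2))
    then show ?thesis using fN that by simp
  qed
  have "\<exists>c. \<forall>i\<in>?N. (\<Sum>j\<in>?N. G i j * c j) = (LINT x|surface_measure \<Omega>. q x * t i x)"
  proof (rule positive_definite_solvable[OF fN])
    fix c :: "real^3 \<Rightarrow> real" assume c: "\<exists>i\<in>?N. c i \<noteq> 0"
    have "0 < (\<Sum>z\<in>?N. (c z)\<^sup>2) * c0"
    proof -
      obtain i where i: "i \<in> ?N" "c i \<noteq> 0" using c by blast
      have "(\<Sum>z\<in>?N. (c z)\<^sup>2) > 0" by (rule sum_pos2[OF fN i(1)]) (use i in auto)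
      then show ?thesis using c0 by simp
    qed
    also have "\<dots> = (\<Sum>z\<in>?N. (\<Sum>z'\<in>?N. c z' * hat z' z)\<^sup>2) * c0"
      using nodal by simp
    also have "\<dots> \<le> (LINT x|surface_measure \<Omega>. (\<Sum>z\<in>?N. c z * t z x)\<^sup>2)"
      using trace_lower_bound[OF r FE_sum[OF fN, of c]] unfolding tsum c0_def by simp
    also have "\<dots> = (LINT x|surface_measure \<Omega>. (\<Sum>i\<in>?N. \<Sum>j\<in>?N. c i * c j * (t i x * t j x)))"
      by (simp add: power2_eq_square sum_product mult_ac)
    also have "\<dots> = (\<Sum>i\<in>?N. \<Sum>j\<in>?N. c i * c j * G i j)"
      unfolding G_def using ti by simp
    also have "\<dots> = (\<Sum>i\<in>?N. c i * (\<Sum>j\<in>?N. G i j * c j))"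
      by (simp add: sum_distrib_left mult_ac)
    finally show "0 < (\<Sum>i\<in>?N. c i * (\<Sum>j\<in>?N. G i j * c j))" .
  qed
  then obtain c where c: "\<And>i. i \<in> ?N \<Longrightarrow> (\<Sum>j\<in>?N. G i j * c j) = (LINT x|surface_measure \<Omega>. q x * t i x)" by blast
  let ?P = "\<lambda>p. p \<in> FE_trace_space \<Omega> \<T> \<and>
      (\<forall>v\<in>FE_trace_space \<Omega> \<T>. (LINT x|surface_measure \<Omega>. (q x - p x) * v x) = 0)"
  define p0 where "p0 = (\<lambda>x. \<Sum>z\<in>?N. c z * t z x)"
  have p0F: "p0 \<in> FE_trace_space \<Omega> \<T>"
    unfolding p0_def tsum[symmetric] FE_trace_space_def using FE_sum[OF fN, of c] by blast
  have trace_rep: "bdry_trace \<Omega> v = (\<lambda>x. \<Sum>z\<in>?N. v z * t z x)" if v: "v \<in> FE_space \<Omega> \<T>" for v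
  proof -
    have d: "(\<lambda>x. 1 * v x + (- 1) * (\<Sum>z\<in>?N. v z * hat z x)) \<in> FE_space \<Omega> \<T>"
      by (rule FE_lincomb[OF v FE_sum[OF fN]])
    have "v x = (\<Sum>z\<in>?N. v z * hat z x)" if "x \<in> frontier \<Omega>" for x
      using FE_zero_on_frontier[OF d _ that] nodal by simp
    then show ?thesis unfolding tsum[symmetric] by (auto simp: bdry_trace_def)
  qed
  have "\<exists>!p. ?P p"
  proof (rule ex_ex1I)
    have "(LINT x|surface_measure \<Omega>. (q x - p0 x) * v x) = 0" if vF: "v \<in> FE_trace_space \<Omega> \<T>" for v
    proof -
      obtain v' where v': "v' \<in> FE_space \<Omega> \<T>" "v = bdry_trace \<Omega> v'" using vF by (auto simp: FE_trace_space_def)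
      have "(LINT x|surface_measure \<Omega>. (q x - p0 x) * v x) =
          (LINT x|surface_measure \<Omega>. (\<Sum>i\<in>?N. v' i * (q x * t i x - (\<Sum>j\<in>?N. c j * (t i x * t j x)))))"
      proof (rule Bochner_Integration.integral_cong[OF refl])
        fix x
        define s where "s = (\<Sum>j\<in>?N. c j * t j x)"
        have "(\<Sum>j\<in>?N. c j * (t i x * t j x)) = t i x * s" for i
          unfolding s_def sum_distrib_left by (rule sum.cong) (simp_all add: mult_ac)
        then have "(\<Sum>i\<in>?N. v' i * (q x * t i x - (\<Sum>j\<in>?N. c j * (t i x * t j x)))) =
            (\<Sum>i\<in>?N. (q x - s) * (v' i * t i x))"
          by (intro sum.cong) (simp_all add: algebra_simps)
        also have "\<dots> = (q x - p0 x) * v x"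
          unfolding v'(2) trace_rep[OF v'(1)] p0_def s_def sum_distrib_left ..
        finally show "(q x - p0 x) * v x =
          (\<Sum>i\<in>?N. v' i * (q x * t i x - (\<Sum>j\<in>?N. c j * (t i x * t j x))))" ..
      qed
      also have "\<dots> = (\<Sum>i\<in>?N. v' i * ((LINT x|surface_measure \<Omega>. q x * t i x) - (\<Sum>j\<in>?N. c j * G i j)))"
        unfolding G_def using ti qi[OF hat(1)] by (simp add: t_def)
      also have "\<dots> = 0" using c by (simp add: mult.commute)
      finally show ?thesis .
    qed
    then show "\<exists>p. ?P p" using p0F by blast
  next
    fix p p' assume p: "?P p" and p': "?P p'"
    obtain w where w: "w \<in> FE_space \<Omega> \<T>" "p = bdry_trace \<Omega> w" using p by (auto simp: FE_trace_space_def)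
    obtain w' where w': "w' \<in> FE_space \<Omega> \<T>" "p' = bdry_trace \<Omega> w'" using p' by (auto simp: FE_trace_space_def)
    define d where "d = (\<lambda>x. 1 * w x + (- 1) * w' x)"
    have d: "d \<in> FE_space \<Omega> \<T>" unfolding d_def by (rule FE_lincomb[OF w(1) w'(1)])
    have dt: "bdry_trace \<Omega> d = (\<lambda>x. p x - p' x)" by (auto simp: d_def w(2) w'(2) bdry_trace_def)
    have dT: "bdry_trace \<Omega> d \<in> FE_trace_space \<Omega> \<T>" using d by (auto simp: FE_trace_space_def)
    have ip: "integrable (surface_measure \<Omega>) (\<lambda>x. (q x - p x) * bdry_trace \<Omega> d x)"
      unfolding w(2) left_diff_distrib using qi[OF d] trace_times_integrable[OF w(1) d] by simp
    have ip': "integrable (surface_measure \<Omega>) (\<lambda>x. (q x - p' x) * bdry_trace \<Omega> d x)"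
      unfolding w'(2) left_diff_distrib using qi[OF d] trace_times_integrable[OF w'(1) d] by simp
    have "(LINT x|surface_measure \<Omega>. (bdry_trace \<Omega> d x)\<^sup>2) =
        (LINT x|surface_measure \<Omega>. (q x - p' x) * bdry_trace \<Omega> d x - (q x - p x) * bdry_trace \<Omega> d x)"
      by (rule Bochner_Integration.integral_cong) (simp_all add: dt power2_eq_square algebra_simps)
    also have "\<dots> = 0" using ip ip' p p' dT by simp
    finally have "(\<Sum>z\<in>?N. (d z)\<^sup>2) * c0 \<le> 0" using trace_lower_bound[OF r d] by (simp add: c0_def)
    then have "(\<Sum>z\<in>?N. (d z)\<^sup>2) \<le> 0" using c0 by (simp add: mult_le_0_iff)
    then have "(\<Sum>z\<in>?N. (d z)\<^sup>2) = 0" by (simp add: sum_nonneg antisym)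
    then have dz: "\<And>z. z \<in> ?N \<Longrightarrow> d z = 0" using fN by (subst (asm) sum_nonneg_eq_0_iff) auto
    have "bdry_trace \<Omega> d = (\<lambda>x. 0)" using FE_zero_on_frontier[OF d dz] by (auto simp: bdry_trace_def)
    then show "p = p'" unfolding dt by (metis eq_iff_diff_eq_0 ext)
  qed
  then have "?P (boundary_projection \<Omega> \<T> q)" unfolding boundary_projection_def by (rule theI')
  then show ?thesis by blast
qed

end

subsection \<open>The weight\<close>

text \<open>Boundedness is included to make the class closed under products, and with a positive
  lower bound also under reciprocals. All ingredients of the weight are built in this way from
  affine functions.\<close>

definition lipb :: "'a::real_normed_vector set \<Rightarrow> ('a \<Rightarrow> real) \<Rightarrow> bool"
  where "lipb S f \<longleftrightarrow> (\<exists>L\<ge>0. \<exists>B\<ge>0. \<forall>x\<in>S. \<bar>f x\<bar> \<le> B \<and> (\<forall>y\<in>S. \<bar>f x - f y\<bar> \<le> L * norm (x - y)))"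

lemma lipbI:
  assumes "L \<ge> 0" "B \<ge> 0" "\<And>x. x \<in> S \<Longrightarrow> \<bar>f x\<bar> \<le> B"
    "\<And>x y. x \<in> S \<Longrightarrow> y \<in> S \<Longrightarrow> \<bar>f x - f y\<bar> \<le> L * norm (x - y)"
  shows "lipb S f"
  unfolding lipb_def using assms by blast

lemma lipb_mult:
  assumes "lipb S f" "lipb S g" shows "lipb S (\<lambda>x. f x * g x)"
proof -
  obtain L1 B1 where 1: "L1 \<ge> 0" "B1 \<ge> 0" "\<And>x. x \<in> S \<Longrightarrow> \<bar>f x\<bar> \<le> B1"
    "\<And>x y. x \<in> S \<Longrightarrow> y \<in> S \<Longrightarrow> \<bar>f x - f y\<bar> \<le> L1 * norm (x - y)"
    using assms(1) unfolding lipb_def by blast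
  obtain A2 B2 where 2: "A2 \<ge> 0" "B2 \<ge> 0" "\<And>x. x \<in> S \<Longrightarrow> \<bar>g x\<bar> \<le> B2"
    "\<And>x y. x \<in> S \<Longrightarrow> y \<in> S \<Longrightarrow> \<bar>g x - g y\<bar> \<le> A2 * norm (x - y)"
    using assms(2) unfolding lipb_def by blast
  show ?thesis
  proof (rule lipbI[of "B1 * A2 + L1 * B2" "B1 * B2"])
    fix x y assume xy: "x \<in> S" "y \<in> S"
    show "\<bar>f x * g x\<bar> \<le> B1 * B2" unfolding abs_mult using 1 2 xy by (intro mult_mono) auto
    have "f x * g x - f y * g y = f x * (g x - g y) + (f x - f y) * g y" by (simp add: algebra_simps)
    also have "\<bar>\<dots>\<bar> \<le> \<bar>f x\<bar> * \<bar>g x - g y\<bar> + \<bar>f x - f y\<bar> * \<bar>g y\<bar>"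
      by (metis abs_mult abs_triangle_ineq)
    also have "\<dots> \<le> B1 * (A2 * norm (x - y)) + (L1 * norm (x - y)) * B2"
      using 1 2 xy by (intro add_mono mult_mono) auto
    finally show "\<bar>f x * g x - f y * g y\<bar> \<le> (B1 * A2 + L1 * B2) * norm (x - y)" by (simp add: algebra_simps)
  qed (use 1 2 in auto)
qed

lemma lipb_sum:
  assumes "finite I" "\<And>i. i \<in> I \<Longrightarrow> lipb S (f i)" shows "lipb S (\<lambda>x. \<Sum>i\<in>I. f i x)"
  using assms
proof (induction I rule: finite_induct)
  case empty
  show ?case by (rule lipbI[of 0 0]) auto
next
  case (insert i I)
  obtain L1 B1 where 1: "L1 \<ge> 0" "B1 \<ge> 0" "\<And>x. x \<in> S \<Longrightarrow> \<bar>f i x\<bar> \<le> B1"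
    "\<And>x y. x \<in> S \<Longrightarrow> y \<in> S \<Longrightarrow> \<bar>f i x - f i y\<bar> \<le> L1 * norm (x - y)"
    using insert.prems[of i] unfolding lipb_def by blast
  obtain A2 B2 where 2: "A2 \<ge> 0" "B2 \<ge> 0" "\<And>x. x \<in> S \<Longrightarrow> \<bar>\<Sum>i\<in>I. f i x\<bar> \<le> B2"
    "\<And>x y. x \<in> S \<Longrightarrow> y \<in> S \<Longrightarrow> \<bar>(\<Sum>i\<in>I. f i x) - (\<Sum>i\<in>I. f i y)\<bar> \<le> A2 * norm (x - y)"
    using insert.IH insert.prems unfolding lipb_def by blast
  show ?case
  proof (rule lipbI[of "L1 + A2" "B1 + B2"])
    fix x y assume xy: "x \<in> S" "y \<in> S"
    show "\<bar>\<Sum>i\<in>insert i I. f i x\<bar> \<le> B1 + B2" using insert.hyps 1(3)[OF xy(1)] 2(3)[OF xy(1)] by simp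
    show "\<bar>(\<Sum>i\<in>insert i I. f i x) - (\<Sum>i\<in>insert i I. f i y)\<bar> \<le> (L1 + A2) * norm (x - y)"
      using insert.hyps 1(4)[OF xy] 2(4)[OF xy] by (simp add: distrib_right)
  qed (use 1 2 in auto)
qed

lemma lipb_inverse:
  assumes "lipb S f" "c > 0" "\<And>x. x \<in> S \<Longrightarrow> f x \<ge> c" shows "lipb S (\<lambda>x. inverse (f x))"
proof -
  obtain L B where 1: "L \<ge> 0" "\<And>x y. x \<in> S \<Longrightarrow> y \<in> S \<Longrightarrow> \<bar>f x - f y\<bar> \<le> L * norm (x - y)"
    using assms(1) unfolding lipb_def by blast
  have b: "0 < inverse (f x)" "inverse (f x) \<le> inverse c" if "x \<in> S" for x
    using assms(2) assms(3)[OF that] by (auto intro: le_imp_inverse_le)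
  show ?thesis
  proof (rule lipbI[of "inverse c * L * inverse c" "inverse c"])
    fix x y assume xy: "x \<in> S" "y \<in> S"
    show "\<bar>inverse (f x)\<bar> \<le> inverse c" using b[OF xy(1)] by simp
    have "f x > 0" "f y > 0" using assms(2) assms(3) xy by force+
    then have "inverse (f x) - inverse (f y) = inverse (f x) * (f y - f x) * inverse (f y)"
      by (simp add: field_simps)
    also have "\<bar>\<dots>\<bar> \<le> inverse c * (L * norm (x - y)) * inverse c"
      unfolding abs_mult using b[OF xy(1)] b[OF xy(2)] 1 xy assms(2)
      by (intro mult_mono) (auto simp: abs_minus_commute)
    finally show "\<bar>inverse (f x) - inverse (f y)\<bar> \<le> inverse c * L * inverse c * norm (x - y)"
      by (simp add: mult_ac)
  qed (use 1 assms(2) in auto)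
qed

text \<open>The remainder of the harmonic mean is the difference between a weighted harmonic and a weighted
  arithmetic mean of \<open>1 + e i\<close>.\<close>

lemma harmonic_remainder:
  fixes q q' e :: "'i \<Rightarrow> real"
  assumes "finite I" "I \<noteq> {}" "\<And>i. i \<in> I \<Longrightarrow> q i > 0"
    and "\<And>i. i \<in> I \<Longrightarrow> q' i = q i / (1 + e i)" "\<And>i. i \<in> I \<Longrightarrow> \<bar>e i\<bar> \<le> 1/2"
    and w: "w = inverse (sum q I)" "w' = inverse (sum q' I)"
  shows "\<bar>w' - w - w * (\<Sum>i\<in>I. w * q i * e i)\<bar> \<le> 2 * w * (\<Sum>i\<in>I. w * q i * (e i)\<^sup>2)"
proof -
  have Q: "sum q I > 0" using assms(1-3) by (intro sum_pos) auto
  then have w0: "w > 0" by (simp add: w)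
  \<comment> \<open>Weights with sum 1: \<open>w' / w\<close> is the harmonic mean of the
    \<open>1 + e i\<close> with respect to them, that is \<open>1 / P\<close>, while their
    arithmetic mean is \<open>1 + A\<close>.\<close>
  define a where "a i = w * q i" for i
  have a: "\<And>i. i \<in> I \<Longrightarrow> a i > 0" using assms(3) w0 by (simp add: a_def)
  have a1: "sum a I = 1" using Q by (simp add: a_def sum_distrib_left[symmetric] w)
  define A where "A = (\<Sum>i\<in>I. a i * e i)"
  define V where "V = (\<Sum>i\<in>I. a i * (e i)\<^sup>2)"
  define P where "P = (\<Sum>i\<in>I. a i / (1 + e i))"
  have e1: "1 + e i \<ge> 1/2" if "i \<in> I" for i using assms(5)[OF that] by linarith
  have lower: "1 - x \<le> 1 / (1 + x)" and upper: "1 / (1 + x) \<le> 1 - x + 2 * x\<^sup>2" if "\<bar>x\<bar> \<le> 1/2" for x :: real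
  proof -
    have x: "1 + x > 0" using that by linarith
    have "(1 - x) * (1 + x) \<le> 1" by (simp add: algebra_simps)
    then show "1 - x \<le> 1 / (1 + x)" using x by (simp add: le_divide_eq)
    have "0 \<le> x\<^sup>2 * (1 + 2 * x)" using that by (intro mult_nonneg_nonneg) auto
    then have "1 \<le> (1 - x + 2 * x\<^sup>2) * (1 + x)" by (simp add: algebra_simps power2_eq_square)
    then show "1 / (1 + x) \<le> 1 - x + 2 * x\<^sup>2" using x by (simp add: divide_le_eq)
  qed
  have Pu: "P \<le> 1 - A + 2 * V"
  proof -
    have "P = (\<Sum>i\<in>I. a i * (1 / (1 + e i)))" by (simp add: P_def)
    also have "\<dots> \<le> (\<Sum>i\<in>I. a i * (1 - e i + 2 * (e i)\<^sup>2))"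
      using a assms(5) upper by (intro sum_mono mult_left_mono) (auto simp: less_imp_le)
    also have "\<dots> = (\<Sum>i\<in>I. a i) - (\<Sum>i\<in>I. a i * e i) + 2 * (\<Sum>i\<in>I. a i * (e i)\<^sup>2)"
      by (simp add: algebra_simps sum.distrib sum_subtractf sum_distrib_left)
    also have "\<dots> = 1 - A + 2 * V" by (simp add: A_def V_def a1)
    finally show ?thesis .
  qed
  have P0: "P > 0" unfolding P_def using assms(1,2) a e1 by (intro sum_pos divide_pos_pos) (auto intro: less_le_trans[of 0 "1/2"])
  have "P = w * (\<Sum>i\<in>I. q i / (1 + e i))" by (simp add: P_def a_def sum_distrib_left)
  also have "(\<Sum>i\<in>I. q i / (1 + e i)) = sum q' I" using assms(4) by (intro sum.cong) auto
  finally have "w' = w / P" using w0 unfolding w(2) by (simp add: divide_inverse)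
  then have w'eq: "w' - w - w * A = w * (1 / P - 1 - A)" by (simp add: algebra_simps)
  have "1 / P - 1 - A \<le> 2 * V"
  proof -
    \<comment> \<open>The harmonic mean does not exceed the arithmetic one, by Cauchy-Schwarz
      applied to the square roots of \<open>a i * m i\<close> and \<open>a i / m i\<close>.\<close>
    define m where "m i = 1 + e i" for i
    have "(1 + A) * P \<ge> 1"
    proof -
      have "(\<Sum>i\<in>I. sqrt (a i * m i) * sqrt (a i / m i))\<^sup>2 \<le> (\<Sum>i\<in>I. (sqrt (a i * m i))\<^sup>2) * (\<Sum>i\<in>I. (sqrt (a i / m i))\<^sup>2)"
        by (rule Cauchy_Schwarz_ineq_sum)
      moreover have m0: "m i > 0" if "i \<in> I" for i using e1[OF that] by (simp add: m_def)
      have "(\<Sum>i\<in>I. sqrt (a i * m i) * sqrt (a i / m i)) = sum a I"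
      proof (rule sum.cong[OF refl])
        fix i assume i: "i \<in> I"
        have "sqrt (a i * m i) * sqrt (a i / m i) = sqrt ((a i)\<^sup>2)"
          using m0[OF i] by (simp add: real_sqrt_mult[symmetric] power2_eq_square)
        then show "sqrt (a i * m i) * sqrt (a i / m i) = a i" using a[OF i] by simp
      qed
      moreover have "(\<Sum>i\<in>I. (sqrt (a i * m i))\<^sup>2) = (\<Sum>i\<in>I. a i * m i)"
        using a m0 by (intro sum.cong) (auto simp: less_imp_le)
      moreover have "(\<Sum>i\<in>I. a i * m i) = 1 + A"
        by (simp add: m_def A_def distrib_left sum.distrib a1)
      moreover have "(\<Sum>i\<in>I. (sqrt (a i / m i))\<^sup>2) = P"
        unfolding P_def m_def[symmetric] using a m0 by (intro sum.cong) (auto simp: less_imp_le)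
      ultimately show ?thesis by (simp add: a1)
    qed
    then have "1 / P \<le> 1 + A" using P0 by (simp add: divide_le_eq)
    moreover have "V \<ge> 0" unfolding V_def using a by (intro sum_nonneg) (auto simp: less_imp_le)
    ultimately show ?thesis by linarith
  qed
  moreover have "- (2 * V) \<le> 1 / P - 1 - A"
  proof -
    \<comment> \<open>The tangent of \<open>1 / x\<close> at 1 lies below its graph; this turns the
      upper bound \<open>Pu\<close> for \<open>P\<close> into a lower bound for
      \<open>1 / P\<close>.\<close>
    have p2: "2 - x \<le> 1 / x" if "x > 0" for x :: real
    proof -
      have "0 \<le> (x - 1)\<^sup>2" by simp
      then have "(2 - x) * x \<le> 1" by (simp add: power2_eq_square algebra_simps)
      then show ?thesis using that by (simp add: le_divide_eq)
    qed
    show ?thesis using p2[OF P0] Pu by linarith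
  qed
  ultimately have "\<bar>1 / P - 1 - A\<bar> \<le> 2 * V" by linarith
  then have "w * \<bar>1 / P - 1 - A\<bar> \<le> w * (2 * V)" using w0 by (intro mult_left_mono) auto
  then have "\<bar>w' - w - w * A\<bar> \<le> 2 * w * V" unfolding w'eq abs_mult using w0 by simp
  then show ?thesis by (simp add: A_def V_def a_def)
qed

text \<open>The pairs in \<open>I\<close> are the outer unit normals and the offsets of half-spaces that cut out the domain.\<close>

locale weighted_mesh = fe_mesh +
  fixes I :: "((real^3) \<times> real) set" and h r k :: real
  assumes I: "finite I" "I \<noteq> {}"
    and unit: "\<And>i. i \<in> I \<Longrightarrow> norm (fst i) = 1"
    and inside: "\<And>i x. i \<in> I \<Longrightarrow> x \<in> closure \<Omega> \<Longrightarrow> fst i \<bullet> x \<le> snd i"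
    and front: "\<And>x. x \<in> frontier \<Omega> \<Longrightarrow> \<exists>i\<in>I. fst i \<bullet> x = snd i"
    and h: "h > 0" and r: "r > 0"
    and diam: "\<And>K x y. K \<in> \<T> \<Longrightarrow> x \<in> closure K \<Longrightarrow> y \<in> closure K \<Longrightarrow> norm (x - y) \<le> h"
    and inball: "\<And>K. K \<in> \<T> \<Longrightarrow> \<exists>x. ball x r \<subseteq> K"
    and k: "k \<ge> 2" "k \<ge> card I"
begin

definition y :: "(real^3) \<times> real \<Rightarrow> real^3 \<Rightarrow> real"
  where "y i x = k * h + (snd i - fst i \<bullet> x)"

definition q :: "(real^3) \<times> real \<Rightarrow> real^3 \<Rightarrow> real"
  where "q i x = inverse (y i x)"

definition \<omega> :: "real^3 \<Rightarrow> real"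
  where "\<omega> x = inverse (\<Sum>i\<in>I. q i x)"

text \<open>The share of \<open>i\<close> in the sum defining \<open>1 / \<omega>\<close>. The
  shares add up to 1, and the gradient of \<omega> is the sum of the inner normals weighted with
  their squares.\<close>

definition t :: "(real^3) \<times> real \<Rightarrow> real^3 \<Rightarrow> real"
  where "t i x = \<omega> x * q i x"

definition N :: real
  where "N = card I"

lemma N: "N \<ge> 1"
  using I by (simp add: N_def Suc_le_eq card_gt_0_iff)

lemma kh: "k * h > 0"
  using k(1) h by simp

lemma y_ge: "i \<in> I \<Longrightarrow> x \<in> closure \<Omega> \<Longrightarrow> k * h \<le> y i x"
  using inside by (simp add: y_def)

lemma y_pos: "i \<in> I \<Longrightarrow> x \<in> closure \<Omega> \<Longrightarrow> 0 < y i x"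
  using y_ge kh by (meson less_le_trans)

lemma q_pos: "i \<in> I \<Longrightarrow> x \<in> closure \<Omega> \<Longrightarrow> 0 < q i x"
  using y_pos by (simp add: q_def)

lemma sum_q_pos: "x \<in> closure \<Omega> \<Longrightarrow> 0 < (\<Sum>i\<in>I. q i x)"
  using I q_pos by (intro sum_pos) auto

lemma \<omega>_pos: "x \<in> closure \<Omega> \<Longrightarrow> 0 < \<omega> x"
  using sum_q_pos by (simp add: \<omega>_def)

lemma \<omega>_le_y: "i \<in> I \<Longrightarrow> x \<in> closure \<Omega> \<Longrightarrow> \<omega> x \<le> y i x"
proof -
  assume i: "i \<in> I" "x \<in> closure \<Omega>"
  have "q i x \<le> (\<Sum>i\<in>I. q i x)"
    using i I q_pos by (intro member_le_sum) (auto simp: less_imp_le)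
  then have "\<omega> x \<le> inverse (q i x)" unfolding \<omega>_def using q_pos[OF i] by (intro le_imp_inverse_le)
  then show ?thesis by (simp add: q_def)
qed

lemma sum_q_le: "x \<in> closure \<Omega> \<Longrightarrow> (\<Sum>i\<in>I. q i x) \<le> N / (k * h)"
proof -
  assume x: "x \<in> closure \<Omega>"
  have "(\<Sum>i\<in>I. q i x) \<le> (\<Sum>i\<in>I. inverse (k * h))"
    unfolding q_def using y_ge[OF _ x] kh by (intro sum_mono le_imp_inverse_le) auto
  then show ?thesis by (simp add: N_def divide_inverse)
qed

lemma \<omega>_ge: "x \<in> closure \<Omega> \<Longrightarrow> k * h / N \<le> \<omega> x"
  using le_imp_inverse_le[OF sum_q_le sum_q_pos] by (simp add: \<omega>_def)

text \<open>The purpose of \<open>k \<ge> card I\<close>: with it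
  \<open>h / \<omega> \<le> 1\<close>, by which a surplus factor in the interpolation error is
  removed.\<close>

lemma \<omega>_ge_h: "x \<in> closure \<Omega> \<Longrightarrow> h \<le> \<omega> x"
proof -
  assume x: "x \<in> closure \<Omega>"
  have "h * N \<le> k * h" using k(2) h by (simp add: N_def mult.commute mult_left_mono)
  then have "h \<le> k * h / N" using N by (simp add: le_divide_eq)
  then show ?thesis using \<omega>_ge[OF x] by linarith
qed

lemma t_pos: "i \<in> I \<Longrightarrow> x \<in> closure \<Omega> \<Longrightarrow> 0 < t i x"
  by (simp add: t_def \<omega>_pos q_pos)

lemma sum_t: "x \<in> closure \<Omega> \<Longrightarrow> (\<Sum>i\<in>I. t i x) = 1"
  using sum_q_pos[of x] by (simp add: t_def \<omega>_def sum_distrib_left[symmetric])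

lemma t_le_1: "i \<in> I \<Longrightarrow> x \<in> closure \<Omega> \<Longrightarrow> t i x \<le> 1"
  using member_le_sum[of i I "\<lambda>i. t i x"] I t_pos[of _ x] sum_t[of x] by (simp add: less_imp_le)

lemma q_derivative:
  assumes "i \<in> I" "x \<in> closure \<Omega>"
  shows "q i differentiable at x" "grad (q i) x = (q i x)\<^sup>2 *\<^sub>R fst i"
proof -
  have "(y i has_derivative (\<lambda>v. - (fst i \<bullet> v))) (at x)"
    unfolding y_def[abs_def] by (auto intro!: derivative_eq_intros)
  from Deriv.has_derivative_inverse[OF _ this] y_pos[OF assms]
  have d: "(q i has_derivative (\<lambda>v. ((q i x)\<^sup>2 *\<^sub>R fst i) \<bullet> v)) (at x)"
    unfolding q_def[abs_def] by (simp add: power2_eq_square mult_ac)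
  show "q i differentiable at x" using d by (auto simp: differentiable_def)
  show "grad (q i) x = (q i x)\<^sup>2 *\<^sub>R fst i" by (rule grad_eq[OF d])
qed

lemma \<omega>_derivative:
  assumes x: "x \<in> closure \<Omega>"
  shows "\<omega> differentiable at x" "grad \<omega> x = - (\<Sum>i\<in>I. (t i x)\<^sup>2 *\<^sub>R fst i)"
proof -
  have "((\<lambda>x. \<Sum>i\<in>I. q i x) has_derivative (\<lambda>v. \<Sum>i\<in>I. grad (q i) x \<bullet> v)) (at x)"
    using has_derivative_grad[OF q_derivative(1)[OF _ x]] by (intro has_derivative_sum) auto
  from Deriv.has_derivative_inverse[OF _ this] sum_q_pos[OF x]
  have "(\<omega> has_derivative (\<lambda>v. - (\<omega> x * (\<Sum>i\<in>I. grad (q i) x \<bullet> v) * \<omega> x))) (at x)"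
    unfolding \<omega>_def[abs_def] by simp
  moreover have "- (\<omega> x * (\<Sum>i\<in>I. grad (q i) x \<bullet> v) * \<omega> x) = (- (\<Sum>i\<in>I. (t i x)\<^sup>2 *\<^sub>R fst i)) \<bullet> v" for v
    using q_derivative(2)[OF _ x]
    by (simp add: inner_sum_left t_def power2_eq_square sum_distrib_left sum_distrib_right mult_ac)
  ultimately have d: "(\<omega> has_derivative (\<lambda>v. (- (\<Sum>i\<in>I. (t i x)\<^sup>2 *\<^sub>R fst i)) \<bullet> v)) (at x)" by simp
  show "\<omega> differentiable at x" using d by (auto simp: differentiable_def)
  show "grad \<omega> x = - (\<Sum>i\<in>I. (t i x)\<^sup>2 *\<^sub>R fst i)" by (rule grad_eq[OF d])
qed

text \<open>The sum of squares is kept, besides the simpler bound by 1 that follows, because the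
  superharmonicity of \<omega> depends on it.\<close>

lemma norm_grad_\<omega>: "x \<in> closure \<Omega> \<Longrightarrow> norm (grad \<omega> x) \<le> (\<Sum>i\<in>I. (t i x)\<^sup>2)"
proof -
  assume x: "x \<in> closure \<Omega>"
  have "norm (grad \<omega> x) \<le> (\<Sum>i\<in>I. norm ((t i x)\<^sup>2 *\<^sub>R fst i))"
    unfolding \<omega>_derivative(2)[OF x] norm_minus_cancel by (rule norm_sum)
  also have "\<dots> = (\<Sum>i\<in>I. (t i x)\<^sup>2)" using unit by simp
  finally show ?thesis .
qed

lemma norm_grad_\<omega>_le_1: "x \<in> closure \<Omega> \<Longrightarrow> norm (grad \<omega> x) \<le> 1"
proof -
  assume x: "x \<in> closure \<Omega>"
  have "(\<Sum>i\<in>I. (t i x)\<^sup>2) \<le> (\<Sum>i\<in>I. t i x)"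
    using t_pos[OF _ x] t_le_1[OF _ x]
    by (intro sum_mono) (simp add: power2_eq_square mult_left_le less_imp_le)
  then show ?thesis using norm_grad_\<omega>[OF x] sum_t[OF x] by simp
qed

lemma t_derivative:
  assumes "i \<in> I" "x \<in> closure \<Omega>"
  shows "t i differentiable at x" "grad (t i) x = (\<omega> x * (q i x)\<^sup>2) *\<^sub>R fst i + q i x *\<^sub>R grad \<omega> x"
proof -
  show "t i differentiable at x"
    unfolding t_def[abs_def] using \<omega>_derivative(1)[OF assms(2)] q_derivative(1)[OF assms] by (rule differentiable_mult)
  show "grad (t i) x = (\<omega> x * (q i x)\<^sup>2) *\<^sub>R fst i + q i x *\<^sub>R grad \<omega> x"
    using grad_mult[OF \<omega>_derivative(1)[OF assms(2)] q_derivative(1)[OF assms]] q_derivative(2)[OF assms]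
    by (simp add: t_def[abs_def])
qed

lemma q_continuous: "i \<in> I \<Longrightarrow> continuous_on (closure \<Omega>) (q i)"
  unfolding q_def[abs_def] y_def[abs_def] using y_pos
  by (intro continuous_intros) (auto simp: y_def dest: y_pos)

lemma \<omega>_continuous: "continuous_on (closure \<Omega>) \<omega>"
proof -
  have "continuous_on (closure \<Omega>) (\<lambda>x. \<Sum>i\<in>I. q i x)"
    by (intro continuous_on_sum q_continuous)
  then show ?thesis unfolding \<omega>_def[abs_def]
    by (rule continuous_on_inverse) (use sum_q_pos in force)
qed

lemma t_continuous: "i \<in> I \<Longrightarrow> continuous_on (closure \<Omega>) (t i)"
  unfolding t_def[abs_def] using q_continuous \<omega>_continuous by (intro continuous_intros) auto

lemma grad_\<omega>_continuous: "continuous_on (closure \<Omega>) (grad \<omega>)"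
proof -
  have "continuous_on (closure \<Omega>) (\<lambda>x. - (\<Sum>i\<in>I. (t i x)\<^sup>2 *\<^sub>R fst i))"
    using t_continuous by (intro continuous_intros) auto
  then show ?thesis by (rule continuous_on_cong[THEN iffD1, rotated 2]) (simp_all add: \<omega>_derivative(2))
qed

lemma lipb_y: "i \<in> I \<Longrightarrow> lipb (closure \<Omega>) (y i)"
proof -
  assume i: "i \<in> I"
  have "bounded (closure \<Omega>)" using \<Omega>(2) by (rule bounded_closure)
  then obtain R where R: "\<And>x. x \<in> closure \<Omega> \<Longrightarrow> norm x \<le> R" by (auto simp: bounded_iff)
  have R0: "R \<ge> 0"
    using R \<Omega>(4) closure_subset by (metis all_not_in_conv norm_ge_zero order_trans subsetD)
  show ?thesis
  proof (rule lipbI[of 1 "k * h + \<bar>snd i\<bar> + R"])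
    fix x z assume xz: "x \<in> closure \<Omega>" "z \<in> closure \<Omega>"
    have "\<bar>fst i \<bullet> x\<bar> \<le> norm x" for x using Cauchy_Schwarz_ineq2[of "fst i" x] unit[OF i] by simp
    then have "\<bar>fst i \<bullet> x\<bar> \<le> R" "\<bar>fst i \<bullet> (x - z)\<bar> \<le> norm (x - z)" using R[OF xz(1)] by (auto intro: order_trans)
    then show "\<bar>y i x\<bar> \<le> k * h + \<bar>snd i\<bar> + R" "\<bar>y i x - y i z\<bar> \<le> 1 * norm (x - z)"
      unfolding y_def inner_diff_right using kh by linarith+
  qed (use kh R0 in auto)
qed

lemma lipb_q: "i \<in> I \<Longrightarrow> lipb (closure \<Omega>) (q i)"
  unfolding q_def[abs_def] using lipb_inverse[OF lipb_y kh y_ge] .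

lemma lipb_\<omega>: "lipb (closure \<Omega>) \<omega>"
proof -
  have "bounded ((\<lambda>x. \<omega> x) ` closure \<Omega>)"
    using compact_continuous_image[OF \<omega>_continuous] \<Omega>(2) by (simp add: compact_closure compact_imp_bounded)
  then obtain M where M: "M > 0" "\<And>x. x \<in> closure \<Omega> \<Longrightarrow> \<bar>\<omega> x\<bar> \<le> M" by (auto simp: bounded_pos)
  have Ml: "inverse M \<le> (\<Sum>i\<in>I. q i x)" if x: "x \<in> closure \<Omega>" for x
  proof -
    have "inverse M \<le> inverse (\<omega> x)" using M(2)[OF x] \<omega>_pos[OF x] by (intro le_imp_inverse_le) auto
    then show ?thesis by (simp add: \<omega>_def)
  qed
  show ?thesis unfolding \<omega>_def[abs_def]
    by (rule lipb_inverse[of _ _ "inverse M"]) (use lipb_sum[OF I(1) lipb_q] M Ml in auto)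
qed

lemma lipb_t: "i \<in> I \<Longrightarrow> lipb (closure \<Omega>) (t i)"
  unfolding t_def[abs_def] by (intro lipb_mult lipb_\<omega> lipb_q)

text \<open>In terms of the relative increments \<open>e i\<close> of the affine functions
  \<open>y i\<close> this is \<open>harmonic_remainder\<close>: the linear term is
  \<open>grad \<omega> x \<bullet> (z - x)\<close>, and \<open>q i x \<le> 1 / \<omega> x\<close>
  turns the quadratic one into the bound. The assumption \<open>k \<ge> 2\<close> keeps the
  increments at most 1/2 in absolute value.\<close>

lemma taylor_\<omega>:
  assumes x: "x \<in> closure \<Omega>" and z: "z \<in> closure \<Omega>" and xz: "norm (z - x) \<le> h"
  shows "\<bar>\<omega> z - \<omega> x - grad \<omega> x \<bullet> (z - x)\<bar> \<le> 2 * h\<^sup>2 / \<omega> x"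
proof -
  define e where "e i = - (fst i \<bullet> (z - x)) * q i x" for i
  have ab: "\<bar>fst i \<bullet> (z - x)\<bar> \<le> h" if "i \<in> I" for i
    using Cauchy_Schwarz_ineq2[of "fst i" "z - x"] unit[OF that] xz by simp
  have yz: "y i z = y i x * (1 + e i)" if i: "i \<in> I" for i
    using y_pos[OF i x] by (simp add: e_def q_def y_def inner_diff_right field_simps)
  have ei: "\<bar>e i\<bar> \<le> h * q i x" if i: "i \<in> I" for i
    unfolding e_def abs_mult abs_minus_cancel using ab[OF i] q_pos[OF i x] by (simp add: mult_right_mono)
  have eh: "\<bar>e i\<bar> \<le> 1/2" if i: "i \<in> I" for i
  proof -
    have "h * 2 \<le> y i x" using y_ge[OF i x] k(1) h mult_right_mono[of 2 k h] by linarith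
    then have "h * q i x \<le> 1/2" using y_pos[OF i x] by (simp add: q_def field_simps)
    then show ?thesis using ei[OF i] by linarith
  qed
  have rem: "\<bar>\<omega> z - \<omega> x - \<omega> x * (\<Sum>i\<in>I. \<omega> x * q i x * e i)\<bar> \<le> 2 * \<omega> x * (\<Sum>i\<in>I. \<omega> x * q i x * (e i)\<^sup>2)"
  proof (rule harmonic_remainder[OF I])
    show "\<omega> x = inverse (\<Sum>i\<in>I. q i x)" "\<omega> z = inverse (\<Sum>i\<in>I. q i z)" by (auto simp: \<omega>_def)
    show "q i z = q i x / (1 + e i)" if "i \<in> I" for i
      using yz[OF that] by (simp add: q_def field_simps)
  qed (use q_pos x eh in auto)
  have "\<omega> x * (\<Sum>i\<in>I. \<omega> x * q i x * e i) = grad \<omega> x \<bullet> (z - x)"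
    unfolding \<omega>_derivative(2)[OF x]
    by (simp add: inner_sum_left t_def e_def power2_eq_square sum_distrib_left sum_negf[symmetric] mult_ac)
  moreover have "2 * \<omega> x * (\<Sum>i\<in>I. \<omega> x * q i x * (e i)\<^sup>2) \<le> 2 * h\<^sup>2 / \<omega> x"
  proof -
    have "\<omega> x * q i x * (e i)\<^sup>2 \<le> t i x * (h / \<omega> x)\<^sup>2" if i: "i \<in> I" for i
    proof -
      have "q i x \<le> inverse (\<omega> x)" unfolding q_def using \<omega>_le_y[OF i x] \<omega>_pos[OF x] by (rule le_imp_inverse_le)
      then have "h * q i x \<le> h / \<omega> x" using h by (simp add: divide_inverse)
      then have "\<bar>e i\<bar> \<le> h / \<omega> x" using ei[OF i] by linarith
      then have "\<bar>e i\<bar>\<^sup>2 \<le> (h / \<omega> x)\<^sup>2" by (intro power_mono) auto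
      then show ?thesis unfolding t_def using \<omega>_pos[OF x] q_pos[OF i x] by (intro mult_left_mono) auto
    qed
    then have "(\<Sum>i\<in>I. \<omega> x * q i x * (e i)\<^sup>2) \<le> (\<Sum>i\<in>I. t i x * (h / \<omega> x)\<^sup>2)" by (rule sum_mono)
    also have "\<dots> = (h / \<omega> x)\<^sup>2" by (simp add: sum_distrib_right[symmetric] sum_t[OF x])
    finally have "2 * \<omega> x * (\<Sum>i\<in>I. \<omega> x * q i x * (e i)\<^sup>2) \<le> 2 * \<omega> x * (h / \<omega> x)\<^sup>2"
      using \<omega>_pos[OF x] by (intro mult_left_mono) auto
    also have "\<dots> = 2 * h\<^sup>2 / \<omega> x" using \<omega>_pos[OF x] by (simp add: power2_eq_square field_simps)
    finally show ?thesis .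
  qed
  ultimately show ?thesis using rem by simp
qed

text \<open>The sum is minus the Laplacian of \<omega>, since the gradient of \<omega> is
  \<open>- (\<Sum>i\<in>I. (t i x)\<^sup>2 *\<^sub>R fst i)\<close>. It equals
  \<open>2 / \<omega>\<close> times the sum of the cubes of the \<open>t i\<close> minus the squared
  norm of that gradient, so the claim is that the squared sum of the squares is at most the sum of
  the cubes.\<close>

lemma weight_superharmonic:
  assumes x: "x \<in> closure \<Omega>"
  shows "0 \<le> (\<Sum>i\<in>I. grad (\<lambda>x. t i x * t i x) x \<bullet> fst i)"
proof -
  have w: "\<omega> x > 0" by (rule \<omega>_pos[OF x])
  have "grad (\<lambda>x. t i x * t i x) x \<bullet> fst i = (2 / \<omega> x) * ((t i x) ^ 3 + (t i x)\<^sup>2 * (grad \<omega> x \<bullet> fst i))"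
    if i: "i \<in> I" for i
  proof -
    have "grad (\<lambda>x. t i x * t i x) x = (2 * t i x) *\<^sub>R ((\<omega> x * (q i x)\<^sup>2) *\<^sub>R fst i + q i x *\<^sub>R grad \<omega> x)"
      using grad_mult[OF t_derivative(1)[OF i x] t_derivative(1)[OF i x]] t_derivative(2)[OF i x]
      by (simp add: scaleR_2 scaleR_add_left[symmetric])
    moreover have "fst i \<bullet> fst i = 1" using unit[OF i] by (simp add: norm_eq_1)
    ultimately have "grad (\<lambda>x. t i x * t i x) x \<bullet> fst i = 2 * t i x * (\<omega> x * (q i x)\<^sup>2 + q i x * (grad \<omega> x \<bullet> fst i))"
      by (simp add: inner_add_left)
    also have "q i x = t i x / \<omega> x" using w by (simp add: t_def)
    finally show ?thesis using w by (simp add: power2_eq_square power3_eq_cube field_simps)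
  qed
  then have "(\<Sum>i\<in>I. grad (\<lambda>x. t i x * t i x) x \<bullet> fst i) =
      (\<Sum>i\<in>I. (2 / \<omega> x) * ((t i x) ^ 3 + (t i x)\<^sup>2 * (grad \<omega> x \<bullet> fst i)))" by (intro sum.cong) auto
  also have "\<dots> = (2 / \<omega> x) * ((\<Sum>i\<in>I. (t i x) ^ 3) + grad \<omega> x \<bullet> (\<Sum>i\<in>I. (t i x)\<^sup>2 *\<^sub>R fst i))"
    unfolding sum_distrib_left[symmetric] sum.distrib inner_sum_right inner_scaleR_right ..
  also have "(\<Sum>i\<in>I. (t i x)\<^sup>2 *\<^sub>R fst i) = - grad \<omega> x" by (simp add: \<omega>_derivative(2)[OF x])
  also have "grad \<omega> x \<bullet> (- grad \<omega> x) = - (norm (grad \<omega> x))\<^sup>2" by (simp add: power2_norm_eq_inner)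
  finally have eq: "(\<Sum>i\<in>I. grad (\<lambda>x. t i x * t i x) x \<bullet> fst i) =
      (2 / \<omega> x) * ((\<Sum>i\<in>I. (t i x) ^ 3) + - (norm (grad \<omega> x))\<^sup>2)" .
  have "(norm (grad \<omega> x))\<^sup>2 \<le> (\<Sum>i\<in>I. (t i x)\<^sup>2)\<^sup>2"
    using norm_grad_\<omega>[OF x] by (intro power_mono) auto
  \<comment> \<open>Splitting \<open>(t i x)\<^sup>2\<close> in this way lets Cauchy-Schwarz produce
    the sum of the \<open>t i x\<close>, which is 1, and the sum of their cubes.\<close>
  also have "(\<Sum>i\<in>I. (t i x)\<^sup>2) = (\<Sum>i\<in>I. sqrt (t i x) * (t i x * sqrt (t i x)))"
    using t_pos[OF _ x] by (intro sum.cong) (auto simp: power2_eq_square less_imp_le)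
  also have "\<dots>\<^sup>2 \<le> (\<Sum>i\<in>I. (sqrt (t i x))\<^sup>2) * (\<Sum>i\<in>I. (t i x * sqrt (t i x))\<^sup>2)"
    by (rule Cauchy_Schwarz_ineq_sum)
  also have "(\<Sum>i\<in>I. (sqrt (t i x))\<^sup>2) = (\<Sum>i\<in>I. t i x)"
    using t_pos[OF _ x] by (intro sum.cong) (auto simp: less_imp_le)
  also have "(\<Sum>i\<in>I. (t i x * sqrt (t i x))\<^sup>2) = (\<Sum>i\<in>I. (t i x) ^ 3)"
    using t_pos[OF _ x] by (intro sum.cong) (auto simp: power_mult_distrib less_imp_le power2_eq_square power3_eq_cube)
  finally have "(norm (grad \<omega> x))\<^sup>2 \<le> (\<Sum>i\<in>I. (t i x) ^ 3)" by (simp add: sum_t[OF x])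
  then show ?thesis unfolding eq using w by simp
qed

end

subsection \<open>Weighted energy estimate\<close>

context fe_mesh
begin

text \<open>Essential boundedness, because gradients of finite element functions are controlled only
  off the faces of the cells. The class is closed under the operations that occur in the integrands,
  so integrability follows from the shape of a term.\<close>

definition bdd :: "(real^3 \<Rightarrow> 'b::real_normed_vector) \<Rightarrow> bool"
  where "bdd f \<longleftrightarrow> f \<in> borel_measurable (lebesgue_on \<Omega>) \<and> (\<exists>B. AE x in lebesgue_on \<Omega>. norm (f x) \<le> B)"

lemma bdd_integrable:
  fixes f :: "real^3 \<Rightarrow> real"
  assumes "bdd f" shows "integrable (lebesgue_on \<Omega>) f"
proof -
  obtain B where "AE x in lebesgue_on \<Omega>. \<bar>f x\<bar> \<le> B" using assms by (auto simp: bdd_def)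
  moreover have "f \<in> borel_measurable (lebesgue_on \<Omega>)" using assms by (simp add: bdd_def)
  ultimately show ?thesis by (intro integrable_bounded_on[OF \<Omega>_lmeasurable])
qed

lemma bdd_const: "bdd (\<lambda>x. c)"
  unfolding bdd_def by auto

lemma bdd_add:
  fixes f g :: "real^3 \<Rightarrow> 'b::euclidean_space"
  assumes "bdd f" "bdd g" shows "bdd (\<lambda>x. f x + g x)"
proof -
  obtain B C where "AE x in lebesgue_on \<Omega>. norm (f x) \<le> B" "AE x in lebesgue_on \<Omega>. norm (g x) \<le> C"
    using assms by (auto simp: bdd_def)
  then have "AE x in lebesgue_on \<Omega>. norm (f x + g x) \<le> B + C"
    by eventually_elim (rule norm_triangle_le, simp)
  then show ?thesis using assms unfolding bdd_def by (auto intro: borel_measurable_add)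
qed

lemma bdd_inner:
  fixes f g :: "real^3 \<Rightarrow> 'b::euclidean_space"
  assumes "bdd f" "bdd g" shows "bdd (\<lambda>x. f x \<bullet> g x)"
proof -
  obtain B C where "AE x in lebesgue_on \<Omega>. norm (f x) \<le> B" "AE x in lebesgue_on \<Omega>. norm (g x) \<le> C"
    using assms by (auto simp: bdd_def)
  then have "AE x in lebesgue_on \<Omega>. norm (f x \<bullet> g x) \<le> B * C"
  proof eventually_elim
    fix x assume b: "norm (f x) \<le> B" "norm (g x) \<le> C"
    have "\<bar>f x \<bullet> g x\<bar> \<le> norm (f x) * norm (g x)" by (rule Cauchy_Schwarz_ineq2)
    also have "\<dots> \<le> B * C" using b order_trans[OF norm_ge_zero b(1)] by (intro mult_mono) auto
    finally show "norm (f x \<bullet> g x) \<le> B * C" by simp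
  qed
  then show ?thesis using assms unfolding bdd_def by (auto intro: borel_measurable_inner)
qed

lemma bdd_mult:
  fixes f g :: "real^3 \<Rightarrow> real"
  assumes "bdd f" "bdd g" shows "bdd (\<lambda>x. f x * g x)"
  using bdd_inner[OF assms] by simp

lemma bdd_norm: "bdd f \<Longrightarrow> bdd (\<lambda>x. norm (f x))"
  unfolding bdd_def by (auto intro: borel_measurable_norm)

lemma bdd_power2: "bdd (f :: real^3 \<Rightarrow> real) \<Longrightarrow> bdd (\<lambda>x. (f x)\<^sup>2)"
  using bdd_mult[of f f] by (simp add: power2_eq_square)

lemma bdd_sum: "finite I \<Longrightarrow> (\<And>i. i \<in> I \<Longrightarrow> bdd (f i)) \<Longrightarrow> bdd (\<lambda>x. \<Sum>i\<in>I. f i x :: real)"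
  by (induction I rule: finite_induct) (auto intro: bdd_const bdd_add)

lemma bdd_continuous:
  fixes f :: "real^3 \<Rightarrow> 'b::euclidean_space"
  assumes "continuous_on (closure \<Omega>) f" shows "bdd f"
proof -
  have "f \<in> borel_measurable (lebesgue_on \<Omega>)"
    using continuous_on_subset[OF assms closure_subset] \<Omega>(1)
    by (intro continuous_imp_measurable_on_sets_lebesgue) auto
  moreover have "bounded (f ` closure \<Omega>)"
    using compact_continuous_image[OF assms] \<Omega>(2) by (simp add: compact_closure compact_imp_bounded)
  then obtain B where B: "\<And>x. x \<in> closure \<Omega> \<Longrightarrow> norm (f x) \<le> B" unfolding bounded_iff by blast
  have "AE x in lebesgue_on \<Omega>. norm (f x) \<le> B"
  proof (rule AE_I2)
    fix x assume "x \<in> space (lebesgue_on \<Omega>)"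
    then show "norm (f x) \<le> B" using B closure_subset[of \<Omega>] by auto
  qed
  ultimately show ?thesis unfolding bdd_def by blast
qed

lemma bdd_FE: "u \<in> FE_space \<Omega> \<T> \<Longrightarrow> bdd u"
  by (rule bdd_continuous) (simp add: FE_space_def)

lemma bdd_grad_FE:
  assumes "u \<in> FE_space \<Omega> \<T>" shows "bdd (grad u)"
proof -
  obtain L where L: "\<And>x y. x \<in> closure \<Omega> \<Longrightarrow> y \<in> closure \<Omega> \<Longrightarrow> \<bar>u x - u y\<bar> \<le> L * norm (x - y)"
    using FE_lipschitz[OF assms] by blast
  have "AE x in lebesgue_on \<Omega>. norm (grad u x) \<le> L"
    using AE_cells
  proof eventually_elim
    fix y assume y: "y \<in> \<Union>\<T>"
    show "norm (grad u y) \<le> L"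
    proof (rule norm_grad_le_lipschitz[OF _ open_cells y])
      show "u differentiable at y" by (rule locally_affine_on_differentiable[OF FE_locally_affine[OF assms] y])
      show "\<bar>u z - u y\<bar> \<le> L * norm (z - y)" if "z \<in> \<Union>\<T>" for z
      proof (rule L)
        show "z \<in> closure \<Omega>" "y \<in> closure \<Omega>" using that y cells_subset closure_subset[of \<Omega>] by auto
      qed
    qed
  qed
  then show ?thesis
    using locally_affine_grad_measurable(1)[OF FE_locally_affine[OF assms] cells_subset negligible_off_cells \<Omega>(1)]
    by (auto simp: bdd_def)
qed

lemma FE_differentiable: "u \<in> FE_space \<Omega> \<T> \<Longrightarrow> x \<in> \<Union>\<T> \<Longrightarrow> u differentiable at x"
  by (rule locally_affine_on_differentiable[OF FE_locally_affine])

text \<open>The product of \<open>g\<close> and the square of \<open>v\<close> is Lipschitz and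
  vanishes off \<Omega>, so its derivative along \<open>n\<close> has integral zero. With
  \<open>g\<close> equal to \<open>q i\<close> this leads to the Hardy inequality, with the square
  of \<open>t i\<close> to the sign of the mixed term.\<close>

lemma FE0_square_by_parts:
  assumes v: "v \<in> FE_space0 \<Omega> \<T>" and g: "lipb (closure \<Omega>) g" "\<And>x. x \<in> closure \<Omega> \<Longrightarrow> g differentiable at x"
    and c: "continuous_on (closure \<Omega>) (\<lambda>x. grad g x \<bullet> n)"
  shows "(LINT x|lebesgue_on \<Omega>. (v x)\<^sup>2 * (grad g x \<bullet> n)) = - (LINT x|lebesgue_on \<Omega>. 2 * v x * (grad v x \<bullet> n) * g x)"
proof -
  have vF: "v \<in> FE_space \<Omega> \<T>" and v0: "\<And>x. x \<in> frontier \<Omega> \<Longrightarrow> v x = 0" using v FE_space0_iff by auto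
  have voff: "v x = 0" if "x \<notin> \<Omega>" for x
    using vF v0 that closure_eq(1) by (cases "x \<in> closure \<Omega>") (auto simp: FE_space_def)
  obtain L where L: "L \<ge> 0" "\<And>x y. \<bar>v x - v y\<bar> \<le> L * norm (x - y)"
    using FE_zero_frontier_lipschitz[OF vF v0] by blast
  have "\<exists>B\<ge>0. \<forall>x. \<bar>v x\<bar> \<le> B"
  proof -
    have "bounded (v ` closure \<Omega>)"
      using compact_continuous_image[of "closure \<Omega>" v] vF \<Omega>(2)
      by (simp add: FE_space_def compact_closure compact_imp_bounded)
    then obtain B where B: "B > 0" "\<And>x. x \<in> closure \<Omega> \<Longrightarrow> \<bar>v x\<bar> \<le> B" by (auto simp: bounded_pos)
    have "\<bar>v x\<bar> \<le> B" for x using B voff[of x] closure_eq(1) by (cases "x \<in> \<Omega>") auto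
    then show ?thesis using B(1) by (intro exI[of _ B]) auto
  qed
  then obtain B where B: "B \<ge> 0" "\<And>x. \<bar>v x\<bar> \<le> B" by blast
  have lip2: "\<bar>v x * v x - v y * v y\<bar> \<le> (B * L + B * L) * norm (x - y)" for x y
    by (rule lipschitz_times_zero_extension[of UNIV]) (use L B in auto)
  have b2: "\<bar>v x * v x\<bar> \<le> B * B" for x unfolding abs_mult using B by (intro mult_mono) auto
  obtain A2 B2 where gl: "A2 \<ge> 0" "B2 \<ge> 0" "\<And>x. x \<in> closure \<Omega> \<Longrightarrow> \<bar>g x\<bar> \<le> B2"
    "\<And>x y. x \<in> closure \<Omega> \<Longrightarrow> y \<in> closure \<Omega> \<Longrightarrow> \<bar>g x - g y\<bar> \<le> A2 * norm (x - y)"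
    using g(1) unfolding lipb_def by blast
  have gc: "continuous_on (closure \<Omega>) g"
  proof (rule lipschitz_on_continuous_on[of A2])
    show "A2-lipschitz_on (closure \<Omega>) g" using gl by (intro lipschitz_onI) (auto simp: dist_norm)
  qed
  have i1: "integrable (lebesgue_on \<Omega>) (\<lambda>x. (v x)\<^sup>2 * (grad g x \<bullet> n))"
    by (intro bdd_integrable bdd_mult bdd_power2 bdd_FE[OF vF] bdd_continuous[OF c])
  have i2: "integrable (lebesgue_on \<Omega>) (\<lambda>x. 2 * v x * (grad v x \<bullet> n) * g x)"
    by (intro bdd_integrable bdd_mult bdd_const bdd_FE[OF vF] bdd_inner bdd_grad_FE[OF vF] bdd_continuous[OF gc])
  have "(LINT x|lebesgue_on \<Omega>. (v x)\<^sup>2 * (grad g x \<bullet> n) + 2 * v x * (grad v x \<bullet> n) * g x) = 0"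
  proof (rule integral_grad_0[OF \<Omega>(1,2) negligible_frontier open_cells cells_subset negligible_off_cells])
    show "\<bar>g x * (v x * v x) - g y * (v y * v y)\<bar> \<le> (B2 * (B * L + B * L) + (B * B) * A2) * norm (x - y)" for x y
      by (rule lipschitz_times_zero_extension[of "closure \<Omega>"])
        (use gl lip2 b2 voff closure_eq(1) B L in auto)
    show "g x * (v x * v x) = 0" if "x \<notin> \<Omega>" for x using voff[OF that] by simp
    show "(\<lambda>x. g x * (v x * v x)) differentiable at x" if "x \<in> \<Union>\<T>" for x
      using that cells_subset closure_eq(1) FE_differentiable[OF vF that]
      by (intro differentiable_mult g(2)) auto
    show "(\<lambda>x. (v x)\<^sup>2 * (grad g x \<bullet> n) + 2 * v x * (grad v x \<bullet> n) * g x) \<in> borel_measurable (lebesgue_on \<Omega>)"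
      using i1 i2 by (intro borel_measurable_add borel_measurable_integrable)
    show "grad (\<lambda>x. g x * (v x * v x)) x \<bullet> n = (v x)\<^sup>2 * (grad g x \<bullet> n) + 2 * v x * (grad v x \<bullet> n) * g x"
      if x: "x \<in> \<Union>\<T>" for x
    proof -
      have dv: "v differentiable at x" by (rule FE_differentiable[OF vF x])
      have dg: "g differentiable at x" using x cells_subset closure_eq(1) by (intro g(2)) auto
      show ?thesis
        unfolding grad_mult[OF dg differentiable_mult[OF dv dv]] grad_mult[OF dv dv]
          inner_add_left inner_scaleR_left power2_eq_square
        by (simp add: algebra_simps)
    qed
  qed
  then show ?thesis using i1 i2 by simp
qed

end

section \<open>Hardy inequality, interpolation and energy\<close>

context weighted_mesh
begin

text \<open>The one-dimensional Hardy argument along the inner normal: there the derivative of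
  \<open>q i\<close> is minus its square, so integration by parts moves one derivative to
  \<open>v\<close>. Young's inequality leaves half of the left side on the right, whence the
  constant 4.\<close>

lemma hardy_facet:
  assumes v: "v \<in> FE_space0 \<Omega> \<T>" and i: "i \<in> I"
  shows "(LINT x|lebesgue_on \<Omega>. (v x * q i x)\<^sup>2) \<le> 4 * (LINT x|lebesgue_on \<Omega>. (norm (grad v x))\<^sup>2)"
proof -
  have vF: "v \<in> FE_space \<Omega> \<T>" using v FE_space0_iff by auto
  have gn: "grad (q i) x \<bullet> (- fst i) = - (q i x)\<^sup>2" if "x \<in> closure \<Omega>" for x
    using q_derivative(2)[OF i that] unit[OF i] by (simp add: norm_eq_1)
  have c: "continuous_on (closure \<Omega>) (\<lambda>x. grad (q i) x \<bullet> (- fst i))"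
  proof -
    have "continuous_on (closure \<Omega>) (\<lambda>x. - (q i x)\<^sup>2)" using q_continuous[OF i] by (intro continuous_intros)
    then show ?thesis by (rule continuous_on_cong[THEN iffD1, rotated 2]) (simp_all only: gn)
  qed
  have b1: "bdd (\<lambda>x. (v x * q i x)\<^sup>2)"
    by (intro bdd_power2 bdd_mult bdd_FE[OF vF] bdd_continuous[OF q_continuous[OF i]])
  have b2: "bdd (\<lambda>x. 2 * v x * (grad v x \<bullet> (- fst i)) * q i x)"
    by (intro bdd_mult bdd_const bdd_FE[OF vF] bdd_inner bdd_grad_FE[OF vF] bdd_continuous[OF q_continuous[OF i]])
  have b3: "bdd (\<lambda>x. (norm (grad v x))\<^sup>2)" by (intro bdd_power2 bdd_norm bdd_grad_FE[OF vF])
  note int = bdd_integrable[OF b1] bdd_integrable[OF b2] bdd_integrable[OF b3]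
  have "(LINT x|lebesgue_on \<Omega>. (v x)\<^sup>2 * (grad (q i) x \<bullet> (- fst i))) = (LINT x|lebesgue_on \<Omega>. - ((v x * q i x)\<^sup>2))"
    by (rule Bochner_Integration.integral_cong[OF refl])
      (use closure_subset[of \<Omega>] in \<open>auto simp: gn power_mult_distrib simp del: inner_minus_right\<close>)
  then have "(LINT x|lebesgue_on \<Omega>. (v x * q i x)\<^sup>2) = (LINT x|lebesgue_on \<Omega>. 2 * v x * (grad v x \<bullet> (- fst i)) * q i x)"
    using FE0_square_by_parts[OF v lipb_q[OF i] q_derivative(1)[OF i] c] by simp
  also have "\<dots> \<le> (LINT x|lebesgue_on \<Omega>. (1/2) * (v x * q i x)\<^sup>2 + 2 * (norm (grad v x))\<^sup>2)"
  proof (rule integral_mono[OF int(2)])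
    show "integrable (lebesgue_on \<Omega>) (\<lambda>x. (1/2) * (v x * q i x)\<^sup>2 + 2 * (norm (grad v x))\<^sup>2)" using int by simp
    fix x
    have "\<bar>grad v x \<bullet> (- fst i)\<bar> \<le> norm (grad v x)"
      using Cauchy_Schwarz_ineq2[of "grad v x" "- fst i"] unit[OF i] by simp
    then have "(grad v x \<bullet> (- fst i))\<^sup>2 \<le> (norm (grad v x))\<^sup>2" by (metis abs_ge_zero power2_abs power_mono)
    moreover have "2 * a * b \<le> (1/2) * a\<^sup>2 + 2 * b\<^sup>2" for a b :: real
      using zero_le_power2[of "a - 2 * b"] by (simp add: power2_eq_square algebra_simps)
    ultimately have "2 * (v x * q i x) * (grad v x \<bullet> (- fst i)) \<le> (1/2) * (v x * q i x)\<^sup>2 + 2 * (norm (grad v x))\<^sup>2"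
      by (meson add_left_mono mult_left_mono order_trans zero_le_numeral)
    then show "2 * v x * (grad v x \<bullet> (- fst i)) * q i x \<le> (1/2) * (v x * q i x)\<^sup>2 + 2 * (norm (grad v x))\<^sup>2"
      by (simp only: mult_ac)
  qed
  also have "\<dots> = (1/2) * (LINT x|lebesgue_on \<Omega>. (v x * q i x)\<^sup>2) + 2 * (LINT x|lebesgue_on \<Omega>. (norm (grad v x))\<^sup>2)"
    using int by simp
  finally show ?thesis by simp
qed

lemma bdd_over_\<omega>: "v \<in> FE_space \<Omega> \<T> \<Longrightarrow> bdd (\<lambda>x. (v x / \<omega> x)\<^sup>2)"
proof -
  assume v: "v \<in> FE_space \<Omega> \<T>"
  have "continuous_on (closure \<Omega>) (\<lambda>x. v x / \<omega> x)"
    using v \<omega>_continuous \<omega>_pos by (intro continuous_on_divide) (force simp: FE_space_def)+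
  then show ?thesis by (intro bdd_power2 bdd_continuous)
qed

text \<open>As \<open>1 / \<omega>\<close> is the sum of the \<open>q i\<close>, Cauchy-Schwarz
  costs a factor \<open>N\<close>, and the \<open>N\<close> facet inequalities cost another
  one.\<close>

lemma hardy:
  assumes v: "v \<in> FE_space0 \<Omega> \<T>"
  shows "(LINT x|lebesgue_on \<Omega>. (v x / \<omega> x)\<^sup>2) \<le> 4 * N\<^sup>2 * (LINT x|lebesgue_on \<Omega>. (norm (grad v x))\<^sup>2)"
proof -
  have vF: "v \<in> FE_space \<Omega> \<T>" using v FE_space0_iff by auto
  have b1: "bdd (\<lambda>x. (v x * q i x)\<^sup>2)" if "i \<in> I" for i
    by (intro bdd_power2 bdd_mult bdd_FE[OF vF] bdd_continuous[OF q_continuous[OF that]])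
  have "(LINT x|lebesgue_on \<Omega>. (v x / \<omega> x)\<^sup>2) \<le> (LINT x|lebesgue_on \<Omega>. N * (\<Sum>i\<in>I. (v x * q i x)\<^sup>2))"
  proof (rule integral_mono[OF bdd_integrable[OF bdd_over_\<omega>[OF vF]]])
    show "integrable (lebesgue_on \<Omega>) (\<lambda>x. N * (\<Sum>i\<in>I. (v x * q i x)\<^sup>2))"
      by (intro bdd_integrable bdd_mult bdd_const bdd_sum I(1) b1)
    fix x
    have "v x / \<omega> x = (\<Sum>i\<in>I. 1 * (v x * q i x))" by (simp add: \<omega>_def sum_distrib_left divide_inverse)
    then have "(v x / \<omega> x)\<^sup>2 \<le> (\<Sum>i\<in>I. 1\<^sup>2) * (\<Sum>i\<in>I. (v x * q i x)\<^sup>2)"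
      using Cauchy_Schwarz_ineq_sum[of "\<lambda>_. 1" "\<lambda>i. v x * q i x" I] by simp
    then show "(v x / \<omega> x)\<^sup>2 \<le> N * (\<Sum>i\<in>I. (v x * q i x)\<^sup>2)" by (simp add: N_def)
  qed
  also have "\<dots> = N * (\<Sum>i\<in>I. (LINT x|lebesgue_on \<Omega>. (v x * q i x)\<^sup>2))"
    using bdd_integrable[OF b1] by simp
  also have "\<dots> \<le> N * (\<Sum>i\<in>I. 4 * (LINT x|lebesgue_on \<Omega>. (norm (grad v x))\<^sup>2))"
    using N hardy_facet[OF v] by (intro mult_left_mono sum_mono) auto
  also have "\<dots> = 4 * N\<^sup>2 * (LINT x|lebesgue_on \<Omega>. (norm (grad v x))\<^sup>2)"
    by (simp add: N_def power2_eq_square)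
  finally show ?thesis .
qed

lemma bdd_v_grad_\<omega>: "v \<in> FE_space \<Omega> \<T> \<Longrightarrow> u \<in> FE_space \<Omega> \<T> \<Longrightarrow> bdd (\<lambda>x. v x * (grad u x \<bullet> grad \<omega> x))"
  by (intro bdd_mult bdd_inner bdd_FE bdd_grad_FE bdd_continuous[OF grad_\<omega>_continuous])

text \<open>\<open>FE0_square_by_parts\<close> works in one fixed direction. The gradient of
  \<omega> is therefore split into the functions \<open>(t i x)\<^sup>2\<close> times the constant
  normals, the parts are integrated separately, and their sum is recognised as the expression in
  \<open>weight_superharmonic\<close>.\<close>

lemma weight_gradient_nonneg:
  assumes v: "v \<in> FE_space0 \<Omega> \<T>"
  shows "0 \<le> (LINT x|lebesgue_on \<Omega>. v x * (grad v x \<bullet> grad \<omega> x))"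
proof -
  have vF: "v \<in> FE_space \<Omega> \<T>" using v FE_space0_iff by auto
  define g where "g i = (\<lambda>x. t i x * t i x)" for i
  have gd: "g i differentiable at x" "grad (g i) x = (2 * t i x) *\<^sub>R ((\<omega> x * (q i x)\<^sup>2) *\<^sub>R fst i + q i x *\<^sub>R grad \<omega> x)"
    if "i \<in> I" "x \<in> closure \<Omega>" for i x
    using grad_mult[OF t_derivative(1)[OF that] t_derivative(1)[OF that]] t_derivative[OF that]
    by (auto simp: g_def scaleR_2 scaleR_add_left[symmetric] intro: differentiable_mult)
  have c: "continuous_on (closure \<Omega>) (\<lambda>x. grad (g i) x \<bullet> fst i)" if i: "i \<in> I" for i
  proof -
    have "continuous_on (closure \<Omega>) (\<lambda>x. ((2 * t i x) *\<^sub>R ((\<omega> x * (q i x)\<^sup>2) *\<^sub>R fst i + q i x *\<^sub>R grad \<omega> x)) \<bullet> fst i)"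
      using t_continuous[OF i] q_continuous[OF i] \<omega>_continuous grad_\<omega>_continuous by (intro continuous_intros)
    then show ?thesis by (rule continuous_on_cong[THEN iffD1, rotated 2]) (simp_all add: gd(2)[OF i])
  qed
  have parts: "(LINT x|lebesgue_on \<Omega>. (v x)\<^sup>2 * (grad (g i) x \<bullet> fst i)) = - (LINT x|lebesgue_on \<Omega>. 2 * v x * (grad v x \<bullet> fst i) * g i x)"
    if i: "i \<in> I" for i
  proof (rule FE0_square_by_parts[OF v _ _ c[OF i]])
    show "lipb (closure \<Omega>) (g i)" unfolding g_def by (intro lipb_mult lipb_t i)
  qed (rule gd(1)[OF i])
  have b1: "bdd (\<lambda>x. (v x)\<^sup>2 * (grad (g i) x \<bullet> fst i))" if "i \<in> I" for i
    by (intro bdd_mult bdd_power2 bdd_FE[OF vF] bdd_continuous[OF c[OF that]])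
  have b2: "bdd (\<lambda>x. 2 * v x * (grad v x \<bullet> fst i) * g i x)" if "i \<in> I" for i
    unfolding g_def
    by (intro bdd_mult bdd_const bdd_FE[OF vF] bdd_inner bdd_grad_FE[OF vF] bdd_continuous[OF t_continuous[OF that]])
  have "0 \<le> (LINT x|lebesgue_on \<Omega>. (v x)\<^sup>2 * (\<Sum>i\<in>I. grad (g i) x \<bullet> fst i))"
    using weight_superharmonic closure_subset[of \<Omega>]
    by (intro Bochner_Integration.integral_nonneg mult_nonneg_nonneg) (auto simp: g_def)
  also have "\<dots> = (\<Sum>i\<in>I. (LINT x|lebesgue_on \<Omega>. (v x)\<^sup>2 * (grad (g i) x \<bullet> fst i)))"
    unfolding sum_distrib_left using bdd_integrable[OF b1] by simp
  also have "\<dots> = (\<Sum>i\<in>I. - (LINT x|lebesgue_on \<Omega>. 2 * v x * (grad v x \<bullet> fst i) * g i x))"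
    using parts by simp
  also have "\<dots> = - (LINT x|lebesgue_on \<Omega>. (\<Sum>i\<in>I. 2 * v x * (grad v x \<bullet> fst i) * g i x))"
  proof -
    have "(LINT x|lebesgue_on \<Omega>. (\<Sum>i\<in>I. 2 * v x * (grad v x \<bullet> fst i) * g i x)) =
        (\<Sum>i\<in>I. (LINT x|lebesgue_on \<Omega>. 2 * v x * (grad v x \<bullet> fst i) * g i x))"
      by (rule Bochner_Integration.integral_sum) (rule bdd_integrable[OF b2])
    then show ?thesis by (simp only: sum_negf)
  qed
  also have "\<dots> = - (LINT x|lebesgue_on \<Omega>. - 2 * (v x * (grad v x \<bullet> grad \<omega> x)))"
  proof (rule arg_cong[where f = uminus], rule Bochner_Integration.integral_cong[OF refl])
    fix x assume "x \<in> space (lebesgue_on \<Omega>)"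
    then have x: "x \<in> closure \<Omega>" using closure_subset by auto
    show "(\<Sum>i\<in>I. 2 * v x * (grad v x \<bullet> fst i) * g i x) = - 2 * (v x * (grad v x \<bullet> grad \<omega> x))"
      unfolding \<omega>_derivative(2)[OF x]
      by (simp add: inner_sum_right sum_distrib_left g_def power2_eq_square mult_ac sum_negf)
  qed
  also have "\<dots> = 2 * (LINT x|lebesgue_on \<Omega>. v x * (grad v x \<bullet> grad \<omega> x))" by simp
  finally show ?thesis by simp
qed

text \<open>\<open>J\<close> is compared on the cell with the tangent plane of
  \<open>\<omega> * v\<close> at \<open>x\<close>, another affine function. At a vertex the two
  differ by a product of first-order increments and the Taylor remainder of \<omega> times
  \<open>v\<close>, as \<open>v\<close> itself is affine. An affine function is bounded by its
  vertex values, and \<open>affine_gradient_bound\<close> passes to the gradient at the cost of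
  \<open>1 / r\<close>.\<close>

lemma interpolation_error:
  assumes v: "v \<in> FE_space \<Omega> \<T>" and J: "J \<in> FE_space \<Omega> \<T>" and K: "K \<in> \<T>"
    and Jz: "\<And>z. z \<in> verts K \<Longrightarrow> J z = \<omega> z * v z" and x: "x \<in> K"
  shows "norm (grad J x - (\<omega> x *\<^sub>R grad v x + v x *\<^sub>R grad \<omega> x)) * r
    \<le> h\<^sup>2 * (3 * norm (grad v x) + 2 * \<bar>v x / \<omega> x\<bar>)"
proof -
  obtain a b where ab: "\<And>x. x \<in> closure K \<Longrightarrow> v x = a \<bullet> x + b" "\<And>x. x \<in> K \<Longrightarrow> grad v x = a"
    using FE_grad[OF v K] by blast
  obtain c d where cd: "\<And>x. x \<in> closure K \<Longrightarrow> J x = c \<bullet> x + d" "\<And>x. x \<in> K \<Longrightarrow> grad J x = c"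
    using FE_grad[OF J K] by blast
  have xK: "x \<in> closure K" using x closure_subset by blast
  have xO: "x \<in> closure \<Omega>" using xK cell_closure_subset[OF K] by blast
  define G where "G = \<omega> x *\<^sub>R a + v x *\<^sub>R grad \<omega> x"
  \<comment> \<open>With this constant, \<open>(c - G) \<bullet> z + e\<close> is the difference at
    \<open>z\<close> between \<open>J\<close> and the tangent plane of \<open>\<omega> * v\<close>
    at \<open>x\<close>.\<close>
  define e where "e = d - \<omega> x * v x + G \<bullet> x"
  define B where "B = h\<^sup>2 * (3 * norm a + 2 * \<bar>v x / \<omega> x\<bar>)"
  have w0: "\<omega> x > 0" by (rule \<omega>_pos[OF xO])
  have "\<bar>(c - G) \<bullet> z + e\<bar> \<le> B" if z: "z \<in> verts K" for z
  proof -
    have zK: "z \<in> closure K" using z verts_subset[OF K] by blast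
    have zO: "z \<in> closure \<Omega>" using zK cell_closure_subset[OF K] by blast
    have nz: "norm (z - x) \<le> h" by (rule diam[OF K zK xK])
    define R where "R = \<omega> z - \<omega> x - grad \<omega> x \<bullet> (z - x)"
    have R: "\<bar>R\<bar> \<le> 2 * h\<^sup>2 / \<omega> x" unfolding R_def by (rule taylor_\<omega>[OF xO zO nz])
    have vz: "v z = v x + a \<bullet> (z - x)" using ab(1)[OF zK] ab(1)[OF xK] by (simp add: inner_diff_right)
    have Jv: "c \<bullet> z + d = \<omega> z * v z" using cd(1)[OF zK] Jz[OF z] by simp
    have "(c - G) \<bullet> z + e = \<omega> z * v z - \<omega> x * v x - G \<bullet> (z - x)"
      using Jv by (simp add: e_def inner_diff_left inner_diff_right)
    also have "\<dots> = (grad \<omega> x \<bullet> (z - x)) * (a \<bullet> (z - x)) + R * v z"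
      unfolding G_def R_def vz by (simp add: inner_add_left algebra_simps)
    also have "\<bar>\<dots>\<bar> \<le> h * (norm a * h) + (2 * h\<^sup>2 / \<omega> x) * (\<bar>v x\<bar> + norm a * h)"
    proof -
      have g: "\<bar>grad \<omega> x \<bullet> (z - x)\<bar> \<le> h"
      proof -
        have "\<bar>grad \<omega> x \<bullet> (z - x)\<bar> \<le> norm (grad \<omega> x) * norm (z - x)" by (rule Cauchy_Schwarz_ineq2)
        also have "\<dots> \<le> 1 * h" using norm_grad_\<omega>_le_1[OF xO] nz by (intro mult_mono) auto
        finally show ?thesis by simp
      qed
      have aa: "\<bar>a \<bullet> (z - x)\<bar> \<le> norm a * h"
        using Cauchy_Schwarz_ineq2[of a "z - x"] mult_left_mono[OF nz norm_ge_zero[of a]] by linarith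
      have vzb: "\<bar>v z\<bar> \<le> \<bar>v x\<bar> + norm a * h" unfolding vz using aa by linarith
      have "\<bar>(grad \<omega> x \<bullet> (z - x)) * (a \<bullet> (z - x)) + R * v z\<bar>
          \<le> \<bar>grad \<omega> x \<bullet> (z - x)\<bar> * \<bar>a \<bullet> (z - x)\<bar> + \<bar>R\<bar> * \<bar>v z\<bar>"
        by (metis abs_mult abs_triangle_ineq)
      also have "\<dots> \<le> h * (norm a * h) + (2 * h\<^sup>2 / \<omega> x) * (\<bar>v x\<bar> + norm a * h)"
        using g aa R vzb h w0 by (intro add_mono mult_mono) auto
      finally show ?thesis .
    qed
    also have "\<dots> \<le> B"
    proof -
      have "h / \<omega> x \<le> 1" using \<omega>_ge_h[OF xO] w0 by (simp add: divide_le_eq)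
      then have "(h / \<omega> x) * (2 * h\<^sup>2 * norm a) \<le> 1 * (2 * h\<^sup>2 * norm a)" by (rule mult_right_mono) simp
      then have "(2 * h\<^sup>2 / \<omega> x) * (norm a * h) \<le> 2 * h\<^sup>2 * norm a" by (simp add: mult_ac)
      moreover have "(2 * h\<^sup>2 / \<omega> x) * \<bar>v x\<bar> = 2 * h\<^sup>2 * \<bar>v x / \<omega> x\<bar>" using w0 by simp
      moreover have "h * (norm a * h) = h\<^sup>2 * norm a" by (simp add: power2_eq_square)
      moreover have "B = h\<^sup>2 * norm a + (2 * h\<^sup>2 * norm a + 2 * h\<^sup>2 * \<bar>v x / \<omega> x\<bar>)"
        by (simp add: B_def algebra_simps)
      ultimately show ?thesis unfolding distrib_left[of "2 * h\<^sup>2 / \<omega> x"] by linarith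
    qed
    finally show ?thesis .
  qed
  then have bK: "\<bar>(c - G) \<bullet> z + e\<bar> \<le> B" if "z \<in> closure K" for z
    using affine_bounded_on_convex_hull[OF cell_facts(3)[OF K]] that cell_facts(4)[OF K] by blast
  obtain z0 where z0: "ball z0 r \<subseteq> K" using inball[OF K] by blast
  have "norm (c - G) * r \<le> B"
    by (rule affine_gradient_bound[OF bK r]) (use z0 closure_subset in blast)
  then show ?thesis using ab(2)[OF x] cd(2)[OF x] by (simp add: G_def B_def)
qed

text \<open>A nonzero gradient of \<open>w\<close> forces a vertex of the cell to lie on the
  frontier, for otherwise \<open>w\<close> vanishes at all vertices. Both bounds compare
  \<open>x\<close> with that vertex, which is at most \<open>h\<close> away: there \<open>v\<close>
  is zero and one of the \<open>y i\<close> equals \<open>k * h\<close>.\<close>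

lemma boundary_layer:
  assumes w: "w \<in> FE_space \<Omega> \<T>" "\<And>z. z \<in> mesh_nodes \<T> \<inter> \<Omega> \<Longrightarrow> w z = 0"
    and v: "v \<in> FE_space0 \<Omega> \<T>" and K: "K \<in> \<T>" and x: "x \<in> K" and g: "grad w x \<noteq> 0"
  shows "\<bar>v x\<bar> \<le> h * norm (grad v x)" "\<omega> x \<le> (k + 1) * h"
proof -
  have vF: "v \<in> FE_space \<Omega> \<T>" and v0: "\<And>x. x \<in> frontier \<Omega> \<Longrightarrow> v x = 0" using v FE_space0_iff by auto
  have xK: "x \<in> closure K" using x closure_subset by blast
  have xO: "x \<in> closure \<Omega>" using xK cell_closure_subset[OF K] by blast
  have "\<exists>z\<in>verts K. z \<in> frontier \<Omega>"
  proof (rule ccontr)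
    assume no: "\<not> ?thesis"
    have "w z = 0" if "z \<in> verts K" for z
    proof -
      have "z \<in> closure \<Omega>" using that verts_subset[OF K] cell_closure_subset[OF K] by blast
      then show ?thesis using w(2)[of z] no that K closure_eq(1) mesh_nodes_eq by auto
    qed
    then have w0: "w y = 0 \<bullet> y + 0" if "y \<in> K" for y
      using FE_eq_0_on_cell[OF w(1) K] that closure_subset by auto
    then show False using grad_locally_affine[OF cell_facts(6)[OF K] x w0] g by simp
  qed
  then obtain z where z: "z \<in> verts K" "z \<in> frontier \<Omega>" by blast
  have zK: "z \<in> closure K" using z verts_subset[OF K] by blast
  have nz: "norm (x - z) \<le> h" by (rule diam[OF K xK zK])
  obtain a b where ab: "\<And>x. x \<in> closure K \<Longrightarrow> v x = a \<bullet> x + b" "\<And>x. x \<in> K \<Longrightarrow> grad v x = a"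
    using FE_grad[OF vF K] by blast
  have "v x = a \<bullet> (x - z)" using ab(1)[OF xK] ab(1)[OF zK] v0[OF z(2)] by (simp add: inner_diff_right)
  then have "\<bar>v x\<bar> \<le> norm a * norm (x - z)" using Cauchy_Schwarz_ineq2 by metis
  also have "\<dots> \<le> norm a * h" using nz by (intro mult_left_mono) auto
  finally show "\<bar>v x\<bar> \<le> h * norm (grad v x)" using ab(2)[OF x] by (simp add: mult.commute)
  obtain i where i: "i \<in> I" "fst i \<bullet> z = snd i" using front[OF z(2)] by blast
  have "snd i - fst i \<bullet> x = fst i \<bullet> (z - x)" using i(2) by (simp add: inner_diff_right)
  also have "\<dots> \<le> h"
    using Cauchy_Schwarz_ineq2[of "fst i" "z - x"] unit[OF i(1)] nz by (simp add: norm_minus_commute)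
  finally have "y i x \<le> (k + 1) * h" by (simp add: y_def algebra_simps)
  then show "\<omega> x \<le> (k + 1) * h" using \<omega>_le_y[OF i(1) xO] by linarith
qed

text \<open>On a cell the inverse estimate bounds the gradient by the nodal values at its frontier
  vertices. Each node is charged on the whole ball of radius \<open>h\<close> around it, which
  contains all cells having it as a vertex; the volume of the ball takes the place of counting these
  cells.\<close>

lemma extension_energy:
  assumes w: "w \<in> FE_space \<Omega> \<T>" "\<And>z. z \<in> mesh_nodes \<T> \<inter> \<Omega> \<Longrightarrow> w z = 0"
  shows "(LINT x|lebesgue_on \<Omega>. (norm (grad w x))\<^sup>2)
    \<le> unit_ball_vol 3 * h ^ 3 / r\<^sup>2 * (\<Sum>z\<in>mesh_nodes \<T> \<inter> frontier \<Omega>. (w z)\<^sup>2)"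
proof -
  let ?N = "mesh_nodes \<T> \<inter> frontier \<Omega>"
  have fN: "finite ?N" using finite_nodes by simp
  define f where "f x = (\<Sum>z\<in>?N. (w z)\<^sup>2 / r\<^sup>2 * indicator (cball z h) x)" for x :: "real^3"
  have bi: "bdd (indicator (cball z h) :: real^3 \<Rightarrow> real)" for z
  proof -
    have "(indicator (cball z h) :: real^3 \<Rightarrow> real) \<in> borel_measurable (lebesgue_on \<Omega>)"
      by (intro measurable_restrict_space1 borel_measurable_indicator) auto
    moreover have "norm (indicator (cball z h) x :: real) \<le> 1" for x by (simp add: indicator_def)
    ultimately show ?thesis unfolding bdd_def by (auto intro!: exI[of _ 1])
  qed
  have bf: "bdd f" unfolding f_def[abs_def] by (intro bdd_sum fN bdd_mult bdd_const bi)
  have pw: "(norm (grad w x))\<^sup>2 \<le> f x" if xT: "x \<in> \<Union>\<T>" for x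
  proof -
    obtain K where K: "K \<in> \<T>" "x \<in> K" using xT by blast
    have xK: "x \<in> closure K" using K closure_subset by blast
    obtain a b where ab: "\<And>x. x \<in> closure K \<Longrightarrow> w x = a \<bullet> x + b" "\<And>x. x \<in> K \<Longrightarrow> grad w x = a"
      using FE_grad[OF w(1) K(1)] by blast
    let ?V = "verts K \<inter> frontier \<Omega>"
    have fV: "finite ?V" using cell_facts(3)[OF K(1)] by simp
    have VN: "?V \<subseteq> ?N" using K(1) mesh_nodes_eq by auto
    define B where "B = sqrt (\<Sum>z\<in>?V. (w z)\<^sup>2)"
    have bK: "\<bar>a \<bullet> z + b\<bar> \<le> B" if z: "z \<in> closure K" for z
    proof (rule affine_bounded_on_convex_hull[OF cell_facts(3)[OF K(1)]])
      show "z \<in> convex hull verts K" using z cell_facts(4)[OF K(1)] by simp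
      fix y assume y: "y \<in> verts K"
      then have yK: "y \<in> closure K" using verts_subset[OF K(1)] by blast
      have "\<bar>w y\<bar> \<le> B"
      proof (cases "y \<in> frontier \<Omega>")
        case True
        have "(w y)\<^sup>2 \<le> (\<Sum>z\<in>?V. (w z)\<^sup>2)" using fV y True by (intro member_le_sum) auto
        then have "sqrt ((w y)\<^sup>2) \<le> B" unfolding B_def by (rule real_sqrt_le_mono)
        then show ?thesis by simp
      next
        case False
        then have "y \<in> \<Omega>" using yK cell_closure_subset[OF K(1)] closure_eq(1) by blast
        then have "w y = 0" using w(2)[of y] y K(1) mesh_nodes_eq by auto
        then show ?thesis by (simp add: B_def sum_nonneg)
      qed
      then show "\<bar>a \<bullet> y + b\<bar> \<le> B" using ab(1)[OF yK] by simp
    qed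
    obtain z0 where z0: "ball z0 r \<subseteq> K" using inball[OF K(1)] by blast
    have "norm a * r \<le> B"
      by (rule affine_gradient_bound[OF bK r]) (use z0 closure_subset in blast)
    then have "(norm a * r)\<^sup>2 \<le> B\<^sup>2" using r by (intro power_mono) auto
    also have "B\<^sup>2 = (\<Sum>z\<in>?V. (w z)\<^sup>2)" by (simp add: B_def sum_nonneg)
    finally have "(norm a)\<^sup>2 \<le> (\<Sum>z\<in>?V. (w z)\<^sup>2) / r\<^sup>2"
      using r by (simp add: le_divide_eq power_mult_distrib)
    also have "\<dots> = (\<Sum>z\<in>?V. (w z)\<^sup>2 / r\<^sup>2 * indicator (cball z h) x)"
      unfolding sum_divide_distrib
    proof (rule sum.cong[OF refl])
      fix z assume "z \<in> ?V"
      then have "z \<in> closure K" using verts_subset[OF K(1)] by blast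
      then have "x \<in> cball z h" using diam[OF K(1) _ xK, of z] by (simp add: dist_norm)
      then show "(w z)\<^sup>2 / r\<^sup>2 = (w z)\<^sup>2 / r\<^sup>2 * indicator (cball z h) x" by simp
    qed
    also have "\<dots> \<le> f x" unfolding f_def using fN VN by (intro sum_mono2) auto
    finally show ?thesis using ab(2)[OF K(2)] by simp
  qed
  have "(LINT x|lebesgue_on \<Omega>. (norm (grad w x))\<^sup>2) \<le> (LINT x|lebesgue_on \<Omega>. f x)"
  proof (rule integral_mono_AE)
    show "integrable (lebesgue_on \<Omega>) (\<lambda>x. (norm (grad w x))\<^sup>2)"
      by (intro bdd_integrable bdd_power2 bdd_norm bdd_grad_FE w)
    show "AE x in lebesgue_on \<Omega>. (norm (grad w x))\<^sup>2 \<le> f x" using AE_cells by eventually_elim (rule pw)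
  qed (rule bdd_integrable[OF bf])
  also have "\<dots> = (\<Sum>z\<in>?N. (w z)\<^sup>2 / r\<^sup>2 * (LINT x|lebesgue_on \<Omega>. indicator (cball z h) x))"
    unfolding f_def using bdd_integrable[OF bi] by simp
  also have "\<dots> \<le> (\<Sum>z\<in>?N. (w z)\<^sup>2 / r\<^sup>2 * (unit_ball_vol 3 * h ^ 3))"
  proof (intro sum_mono mult_left_mono)
    fix z
    have "(LINT x|lebesgue_on \<Omega>. indicator (cball z h) x) = (LINT x|lebesgue. indicator \<Omega> x *\<^sub>R (indicator (cball z h) x :: real))"
      using \<Omega>(1) by (intro integral_restrict_space) auto
    also have "\<dots> \<le> (LINT x|lebesgue. indicator (cball z h) x)"
    proof (rule integral_mono_AE')
      show "integrable lebesgue (indicator (cball z h) :: real^3 \<Rightarrow> real)"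
        by (intro integrable_real_indicator) (use emeasure_bounded_finite[OF bounded_cball, of z h] in \<open>auto simp: less_top\<close>)
    qed (auto simp: indicator_def)
    also have "\<dots> = unit_ball_vol 3 * h ^ 3" using h by (simp add: content_cball)
    finally show "(LINT x|lebesgue_on \<Omega>. indicator (cball z h) x) \<le> unit_ball_vol 3 * h ^ 3" .
  qed auto
  also have "\<dots> = unit_ball_vol 3 * h ^ 3 / r\<^sup>2 * (\<Sum>z\<in>?N. (w z)\<^sup>2)"
    by (simp add: sum_distrib_left sum_divide_distrib mult_ac)
  finally show ?thesis .
qed

text \<open>\<open>kk\<close> is the absorption condition: through
  \<open>\<omega> \<ge> k * h / N\<close> it makes the unweighted energy of \<open>u\<close> on the
  right at most half of the left side. The factor 2 in the conclusion is the price of absorbing that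
  half.\<close>

lemma energy_estimate:
  assumes w: "w \<in> FE_space \<Omega> \<T>" "\<And>z. z \<in> mesh_nodes \<T> \<inter> \<Omega> \<Longrightarrow> w z = 0"
    and v: "v \<in> FE_space0 \<Omega> \<T>" and u: "u = (\<lambda>x. w x + v x)"
    and orth: "\<And>\<phi>. \<phi> \<in> FE_space0 \<Omega> \<T> \<Longrightarrow> (LINT x|lebesgue_on \<Omega>. grad u x \<bullet> grad \<phi> x) = 0"
    and s: "s = h / r" and kk: "k \<ge> 2 * N * (11/2 * s + 1 + 8 * s * N\<^sup>2)"
  shows "(LINT x|lebesgue_on \<Omega>. \<omega> x * (norm (grad u x))\<^sup>2)
    \<le> 2 * h * (3/2 * s + 3/2 + (k + 1)\<^sup>2 / 2 + 8 * s * N\<^sup>2) * (LINT x|lebesgue_on \<Omega>. (norm (grad w x))\<^sup>2)"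
proof -
  have vF: "v \<in> FE_space \<Omega> \<T>" and v0: "\<And>x. x \<in> frontier \<Omega> \<Longrightarrow> v x = 0" using v FE_space0_iff by auto
  have uF: "u \<in> FE_space \<Omega> \<T>" using FE_lincomb[OF w(1) vF, of 1 1] by (simp add: u)
  have s0: "s > 0" using h r by (simp add: s)
  obtain J where J: "J \<in> FE_space \<Omega> \<T>" "\<And>z. z \<in> mesh_nodes \<T> \<Longrightarrow> J z = \<omega> z * v z"
    using FE_interpolant_exists[of "\<lambda>z. \<omega> z * v z"] by blast
  have J0: "J \<in> FE_space0 \<Omega> \<T>"
    unfolding FE_space0_iff using J(1) FE_zero_on_frontier[OF J(1)] J(2) v0 by auto
  define C where "C = 3/2 * s + 3/2 + (k + 1)\<^sup>2 / 2"
  define U where "U = (LINT x|lebesgue_on \<Omega>. (norm (grad u x))\<^sup>2)"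
  define W where "W = (LINT x|lebesgue_on \<Omega>. (norm (grad w x))\<^sup>2)"
  define E where "E = (LINT x|lebesgue_on \<Omega>. \<omega> x * (norm (grad u x))\<^sup>2)"
  have gu: "grad u x = grad w x + grad v x" if "x \<in> \<Union>\<T>" for x
    unfolding u by (rule grad_add[OF FE_differentiable[OF w(1) that] FE_differentiable[OF vF that]])
  have pw: "\<omega> x * (norm (grad u x))\<^sup>2 \<le> grad u x \<bullet> grad J x - v x * (grad v x \<bullet> grad \<omega> x) +
      h * ((11/2 * s + 1) * (norm (grad u x))\<^sup>2 + s * (v x / \<omega> x)\<^sup>2 + C * (norm (grad w x))\<^sup>2)"
    if xT: "x \<in> \<Union>\<T>" for x
  proof -
    obtain K where K: "K \<in> \<T>" "x \<in> K" using xT by blast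
    have xO: "x \<in> closure \<Omega>" using xT cells_subset closure_eq(1) by blast
    have w0: "\<omega> x > 0" by (rule \<omega>_pos[OF xO])
    define nu where "nu = norm (grad u x)"
    define nv where "nv = norm (grad v x)"
    define nw where "nw = norm (grad w x)"
    define m where "m = \<bar>v x / \<omega> x\<bar>"
    define D where "D = grad J x - (\<omega> x *\<^sub>R grad v x + v x *\<^sub>R grad \<omega> x)"
    have nn: "nu \<ge> 0" "nv \<ge> 0" "nw \<ge> 0" "m \<ge> 0" by (auto simp: nu_def nv_def nw_def m_def)
    have nvle: "nv \<le> nu + nw"
      using norm_triangle_ineq4[of "grad u x" "grad w x"] gu[OF xT] by (simp add: nu_def nv_def nw_def)
    have Dle: "norm D \<le> h * s * (3 * nv + 2 * m)"
    proof -
      have "norm D * r \<le> h\<^sup>2 * (3 * nv + 2 * m)"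
        unfolding D_def nv_def m_def
        by (rule interpolation_error[OF vF J(1) K(1) _ K(2)]) (use J(2) K(1) mesh_nodes_eq in auto)
      then show ?thesis using r by (simp add: s power2_eq_square field_simps)
    qed
    \<comment> \<open>An exact identity, obtained by inserting
      \<open>grad J = D + \<omega> grad v + v grad \<omega>\<close> and
      \<open>grad v = grad u - grad w\<close>.\<close>
    have "\<omega> x * nu\<^sup>2 = grad u x \<bullet> grad J x - grad u x \<bullet> D - v x * (grad v x \<bullet> grad \<omega> x)
        - v x * (grad w x \<bullet> grad \<omega> x) + \<omega> x * (grad u x \<bullet> grad w x)"
      unfolding nu_def D_def power2_norm_eq_inner gu[OF xT]
      by (simp add: inner_add_left inner_add_right inner_diff_right inner_commute algebra_simps)
    moreover have "- (grad u x \<bullet> D) \<le> nu * (h * s * (3 * nv + 2 * m))"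
    proof -
      have "- (grad u x \<bullet> D) \<le> nu * norm D" using Cauchy_Schwarz_ineq2[of "grad u x" D] by (simp add: nu_def)
      also have "\<dots> \<le> nu * (h * s * (3 * nv + 2 * m))" using Dle nn by (intro mult_left_mono)
      finally show ?thesis .
    qed
    moreover have "- (v x * (grad w x \<bullet> grad \<omega> x)) \<le> h * nv * nw \<and> \<omega> x * (grad u x \<bullet> grad w x) \<le> (k + 1) * h * (nu * nw)"
    proof (cases "grad w x = 0")
      case True
      then show ?thesis using nn h k by simp
    next
      case False
      note bl = boundary_layer[OF w v K(1,2) False]
      have "\<bar>grad w x \<bullet> grad \<omega> x\<bar> \<le> nw * 1"
        unfolding nw_def using Cauchy_Schwarz_ineq2[of "grad w x" "grad \<omega> x"] norm_grad_\<omega>_le_1[OF xO]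
        by (meson mult_left_mono norm_ge_zero order_trans)
      then have "\<bar>v x\<bar> * \<bar>grad w x \<bullet> grad \<omega> x\<bar> \<le> (h * nv) * nw"
        using bl(1) nn h by (intro mult_mono) (auto simp: nv_def)
      then have "\<bar>v x * (grad w x \<bullet> grad \<omega> x)\<bar> \<le> h * nv * nw" by (simp add: abs_mult)
      moreover have "\<omega> x * (grad u x \<bullet> grad w x) \<le> (k + 1) * h * (nu * nw)"
      proof -
        have "\<omega> x * (grad u x \<bullet> grad w x) \<le> \<omega> x * (nu * nw)"
          unfolding nu_def nw_def using w0 by (intro mult_left_mono norm_cauchy_schwarz) auto
        also have "\<dots> \<le> (k + 1) * h * (nu * nw)" using bl(2) nn by (intro mult_right_mono) auto
        finally show ?thesis .
      qed
      ultimately show ?thesis by linarith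
    qed
    \<comment> \<open>Eliminating \<open>nv\<close> by \<open>nv \<le> nu + nw\<close>, the
      interpolation error gives \<open>s\<close> times \<open>3 * (3/2) + 1 = 11/2\<close> in front
      of \<open>nu\<^sup>2\<close>, and the two terms with \<open>nw\<close> give 1/2 each. The
      factor \<open>k + 1\<close> is attached to \<open>nw\<close> before Young's inequality, so it
      appears only in \<open>C\<close>.\<close>
    moreover have "nu * (h * s * (3 * nv + 2 * m)) + h * nv * nw + (k + 1) * h * (nu * nw)
        \<le> h * ((11/2 * s + 1) * nu\<^sup>2 + s * m\<^sup>2 + C * nw\<^sup>2)"
    proof -
      have y2: "a * b \<le> a\<^sup>2 / 2 + b\<^sup>2 / 2" for a b :: real
        using zero_le_power2[of "a - b"] by (simp add: power2_eq_square algebra_simps)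
      have "nu * nv \<le> nu * (nu + nw)" "nv * nw \<le> (nu + nw) * nw"
        using nvle nn by (auto intro: mult_left_mono mult_right_mono)
      then have 1: "nu * nv \<le> 3/2 * nu\<^sup>2 + 1/2 * nw\<^sup>2" and 2: "nv * nw \<le> 1/2 * nu\<^sup>2 + 3/2 * nw\<^sup>2"
        using y2[of nu nw] by (auto simp: power2_eq_square algebra_simps)
      have 3: "2 * (nu * m) \<le> nu\<^sup>2 + m\<^sup>2" using y2[of nu m] by simp
      have 4: "(k + 1) * (nu * nw) \<le> 1/2 * nu\<^sup>2 + (k + 1)\<^sup>2 / 2 * nw\<^sup>2"
        using y2[of nu "(k + 1) * nw"] by (simp add: power_mult_distrib mult_ac)
      have "s * (3 * (nu * nv) + 2 * (nu * m)) \<le> s * (3 * (3/2 * nu\<^sup>2 + 1/2 * nw\<^sup>2) + (nu\<^sup>2 + m\<^sup>2))"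
        using 1 3 s0 by (intro mult_left_mono add_mono) auto
      then have "s * (3 * (nu * nv) + 2 * (nu * m)) + nv * nw + (k + 1) * (nu * nw)
          \<le> (11/2 * s + 1) * nu\<^sup>2 + s * m\<^sup>2 + C * nw\<^sup>2"
        using 2 4 by (simp add: C_def algebra_simps)
      then have "h * (s * (3 * (nu * nv) + 2 * (nu * m)) + nv * nw + (k + 1) * (nu * nw))
          \<le> h * ((11/2 * s + 1) * nu\<^sup>2 + s * m\<^sup>2 + C * nw\<^sup>2)"
        using h by (intro mult_left_mono) auto
      then show ?thesis by (simp add: algebra_simps)
    qed
    ultimately have "\<omega> x * nu\<^sup>2 \<le> grad u x \<bullet> grad J x - v x * (grad v x \<bullet> grad \<omega> x) +
        h * ((11/2 * s + 1) * nu\<^sup>2 + s * m\<^sup>2 + C * nw\<^sup>2)" by linarith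
    moreover have "m\<^sup>2 = (v x / \<omega> x)\<^sup>2" by (simp only: m_def power2_abs)
    ultimately show ?thesis unfolding nu_def nw_def by metis
  qed
  have b\<omega>: "bdd \<omega>" by (rule bdd_continuous[OF \<omega>_continuous])
  have iE: "integrable (lebesgue_on \<Omega>) (\<lambda>x. \<omega> x * (norm (grad u x))\<^sup>2)"
    by (intro bdd_integrable bdd_mult b\<omega> bdd_power2 bdd_norm bdd_grad_FE uF)
  have iU: "integrable (lebesgue_on \<Omega>) (\<lambda>x. (norm (grad u x))\<^sup>2)"
    and iV: "integrable (lebesgue_on \<Omega>) (\<lambda>x. (norm (grad v x))\<^sup>2)"
    and iW: "integrable (lebesgue_on \<Omega>) (\<lambda>x. (norm (grad w x))\<^sup>2)"
    by (intro bdd_integrable bdd_power2 bdd_norm bdd_grad_FE uF vF w)+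
  have iJ: "integrable (lebesgue_on \<Omega>) (\<lambda>x. grad u x \<bullet> grad J x)"
    by (intro bdd_integrable bdd_inner bdd_grad_FE uF J)
  note iS = bdd_integrable[OF bdd_v_grad_\<omega>[OF vF vF]]
  note iH = bdd_integrable[OF bdd_over_\<omega>[OF vF]]
  have "E \<le> (LINT x|lebesgue_on \<Omega>. grad u x \<bullet> grad J x - v x * (grad v x \<bullet> grad \<omega> x) +
      h * ((11/2 * s + 1) * (norm (grad u x))\<^sup>2 + s * (v x / \<omega> x)\<^sup>2 + C * (norm (grad w x))\<^sup>2))"
    unfolding E_def
  proof (rule integral_mono_AE[OF iE])
    show "integrable (lebesgue_on \<Omega>) (\<lambda>x. grad u x \<bullet> grad J x - v x * (grad v x \<bullet> grad \<omega> x) +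
      h * ((11/2 * s + 1) * (norm (grad u x))\<^sup>2 + s * (v x / \<omega> x)\<^sup>2 + C * (norm (grad w x))\<^sup>2))"
      by (intro Bochner_Integration.integrable_add Bochner_Integration.integrable_diff integrable_mult_right iJ iS iU iH iW)
    show "AE x in lebesgue_on \<Omega>. \<omega> x * (norm (grad u x))\<^sup>2 \<le> grad u x \<bullet> grad J x - v x * (grad v x \<bullet> grad \<omega> x) +
      h * ((11/2 * s + 1) * (norm (grad u x))\<^sup>2 + s * (v x / \<omega> x)\<^sup>2 + C * (norm (grad w x))\<^sup>2)"
      using AE_cells by eventually_elim (rule pw)
  qed
  also have "\<dots> = (LINT x|lebesgue_on \<Omega>. grad u x \<bullet> grad J x) - (LINT x|lebesgue_on \<Omega>. v x * (grad v x \<bullet> grad \<omega> x)) +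
      h * ((11/2 * s + 1) * U + s * (LINT x|lebesgue_on \<Omega>. (v x / \<omega> x)\<^sup>2) + C * W)"
    using iJ iS iU iH iW by (simp add: U_def W_def)
  \<comment> \<open>The interpolant is an admissible test function and the mixed term has a sign, so
    both integrals drop out. The coefficient 8 arises below from the 4 in the Hardy inequality and
    the 2 in the bound for \<open>grad v\<close>.\<close>
  also have "\<dots> \<le> h * ((11/2 * s + 1) * U + s * (4 * N\<^sup>2 * (2 * U + 2 * W)) + C * W)"
  proof -
    have V: "(LINT x|lebesgue_on \<Omega>. (norm (grad v x))\<^sup>2) \<le> 2 * U + 2 * W"
    proof -
      have "(LINT x|lebesgue_on \<Omega>. (norm (grad v x))\<^sup>2)
          \<le> (LINT x|lebesgue_on \<Omega>. 2 * (norm (grad u x))\<^sup>2 + 2 * (norm (grad w x))\<^sup>2)"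
      proof (rule integral_mono_AE[OF iV])
        show "integrable (lebesgue_on \<Omega>) (\<lambda>x. 2 * (norm (grad u x))\<^sup>2 + 2 * (norm (grad w x))\<^sup>2)"
          using iU iW by simp
        show "AE x in lebesgue_on \<Omega>. (norm (grad v x))\<^sup>2 \<le> 2 * (norm (grad u x))\<^sup>2 + 2 * (norm (grad w x))\<^sup>2"
          using AE_cells
        proof eventually_elim
          fix x assume xT: "x \<in> \<Union>\<T>"
          have "norm (grad v x) \<le> norm (grad u x) + norm (grad w x)"
            using norm_triangle_ineq4[of "grad u x" "grad w x"] gu[OF xT] by simp
          then have "(norm (grad v x))\<^sup>2 \<le> (norm (grad u x) + norm (grad w x))\<^sup>2" by (intro power_mono) auto
          also have "\<dots> \<le> 2 * (norm (grad u x))\<^sup>2 + 2 * (norm (grad w x))\<^sup>2"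
            using zero_le_power2[of "norm (grad u x) - norm (grad w x)"] by (simp add: power2_eq_square algebra_simps)
          finally show "(norm (grad v x))\<^sup>2 \<le> 2 * (norm (grad u x))\<^sup>2 + 2 * (norm (grad w x))\<^sup>2" .
        qed
      qed
      then show ?thesis using iU iW by (simp add: U_def W_def)
    qed
    have "(LINT x|lebesgue_on \<Omega>. (v x / \<omega> x)\<^sup>2) \<le> 4 * N\<^sup>2 * (2 * U + 2 * W)"
      using hardy[OF v] mult_left_mono[OF V, of "4 * N\<^sup>2"] by simp
    then have "s * (LINT x|lebesgue_on \<Omega>. (v x / \<omega> x)\<^sup>2) \<le> s * (4 * N\<^sup>2 * (2 * U + 2 * W))"
      using s0 by (intro mult_left_mono) auto
    then have "h * ((11/2 * s + 1) * U + s * (LINT x|lebesgue_on \<Omega>. (v x / \<omega> x)\<^sup>2) + C * W)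
        \<le> h * ((11/2 * s + 1) * U + s * (4 * N\<^sup>2 * (2 * U + 2 * W)) + C * W)"
      using h by (intro mult_left_mono) auto
    then show ?thesis using orth[OF J0] weight_gradient_nonneg[OF v] by linarith
  qed
  also have "\<dots> = h * (11/2 * s + 1 + 8 * s * N\<^sup>2) * U + h * (C + 8 * s * N\<^sup>2) * W"
    by (simp add: algebra_simps)
  finally have E1: "E \<le> h * (11/2 * s + 1 + 8 * s * N\<^sup>2) * U + h * (C + 8 * s * N\<^sup>2) * W" .
  have U0: "U \<ge> 0" unfolding U_def by (intro Bochner_Integration.integral_nonneg) auto
  have "k * h / N * U = (LINT x|lebesgue_on \<Omega>. k * h / N * (norm (grad u x))\<^sup>2)" by (simp add: U_def)
  also have "\<dots> \<le> E"
    unfolding E_def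
  proof (rule integral_mono[OF _ iE])
    show "integrable (lebesgue_on \<Omega>) (\<lambda>x. k * h / N * (norm (grad u x))\<^sup>2)" using iU by (rule integrable_mult_right)
    show "k * h / N * (norm (grad u x))\<^sup>2 \<le> \<omega> x * (norm (grad u x))\<^sup>2" if "x \<in> space (lebesgue_on \<Omega>)" for x
    proof (rule mult_right_mono)
      show "k * h / N \<le> \<omega> x" using that closure_subset[of \<Omega>] by (intro \<omega>_ge) auto
    qed simp
  qed
  finally have E2: "k * h / N * U \<le> E" .
  \<comment> \<open>Twice the coefficient of the unweighted energy is at most \<open>k / N\<close>,
    so that term is at most half of \<open>E\<close>.\<close>
  have "2 * (11/2 * s + 1 + 8 * s * N\<^sup>2) \<le> k / N" using kk N by (simp add: le_divide_eq mult_ac)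
  then have "2 * (11/2 * s + 1 + 8 * s * N\<^sup>2) * (h * U) \<le> k / N * (h * U)"
    using h U0 by (intro mult_right_mono) auto
  then have "2 * (h * (11/2 * s + 1 + 8 * s * N\<^sup>2) * U) \<le> E" using E2 by (simp add: mult_ac)
  then have "E \<le> 2 * (h * (C + 8 * s * N\<^sup>2) * W)" using E1 by linarith
  then show ?thesis unfolding E_def W_def C_def by (simp only: mult.assoc)
qed

end

text \<open>If no constraint were active at a frontier point, the finitely many strict inequalities
  would hold in a neighbourhood. Boundedness makes the frontier, and with it \<open>I\<close>,
  nonempty. The description of the polyhedron is not assumed minimal, so \<open>card I\<close> may
  exceed the number of facets.\<close>

lemma polyhedron_unit_halfspaces:
  fixes S :: "'a::euclidean_space set"
  assumes "polyhedron S" "bounded S" "S \<noteq> {}"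
  obtains I :: "('a \<times> real) set" where "finite I" "I \<noteq> {}" "\<And>i. i \<in> I \<Longrightarrow> norm (fst i) = 1"
    "\<And>i x. i \<in> I \<Longrightarrow> x \<in> S \<Longrightarrow> fst i \<bullet> x \<le> snd i"
    "\<And>x. x \<in> frontier S \<Longrightarrow> \<exists>i\<in>I. fst i \<bullet> x = snd i"
proof -
  obtain F where F: "finite F" "S = \<Inter>F" "\<forall>H\<in>F. \<exists>a b. a \<noteq> 0 \<and> H = {x. a \<bullet> x \<le> b}"
    using assms(1) unfolding polyhedron_def by blast
  have "\<exists>i. norm (fst i) = 1 \<and> H = {x. fst i \<bullet> x \<le> snd i}" if H: "H \<in> F" for H
  proof -
    obtain a b where ab: "a \<noteq> 0" "H = {x. a \<bullet> x \<le> b}" using F(3) H by blast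
    have "norm (a /\<^sub>R norm a) = 1" "{x. a \<bullet> x \<le> b} = {x. (a /\<^sub>R norm a) \<bullet> x \<le> b / norm a}"
      using ab(1) by (auto simp: divide_simps mult_ac)
    then show ?thesis using ab(2) by (intro exI[of _ "(a /\<^sub>R norm a, b / norm a)"]) simp
  qed
  then have "\<exists>n. \<forall>H\<in>F. norm (fst (n H)) = 1 \<and> H = {x. fst (n H) \<bullet> x \<le> snd (n H)}" by (intro bchoice) blast
  then obtain n where n: "\<And>H. H \<in> F \<Longrightarrow> norm (fst (n H)) = 1"
    "\<And>H. H \<in> F \<Longrightarrow> H = {x. fst (n H) \<bullet> x \<le> snd (n H)}" by blast
  have Seq: "S = (\<Inter>i\<in>n ` F. {x. fst i \<bullet> x \<le> snd i})" using F(2) n(2) by auto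
  have clS: "closed S" using assms(1) by (rule polyhedron_imp_closed)
  have act: "\<exists>i\<in>n ` F. fst i \<bullet> x = snd i" if x: "x \<in> frontier S" for x
  proof (rule ccontr)
    assume neg: "\<not> ?thesis"
    have xS: "x \<in> S" using x clS by (simp add: frontier_def)
    then have "x \<in> (\<Inter>i\<in>n ` F. {x. fst i \<bullet> x < snd i})"
      using neg Seq by (auto simp: less_le)
    moreover have "open (\<Inter>i\<in>n ` F. {x. fst i \<bullet> x < snd i})"
      using F(1) by (intro open_INT) (auto simp: open_halfspace_lt)
    moreover have "(\<Inter>i\<in>n ` F. {x. fst i \<bullet> x < snd i}) \<subseteq> S" unfolding Seq by force
    ultimately have "x \<in> interior S" by (meson interiorI)
    then show False using x by (simp add: frontier_def)
  qed
  have "frontier S \<noteq> {}" using frontier_not_empty[of S] assms(2,3) not_bounded_UNIV by blast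
  then have "n ` F \<noteq> {}" using act by blast
  show ?thesis
  proof (rule that)
    show "finite (n ` F)" using F(1) by simp
    show "n ` F \<noteq> {}" by fact
    show "norm (fst i) = 1" if "i \<in> n ` F" for i using n(1) that by blast
    show "fst i \<bullet> x \<le> snd i" if "i \<in> n ` F" "x \<in> S" for i x using Seq that by blast
  qed (rule act)
qed

text \<open>Going from \<open>x\<close> along the normal up to the bounding plane leaves the open
  set: a point of the plane inside it would have neighbours beyond the plane. The frontier is thus
  met within distance \<open>b - a \<bullet> x\<close>.\<close>

lemma infdist_frontier_le_halfspace:
  fixes S :: "'a::euclidean_space set"
  assumes "open S" "x \<in> S" "norm a = 1" "\<And>z. z \<in> closure S \<Longrightarrow> a \<bullet> z \<le> b"
  shows "infdist x (frontier S) \<le> b - a \<bullet> x"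
proof -
  define d where "d = b - a \<bullet> x"
  have d0: "d \<ge> 0" using assms(2,4) closure_subset[of S] by (auto simp: d_def)
  have aa: "a \<bullet> a = 1" using assms(3) by (simp add: norm_eq_1)
  let ?p = "x + d *\<^sub>R a"
  have "?p \<notin> S"
  proof
    assume p: "?p \<in> S"
    then obtain e where e: "e > 0" "ball ?p e \<subseteq> S" using assms(1) open_contains_ball by blast
    have "?p + (e/2) *\<^sub>R a \<in> ball ?p e" using e(1) assms(3) by (simp add: dist_norm)
    then have "?p + (e/2) *\<^sub>R a \<in> closure S" using e(2) closure_subset by blast
    from assms(4)[OF this] e(1) show False by (simp add: inner_add_right aa d_def)
  qed
  then have "closed_segment x ?p \<inter> frontier S \<noteq> {}"
    using assms(2) by (intro connected_Int_frontier) auto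
  then obtain z where z: "z \<in> closed_segment x ?p" "z \<in> frontier S" by blast
  have "dist x z \<le> dist x ?p" using z(1) dist_in_closed_segment(1)[of z x ?p] by (simp add: dist_commute)
  then have "infdist x (frontier S) \<le> dist x ?p" using infdist_le[OF z(2), of x] by linarith
  then show ?thesis using d0 assms(3) by (simp add: dist_norm d_def)
qed

text \<open>Strictly below the supremum a larger ball is available, so attainment need not be
  discussed. The set of radii is nonempty because a ball of radius 0 is empty.\<close>

lemma inradius_ball:
  assumes "0 < s" "s < inradius K"
  shows "\<exists>x. ball x s \<subseteq> K"
proof -
  have "{r. \<exists>x. ball x r \<subseteq> K} \<noteq> {}" by (auto intro!: exI[of _ 0])
  then obtain r x where "s < r" "ball x r \<subseteq> K"
    using less_cSupD[of "{r. \<exists>x. ball x r \<subseteq> K}" s] assms(2) by (auto simp: inradius_def)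
  then have "ball x s \<subseteq> K" using subset_ball[of s r x] by auto
  then show ?thesis by blast
qed

context fe_mesh
begin

lemma diameter_cell:
  assumes "K \<in> \<T>"
  shows "0 < diameter K" "diameter K \<le> mesh_size \<T>"
    "\<And>x y. x \<in> closure K \<Longrightarrow> y \<in> closure K \<Longrightarrow> norm (x - y) \<le> mesh_size \<T>"
proof -
  have ot: "open_tetrahedron K" using mesh assms by (simp add: tetrahedral_mesh_def)
  note f = open_tetrahedron_facts[OF ot]
  have bK: "bounded (closure K)" using f(9) by (rule compact_imp_bounded)
  obtain x e where e: "e > 0" "ball x e \<subseteq> K" using f(6,8) open_contains_ball by blast
  have "diameter (ball x e) \<le> diameter K"
    using e(2) bounded_subset[OF bK closure_subset] by (rule diameter_subset)
  then show "0 < diameter K" using e(1) by simp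
  show le: "diameter K \<le> mesh_size \<T>"
    unfolding mesh_size_def using finite_cells assms by (intro Max_ge) auto
  fix x y assume "x \<in> closure K" "y \<in> closure K"
  then have "dist x y \<le> diameter (closure K)" using bK by (intro diameter_bounded_bound)
  moreover have "diameter (closure K) = diameter K"
    using bounded_subset[OF bK closure_subset] by (rule diameter_closure)
  ultimately show "norm (x - y) \<le> mesh_size \<T>" using le by (simp add: dist_norm)
qed

end

section \<open>Constants and comparison of the weights\<close>

context weighted_mesh
begin

text \<open>The constant multiplies three estimates: \<open>energy_estimate\<close> gives
  \<open>2 * h\<close>, \<open>extension_energy\<close> gives \<open>h ^ 3 / r\<^sup>2\<close>, and
  \<open>trace_lower_bound\<close> gives \<open>2880 / r\<^sup>2\<close>, where 2880 is 180 times
  16. All powers of \<open>h\<close> and \<open>r\<close> combine to \<open>s ^ 4\<close>, which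
  makes the constant independent of the mesh size.\<close>

lemma weighted_stability:
  assumes g: "g \<in> L2 (surface_measure \<Omega>)" and u: "discrete_solution \<Omega> \<T> g u"
    and s: "s = h / r" and kk: "k \<ge> 2 * N * (11/2 * s + 1 + 8 * s * N\<^sup>2)"
  defines "C \<equiv> 5760 * (3/2 * s + 3/2 + (k + 1)\<^sup>2 / 2 + 8 * s * N\<^sup>2) * s ^ 4 * unit_ball_vol 3 / unit_ball_vol 2"
  shows "integrable (lebesgue_on \<Omega>) (\<lambda>x. \<omega> x * (norm (grad u x))\<^sup>2)"
    "(LINT x|lebesgue_on \<Omega>. \<omega> x * (norm (grad u x))\<^sup>2)
      \<le> C * (LINT x|surface_measure \<Omega>. (boundary_projection \<Omega> \<T> g x)\<^sup>2)"
proof -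
  let ?p = "boundary_projection \<Omega> \<T> g"
  have pT: "?p \<in> FE_trace_space \<Omega> \<T>" by (rule boundary_projection_trace[OF r inball g])
  define w where "w = zero_extension \<Omega> \<T> ?p"
  have w: "w \<in> FE_space \<Omega> \<T>" "bdry_trace \<Omega> w = ?p" "\<And>z. z \<in> mesh_nodes \<T> \<inter> \<Omega> \<Longrightarrow> w z = 0"
    unfolding w_def using zero_extension[OF pT] by auto
  obtain v where v: "v \<in> FE_space0 \<Omega> \<T>" "u = (\<lambda>x. w x + v x)"
    and uF: "u \<in> FE_space \<Omega> \<T>"
    and orth: "\<And>\<phi>. \<phi> \<in> FE_space0 \<Omega> \<T> \<Longrightarrow> (LINT x|lebesgue_on \<Omega>. weak_grad \<Omega> u x \<bullet> weak_grad \<Omega> \<phi> x) = 0"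
    using u unfolding discrete_solution_def w_def by blast
  \<comment> \<open>Discrete harmonicity is stated with chosen weak gradients; almost everywhere
    these are the classical gradients, with which the estimates are carried out.\<close>
  have orth': "(LINT x|lebesgue_on \<Omega>. grad u x \<bullet> grad \<phi> x) = 0" if p: "\<phi> \<in> FE_space0 \<Omega> \<T>" for \<phi>
  proof -
    have pF: "\<phi> \<in> FE_space \<Omega> \<T>" using p FE_space0_iff by auto
    have mu: "grad u \<in> borel_measurable (lebesgue_on \<Omega>)" "grad \<phi> \<in> borel_measurable (lebesgue_on \<Omega>)"
      using bdd_grad_FE[OF uF] bdd_grad_FE[OF pF] by (auto simp: bdd_def)
    have ae: "AE x in lebesgue_on \<Omega>. weak_grad \<Omega> u x \<bullet> weak_grad \<Omega> \<phi> x = grad u x \<bullet> grad \<phi> x"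
      using FE_weak_grad_AE[OF uF] FE_weak_grad_AE[OF pF] by eventually_elim simp
    have mw: "weak_grad \<Omega> f \<in> borel_measurable (lebesgue_on \<Omega>)" if f: "f \<in> FE_space \<Omega> \<T>" for f
      using someI[where P="has_weak_gradient \<Omega> f", OF FE_weak_gradient[OF f]]
      unfolding weak_grad_def[symmetric] by (simp add: has_weak_gradient_def L2_def)
    have "(LINT x|lebesgue_on \<Omega>. weak_grad \<Omega> u x \<bullet> weak_grad \<Omega> \<phi> x) = (LINT x|lebesgue_on \<Omega>. grad u x \<bullet> grad \<phi> x)"
      by (rule integral_cong_AE[OF _ _ ae]) (use mu mw[OF uF] mw[OF pF] in measurable)
    then show ?thesis using orth[OF p] by simp
  qed
  show "integrable (lebesgue_on \<Omega>) (\<lambda>x. \<omega> x * (norm (grad u x))\<^sup>2)"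
    by (intro bdd_integrable bdd_mult bdd_power2 bdd_norm bdd_grad_FE bdd_continuous[OF \<omega>_continuous] uF)
  define P where "P = (LINT x|surface_measure \<Omega>. (?p x)\<^sup>2)"
  define S where "S = (\<Sum>z\<in>mesh_nodes \<T> \<inter> frontier \<Omega>. (w z)\<^sup>2)"
  define D where "D = 3/2 * s + 3/2 + (k + 1)\<^sup>2 / 2 + 8 * s * N\<^sup>2"
  have CD: "C = 5760 * D * s ^ 4 * unit_ball_vol 3 / unit_ball_vol 2" by (simp only: C_def D_def)
  have s0: "s > 0" using h r by (simp add: s)
  have D0: "D \<ge> 0" unfolding D_def using s0 by (intro add_nonneg_nonneg) auto
  have b: "unit_ball_vol 2 > (0::real)" by (rule unit_ball_vol_pos) simp
  have "S * (unit_ball_vol 2 * (r / 4)\<^sup>2 / 180) \<le> P"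
    using trace_lower_bound[OF r inball w(1)] by (simp add: S_def P_def w(2))
  then have SP: "S \<le> 2880 / (unit_ball_vol 2 * r\<^sup>2) * P"
    using b r by (simp add: field_simps power2_eq_square)
  have "(LINT x|lebesgue_on \<Omega>. \<omega> x * (norm (grad u x))\<^sup>2) \<le> 2 * h * D * (LINT x|lebesgue_on \<Omega>. (norm (grad w x))\<^sup>2)"
    unfolding D_def by (rule energy_estimate[OF w(1,3) v orth' s kk])
  also have "\<dots> \<le> 2 * h * D * (unit_ball_vol 3 * h ^ 3 / r\<^sup>2 * S)"
    using extension_energy[OF w(1,3)] h D0 unfolding S_def by (intro mult_left_mono) auto
  also have "\<dots> \<le> 2 * h * D * (unit_ball_vol 3 * h ^ 3 / r\<^sup>2 * (2880 / (unit_ball_vol 2 * r\<^sup>2) * P))"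
    using SP h D0 r by (intro mult_left_mono) auto
  also have "\<dots> = C * P"
    unfolding CD unfolding s using b r by (simp add: field_simps eval_nat_numeral)
  finally show "(LINT x|lebesgue_on \<Omega>. \<omega> x * (norm (grad u x))\<^sup>2) \<le> C * (LINT x|surface_measure \<Omega>. (?p x)\<^sup>2)"
    by (simp add: P_def)
qed

text \<open>The first entry of the maximum compares \<rho> with the distance to a facet plane, the
  second \<open>\<kappa> * h\<close> with the offset \<open>k * h\<close>. Hence
  \<open>rho_tilde\<close> is bounded by a multiple of every \<open>y i\<close>; dividing by
  \<open>y i\<close> and summing over \<open>I\<close> replaces \<open>y i\<close> by \<omega> at
  the cost of \<open>N\<close>.\<close>

lemma rho_tilde_le_weight:
  assumes x: "x \<in> \<Omega>" and c1: "c1 > 0" "0 \<le> \<rho> x" "c1 * \<rho> x \<le> infdist x (frontier \<Omega>)" and \<kappa>: "\<kappa> \<ge> 0"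
  shows "rho_tilde \<rho> \<kappa> h x \<le> max (1 / c1) (\<kappa> / k) * N * \<omega> x"
proof -
  define M where "M = max (1 / c1) (\<kappa> / k)"
  have xc: "x \<in> closure \<Omega>" using x closure_subset by blast
  have "rho_tilde \<rho> \<kappa> h x \<le> M * y i x" if i: "i \<in> I" for i
  proof -
    define d where "d = snd i - fst i \<bullet> x"
    have d0: "d \<ge> 0" using inside[OF i xc] by (simp add: d_def)
    have "infdist x (frontier \<Omega>) \<le> d" unfolding d_def
      by (rule infdist_frontier_le_halfspace[OF \<Omega>(1) x unit[OF i] inside[OF i]])
    then have "\<rho> x \<le> d * (1 / c1)" using c1 by (simp add: le_divide_eq mult.commute)
    also have "\<dots> \<le> d * M" using d0 by (intro mult_left_mono) (auto simp: M_def)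
    finally have 1: "\<rho> x \<le> M * d" by (simp add: mult.commute)
    have "k * h * (\<kappa> / k) \<le> k * h * M" using kh by (intro mult_left_mono) (auto simp: M_def)
    then have 2: "\<kappa> * h \<le> M * (k * h)" using k(1) by (simp add: mult_ac)
    have "rho_tilde \<rho> \<kappa> h x \<le> \<bar>\<rho> x\<bar> + \<bar>\<kappa> * h\<bar>"
      unfolding rho_tilde_def power_mult_distrib[symmetric] by (rule sqrt_sum_squares_le_sum_abs)
    also have "\<dots> = \<rho> x + \<kappa> * h" using c1 \<kappa> h by simp
    also have "\<dots> \<le> M * y i x" using 1 2 by (simp add: y_def d_def algebra_simps)
    finally show ?thesis .
  qed
  then have "rho_tilde \<rho> \<kappa> h x * q i x \<le> M" if "i \<in> I" for i
    using that y_pos[OF that xc] by (simp add: q_def field_simps)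
  then have "(\<Sum>i\<in>I. rho_tilde \<rho> \<kappa> h x * q i x) \<le> (\<Sum>i\<in>I. M)" by (rule sum_mono)
  then have "rho_tilde \<rho> \<kappa> h x * (\<Sum>i\<in>I. q i x) \<le> M * N" by (simp add: N_def sum_distrib_left mult.commute)
  then show ?thesis using sum_q_pos[OF xc] by (simp add: \<omega>_def M_def field_simps)
qed

end

theorem theorem14:
  fixes \<Omega> :: "(real^3) set" and \<rho> :: "real^3 \<Rightarrow> real"
    and H :: "real set" and \<T> :: "real \<Rightarrow> (real^3) set set"
  assumes "convex_polyhedral_domain \<Omega>"
    and "regularized_distance \<Omega> \<rho>"
    and "mesh_family \<Omega> H \<T>"
    and "shape_regular H \<T>"
    and "quasi_uniform H \<T>"
  shows "\<exists>\<kappa>0\<ge>1. \<forall>\<kappa>\<ge>\<kappa>0. \<exists>c>0. \<forall>h\<in>H. \<forall>q\<in>L2 (surface_measure \<Omega>).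
    \<forall>u. discrete_solution \<Omega> (\<T> h) q u \<longrightarrow>
      L2_norm (lebesgue_on \<Omega>) (\<lambda>x. (rho_tilde \<rho> \<kappa> h x) powr (1/2) *\<^sub>R weak_grad \<Omega> u x)
        \<le> c * L2_norm (surface_measure \<Omega>) (boundary_projection \<Omega> (\<T> h) q)"
proof -
  obtain \<sigma> where \<sigma>: "\<sigma> > 0" "\<And>h K. h \<in> H \<Longrightarrow> K \<in> \<T> h \<Longrightarrow> diameter K \<le> \<sigma> * inradius K"
    using assms(4) unfolding shape_regular_def by blast
  obtain \<tau> where \<tau>: "\<tau> > 0" "\<And>h K. h \<in> H \<Longrightarrow> K \<in> \<T> h \<Longrightarrow> h \<le> \<tau> * diameter K"
    using assms(5) unfolding quasi_uniform_def by blast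
  have "\<forall>x\<in>closure \<Omega>. 0 \<le> \<rho> x"
    "\<exists>c1>0. \<exists>c2>0. \<forall>x\<in>closure \<Omega>. c1 * \<rho> x \<le> infdist x (frontier \<Omega>) \<and> infdist x (frontier \<Omega>) \<le> c2 * \<rho> x"
    using assms(2) unfolding regularized_distance_def by argo+
  then obtain c1 where c1: "c1 > 0" "\<And>x. x \<in> closure \<Omega> \<Longrightarrow> 0 \<le> \<rho> x"
    "\<And>x. x \<in> closure \<Omega> \<Longrightarrow> c1 * \<rho> x \<le> infdist x (frontier \<Omega>)"
    by auto
  have \<Omega>: "open \<Omega>" "\<Omega> \<noteq> {}" "bounded \<Omega>" "convex \<Omega>" "polyhedron (closure \<Omega>)"
    using assms(1) by (auto simp: convex_polyhedral_domain_def)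
  have fr: "frontier (closure \<Omega>) = frontier \<Omega>"
    using \<Omega>(1,2,4) convex_interior_closure[of \<Omega>] by (simp add: frontier_def interior_open)
  obtain I :: "((real^3) \<times> real) set" where I: "finite I" "I \<noteq> {}" "\<And>i. i \<in> I \<Longrightarrow> norm (fst i) = 1"
    "\<And>i x. i \<in> I \<Longrightarrow> x \<in> closure \<Omega> \<Longrightarrow> fst i \<bullet> x \<le> snd i"
    "\<And>x. x \<in> frontier \<Omega> \<Longrightarrow> \<exists>i\<in>I. fst i \<bullet> x = snd i"
    by (rule polyhedron_unit_halfspaces[OF \<Omega>(5)]) (use \<Omega>(2,3) fr in auto)
  \<comment> \<open>The radius \<open>h / s\<close> has to lie strictly below all inradii.
    Quasi-uniformity and shape regularity give
    \<open>h \<le> \<tau> * (\<sigma> * inradius K)\<close>, and the extra factor 2 makes the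
    comparison strict.\<close>
  define s where "s = 2 * \<sigma> * \<tau>"
  define n where "n = real (card I)"
  \<comment> \<open>The entries are the two bounds on \<open>k\<close> in
    \<open>weighted_mesh\<close> and the absorption condition. They depend only on the domain and
    the mesh constants, so \<open>k\<close> is fixed before \<kappa> and \<open>h\<close>.\<close>
  define k where "k = max (max 2 n) (2 * n * (11/2 * s + 1 + 8 * s * n\<^sup>2))"
  have s0: "s > 0" using \<sigma>(1) \<tau>(1) by (simp add: s_def)
  have n0: "n > 0" using I(1,2) by (simp add: n_def card_gt_0_iff)
  have k2: "k \<ge> 2" by (simp add: k_def)
  define C where "C = 5760 * (3/2 * s + 3/2 + (k + 1)\<^sup>2 / 2 + 8 * s * n\<^sup>2) * s ^ 4 * unit_ball_vol 3 / unit_ball_vol (2::real)"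
  have "\<exists>c>0. \<forall>h\<in>H. \<forall>q\<in>L2 (surface_measure \<Omega>). \<forall>u. discrete_solution \<Omega> (\<T> h) q u \<longrightarrow>
      L2_norm (lebesgue_on \<Omega>) (\<lambda>x. (rho_tilde \<rho> \<kappa> h x) powr (1/2) *\<^sub>R weak_grad \<Omega> u x)
        \<le> c * L2_norm (surface_measure \<Omega>) (boundary_projection \<Omega> (\<T> h) q)" if \<kappa>: "\<kappa> \<ge> 1" for \<kappa>
  proof -
    define M where "M = max (1 / c1) (\<kappa> / k)"
    have M0: "M > 0" using c1(1) by (simp add: M_def less_max_iff_disj)
    have "3/2 * s + 3/2 + (k + 1)\<^sup>2 / 2 + 8 * s * n\<^sup>2 > 0"
      using s0 by (intro add_pos_nonneg) auto
    then have C0: "C > 0" unfolding C_def using s0 by (intro divide_pos_pos mult_pos_pos unit_ball_vol_pos) auto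
    have "L2_norm (lebesgue_on \<Omega>) (\<lambda>x. (rho_tilde \<rho> \<kappa> h x) powr (1/2) *\<^sub>R weak_grad \<Omega> u x)
        \<le> sqrt (M * n * C) * L2_norm (surface_measure \<Omega>) (boundary_projection \<Omega> (\<T> h) q)"
      if hH: "h \<in> H" and q: "q \<in> L2 (surface_measure \<Omega>)" and u: "discrete_solution \<Omega> (\<T> h) q u" for h q u
    proof -
      have msh: "tetrahedral_mesh \<Omega> (\<T> h)" "mesh_size (\<T> h) = h"
        using assms(3) hH by (auto simp: mesh_family_def)
      interpret fe_mesh \<Omega> "\<T> h" by unfold_locales (use assms(1) msh in auto)
      obtain K0 where "K0 \<in> \<T> h" using cells_nonempty by blast
      from diameter_cell(1,2)[OF this] have h0: "h > 0" using msh(2) by linarith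
      define r where "r = h / s"
      have r0: "r > 0" using h0 s0 by (simp add: r_def)
      have ball: "\<exists>x. ball x r \<subseteq> K" if K: "K \<in> \<T> h" for K
      proof (rule inradius_ball[OF r0])
        have "h \<le> \<tau> * (\<sigma> * inradius K)"
          using \<tau>(2)[OF hH K] mult_left_mono[OF \<sigma>(2)[OF hH K], of \<tau>] \<tau>(1) by linarith
        then have "h < \<tau> * (\<sigma> * inradius K) * 2" using h0 by linarith
        then show "r < inradius K" using s0 by (simp add: r_def s_def divide_less_eq mult_ac)
      qed
      interpret weighted_mesh \<Omega> "\<T> h" I h r k
      proof unfold_locales
        show "norm (x - y) \<le> h" if "K \<in> \<T> h" "x \<in> closure K" "y \<in> closure K" for K x y
          using diameter_cell(3)[OF that] msh(2) by simp
      qed (use I h0 r0 ball k2 in \<open>auto simp: k_def n_def\<close>)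
      have Nn: "N = n" by (simp add: N_def n_def)
      have sr: "s = h / r" using h0 s0 by (simp add: r_def)
      have kk: "k \<ge> 2 * N * (11/2 * s + 1 + 8 * s * N\<^sup>2)" unfolding Nn by (simp add: k_def)
      note ws = weighted_stability[OF q u sr kk]
      let ?p = "boundary_projection \<Omega> (\<T> h) q"
      let ?f = "\<lambda>x. (rho_tilde \<rho> \<kappa> h x) powr (1/2) *\<^sub>R weak_grad \<Omega> u x"
      have uF: "u \<in> FE_space \<Omega> (\<T> h)" using u by (simp add: discrete_solution_def)
      have "(LINT x|lebesgue_on \<Omega>. (norm (?f x))\<^sup>2) \<le> (LINT x|lebesgue_on \<Omega>. M * n * (\<omega> x * (norm (grad u x))\<^sup>2))"
      \<comment> \<open>Only the majorant has to be integrable: a left integrand that is not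
        integrable has integral 0 by convention, and the majorant is nonnegative.\<close>
      proof (rule integral_mono_AE')
        show "integrable (lebesgue_on \<Omega>) (\<lambda>x. M * n * (\<omega> x * (norm (grad u x))\<^sup>2))"
          using ws(1) by (rule integrable_mult_right)
        have le: "(norm (?f x))\<^sup>2 \<le> M * n * (\<omega> x * (norm (grad u x))\<^sup>2)"
          if x: "x \<in> \<Omega>" and eq: "weak_grad \<Omega> u x = grad u x" for x
        proof -
          have xc: "x \<in> closure \<Omega>" using x closure_subset by blast
          have 0: "rho_tilde \<rho> \<kappa> h x \<ge> 0" by (simp add: rho_tilde_def)
          have "(norm (?f x))\<^sup>2 = rho_tilde \<rho> \<kappa> h x * (norm (grad u x))\<^sup>2"
            using 0 by (simp add: eq power_mult_distrib powr_half_sqrt)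
          also have "\<dots> \<le> M * N * \<omega> x * (norm (grad u x))\<^sup>2"
            unfolding M_def using \<kappa> by (intro mult_right_mono rho_tilde_le_weight x c1 xc) auto
          finally show ?thesis by (simp add: Nn mult_ac)
        qed
        show "AE x in lebesgue_on \<Omega>. (norm (?f x))\<^sup>2 \<le> M * n * (\<omega> x * (norm (grad u x))\<^sup>2)"
          using FE_weak_grad_AE[OF uF] AE_space by eventually_elim (rule le, auto)
        show "AE x in lebesgue_on \<Omega>. 0 \<le> M * n * (\<omega> x * (norm (grad u x))\<^sup>2)"
        proof (rule AE_I2)
          fix x assume "x \<in> space (lebesgue_on \<Omega>)"
          then have "\<omega> x > 0" using closure_subset[of \<Omega>] by (intro \<omega>_pos) auto
          then show "0 \<le> M * n * (\<omega> x * (norm (grad u x))\<^sup>2)" using M0 n0 by simp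
        qed
      qed
      also have "\<dots> = M * n * (LINT x|lebesgue_on \<Omega>. \<omega> x * (norm (grad u x))\<^sup>2)" by simp
      also have "\<dots> \<le> M * n * (C * (LINT x|surface_measure \<Omega>. (?p x)\<^sup>2))"
        using ws(2) M0 n0 unfolding Nn C_def by (intro mult_left_mono) auto
      finally have "sqrt (LINT x|lebesgue_on \<Omega>. (norm (?f x))\<^sup>2) \<le> sqrt (M * n * C * (LINT x|surface_measure \<Omega>. (?p x)\<^sup>2))"
        by (simp add: mult.assoc)
      then show ?thesis by (simp add: L2_norm_def real_sqrt_mult)
    qed
    then show ?thesis using M0 n0 C0 by (intro exI[of _ "sqrt (M * n * C)"]) auto
  qed
  then show ?thesis by (intro exI[of _ 1]) auto
qed

end
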